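(* Let $d\in\mathbb{N}$ and let $\Theta=[\nu_{\min},\nu_{\max}]$ with $0<\nu_{\min}\le\nu_{\max}<\infty$ and $\nu_{\max}>d/2$. Let $K_\nu$, $\nu\in\Theta$, be the Matérn kernels on $\mathbb{R}^d$ with fixed $\sigma,\lambda>0$ and positive scaling factor $c(\nu)$, and suppose that $\inf_{\nu\in[\nu_{\min},\nu_{\max}]}c(\nu)>0$. Suppose that $\Omega\subset\mathbb{R}^d$ is a bounded connected open set which satisfies an interior cone condition and has a Lipschitz boundary, and that $\{x_i\}_{i=1}^\infty\subset\Omega$ is a sequence of pairwise distinct points that is quasi-uniform on $\Omega$. (1) If $f_0:\Omega\to\mathbb{R}$ is such that $\nu(f_0)\in(d/2,\nu_{\max}]$, where $\nu(f_0)=\sup\{\nu>0: f_0\in H^\nu(\Omega)\}$, then $$\liminf_{n\to\infty}\hat\nu_{\mathrm{ML}}^{f_0}(X_n)\ge\nu(f_0).$$ (2) If $f_0\in H_{\mathrm{ss}}^{\nu_0}(\Omega)$ for some $\nu_0\in(d/2,\nu_{\max}]$ with $\nu_0\ge\nu_{\min}$, and in addition $\sup_{\nu\in[\nu_{\min},\nu_{\max}]}c(\nu)<\infty$, then $$\lim_{n\to\infty}\hat\nu_{\mathrm{ML}}^{f_0}(X_n)=\nu_0.$$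
   Context: Matérn kernels: $\sigma,\lambda>0$ are fixed, $c(\nu)>0$ is a scaling factor, and for $\nu>0$, $x,y\in\mathbb{R}^d$, $$K_\nu(x,y)=\sigma^2c(\nu)\Big(\tfrac{\sqrt{2\nu}\,\|x-y\|}{\lambda}\Big)^{\nu}\mathcal K_\nu\Big(\tfrac{\sqrt{2\nu}\,\|x-y\|}{\lambda}\Big),$$ where $\mathcal K_\nu$ is the modified Bessel function of the second kind of order $\nu$, $\|\cdot\|$ is the Euclidean norm, and the value at $x=y$ is defined by continuity. $K_\nu$ is symmetric and strictly positive-definite. Estimator: $X_n=\{x_i\}_{i=1}^n$, $f_0(X_n)=(f_0(x_1),\dots,f_0(x_n))$ (column vector), $K_\nu(X_n)=(K_\nu(x_i,x_j))_{i,j=1}^n$, and $\hat\nu_{\mathrm{ML}}^{f_0}(X_n)$ is any minimiser over $\nu\in\Theta$ of $$\ell_{\mathrm{ML}}^{f_0}(\nu\mid X_n)=f_0(X_n)^{\mathsf T}K_\nu(X_n)^{-1}f_0(X_n)+\log\det K_\nu(X_n).$$ Minimisers are assumed to exist; results hold for an arbitrary choice of minimisers. Quasi-uniformity: with fill-distance $h_{n,\Omega}=\sup_{x\in\Omega}\min_{1\le i\le n}\|x-x_i\|$ and separation radius $q_n=\frac12\min_{1\le i\ne j\le n}\|x_i-x_j\|$, the sequence is quasi-uniform on $\Omega$ if there is a constant $c_{\mathrm{qu}}>0$ with $q_n\le h_{n,\Omega}\le c_{\mathrm{qu}}q_n$ for every $n\ge2$. Interior cone condition: there are an angle in $(0,\pi/2)$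 and a radius $r>0$ such that every $x\in\Omega$ is the vertex of a cone of that angle and radius contained in $\Omega$. Sobolev spaces: with $\widehat f(\xi)=\int_{\mathbb{R}^d}f(x)e^{-\mathrm i x^{\mathsf T}\xi}\,dx$, $H^\alpha(\mathbb{R}^d)$ ($\alpha>0$) consists of $f\in L^2(\mathbb{R}^d)$ with $\int_{\mathbb{R}^d}(1+\|\xi\|^2)^\alpha|\widehat f(\xi)|^2\,d\xi<\infty$; for $\alpha>d/2$ its elements are identified with continuous functions. $H^\alpha(\Omega)$ is the set of $f:\Omega\to\mathbb{R}$ having an extension $f_e\in H^\alpha(\mathbb{R}^d)$ with $f_e|_\Omega=f$. Self-similarity: for $\beta>0$, a (real-valued) function $f\in L^2(\mathbb{R}^d)$ is $\beta$-self-similar if $\sup_{\xi\in\mathbb{R}^d}\|\xi\|^{2\beta+d}|\widehat f(\xi)|^2<\infty$ and there are constants $C,R_0>0$ such that $\int_{\|\xi\|\ge R}|\widehat f(\xi)|^2\,d\xi\ge CR^{-2\beta}$ for all $R\ge R_0$. $H_{\mathrm{ss}}^\beta(\Omega)$ is the set of $\beta$-self-similar $f\in L^2(\mathbb{R}^d)$ whose support is contained in $\Omega$. For $\beta>d/2$ such $f$ is identified with its continuous representative. *)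

theory Defs
  imports "HOL-Analysis.Analysis" "Jordan_Normal_Form.Gauss_Jordan_Elimination"
    "Jordan_Normal_Form.Determinant"
begin

text \<open>The modified Bessel function of the second kind (Macdonald function) is defined by its
  integral representation, as in Wendland, Scattered Data Approximation, Definition 5.10.  It is
  only meaningful for z > 0.\<close>

definition bessel_K :: "real \<Rightarrow> real \<Rightarrow> real" where
  "bessel_K \<nu> z = (LBINT t:{0..}. exp (- z * cosh t) * cosh (\<nu> * t))"

text \<open>The function mapping z to z to the power nu times the Bessel function, extended to z = 0 by
  continuity.\<close>

definition matern_profile :: "real \<Rightarrow> real \<Rightarrow> real" where
  "matern_profile \<nu> z =
     (if z = 0 then Lim (at_right 0) (\<lambda>t. t powr \<nu> * bessel_K \<nu> t)
      else z powr \<nu> * bessel_K \<nu> z)"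

text \<open>The length scale, often written lambda, is rho here.\<close>

definition matern ::
  "real \<Rightarrow> real \<Rightarrow> (real \<Rightarrow> real) \<Rightarrow> real \<Rightarrow> 'a::euclidean_space \<Rightarrow> 'a \<Rightarrow> real" where
  "matern \<sigma> \<rho> c \<nu> x y =
     \<sigma>\<^sup>2 * c \<nu> * matern_profile \<nu> (sqrt (2 * \<nu>) * norm (x - y) / \<rho>)"

text \<open>A sequence x 0, x 1, ... of points is indexed from 0, and its n-th point set consists of
  the x i with i < n.\<close>

definition kernel_matrix :: "('a \<Rightarrow> 'a \<Rightarrow> real) \<Rightarrow> (nat \<Rightarrow> 'a) \<Rightarrow> nat \<Rightarrow> real Matrix.mat" where
  "kernel_matrix K x n = Matrix.mat n n (\<lambda>(i, j). K (x i) (x j))"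

definition data_vector :: "('a \<Rightarrow> real) \<Rightarrow> (nat \<Rightarrow> 'a) \<Rightarrow> nat \<Rightarrow> real Matrix.vec" where
  "data_vector f x n = Matrix.vec n (\<lambda>i. f (x i))"

definition neg_log_lik :: "('a \<Rightarrow> real) \<Rightarrow> ('a \<Rightarrow> 'a \<Rightarrow> real) \<Rightarrow> (nat \<Rightarrow> 'a) \<Rightarrow> nat \<Rightarrow> real" where
  "neg_log_lik f K x n =
     scalar_prod (data_vector f x n)
       (mult_mat_vec (the (mat_inverse (kernel_matrix K x n))) (data_vector f x n))
     + ln (Determinant.det (kernel_matrix K x n))"

definition fill_distance :: "'a::euclidean_space set \<Rightarrow> (nat \<Rightarrow> 'a) \<Rightarrow> nat \<Rightarrow> real" where
  "fill_distance \<Omega> x n = (SUP y\<in>\<Omega>. MIN i\<in>{..<n}. norm (y - x i))"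

definition separation_radius :: "(nat \<Rightarrow> 'a::euclidean_space) \<Rightarrow> nat \<Rightarrow> real" where
  "separation_radius x n =
     (MIN (i, j)\<in>{(i, j). i < n \<and> j < n \<and> i \<noteq> j}. norm (x i - x j)) / 2"

definition quasi_uniform :: "'a::euclidean_space set \<Rightarrow> (nat \<Rightarrow> 'a) \<Rightarrow> bool" where
  "quasi_uniform \<Omega> x \<longleftrightarrow> (\<exists>c>0. \<forall>n\<ge>2.
     separation_radius x n \<le> fill_distance \<Omega> x n \<and>
     fill_distance \<Omega> x n \<le> c * separation_radius x n)"

definition cone :: "'a::euclidean_space \<Rightarrow> 'a \<Rightarrow> real \<Rightarrow> real \<Rightarrow> 'a set" where
  "cone x e \<theta> r = {x + t *\<^sub>R y | t y. 0 \<le> t \<and> t \<le> r \<and> norm y = 1 \<and> cos \<theta> \<le> inner y e}"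

definition interior_cone_condition :: "'a::euclidean_space set \<Rightarrow> bool" where
  "interior_cone_condition \<Omega> \<longleftrightarrow> (\<exists>\<theta> r. 0 < \<theta> \<and> \<theta> < pi / 2 \<and> 0 < r \<and>
     (\<forall>x\<in>\<Omega>. \<exists>e. norm e = 1 \<and> cone x e \<theta> r \<subseteq> \<Omega>))"

text \<open>Near each boundary point the set is the strict epigraph, in the direction of some unit
  vector e, of a Lipschitz function on the orthogonal complement of e.\<close>

definition lipschitz_boundary :: "'a::euclidean_space set \<Rightarrow> bool" where
  "lipschitz_boundary \<Omega> \<longleftrightarrow> (\<forall>p\<in>frontier \<Omega>. \<exists>e r L \<phi>. norm e = 1 \<and> 0 < r \<and>
     L-lipschitz_on {y. inner y e = 0} \<phi> \<and>
     (\<forall>x\<in>ball p r. x \<in> \<Omega> \<longleftrightarrow> \<phi> (x - inner x e *\<^sub>R e) < inner x e))"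

definition square_integrable :: "('a::euclidean_space \<Rightarrow> 'b::euclidean_space) \<Rightarrow> bool" where
  "square_integrable f \<longleftrightarrow>
     f \<in> borel_measurable lborel \<and> integrable lborel (\<lambda>x. (norm (f x))\<^sup>2)"

text \<open>The Fourier transform of a square-integrable function is given by Plancherel's theorem: it
  is the limit in mean square, as R tends to infinity, of the (absolutely convergent) Fourier
  integrals over the balls of radius R.  It is determined up to null sets, hence a relation; for
  absolutely integrable f it agrees almost everywhere with the usual integral.\<close>

definition truncated_fourier :: "('a::euclidean_space \<Rightarrow> real) \<Rightarrow> real \<Rightarrow> 'a \<Rightarrow> complex" where
  "truncated_fourier f R \<xi> =
     (LINT x:cball 0 R|lborel. complex_of_real (f x) * exp (- \<i> * complex_of_real (inner x \<xi>)))"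

definition is_fourier_transform ::
  "('a::euclidean_space \<Rightarrow> real) \<Rightarrow> ('a \<Rightarrow> complex) \<Rightarrow> bool" where
  "is_fourier_transform f g \<longleftrightarrow> square_integrable f \<and> square_integrable g \<and>
     ((\<lambda>R. \<integral>\<^sup>+ \<xi>. ennreal ((norm (g \<xi> - truncated_fourier f R \<xi>))\<^sup>2) \<partial>lborel) \<longlongrightarrow> 0) at_top"

text \<open>Elements of function spaces are functions rather than equivalence classes.  Above the
  embedding threshold half the dimension, only the continuous representative is admitted, so that
  equality on a set of points is meaningful.\<close>

definition sobolev :: "real \<Rightarrow> ('a::euclidean_space \<Rightarrow> real) set" where
  "sobolev \<alpha> = {f. square_integrable f \<and>
     (\<exists>g. is_fourier_transform f g \<and>
          integrable lborel (\<lambda>\<xi>. (1 + (norm \<xi>)\<^sup>2) powr \<alpha> * (norm (g \<xi>))\<^sup>2)) \<and>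
     (real DIM('a) / 2 < \<alpha> \<longrightarrow> continuous_on UNIV f)}"

text \<open>Only the values on Omega of the functions below matter.\<close>

definition sobolev_on :: "real \<Rightarrow> 'a::euclidean_space set \<Rightarrow> ('a \<Rightarrow> real) set" where
  "sobolev_on \<alpha> \<Omega> = {f. \<exists>fe\<in>sobolev \<alpha>. \<forall>x\<in>\<Omega>. fe x = f x}"

text \<open>Extended real valued: infinite if f is in every Sobolev space.\<close>

definition smoothness :: "'a::euclidean_space set \<Rightarrow> ('a \<Rightarrow> real) \<Rightarrow> ereal" where
  "smoothness \<Omega> f = Sup (ereal ` {\<nu>. 0 < \<nu> \<and> f \<in> sobolev_on \<nu> \<Omega>})"

text \<open>The supremum is an essential one, since g is determined only up to null sets.\<close>

definition self_similar :: "real \<Rightarrow> ('a::euclidean_space \<Rightarrow> real) \<Rightarrow> bool" where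
  "self_similar \<beta> f \<longleftrightarrow> square_integrable f \<and> (\<exists>g. is_fourier_transform f g \<and>
     (\<exists>B. AE \<xi> in lborel. norm \<xi> powr (2 * \<beta> + real DIM('a)) * (norm (g \<xi>))\<^sup>2 \<le> B) \<and>
     (\<exists>C>0. \<exists>R0>0. \<forall>R\<ge>R0.
        C * R powr (- 2 * \<beta>) \<le> (LINT \<xi>:{\<xi>. R \<le> norm \<xi>}|lborel. (norm (g \<xi>))\<^sup>2)))"

definition self_similar_on :: "real \<Rightarrow> 'a::euclidean_space set \<Rightarrow> ('a \<Rightarrow> real) set" where
  "self_similar_on \<beta> \<Omega> = {f. self_similar \<beta> f \<and> closure {x. f x \<noteq> 0} \<subseteq> \<Omega> \<and>
     (real DIM('a) / 2 < \<beta> \<longrightarrow> continuous_on UNIV f)}"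

end

theory Submission
  imports Defs "HOL-Probability.Probability"
begin

text \<open>Substituting exponentials in the Bessel integral exhibits the Matern kernel as a mixture of
  Gaussian kernels over all scales, with spectral density proportional to
  (\<kappa> + |\<xi>|^2)^(-\<nu> - d/2).  Gaussian forms on separated points are nearly diagonal below the
  separation scale, which gives coercivity and a Bernstein inequality for Matern forms; eliminating
  polynomial moments in small cells gives the matching upper bound for the determinant.  Hence
  log det K_\<nu> is -(2\<nu>/d) n ln n up to lower order, and the data term of a function of smoothness
  \<alpha> is at most of order n^(1 + 2(\<nu> - \<alpha>)/d).  Comparing \<nu> = \<alpha> with smaller \<nu> yields
  the lower bound on the estimator.

  For a self-similar f the data term at \<nu> \<ge> \<mu> > \<nu>0 is at least of order
  n^(1 + 2(\<mu> - \<nu>0)/d): the interpolant, cut off away from the support of f, agrees with f on a set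
  that is h-dense in the whole space.  A function with h-dense zeros has small L2 norm relative to its
  frequencies above 1/h, so if the data term were smaller, then f would lack the prescribed Fourier
  tail at frequencies of order 1/h.  Since log det is only of order n ln n, this excludes \<nu> \<ge> \<mu>.\<close>

section \<open>Gaussian kernel forms\<close>

text \<open>The estimator moves with n, so bounds at one fixed \<nu> do not control it. The lower
  bounds for log det and for the data term of a self-similar f therefore have constants independent
  of \<nu>; upper bounds are taken at a single competitor, \<nu> = \<alpha> or \<nu> = \<nu>0. The
  exponents come from the shift d/2 between kernel order and spectral order: samples of a function
  of smoothness \<alpha> are dual to the form of kernel order \<alpha> - d/2, and each further unit
  of order costs n^(2/d). Hence the data term is of order n at \<nu> = \<alpha>, which is invisible
  against n ln n. A choice of \<nu> below \<alpha> - \<eta> loses (2 \<eta>/d) n ln n in the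
  determinant, so log det must be known with its leading constant from both sides. For the upper
  bound on the estimator logarithms are harmless and powers of n are compared. The obstacle there is
  that the points fill only \<Omega>, whereas Fourier arguments see the whole space, and that a
  cutoff must not spoil the native norm of the interpolant.\<close>

lemma gaussian_fourier_real:
  fixes w t :: real assumes w: "0 < w"
  shows "integrable lborel (\<lambda>s. complex_of_real (exp (- w * s\<^sup>2)) * cis (t * s))"
    and "(LINT s|lborel. complex_of_real (exp (- w * s\<^sup>2)) * cis (t * s))
       = complex_of_real (sqrt (pi / w) * exp (- t\<^sup>2 / (4 * w)))"
proof -
  \<comment> \<open>Substituting s by c s turns the integrand into the one for the characteristic
    function of the standard normal distribution, at frequency t c.\<close>
  define c where "c = 1 / sqrt (2 * w)"
  have c: "0 < c" using w by (simp add: c_def)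
  have wc: "w * (c * s)\<^sup>2 = s\<^sup>2 / 2" for s
    using w by (simp add: c_def power2_eq_square field_simps)
  have dens: "std_normal_density s = exp (- s\<^sup>2 / 2) / sqrt (2 * pi)" for s
    by (simp add: std_normal_density_def)
  have int1: "integrable lborel (\<lambda>s. complex_of_real (exp (- s\<^sup>2 / 2)) * cis (u * s))" for u
  proof (rule Bochner_Integration.integrable_bound[where f = "\<lambda>s. sqrt (2 * pi) * std_normal_density s"])
    show "AE s in lborel. cmod (complex_of_real (exp (- s\<^sup>2 / 2)) * cis (u * s))
        \<le> norm (sqrt (2 * pi) * std_normal_density s)"
      by (simp add: dens norm_mult)
  qed (auto intro!: borel_measurable_continuous_onI continuous_intros)
  have "char std_normal_distribution u
      = (LINT s|lborel. std_normal_density s *\<^sub>R iexp (u * s))" for u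
    unfolding char_def by (subst integral_density) (auto simp: normal_density_nonneg)
  also have "(LINT s|lborel. std_normal_density s *\<^sub>R iexp (u * s))
      = (LINT s|lborel. complex_of_real (1 / sqrt (2 * pi)) * (complex_of_real (exp (- s\<^sup>2 / 2)) * cis (u * s)))" for u
    by (intro Bochner_Integration.integral_cong)
       (auto simp: dens cis_conv_exp scaleR_conv_of_real mult_ac)
  finally have ch: "(LINT s|lborel. complex_of_real (exp (- s\<^sup>2 / 2)) * cis (u * s))
      = complex_of_real (sqrt (2 * pi) * exp (- u\<^sup>2 / 2))" for u
    by (simp add: char_std_normal_distribution field_simps)
  have eq: "complex_of_real (exp (- w * (0 + c * s)\<^sup>2)) * cis (t * (0 + c * s))
      = complex_of_real (exp (- s\<^sup>2 / 2)) * cis ((t * c) * s)" for s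
    using wc[of s] by (simp add: mult_ac)
  show "integrable lborel (\<lambda>s. complex_of_real (exp (- w * s\<^sup>2)) * cis (t * s))"
    using lborel_integrable_real_affine_iff[of c "\<lambda>s. complex_of_real (exp (- w * s\<^sup>2)) * cis (t * s)" 0]
      c int1[of "t * c"] unfolding eq by simp
  have "(LINT s|lborel. complex_of_real (exp (- w * s\<^sup>2)) * cis (t * s))
      = c *\<^sub>R (LINT s|lborel. complex_of_real (exp (- s\<^sup>2 / 2)) * cis ((t * c) * s))"
    using lborel_integral_real_affine[of c "\<lambda>s. complex_of_real (exp (- w * s\<^sup>2)) * cis (t * s)" 0] c
    unfolding eq by simp
  also have "\<dots> = complex_of_real (c * (sqrt (2 * pi) * exp (- (t * c)\<^sup>2 / 2)))"
    by (simp only: ch scaleR_conv_of_real of_real_mult)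
  also have "c * (sqrt (2 * pi) * exp (- (t * c)\<^sup>2 / 2)) = sqrt (pi / w) * exp (- t\<^sup>2 / (4 * w))"
    using w by (simp add: c_def real_sqrt_mult real_sqrt_divide power_mult_distrib field_simps)
  finally show "(LINT s|lborel. complex_of_real (exp (- w * s\<^sup>2)) * cis (t * s))
       = complex_of_real (sqrt (pi / w) * exp (- t\<^sup>2 / (4 * w)))" .
qed

lemma cis_sum: "finite I \<Longrightarrow> cis (\<Sum>i\<in>I. f i) = (\<Prod>i\<in>I. cis (f i))"
  by (induction I rule: finite_induct) (auto simp: cis_mult[symmetric])

text \<open>The Gaussian and the character both factor over the coordinates, and
  \<open>lborel\<close> is the image of a product measure, so the integral is a product of
  one-dimensional ones.\<close>

lemma gaussian_fourier:
  fixes x :: "'a::euclidean_space" and w :: real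
  assumes w: "0 < w"
  shows "integrable lborel (\<lambda>\<xi>::'a. complex_of_real (exp (- w * (norm \<xi>)\<^sup>2)) * cis (inner x \<xi>))"
    and "(LINT \<xi>|lborel. complex_of_real (exp (- w * (norm \<xi>)\<^sup>2)) * cis (inner x \<xi>))
       = complex_of_real ((pi / w) powr (real DIM('a) / 2) * exp (- (norm x)\<^sup>2 / (4 * w)))"
proof -
  interpret P: product_sigma_finite "\<lambda>b::'a. lborel :: real measure" ..
  define F where "F = (\<lambda>(b::'a) s. complex_of_real (exp (- w * s\<^sup>2)) * cis (inner x b * s))"
  define G where "G = (\<lambda>\<xi>::'a. complex_of_real (exp (- w * (norm \<xi>)\<^sup>2)) * cis (inner x \<xi>))"
  have G: "G (\<Sum>b\<in>Basis. f b *\<^sub>R b) = (\<Prod>b\<in>Basis. F b (f b))" for f :: "'a \<Rightarrow> real"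
  proof -
    have "(norm (\<Sum>b\<in>Basis. f b *\<^sub>R b))\<^sup>2 = (\<Sum>b\<in>Basis. (f b)\<^sup>2)"
      unfolding power2_norm_eq_inner by (subst euclidean_inner) (simp add: power2_eq_square)
    thus ?thesis
      by (simp add: G_def F_def prod.distrib inner_sum_right cis_sum mult_ac exp_sum sum_distrib_left
          flip: sum_negf of_real_prod)
  qed
  have meas: "(\<lambda>f. \<Sum>b\<in>Basis. f b *\<^sub>R b) \<in> measurable (\<Pi>\<^sub>M b\<in>Basis. (lborel::real measure)) (borel :: 'a measure)"
    by measurable
  have Gm: "G \<in> borel_measurable borel" unfolding G_def by (intro borel_measurable_continuous_onI continuous_intros)
  have Fi: "integrable lborel (F b)" for b unfolding F_def by (rule gaussian_fourier_real[OF w])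
  have "integrable (\<Pi>\<^sub>M b\<in>(Basis::'a set). (lborel::real measure)) (\<lambda>f. \<Prod>b\<in>Basis. F b (f b))"
    by (rule P.product_integrable_prod) (auto intro: Fi)
  thus "integrable lborel (\<lambda>\<xi>::'a. complex_of_real (exp (- w * (norm \<xi>)\<^sup>2)) * cis (inner x \<xi>))"
    unfolding G_def[symmetric]
    by (subst lborel_eq, subst integrable_distr_eq[OF meas Gm]) (simp add: G)
  have "(LINT \<xi>|lborel. G \<xi>) = (LINT f|(\<Pi>\<^sub>M b\<in>(Basis::'a set). (lborel::real measure)). (\<Prod>b\<in>Basis. F b (f b)))"
    by (subst lborel_eq, subst integral_distr[OF meas Gm]) (simp add: G)
  also have "\<dots> = (\<Prod>b\<in>Basis. LINT s|lborel. F b s)"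
    by (rule P.product_integral_prod) (auto intro: Fi)
  also have "\<dots> = (\<Prod>b\<in>Basis. complex_of_real (sqrt (pi / w) * exp (- (inner x b)\<^sup>2 / (4 * w))))"
    unfolding F_def using gaussian_fourier_real(2)[OF w] by simp
  also have "\<dots> = complex_of_real (sqrt (pi / w) ^ DIM('a) * exp (\<Sum>b\<in>Basis. - (inner x b)\<^sup>2 / (4 * w)))"
    by (simp add: prod.distrib exp_sum)
  also have "sqrt (pi / w) ^ DIM('a) = (pi / w) powr (real DIM('a) / 2)"
    using w by (simp add: powr_half_sqrt[symmetric] powr_realpow[symmetric] powr_powr del: powr_half_sqrt)
  also have "(\<Sum>b\<in>Basis. - (inner x b)\<^sup>2 / (4 * w)) = - (norm x)\<^sup>2 / (4 * w)"
    by (simp add: sum_divide_distrib[symmetric] sum_negf power2_norm_eq_inner euclidean_inner[of x x] flip: power2_eq_square)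
  finally show "(LINT \<xi>|lborel. complex_of_real (exp (- w * (norm \<xi>)\<^sup>2)) * cis (inner x \<xi>))
       = complex_of_real ((pi / w) powr (real DIM('a) / 2) * exp (- (norm x)\<^sup>2 / (4 * w)))"
    unfolding G_def .
qed

text \<open>Up to conjugation, the Fourier transform of the discrete measure with mass
  \<open>a i\<close> at \<open>p i\<close>. The index type is left free so that two families of
  points can later be joined by a sum type.\<close>

definition trig_sum :: "('i \<Rightarrow> 'a::euclidean_space) \<Rightarrow> ('i \<Rightarrow> real) \<Rightarrow> 'i set \<Rightarrow> 'a \<Rightarrow> complex" where
  "trig_sum p a I \<xi> = (\<Sum>i\<in>I. complex_of_real (a i) * cis (inner (p i) \<xi>))"

text \<open>Parametrised by the frequency-side scale: exp(-|x|^2/(4w)) is the transform of exp(-w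
  |\<xi>|^2) up to a factor, and it is w that is mixed over.\<close>

definition gauss_form :: "real \<Rightarrow> ('i \<Rightarrow> 'a::euclidean_space) \<Rightarrow> ('i \<Rightarrow> real) \<Rightarrow> 'i set \<Rightarrow> real" where
  "gauss_form w p a I = (\<Sum>i\<in>I. \<Sum>j\<in>I. a i * a j * exp (- (norm (p i - p j))\<^sup>2 / (4 * w)))"

lemma trig_sum_measurable [measurable]: "trig_sum p a I \<in> borel_measurable borel"
  unfolding trig_sum_def by (intro borel_measurable_continuous_onI continuous_intros)

lemma norm_trig_sum_sq:
  "complex_of_real ((norm (trig_sum p a I \<xi>))\<^sup>2)
    = (\<Sum>i\<in>I. \<Sum>j\<in>I. complex_of_real (a i * a j) * cis (inner (p i - p j) \<xi>))"
  unfolding complex_norm_square trig_sum_def cnj_sum sum_product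
  by (intro sum.cong refl) (simp add: cis_cnj cis_mult inner_diff_left)

lemma norm_trig_sum_le: "norm (trig_sum p a I \<xi>) \<le> (\<Sum>i\<in>I. \<bar>a i\<bar>)"
  unfolding trig_sum_def by (rule order_trans[OF norm_sum]) (simp add: norm_mult)

text \<open>Expanding the squared modulus leaves one Gaussian integral per pair of points. Seeing
  the form as an integral of a square also makes it nonnegative.\<close>

lemma gaussian_trig_sum:
  fixes p :: "'i \<Rightarrow> 'a::euclidean_space" and w :: real
  assumes w: "0 < w"
  shows "integrable lborel (\<lambda>\<xi>. exp (- w * (norm \<xi>)\<^sup>2) * (norm (trig_sum p a I \<xi>))\<^sup>2)"
    and "(LINT \<xi>|lborel. exp (- w * (norm \<xi>)\<^sup>2) * (norm (trig_sum p a I \<xi>))\<^sup>2)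
       = (pi / w) powr (real DIM('a) / 2) * gauss_form w p a I"
proof -
  have eq: "complex_of_real (exp (- w * (norm \<xi>)\<^sup>2) * (norm (trig_sum p a I \<xi>))\<^sup>2) =
    (\<Sum>i\<in>I. \<Sum>j\<in>I. complex_of_real (a i * a j) *
       (complex_of_real (exp (- w * (norm \<xi>)\<^sup>2)) * cis (inner (p i - p j) \<xi>)))" for \<xi>
    unfolding of_real_mult[of "exp (- w * (norm \<xi>)\<^sup>2)"] norm_trig_sum_sq sum_distrib_left
    by (intro sum.cong refl) (simp add: mult_ac)
  have int: "integrable lborel (\<lambda>\<xi>. complex_of_real (exp (- w * (norm \<xi>)\<^sup>2) * (norm (trig_sum p a I \<xi>))\<^sup>2))"
    unfolding eq by (intro Bochner_Integration.integrable_sum integrable_mult_right gaussian_fourier w)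
  thus "integrable lborel (\<lambda>\<xi>. exp (- w * (norm \<xi>)\<^sup>2) * (norm (trig_sum p a I \<xi>))\<^sup>2)"
    by (simp only: complex_of_real_integrable_eq)
  have "complex_of_real (LINT \<xi>|lborel. exp (- w * (norm \<xi>)\<^sup>2) * (norm (trig_sum p a I \<xi>))\<^sup>2)
    = (LINT \<xi>|lborel. complex_of_real (exp (- w * (norm \<xi>)\<^sup>2) * (norm (trig_sum p a I \<xi>))\<^sup>2))"
    by (rule integral_complex_of_real[symmetric])
  also have "\<dots> = (\<Sum>i\<in>I. \<Sum>j\<in>I. complex_of_real (a i * a j) *
       (complex_of_real ((pi / w) powr (real DIM('a) / 2) * exp (- (norm (p i - p j))\<^sup>2 / (4 * w)))))"
    unfolding eq
    by (subst Bochner_Integration.integral_sum, intro Bochner_Integration.integrable_sum integrable_mult_right gaussian_fourier w,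
        rule sum.cong[OF refl],
        subst Bochner_Integration.integral_sum, intro Bochner_Integration.integrable_sum integrable_mult_right gaussian_fourier w)
       (simp only: integral_mult_right_zero gaussian_fourier(2)[OF w])
  also have "\<dots> = complex_of_real ((pi / w) powr (real DIM('a) / 2) * gauss_form w p a I)"
    unfolding gauss_form_def of_real_mult of_real_sum sum_distrib_left
    by (intro sum.cong refl) (simp add: mult_ac)
  finally show "(LINT \<xi>|lborel. exp (- w * (norm \<xi>)\<^sup>2) * (norm (trig_sum p a I \<xi>))\<^sup>2)
       = (pi / w) powr (real DIM('a) / 2) * gauss_form w p a I" by (simp only: of_real_eq_iff)
qed

lemma gauss_form_nonneg:
  fixes p :: "'i \<Rightarrow> 'a::euclidean_space"
  assumes w: "0 < w" shows "0 \<le> gauss_form w p a I"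
proof -
  have "0 \<le> (pi / w) powr (real DIM('a) / 2) * gauss_form w p a I"
    unfolding gaussian_trig_sum(2)[OF w, symmetric] by (intro integral_nonneg_AE) auto
  with w show ?thesis by (simp add: zero_le_mult_iff)
qed

text \<open>The inequality 2 |a i a j| \<le> (a i)^2 + (a j)^2 decouples the double sum, and by
  symmetry both halves are weighted row sums.\<close>

lemma schur_test:
  fixes G :: "'i \<Rightarrow> 'i \<Rightarrow> real"
  assumes nonneg: "\<And>i j. i \<in> I \<Longrightarrow> j \<in> I \<Longrightarrow> 0 \<le> G i j"
    and sym: "\<And>i j. i \<in> I \<Longrightarrow> j \<in> I \<Longrightarrow> G i j = G j i"
    and row: "\<And>i. i \<in> I \<Longrightarrow> (\<Sum>j\<in>I. G i j) \<le> C"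
  shows "\<bar>\<Sum>i\<in>I. \<Sum>j\<in>I. a i * a j * G i j\<bar> \<le> C * (\<Sum>i\<in>I. (a i)\<^sup>2)"
proof -
  have "\<bar>\<Sum>i\<in>I. \<Sum>j\<in>I. a i * a j * G i j\<bar> \<le> (\<Sum>i\<in>I. \<Sum>j\<in>I. \<bar>a i * a j * G i j\<bar>)"
    by (rule order_trans[OF sum_abs sum_mono[OF sum_abs]])
  also have "\<dots> \<le> (\<Sum>i\<in>I. \<Sum>j\<in>I. ((a i)\<^sup>2 + (a j)\<^sup>2) / 2 * G i j)"
  proof (intro sum_mono)
    fix i j assume ij: "i \<in> I" "j \<in> I"
    have "\<bar>a i * a j\<bar> \<le> ((a i)\<^sup>2 + (a j)\<^sup>2) / 2"
      using sum_squares_bound[of "\<bar>a i\<bar>" "\<bar>a j\<bar>"] by (simp add: abs_mult)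
    thus "\<bar>a i * a j * G i j\<bar> \<le> ((a i)\<^sup>2 + (a j)\<^sup>2) / 2 * G i j"
      unfolding abs_mult[of "a i * a j"] abs_of_nonneg[OF nonneg[OF ij]] by (rule mult_right_mono[OF _ nonneg[OF ij]])
  qed
  also have "\<dots> = (\<Sum>i\<in>I. \<Sum>j\<in>I. (a i)\<^sup>2 / 2 * G i j) + (\<Sum>i\<in>I. \<Sum>j\<in>I. (a j)\<^sup>2 / 2 * G i j)"
    by (simp add: sum.distrib add_divide_distrib distrib_right)
  also have "(\<Sum>i\<in>I. \<Sum>j\<in>I. (a j)\<^sup>2 / 2 * G i j) = (\<Sum>i\<in>I. \<Sum>j\<in>I. (a i)\<^sup>2 / 2 * G i j)"
    by (subst sum.swap) (intro sum.cong refl, simp add: sym)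
  also have "(\<Sum>i\<in>I. \<Sum>j\<in>I. (a i)\<^sup>2 / 2 * G i j) + (\<Sum>i\<in>I. \<Sum>j\<in>I. (a i)\<^sup>2 / 2 * G i j)
      = (\<Sum>i\<in>I. (a i)\<^sup>2 * (\<Sum>j\<in>I. G i j))"
    by (simp add: sum.distrib[symmetric] sum_distrib_left sum_distrib_right mult.commute)
  also have "\<dots> \<le> (\<Sum>i\<in>I. (a i)\<^sup>2 * C)"
    by (intro sum_mono mult_left_mono row) auto
  also have "\<dots> = C * (\<Sum>i\<in>I. (a i)\<^sup>2)" by (simp add: sum_distrib_left mult_ac)
  finally show ?thesis .
qed

lemma gaussian_integral:
  fixes x :: "'a::euclidean_space"
  assumes w: "0 < w"
  shows "integrable lborel (\<lambda>y::'a. exp (- (norm (y - x))\<^sup>2 / w))"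
    and "(LINT y|lborel. exp (- (norm (y - x))\<^sup>2 / w)) = (pi * w) powr (real DIM('a) / 2)"
proof -
  have i: "integrable lborel (\<lambda>y::'a. exp (- (norm y)\<^sup>2 / w))"
    using gaussian_fourier(1)[of "1/w" "0::'a"] w complex_of_real_integrable_eq[of lborel "\<lambda>y::'a. exp (- (norm y)\<^sup>2 / w)"] by simp
  have "complex_of_real (LINT y::'a|lborel. exp (- (norm y)\<^sup>2 / w)) = complex_of_real ((pi * w) powr (real DIM('a) / 2))"
    using gaussian_fourier(2)[of "1/w" "0::'a"] w by simp
  hence v: "(LINT y::'a|lborel. exp (- (norm y)\<^sup>2 / w)) = (pi * w) powr (real DIM('a) / 2)"
    by (simp only: of_real_eq_iff)
  have l: "lborel = distr lborel borel (\<lambda>y::'a. - x + y)" by (rule lborel_distr_plus[symmetric])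
  show "integrable lborel (\<lambda>y::'a. exp (- (norm (y - x))\<^sup>2 / w))"
    using i by (subst (asm) l) (simp add: integrable_distr_eq)
  show "(LINT y|lborel. exp (- (norm (y - x))\<^sup>2 / w)) = (pi * w) powr (real DIM('a) / 2)"
    using v by (subst (asm) l) (simp add: integral_distr)
qed

text \<open>Each term is compared with an integral over its own cell \<open>Q j\<close>: since |y -
  z|^2 \<le> 2 |z - p j|^2 + 2 r^2, it is dominated on the cell by a Gaussian of twice the scale.
  The cells are disjoint, so these integrals add up to at most the integral over the whole
  space.\<close>

lemma gaussian_packing_sum:
  fixes p :: "'i \<Rightarrow> 'a::euclidean_space" and Q :: "'i \<Rightarrow> 'a set"
  assumes w: "0 < w" and v: "0 < v" and I: "finite I"
    and Q: "\<And>j. j \<in> I \<Longrightarrow> Q j \<in> sets borel" "\<And>j. j \<in> I \<Longrightarrow> v \<le> measure lborel (Q j)"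
      "\<And>j. j \<in> I \<Longrightarrow> emeasure lborel (Q j) < \<infinity>"
    and disj: "disjoint_family_on Q I"
    and r: "\<And>j y. j \<in> I \<Longrightarrow> y \<in> Q j \<Longrightarrow> norm (y - p j) \<le> r"
  shows "(\<Sum>j\<in>I. exp (- (norm (z - p j))\<^sup>2 / (4 * w)))
    \<le> exp (r\<^sup>2 / (4 * w)) * (8 * pi * w) powr (real DIM('a) / 2) / v"
proof -
  let ?g = "\<lambda>y::'a. exp (- (norm (y - z))\<^sup>2 / (8 * w))"
  have ig: "integrable lborel ?g" using gaussian_integral(1)[of "8 * w" z] w by simp
  have sI: "set_integrable lborel (Q j) ?g" if "j \<in> I" for j
    unfolding set_integrable_def using Q that by (intro integrable_mult_indicator ig) auto
  have le: "exp (- (norm (z - p j))\<^sup>2 / (4 * w)) * v \<le> exp (r\<^sup>2 / (4 * w)) * (LINT y:Q j|lborel. ?g y)" if j: "j \<in> I" for j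
  proof -
    have pt: "exp (- (norm (z - p j))\<^sup>2 / (4 * w)) \<le> exp (r\<^sup>2 / (4 * w)) * ?g y" if y: "y \<in> Q j" for y
    proof -
      have "norm (y - z) \<le> norm (z - p j) + norm (y - p j)" by norm
      hence "(norm (y - z))\<^sup>2 \<le> (norm (z - p j) + r)\<^sup>2" using r[OF j y] by (intro power_mono) auto
      also have "\<dots> \<le> 2 * (norm (z - p j))\<^sup>2 + 2 * r\<^sup>2"
        using sum_squares_bound[of "norm (z - p j)" r] by (simp add: power2_sum)
      finally have "- (norm (z - p j))\<^sup>2 / (4 * w) \<le> r\<^sup>2 / (4 * w) + (- (norm (y - z))\<^sup>2 / (8 * w))"
        using w by (simp add: field_simps)
      thus ?thesis by (simp add: exp_add[symmetric])
    qed
    have "exp (- (norm (z - p j))\<^sup>2 / (4 * w)) * v \<le> exp (- (norm (z - p j))\<^sup>2 / (4 * w)) * measure lborel (Q j)"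
      using Q(2)[OF j] by simp
    also have "\<dots> = (LINT y:Q j|lborel. exp (- (norm (z - p j))\<^sup>2 / (4 * w)))"
      using Q(1,3)[OF j] by (simp add: set_lebesgue_integral_def)
    also have "\<dots> \<le> (LINT y:Q j|lborel. exp (r\<^sup>2 / (4 * w)) * ?g y)"
      using Q(1,3)[OF j] sI[OF j] pt
      by (intro set_integral_mono set_integrable_mult_right) (auto simp: set_integrable_def)
    also have "\<dots> = exp (r\<^sup>2 / (4 * w)) * (LINT y:Q j|lborel. ?g y)" by simp
    finally show ?thesis .
  qed
  have "(\<Sum>j\<in>I. exp (- (norm (z - p j))\<^sup>2 / (4 * w))) * v \<le> exp (r\<^sup>2 / (4 * w)) * (\<Sum>j\<in>I. LINT y:Q j|lborel. ?g y)"
    unfolding sum_distrib_right sum_distrib_left by (intro sum_mono le)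
  also have "(\<Sum>j\<in>I. LINT y:Q j|lborel. ?g y) = (LINT y:(\<Union>j\<in>I. Q j)|lborel. ?g y)"
    using I Q disj sI by (intro set_integral_finite_Union[symmetric]) auto
  also have "\<dots> \<le> (LINT y|lborel. ?g y)"
    unfolding set_lebesgue_integral_def using Q I
    by (intro integral_mono integrable_mult_indicator ig) (auto simp: indicator_def)
  also have "\<dots> = (8 * pi * w) powr (real DIM('a) / 2)" using gaussian_integral(2)[of "8 * w" z] w by (simp add: mult_ac)
  finally show ?thesis using v by (simp add: field_simps)
qed

text \<open>For w at most sep_const d times the squared separation radius, the off-diagonal row sums of
  the Gaussian matrix are at most 1/2.\<close>

definition sep_const :: "real \<Rightarrow> real" where
  "sep_const d = min 1 (unit_ball_vol d / (4 * (exp (1 / 8) * (16 * pi) powr (d / 2))))"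

lemma sep_const_pos: "0 \<le> d \<Longrightarrow> 0 < sep_const d"
  unfolding sep_const_def by (auto intro!: divide_pos_pos mult_pos_pos)

text \<open>Off the diagonal the exponent is split in two halves. By separation one half gives the
  small factor exp(-q^2/(2w)); in the other, w is enlarged to q^2, and the resulting row sum is
  bounded by the packing constant \<open>S\<close> independently of w and of the number of
  points.\<close>

lemma gauss_form_separated:
  fixes p :: "'i \<Rightarrow> 'a::euclidean_space"
  assumes I: "finite I" and q: "0 < q"
    and sep: "\<And>i j. i \<in> I \<Longrightarrow> j \<in> I \<Longrightarrow> i \<noteq> j \<Longrightarrow> 2 * q \<le> norm (p i - p j)"
    and w: "0 < w" "w \<le> sep_const (real DIM('a)) * q\<^sup>2"
  shows "\<bar>gauss_form w p a I - (\<Sum>i\<in>I. (a i)\<^sup>2)\<bar> \<le> 1 / 2 * (\<Sum>i\<in>I. (a i)\<^sup>2)"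
proof -
  define d where "d = real DIM('a)"
  define S where "S = exp (1 / 8) * (16 * pi) powr (d / 2) / unit_ball_vol d"
  have ub: "0 < unit_ball_vol d" unfolding d_def by simp
  have S: "0 < S" unfolding S_def using ub by simp
  have sc: "sep_const d \<le> 1" "sep_const d \<le> 1 / (4 * S)"
    by (simp_all add: sep_const_def S_def)
  have wq: "w \<le> q\<^sup>2" using w sc(1) mult_right_mono[of "sep_const d" 1 "q\<^sup>2"] by (simp add: d_def)
  \<comment> \<open>From exp t \<ge> 1 + t: once q^2/(2w) is at least 2 S, the factor exp(-q^2/(2w))
    brings \<open>S\<close> below 1/2.\<close>
  have "w \<le> q\<^sup>2 / (4 * S)" using w sc(2) mult_right_mono[of "sep_const d" "1 / (4 * S)" "q\<^sup>2"] by (simp add: d_def)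
  hence "2 * S \<le> q\<^sup>2 / (2 * w)" using w S by (simp add: field_simps)
  hence "2 * S \<le> exp (q\<^sup>2 / (2 * w))" using exp_ge_add_one_self[of "q\<^sup>2 / (2 * w)"] by linarith
  hence small: "exp (- q\<^sup>2 / (2 * w)) * S \<le> 1 / 2"
    by (simp add: exp_minus field_simps)
  define G where "G = (\<lambda>i j. if i = j then 0 else exp (- (norm (p i - p j))\<^sup>2 / (4 * w)))"
  have disj: "disjoint_family_on (\<lambda>j. ball (p j) q) I"
  proof (unfold disjoint_family_on_def, intro ballI impI)
    fix i j assume "i \<in> I" "j \<in> I" "i \<noteq> j"
    from sep[OF this] show "ball (p i) q \<inter> ball (p j) q = {}"
      by (intro disjoint_ballI) (simp add: dist_norm)
  qed
  \<comment> \<open>The packing bound at scale 2 q^2 with balls of radius q; the numbers 1/8 and 16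
    \<pi> in \<open>sep_const\<close> arise here.\<close>
  have pk: "(\<Sum>j\<in>I. exp (- (norm (z - p j))\<^sup>2 / (8 * q\<^sup>2))) \<le> S" for z
  proof -
    have "(\<Sum>j\<in>I. exp (- (norm (z - p j))\<^sup>2 / (4 * (2 * q\<^sup>2))))
      \<le> exp (q\<^sup>2 / (4 * (2 * q\<^sup>2))) * (8 * pi * (2 * q\<^sup>2)) powr (d / 2) / (unit_ball_vol d * q ^ DIM('a))"
      unfolding d_def
    proof (rule gaussian_packing_sum[where Q = "\<lambda>j. ball (p j) q"])
      show "0 < unit_ball_vol (real DIM('a)) * q ^ DIM('a)" using q by simp
      show "unit_ball_vol (real DIM('a)) * q ^ DIM('a) \<le> measure lborel (ball (p j) q)" for j
        using q by (simp add: content_ball)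
      show "norm (y - p j) \<le> q" if "y \<in> ball (p j) q" for j y
        using that by (simp add: dist_norm norm_minus_commute)
    qed (use q I disj emeasure_lborel_ball_finite in auto)
    also have "(8 * pi * (2 * q\<^sup>2)) powr (d / 2) = (16 * pi) powr (d / 2) * q ^ DIM('a)"
    proof -
      have "(q\<^sup>2) powr (d / 2) = q ^ DIM('a)"
      proof -
        have "(q\<^sup>2) powr (d / 2) = (q powr 2) powr (d / 2)" using q by simp
        also have "\<dots> = q powr real DIM('a)" unfolding powr_powr by (simp add: d_def)
        also have "\<dots> = q ^ DIM('a)" using q by (simp add: powr_realpow)
        finally show ?thesis .
      qed
      thus ?thesis using powr_mult[of "16 * pi" "q\<^sup>2" "d / 2"] by (simp add: mult_ac)
    qed
    also have "exp (q\<^sup>2 / (4 * (2 * q\<^sup>2))) * ((16 * pi) powr (d / 2) * q ^ DIM('a)) / (unit_ball_vol d * q ^ DIM('a)) = S"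
      using q by (simp add: S_def)
    finally show ?thesis by simp
  qed
  have row: "(\<Sum>j\<in>I. G i j) \<le> 1 / 2" if i: "i \<in> I" for i
  proof -
    have "(\<Sum>j\<in>I. G i j) \<le> (\<Sum>j\<in>I. exp (- q\<^sup>2 / (2 * w)) * exp (- (norm (p i - p j))\<^sup>2 / (8 * q\<^sup>2)))"
    proof (rule sum_mono)
      fix j assume j: "j \<in> I"
      show "G i j \<le> exp (- q\<^sup>2 / (2 * w)) * exp (- (norm (p i - p j))\<^sup>2 / (8 * q\<^sup>2))"
      proof (cases "i = j")
        case False
        define D where "D = (norm (p i - p j))\<^sup>2"
        have "(2 * q)\<^sup>2 \<le> D" unfolding D_def using sep[OF i j False] q by (intro power_mono) auto
        hence 1: "q\<^sup>2 / (2 * w) \<le> D / (8 * w)" using w by (simp add: field_simps power2_eq_square)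
        have 2: "D / (8 * q\<^sup>2) \<le> D / (8 * w)" using w wq q by (intro divide_left_mono) (auto simp: D_def)
        have "- D / (4 * w) = - D / (8 * w) - D / (8 * w)" using w by (simp add: field_simps)
        also have "\<dots> \<le> - q\<^sup>2 / (2 * w) + - D / (8 * q\<^sup>2)" using 1 2 by (simp add: minus_divide_left[symmetric])
        finally show ?thesis using False by (simp add: G_def D_def exp_add[symmetric])
      qed (simp add: G_def)
    qed
    also have "\<dots> \<le> exp (- q\<^sup>2 / (2 * w)) * S"
      unfolding sum_distrib_left[symmetric] by (intro mult_left_mono pk) auto
    finally show ?thesis using small by linarith
  qed
  have "gauss_form w p a I = (\<Sum>i\<in>I. \<Sum>j\<in>I. (if i = j then (a i)\<^sup>2 else 0) + a i * a j * G i j)"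
    unfolding gauss_form_def G_def by (intro sum.cong refl) (auto simp: power2_eq_square)
  also have "\<dots> = (\<Sum>i\<in>I. (a i)\<^sup>2) + (\<Sum>i\<in>I. \<Sum>j\<in>I. a i * a j * G i j)"
    using I by (simp add: sum.distrib)
  finally show ?thesis
    using schur_test[of I G "1 / 2" a] row by (simp add: G_def norm_minus_commute)
qed

section \<open>Matern kernels as Gaussian mixtures\<close>

lemma has_bochner_integral_exp_atLeast:
  fixes c a :: real assumes c: "0 < c"
  shows "has_bochner_integral lborel (\<lambda>t. indicator {a..} t * exp (- c * t)) (exp (- c * a) / c)"
proof (rule has_bochner_integral_nn_integral)
  have "(\<integral>\<^sup>+t. ennreal (exp (- c * t)) * indicator {a..} t \<partial>lborel) = ennreal (0 - (- exp (- c * a) / c))"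
  proof (rule nn_integral_FTC_atLeast)
    show "DERIV (\<lambda>t. - exp (- c * t) / c) x :> exp (- c * x)" for x
      using c by (auto intro!: derivative_eq_intros)
    have "((\<lambda>t. exp (- (c * t))) \<longlongrightarrow> 0) at_top"
      using c by (intro filterlim_compose[OF exp_at_bot] filterlim_uminus_at_bot_at_top[THEN filterlim_compose] filterlim_tendsto_pos_mult_at_top[OF tendsto_const]) (auto simp: filterlim_ident)
    thus "((\<lambda>t. - exp (- c * t) / c) \<longlongrightarrow> 0) at_top"
      using tendsto_mult_right[of "\<lambda>t. exp (- (c * t))" 0 at_top "- 1 / c"] by simp
  qed auto
  thus "(\<integral>\<^sup>+t. ennreal (indicator {a..} t * exp (- c * t)) \<partial>lborel) = ennreal (exp (- c * a) / c)"
    by (simp add: ennreal_mult' mult.commute flip: ennreal_indicator)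
qed (use c in auto)

lemma has_bochner_integral_exp_atMost:
  fixes c a :: real assumes c: "0 < c"
  shows "has_bochner_integral lborel (\<lambda>t. indicator {..a} t * exp (c * t)) (exp (c * a) / c)"
  using has_bochner_integral_exp_atLeast[OF c, of "- a"]
    lborel_has_bochner_integral_real_affine_iff[of "-1" "\<lambda>t. indicator {..a} t * exp (c * t)" "exp (c * a) / c" 0]
  by (simp add: indicator_def minus_le_iff cong: if_cong)

text \<open>The Gamma weight t^(\<nu>-1) exp(-\<kappa> t) dt in the variable t = exp \<tau>.\<close>

definition mix :: "real \<Rightarrow> real \<Rightarrow> real \<Rightarrow> real" where
  "mix \<nu> \<kappa> \<tau> = exp (\<nu> * \<tau> - \<kappa> * exp \<tau>)"

lemma mix_nonneg: "0 \<le> mix \<nu> \<kappa> \<tau>"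
  by (simp add: mix_def)

lemma mix_measurable [measurable]: "mix \<nu> \<kappa> \<in> borel_measurable borel"
  unfolding mix_def by measurable

lemma mix_le_exp: "0 \<le> \<kappa> \<Longrightarrow> mix \<nu> \<kappa> \<tau> \<le> exp (\<nu> * \<tau>)"
  by (simp add: mix_def)

lemma power_le_fact_exp: "0 \<le> x \<Longrightarrow> x ^ k \<le> fact k * exp (x::real)"
proof -
  assume x: "0 \<le> x"
  have "(\<Sum>j\<in>{k}. x ^ j /\<^sub>R fact j) \<le> exp x"
    unfolding exp_def by (rule sum_le_suminf[OF summable_exp_generic]) (use x in auto)
  thus ?thesis by (simp add: field_simps)
qed

lemma integrable_mix:
  assumes "0 < \<nu>" "0 < \<kappa>" shows "integrable lborel (mix \<nu> \<kappa>)"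
proof -
  \<comment> \<open>With k > \<nu> + 1 the bound exp(-\<kappa> t) \<le> C t^(-k) turns the right
    half of the weight into a function decaying at least like exp(-\<tau>).\<close>
  obtain k :: nat where k: "\<nu> + 1 < real k" using reals_Archimedean2 by blast
  define C where "C = fact k / \<kappa> ^ k"
  have C: "0 < C" using assms by (simp add: C_def)
  have le: "mix \<nu> \<kappa> \<tau> \<le> indicator {..0} \<tau> * exp (\<nu> * \<tau>) + C * (indicator {0..} \<tau> * exp (- 1 * \<tau>))" for \<tau>
  proof (cases "\<tau> \<le> 0")
    case True
    thus ?thesis using mix_le_exp[of \<kappa> \<nu> \<tau>] assms C by (auto simp: indicator_def)
  next
    case False
    have "(\<kappa> * exp \<tau>) ^ k \<le> fact k * exp (\<kappa> * exp \<tau>)" by (rule power_le_fact_exp) (use assms in auto)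
    hence "exp (- (\<kappa> * exp \<tau>)) \<le> C * exp (- real k * \<tau>)"
      using assms exp_of_nat_mult[of k \<tau>] by (simp add: C_def exp_minus field_simps power_mult_distrib)
    hence "mix \<nu> \<kappa> \<tau> \<le> exp (\<nu> * \<tau>) * (C * exp (- real k * \<tau>))"
      by (simp add: mix_def exp_diff exp_minus field_simps)
    also have "\<dots> = C * exp ((\<nu> - real k) * \<tau>)" by (simp add: exp_add[symmetric] algebra_simps)
    also have "\<dots> \<le> C * exp (- 1 * \<tau>)"
      using C False k mult_right_mono[of "\<nu> - real k" "- 1" \<tau>] by (intro mult_left_mono) auto
    finally show ?thesis using False by (simp add: indicator_def)
  qed
  show ?thesis
  proof (rule Bochner_Integration.integrable_bound)
    show "integrable lborel (\<lambda>\<tau>. indicator {..0} \<tau> * exp (\<nu> * \<tau>) + C * (indicator {0..} \<tau> * exp (- 1 * \<tau>)))"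
      using has_bochner_integral_exp_atMost[of \<nu> 0] has_bochner_integral_exp_atLeast[of 1 0] assms
      by (intro Bochner_Integration.integrable_add integrable_mult_right) (auto simp: has_bochner_integral_iff)
    show "AE \<tau> in lborel. norm (mix \<nu> \<kappa> \<tau>) \<le> norm (indicator {..0} \<tau> * exp (\<nu> * \<tau>) + C * (indicator {0..} \<tau> * exp (- 1 * \<tau>)))"
      using le mix_nonneg[of \<nu> \<kappa>] by (intro AE_I2) (metis abs_ge_self abs_of_nonneg order_trans real_norm_def)
  qed simp
qed

text \<open>The Gaussian scales are parametrised logarithmically, as exp \<tau>: rescaling \<kappa> then becomes a
  translation of \<tau>.\<close>

definition Psi :: "real \<Rightarrow> real \<Rightarrow> real \<Rightarrow> real" where
  "Psi \<nu> \<kappa> r = (LINT \<tau>|lborel. mix \<nu> \<kappa> \<tau> * exp (- r\<^sup>2 / (4 * exp \<tau>)))"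

lemma integrable_mix_bounded:
  fixes f :: "real \<Rightarrow> real"
  assumes "0 < \<nu>" "0 < \<kappa>" and [measurable]: "f \<in> borel_measurable borel" and f: "\<And>\<tau>. \<bar>f \<tau>\<bar> \<le> B"
  shows "integrable lborel (\<lambda>\<tau>. mix \<nu> \<kappa> \<tau> * f \<tau>)"
proof (rule Bochner_Integration.integrable_bound)
  show "integrable lborel (\<lambda>\<tau>. mix \<nu> \<kappa> \<tau> * B)" using integrable_mix[OF assms(1,2)] by simp
  show "AE \<tau> in lborel. norm (mix \<nu> \<kappa> \<tau> * f \<tau>) \<le> norm (mix \<nu> \<kappa> \<tau> * B)"
    using f order_trans[OF f abs_ge_self] by (auto simp: abs_mult intro!: mult_left_mono AE_I2)
qed measurable

lemma integrable_Psi: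
  assumes "0 < \<nu>" "0 < \<kappa>"
  shows "integrable lborel (\<lambda>\<tau>. mix \<nu> \<kappa> \<tau> * exp (- r\<^sup>2 / (4 * exp \<tau>)))"
  by (rule integrable_mix_bounded[OF assms, of _ 1]) auto

lemma Psi_scale:
  assumes "0 < \<nu>" "0 < \<kappa>" "0 < s"
  shows "Psi \<nu> (\<kappa> * s) r = s powr (- \<nu>) * Psi \<nu> \<kappa> (sqrt s * r)"
proof -
  have "Psi \<nu> \<kappa> (sqrt s * r) = (LINT \<tau>|lborel. mix \<nu> \<kappa> (ln s + 1 * \<tau>) * exp (- (sqrt s * r)\<^sup>2 / (4 * exp (ln s + 1 * \<tau>))))"
    unfolding Psi_def by (subst lborel_integral_real_affine[of 1 _ "ln s"]) auto
  also have "\<dots> = (LINT \<tau>|lborel. s powr \<nu> * (mix \<nu> (\<kappa> * s) \<tau> * exp (- r\<^sup>2 / (4 * exp \<tau>))))"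
    using assms(3) by (intro Bochner_Integration.integral_cong)
      (auto simp: mix_def exp_add powr_def power_mult_distrib exp_diff algebra_simps)
  finally show ?thesis using assms by (simp add: Psi_def powr_minus field_simps)
qed

text \<open>Under \<tau> = ln (z/2) + t the two competing exponents exp \<tau> and z^2/(4 exp
  \<tau>) add up to z cosh t. Folding the line at 0 then replaces exp(\<nu> t) by 2 cosh(\<nu>
  t).\<close>

lemma Psi_bessel:
  assumes z: "0 < z" and \<nu>: "0 < \<nu>"
  shows "z powr \<nu> * bessel_K \<nu> z = 2 powr (\<nu> - 1) * Psi \<nu> 1 z"
proof -
  define f where "f = (\<lambda>t. exp (- z * cosh t + \<nu> * t))"
  have fm [measurable]: "f \<in> borel_measurable borel"
    unfolding f_def by (intro borel_measurable_continuous_onI continuous_intros)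
  have sh: "(z / 2) powr \<nu> * f t = mix \<nu> 1 (ln (z / 2) + 1 * t) * exp (- z\<^sup>2 / (4 * exp (ln (z / 2) + 1 * t)))" for t
  proof -
    have "z * cosh t = z / 2 * exp t + z\<^sup>2 / (4 * (z / 2 * exp t))"
      using z by (simp add: cosh_def exp_minus field_simps power2_eq_square)
    hence eq: "\<nu> * ln (z / 2) + (- z * cosh t + \<nu> * t) = \<nu> * (ln (z / 2) + 1 * t) - 1 * (z / 2 * exp t) + - z\<^sup>2 / (4 * (z / 2 * exp t))"
      by (simp add: distrib_left)
    have E: "exp (ln (z / 2) + 1 * t) = z / 2 * exp t" using z by (simp add: exp_add)
    have pw: "(z / 2) powr \<nu> = exp (\<nu> * ln (z / 2))" using z by (simp add: powr_def)
    show ?thesis unfolding f_def mix_def E pw exp_add[symmetric] eq ..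
  qed
  have i0: "integrable lborel (\<lambda>t. (z / 2) powr \<nu> * f t)"
    unfolding sh using integrable_Psi[OF \<nu>, of 1 z]
    by (intro lborel_integrable_real_affine_iff[THEN iffD2]) auto
  hence i: "integrable lborel f" using z by simp
  have "Psi \<nu> 1 z = (LINT t|lborel. (z / 2) powr \<nu> * f t)"
    unfolding sh Psi_def by (subst lborel_integral_real_affine[of 1 _ "ln (z / 2)"]) auto
  hence P: "Psi \<nu> 1 z = (z / 2) powr \<nu> * (LINT t|lborel. f t)" by simp
  have i': "integrable lborel (\<lambda>t. f (- t))"
    using lborel_integrable_real_affine_iff[of "-1" f 0] i by simp
  have si: "integrable lborel (\<lambda>t. indicator {0..} t *\<^sub>R f t)" "integrable lborel (\<lambda>t. indicator {0..} t *\<^sub>R f (- t))"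
    "integrable lborel (\<lambda>t. indicator {..0} t *\<^sub>R f t)"
    by (intro integrable_mult_indicator i i', simp)+
  have ae: "AE t in lborel. f t = indicator {0..} t *\<^sub>R f t + indicator {..0} t *\<^sub>R f t"
    using AE_lborel_singleton[of "0::real"] by eventually_elim (auto simp: indicator_def)
  have "(LINT t|lborel. f t) = (LINT t|lborel. indicator {0..} t *\<^sub>R f t + indicator {..0} t *\<^sub>R f t)"
    by (rule integral_cong_AE[OF _ _ ae]) auto
  also have "\<dots> = (LINT t|lborel. indicator {0..} t *\<^sub>R f t) + (LINT t|lborel. indicator {..0} t *\<^sub>R f t)"
    by (rule Bochner_Integration.integral_add[OF si(1,3)])
  also have "(LINT t|lborel. indicator {..0} t *\<^sub>R f t) = (LINT t|lborel. indicator {0..} t *\<^sub>R f (- t))"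
    by (subst lborel_integral_real_affine[of "-1" _ 0]) (auto simp: indicator_def cong: if_cong)
  also have "(LINT t|lborel. indicator {0..} t *\<^sub>R f t) + (LINT t|lborel. indicator {0..} t *\<^sub>R f (- t))
     = (LINT t|lborel. indicator {0..} t *\<^sub>R f t + indicator {0..} t *\<^sub>R f (- t))"
    by (rule Bochner_Integration.integral_add[OF si(1,2), symmetric])
  also have "\<dots> = (LINT t|lborel. 2 * (indicator {0..} t *\<^sub>R (exp (- z * cosh t) * cosh (\<nu> * t))))"
  proof (intro Bochner_Integration.integral_cong refl)
    have "exp (- z * cosh t + \<nu> * t) + exp (- z * cosh (- t) + \<nu> * (- t)) = 2 * (exp (- z * cosh t) * cosh (\<nu> * t))" for t
      unfolding exp_add cosh_minus by (simp add: cosh_def distrib_left)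
    thus "indicator {0..} t *\<^sub>R f t + indicator {0..} t *\<^sub>R f (- t) = 2 * (indicator {0..} t *\<^sub>R (exp (- z * cosh t) * cosh (\<nu> * t)))" for t :: real
      unfolding f_def by (simp add: indicator_def)
  qed
  also have "\<dots> = 2 * bessel_K \<nu> z" by (simp add: bessel_K_def set_lebesgue_integral_def)
  finally have "Psi \<nu> 1 z = (z / 2) powr \<nu> * (2 * bessel_K \<nu> z)" using P by simp
  thus ?thesis using z by (simp add: powr_divide powr_diff)
qed

text \<open>The mixture makes sense at z = 0 and is continuous there by dominated convergence, so it
  identifies the limit that defines the profile at 0.\<close>

lemma matern_profile_Psi:
  assumes z: "0 \<le> z" and \<nu>: "0 < \<nu>"
  shows "matern_profile \<nu> z = 2 powr (\<nu> - 1) * Psi \<nu> 1 z"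
proof (cases "z = 0")
  case True
  have "((\<lambda>t. 2 powr (\<nu> - 1) * Psi \<nu> 1 t) \<longlongrightarrow> 2 powr (\<nu> - 1) * Psi \<nu> 1 0) (at_right 0)"
  proof (rule tendsto_mult_left, unfold tendsto_at_iff_sequentially, intro allI impI)
    fix X :: "nat \<Rightarrow> real" assume X: "X \<longlonglongrightarrow> 0"
    show "(Psi \<nu> 1 \<circ> X) \<longlonglongrightarrow> Psi \<nu> 1 0"
      unfolding Psi_def o_def
    proof (rule integral_dominated_convergence[where w = "mix \<nu> 1"])
      show "AE \<tau> in lborel. (\<lambda>i. mix \<nu> 1 \<tau> * exp (- (X i)\<^sup>2 / (4 * exp \<tau>))) \<longlonglongrightarrow> mix \<nu> 1 \<tau> * exp (- 0\<^sup>2 / (4 * exp \<tau>))"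
        by (intro AE_I2 tendsto_intros X) auto
    qed (auto simp: integrable_mix \<nu> mix_nonneg mult_left_le)
  qed
  hence "((\<lambda>t. t powr \<nu> * bessel_K \<nu> t) \<longlongrightarrow> 2 powr (\<nu> - 1) * Psi \<nu> 1 0) (at_right 0)"
    by (rule Lim_transform_eventually)
       (auto simp: eventually_at_filter Psi_bessel[OF _ \<nu>])
  hence "Lim (at_right 0) (\<lambda>t. t powr \<nu> * bessel_K \<nu> t) = 2 powr (\<nu> - 1) * Psi \<nu> 1 0"
    by (intro tendsto_Lim) auto
  with True show ?thesis by (simp add: matern_profile_def)
qed (use assms Psi_bessel in \<open>simp add: matern_profile_def\<close>)

text \<open>All factors that depend on \<nu> alone. The last one appears because the length scale is
  moved from the argument of \<open>Psi\<close> into \<kappa> by \<open>Psi_scale\<close>.\<close>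

definition matern_amp :: "real \<Rightarrow> real \<Rightarrow> (real \<Rightarrow> real) \<Rightarrow> real \<Rightarrow> real" where
  "matern_amp \<sigma> \<rho> c \<nu> = \<sigma>\<^sup>2 * c \<nu> * 2 powr (\<nu> - 1) * (2 * \<nu> / \<rho>\<^sup>2) powr \<nu>"

lemma matern_Psi:
  assumes \<nu>: "0 < \<nu>" and \<rho>: "0 < \<rho>"
  shows "matern \<sigma> \<rho> c \<nu> x y = matern_amp \<sigma> \<rho> c \<nu> * Psi \<nu> (2 * \<nu> / \<rho>\<^sup>2) (norm (x - y))"
  using assms Psi_scale[of \<nu> 1 "2 * \<nu> / \<rho>\<^sup>2" "norm (x - y)"]
  by (simp add: matern_def matern_profile_Psi matern_amp_def powr_minus real_sqrt_divide field_simps)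

lemma tonelli_real:
  fixes f :: "'a::euclidean_space \<Rightarrow> 'b::euclidean_space \<Rightarrow> real"
  assumes m: "(\<lambda>(x, y). f x y) \<in> borel_measurable (lborel \<Otimes>\<^sub>M lborel)"
    and nonneg: "\<And>x y. 0 \<le> f x y"
    and i1: "\<And>x. integrable lborel (f x)"
    and i2: "integrable lborel (\<lambda>x. LINT y|lborel. f x y)"
  shows "AE y in lborel. integrable lborel (\<lambda>x. f x y)"
    and "integrable lborel (\<lambda>y. LINT x|lborel. f x y)"
    and "(LINT y|lborel. LINT x|lborel. f x y) = (LINT x|lborel. LINT y|lborel. f x y)"
proof -
  have I: "integrable (lborel \<Otimes>\<^sub>M lborel) (\<lambda>(x, y). f x y)"
    by (rule lborel_pair.Fubini_integrable[OF m]) (use i1 i2 nonneg in auto)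
  show "AE y in lborel. integrable lborel (\<lambda>x. f x y)"
    using lborel_pair.AE_integrable_snd[OF I] .
  show "integrable lborel (\<lambda>y. LINT x|lborel. f x y)"
    using lborel_pair.integrable_snd[OF I] .
  show "(LINT y|lborel. LINT x|lborel. f x y) = (LINT x|lborel. LINT y|lborel. f x y)"
    using lborel_pair.Fubini_integral[OF I] .
qed

section \<open>Coercivity and a Bernstein inequality for mixtures of Gaussian forms\<close>

definition psi_form :: "real \<Rightarrow> real \<Rightarrow> ('i \<Rightarrow> 'a::euclidean_space) \<Rightarrow> ('i \<Rightarrow> real) \<Rightarrow> 'i set \<Rightarrow> real" where
  "psi_form \<nu> \<kappa> p a I = (\<Sum>i\<in>I. \<Sum>j\<in>I. a i * a j * Psi \<nu> \<kappa> (norm (p i - p j)))"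

lemma gauss_form_measurable [measurable]:
  "(\<lambda>\<tau>. gauss_form (exp \<tau>) p a I) \<in> borel_measurable borel"
  unfolding gauss_form_def by measurable

lemma psi_form_eq:
  fixes p :: "'i \<Rightarrow> 'a::euclidean_space"
  assumes "0 < \<nu>" "0 < \<kappa>"
  shows "integrable lborel (\<lambda>\<tau>. mix \<nu> \<kappa> \<tau> * gauss_form (exp \<tau>) p a I)"
    and "psi_form \<nu> \<kappa> p a I = (LINT \<tau>|lborel. mix \<nu> \<kappa> \<tau> * gauss_form (exp \<tau>) p a I)"
proof -
  have eq: "mix \<nu> \<kappa> \<tau> * gauss_form (exp \<tau>) p a I
    = (\<Sum>i\<in>I. \<Sum>j\<in>I. a i * a j * (mix \<nu> \<kappa> \<tau> * exp (- (norm (p i - p j))\<^sup>2 / (4 * exp \<tau>))))" for \<tau>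
    unfolding gauss_form_def sum_distrib_left by (intro sum.cong refl) (simp add: mult_ac)
  have int: "integrable lborel (\<lambda>\<tau>. a i * a j * (mix \<nu> \<kappa> \<tau> * exp (- (norm (p i - p j))\<^sup>2 / (4 * exp \<tau>))))" for i j
    by (intro integrable_mult_right integrable_Psi assms)
  show "integrable lborel (\<lambda>\<tau>. mix \<nu> \<kappa> \<tau> * gauss_form (exp \<tau>) p a I)"
    unfolding eq by (intro Bochner_Integration.integrable_sum int)
  show "psi_form \<nu> \<kappa> p a I = (LINT \<tau>|lborel. mix \<nu> \<kappa> \<tau> * gauss_form (exp \<tau>) p a I)"
    unfolding eq psi_form_def Psi_def
    using int by (simp add: Bochner_Integration.integral_sum Bochner_Integration.integrable_sum)
qed

lemma psi_form_nonneg: "0 < \<nu> \<Longrightarrow> 0 < \<kappa> \<Longrightarrow> 0 \<le> psi_form \<nu> \<kappa> p a I"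
  unfolding psi_form_eq by (intro integral_nonneg_AE) (auto simp: mix_nonneg gauss_form_nonneg)

context
  fixes p :: "'i \<Rightarrow> 'a::euclidean_space" and I :: "'i set" and q s :: real
  assumes I: "finite I" and q: "0 < q"
    and sep: "\<And>i j. i \<in> I \<Longrightarrow> j \<in> I \<Longrightarrow> i \<noteq> j \<Longrightarrow> 2 * q \<le> norm (p i - p j)"
  defines "s \<equiv> sep_const (real DIM('a)) * q\<^sup>2"
begin

lemma sep_scale_pos: "0 < s"
  unfolding s_def using q sep_const_pos[of "real DIM('a)"] by simp

lemma gauss_form_sep_bounds:
  assumes "\<tau> \<le> ln s"
  shows "1 / 2 * (\<Sum>i\<in>I. (a i)\<^sup>2) \<le> gauss_form (exp \<tau>) p a I"
    and "gauss_form (exp \<tau>) p a I \<le> 3 / 2 * (\<Sum>i\<in>I. (a i)\<^sup>2)"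
proof -
  have "exp \<tau> \<le> s" using assms sep_scale_pos by (metis exp_le_cancel_iff exp_ln)
  hence "\<bar>gauss_form (exp \<tau>) p a I - (\<Sum>i\<in>I. (a i)\<^sup>2)\<bar> \<le> 1 / 2 * (\<Sum>i\<in>I. (a i)\<^sup>2)"
    unfolding s_def by (intro gauss_form_separated[OF I q sep]) auto
  thus "1 / 2 * (\<Sum>i\<in>I. (a i)\<^sup>2) \<le> gauss_form (exp \<tau>) p a I"
    and "gauss_form (exp \<tau>) p a I \<le> 3 / 2 * (\<Sum>i\<in>I. (a i)\<^sup>2)" by linarith+
qed

text \<open>Only the window of logarithmic scales from ln s - 1 to ln s is kept. There the Gaussian
  form is at least half the sum of squares, and the weight is at least exp(-\<kappa> s - \<nu>)
  s^\<nu>.\<close>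

lemma psi_form_coercive:
  assumes "0 < \<nu>" "0 < \<kappa>"
  shows "1 / 2 * exp (- \<kappa> * s - \<nu>) * s powr \<nu> * (\<Sum>i\<in>I. (a i)\<^sup>2) \<le> psi_form \<nu> \<kappa> p a I"
proof -
  let ?A = "\<Sum>i\<in>I. (a i)\<^sup>2" and ?c = "exp (- \<kappa> * s - \<nu>) * s powr \<nu>"
  have A: "0 \<le> ?A" by (intro sum_nonneg) auto
  have "1 / 2 * ?c * ?A = (LINT \<tau>|lborel. indicator {ln s - 1..ln s} \<tau> * (?c * (1 / 2 * ?A)))"
    by simp
  also have "\<dots> \<le> (LINT \<tau>|lborel. mix \<nu> \<kappa> \<tau> * gauss_form (exp \<tau>) p a I)"
  proof (rule integral_mono)
    show "integrable lborel (\<lambda>\<tau>. indicator {ln s - 1..ln s} \<tau> * (?c * (1 / 2 * ?A)))"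
      by (intro integrable_mult_left integrable_real_indicator) auto
    fix \<tau> :: real
    show "indicator {ln s - 1..ln s} \<tau> * (?c * (1 / 2 * ?A)) \<le> mix \<nu> \<kappa> \<tau> * gauss_form (exp \<tau>) p a I"
    proof (cases "\<tau> \<in> {ln s - 1..ln s}")
      case True
      have "exp \<tau> \<le> s" using True sep_scale_pos by (metis atLeastAtMost_iff exp_le_cancel_iff exp_ln)
      hence "\<kappa> * exp \<tau> \<le> \<kappa> * s" using assms by simp
      moreover have "\<nu> * (ln s - 1) \<le> \<nu> * \<tau>" using True assms by simp
      ultimately have "- \<kappa> * s - \<nu> + \<nu> * ln s \<le> \<nu> * \<tau> - \<kappa> * exp \<tau>" by (simp add: algebra_simps)
      hence "?c \<le> mix \<nu> \<kappa> \<tau>" using sep_scale_pos by (simp add: mix_def powr_def exp_add[symmetric])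
      thus ?thesis using True A gauss_form_sep_bounds(1)[of \<tau> a]
        using mult_mono[of ?c "mix \<nu> \<kappa> \<tau>" "1 / 2 * ?A" "gauss_form (exp \<tau>) p a I"] by (auto simp: mix_nonneg)
    next
      case False
      thus ?thesis by (simp add: mix_nonneg gauss_form_nonneg)
    qed
  qed (rule psi_form_eq[OF assms])
  finally show ?thesis unfolding psi_form_eq(2)[OF assms] by simp
qed

text \<open>Above the separation scale the weights compare pointwise, with ratio at most
  s^(\<mu>-\<nu>). Below it the Gaussian form is comparable to the sum of squares, which coercivity
  of the form of order \<nu> controls.\<close>

lemma psi_form_bernstein:
  assumes "0 < \<mu>" "\<mu> \<le> \<nu>" "0 < \<kappa>"
  shows "psi_form \<mu> \<kappa> p a I \<le> s powr (\<mu> - \<nu>) * (1 + 3 * exp (\<kappa> * s + \<nu>) / \<mu>) * psi_form \<nu> \<kappa> p a I"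
proof -
  let ?A = "\<Sum>i\<in>I. (a i)\<^sup>2"
  have A: "0 \<le> ?A" by (intro sum_nonneg) auto
  have \<nu>: "0 < \<nu>" using assms by simp
  note E = has_bochner_integral_exp_atMost[OF assms(1), of "ln s"]
  have i1: "integrable lborel (\<lambda>\<tau>. indicator {..ln s} \<tau> * exp (\<mu> * \<tau>) * (3 / 2 * ?A))"
    using E by (intro integrable_mult_left) (simp add: has_bochner_integral_iff)
  have i2: "integrable lborel (\<lambda>\<tau>. s powr (\<mu> - \<nu>) * (mix \<nu> \<kappa> \<tau> * gauss_form (exp \<tau>) p a I))"
    by (intro integrable_mult_right psi_form_eq \<nu> assms)
  have "psi_form \<mu> \<kappa> p a I \<le> (LINT \<tau>|lborel. indicator {..ln s} \<tau> * exp (\<mu> * \<tau>) * (3 / 2 * ?A)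
      + s powr (\<mu> - \<nu>) * (mix \<nu> \<kappa> \<tau> * gauss_form (exp \<tau>) p a I))"
    unfolding psi_form_eq(2)[OF assms(1,3)]
  proof (rule integral_mono)
    fix \<tau> :: real
    have nn: "0 \<le> s powr (\<mu> - \<nu>) * (mix \<nu> \<kappa> \<tau> * gauss_form (exp \<tau>) p a I)"
      by (simp add: mix_nonneg gauss_form_nonneg)
    show "mix \<mu> \<kappa> \<tau> * gauss_form (exp \<tau>) p a I \<le> indicator {..ln s} \<tau> * exp (\<mu> * \<tau>) * (3 / 2 * ?A)
      + s powr (\<mu> - \<nu>) * (mix \<nu> \<kappa> \<tau> * gauss_form (exp \<tau>) p a I)"
    proof (cases "\<tau> \<le> ln s")
      case True
      have "mix \<mu> \<kappa> \<tau> * gauss_form (exp \<tau>) p a I \<le> exp (\<mu> * \<tau>) * (3 / 2 * ?A)"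
        using gauss_form_sep_bounds(2)[OF True] assms mix_le_exp[of \<kappa> \<mu> \<tau>]
        by (intro mult_mono) (auto simp: mix_nonneg gauss_form_nonneg)
      thus ?thesis using True nn by simp
    next
      case False
      have "\<mu> * \<tau> \<le> (\<mu> - \<nu>) * ln s + \<nu> * \<tau>"
        using mult_left_mono[of "ln s" \<tau> "\<nu> - \<mu>"] False assms by (simp add: algebra_simps)
      hence "mix \<mu> \<kappa> \<tau> \<le> s powr (\<mu> - \<nu>) * mix \<nu> \<kappa> \<tau>"
        using sep_scale_pos by (simp add: mix_def powr_def exp_add[symmetric])
      hence "mix \<mu> \<kappa> \<tau> * gauss_form (exp \<tau>) p a I \<le> s powr (\<mu> - \<nu>) * mix \<nu> \<kappa> \<tau> * gauss_form (exp \<tau>) p a I"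
        by (intro mult_right_mono gauss_form_nonneg) auto
      thus ?thesis using False by (simp add: mult_ac)
    qed
  qed (use i1 i2 assms in \<open>auto intro: psi_form_eq\<close>)
  also have "\<dots> = exp (\<mu> * ln s) / \<mu> * (3 / 2 * ?A) + s powr (\<mu> - \<nu>) * psi_form \<nu> \<kappa> p a I"
    unfolding Bochner_Integration.integral_add[OF i1 i2] psi_form_eq(2)[OF \<nu> assms(3)]
    using E by (simp add: has_bochner_integral_iff)
  \<comment> \<open>Rearranged so that the last factor is exactly the left-hand side of
    \<open>psi_form_coercive\<close>.\<close>
  also have "exp (\<mu> * ln s) / \<mu> * (3 / 2 * ?A) = s powr (\<mu> - \<nu>) * (3 * exp (\<kappa> * s + \<nu>) / \<mu>) * (1 / 2 * exp (- \<kappa> * s - \<nu>) * s powr \<nu> * ?A)"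
  proof -
    have "exp (\<mu> * ln s) = s powr (\<mu> - \<nu>) * s powr \<nu>" using sep_scale_pos
      by (simp add: powr_def exp_add[symmetric] left_diff_distrib)
    moreover have "exp (\<kappa> * s + \<nu>) * exp (- \<kappa> * s - \<nu>) = 1" by (simp add: exp_add[symmetric])
    ultimately show ?thesis by (simp add: field_simps)
  qed
  also have "\<dots> \<le> s powr (\<mu> - \<nu>) * (3 * exp (\<kappa> * s + \<nu>) / \<mu>) * psi_form \<nu> \<kappa> p a I"
    using assms by (intro mult_left_mono psi_form_coercive \<nu>) auto
  finally show ?thesis by (simp add: algebra_simps)
qed

end

text \<open>The spectral density of the Matern kernel of order \<alpha> - d/2, up to a constant. It
  is kept as a mixture so that identities for Gaussians pass to it by Tonelli;
  \<open>spec_eq\<close> gives the closed form.\<close>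

definition spec :: "real \<Rightarrow> real \<Rightarrow> 'a::euclidean_space \<Rightarrow> real" where
  "spec \<alpha> \<kappa> \<xi> = (LINT \<tau>|lborel. mix \<alpha> (\<kappa> + (norm \<xi>)\<^sup>2) \<tau>)"

text \<open>Euler's Gamma function, in the logarithmic variable.\<close>

definition Gam :: "real \<Rightarrow> real" where "Gam \<alpha> = (LINT \<tau>|lborel. mix \<alpha> 1 \<tau>)"

lemma Gam_pos: assumes "0 < \<alpha>" shows "0 < Gam \<alpha>"
proof -
  have "exp (- 1 - \<alpha>) = (LINT \<tau>|lborel. indicator {-1..0::real} \<tau> * exp (- 1 - \<alpha>))" by simp
  also have "\<dots> \<le> Gam \<alpha>" unfolding Gam_def
  proof (rule integral_mono)
    fix \<tau> :: real
    show "indicator {-1..0} \<tau> * exp (- 1 - \<alpha>) \<le> mix \<alpha> 1 \<tau>"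
    proof (cases "\<tau> \<in> {-1..0}")
      case True
      hence "\<alpha> * (-1) \<le> \<alpha> * \<tau>" using assms by (intro mult_left_mono) auto
      moreover have "exp \<tau> \<le> 1" using True by simp
      ultimately have "- 1 - \<alpha> \<le> \<alpha> * \<tau> - exp \<tau>" by linarith
      thus ?thesis using True by (simp add: mix_def)
    qed (simp add: mix_nonneg)
  qed (use assms in \<open>auto intro!: integrable_mult_left integrable_mix\<close>)
  finally show ?thesis using exp_gt_zero[of "- 1 - \<alpha>"] by linarith
qed

lemma integral_mix:
  assumes "0 < \<alpha>" "0 < \<kappa>" shows "(LINT \<tau>|lborel. mix \<alpha> \<kappa> \<tau>) = Gam \<alpha> * \<kappa> powr (- \<alpha>)"
  using Psi_scale[of \<alpha> 1 \<kappa> 0] assms by (simp add: Psi_def Gam_def)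

lemma spec_eq:
  assumes "0 < \<alpha>" "0 < \<kappa>" shows "spec \<alpha> \<kappa> \<xi> = Gam \<alpha> * (\<kappa> + (norm \<xi>)\<^sup>2) powr (- \<alpha>)"
  unfolding spec_def using assms by (intro integral_mix add_pos_nonneg) auto

text \<open>The Gaussian identity integrated over all scales. Its factor (\<pi>/w)^(d/2) lowers the
  exponent of the weight by d/2, which is the gap between spectral and kernel order.\<close>

lemma spec_trig_sum:
  fixes p :: "'i \<Rightarrow> 'a::euclidean_space"
  assumes \<alpha>: "real DIM('a) / 2 < \<alpha>" and \<kappa>: "0 < \<kappa>"
  shows "integrable lborel (\<lambda>\<xi>. spec \<alpha> \<kappa> \<xi> * (norm (trig_sum p a I \<xi>))\<^sup>2)"
    and "(LINT \<xi>|lborel. spec \<alpha> \<kappa> \<xi> * (norm (trig_sum p a I \<xi>))\<^sup>2)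
        = pi powr (real DIM('a) / 2) * psi_form (\<alpha> - real DIM('a) / 2) \<kappa> p a I"
proof -
  let ?d = "real DIM('a) / 2"
  define f where "f = (\<lambda>\<tau> (\<xi>::'a). mix \<alpha> \<kappa> \<tau> * (exp (- exp \<tau> * (norm \<xi>)\<^sup>2) * (norm (trig_sum p a I \<xi>))\<^sup>2))"
  have \<alpha>0: "0 < \<alpha>" using \<alpha> DIM_positive[where 'a = 'a] by linarith
  have fl: "(LINT \<xi>|lborel. f \<tau> \<xi>) = pi powr ?d * (mix (\<alpha> - ?d) \<kappa> \<tau> * gauss_form (exp \<tau>) p a I)" for \<tau>
  proof -
    have "(LINT \<xi>|lborel. f \<tau> \<xi>) = mix \<alpha> \<kappa> \<tau> * ((pi / exp \<tau>) powr ?d * gauss_form (exp \<tau>) p a I)"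
      unfolding f_def using gaussian_trig_sum(2)[of "exp \<tau>" p a I] by simp
    also have "(pi / exp \<tau>) powr ?d = pi powr ?d * exp (- ?d * \<tau>)"
      by (simp add: powr_divide powr_def[of "exp \<tau>"] exp_minus field_simps)
    also have "mix \<alpha> \<kappa> \<tau> * (pi powr ?d * exp (- ?d * \<tau>) * gauss_form (exp \<tau>) p a I)
        = pi powr ?d * (mix \<alpha> \<kappa> \<tau> * exp (- ?d * \<tau>) * gauss_form (exp \<tau>) p a I)" by (simp only: mult_ac)
    also have "mix \<alpha> \<kappa> \<tau> * exp (- ?d * \<tau>) = mix (\<alpha> - ?d) \<kappa> \<tau>"
      by (simp add: mix_def exp_add[symmetric] left_diff_distrib)
    finally show ?thesis .
  qed
  have m: "(\<lambda>(\<tau>, \<xi>). f \<tau> \<xi>) \<in> borel_measurable (lborel \<Otimes>\<^sub>M lborel)"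
    unfolding f_def split_beta' by measurable
  have i1: "integrable lborel (f \<tau>)" for \<tau>
    unfolding f_def using gaussian_trig_sum(1)[of "exp \<tau>" p a I] by (intro integrable_mult_right) auto
  have i2: "integrable lborel (\<lambda>\<tau>. LINT \<xi>|lborel. f \<tau> \<xi>)"
    unfolding fl using \<alpha> \<kappa> by (intro integrable_mult_right psi_form_eq) auto
  have nn: "0 \<le> f \<tau> \<xi>" for \<tau> \<xi> by (simp add: f_def mix_nonneg)
  have sp: "(LINT \<tau>|lborel. f \<tau> \<xi>) = spec \<alpha> \<kappa> \<xi> * (norm (trig_sum p a I \<xi>))\<^sup>2" for \<xi>
  proof -
    have "f \<tau> \<xi> = mix \<alpha> (\<kappa> + (norm \<xi>)\<^sup>2) \<tau> * (norm (trig_sum p a I \<xi>))\<^sup>2" for \<tau>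
      by (simp add: f_def mix_def exp_add[symmetric] algebra_simps exp_diff exp_minus field_simps)
    thus ?thesis by (simp add: spec_def)
  qed
  note T = tonelli_real[OF m nn i1 i2, unfolded sp fl]
  show "integrable lborel (\<lambda>\<xi>. spec \<alpha> \<kappa> \<xi> * (norm (trig_sum p a I \<xi>))\<^sup>2)" by (rule T(2))
  show "(LINT \<xi>|lborel. spec \<alpha> \<kappa> \<xi> * (norm (trig_sum p a I \<xi>))\<^sup>2)
        = pi powr (real DIM('a) / 2) * psi_form (\<alpha> - real DIM('a) / 2) \<kappa> p a I"
    using T(3) psi_form_eq(2)[of "\<alpha> - ?d" \<kappa> p a I] \<alpha> \<kappa> by simp
qed

lemma spec_pos: "0 < \<alpha> \<Longrightarrow> 0 < \<kappa> \<Longrightarrow> 0 < spec \<alpha> \<kappa> \<xi>"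
  by (auto simp: spec_eq Gam_pos intro!: mult_pos_pos add_pos_nonneg) (metis add_pos_nonneg less_numeral_extra(3) zero_le_power2)

lemma spec_measurable [measurable]: "0 < \<alpha> \<Longrightarrow> 0 < \<kappa> \<Longrightarrow> spec \<alpha> \<kappa> \<in> borel_measurable borel"
  by (subst measurable_cong[OF spec_eq]) auto

text \<open>A unit mass at the origin has trigonometric sum 1.\<close>

lemma integrable_spec:
  assumes \<alpha>: "real DIM('a::euclidean_space) / 2 < \<alpha>" and \<kappa>: "0 < \<kappa>"
  shows "integrable lborel (spec \<alpha> \<kappa> :: 'a \<Rightarrow> real)"
  using spec_trig_sum(1)[OF assms, of "\<lambda>_. 0" "\<lambda>_. 1" "{()}"] by (simp add: trig_sum_def)

section \<open>Duality between samples and Fourier transforms\<close>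

lemma integrable_mult_of_sq:
  fixes u v :: "'a \<Rightarrow> real"
  assumes [measurable]: "u \<in> borel_measurable M" "v \<in> borel_measurable M"
    and u: "integrable M (\<lambda>x. (u x)\<^sup>2)" and v: "integrable M (\<lambda>x. (v x)\<^sup>2)"
  shows "integrable M (\<lambda>x. u x * v x)"
proof (rule Bochner_Integration.integrable_bound)
  show "integrable M (\<lambda>x. (u x)\<^sup>2 + (v x)\<^sup>2)" using u v by simp
  have "\<bar>u x * v x\<bar> \<le> (u x)\<^sup>2 + (v x)\<^sup>2" for x
  proof -
    have "2 * \<bar>u x * v x\<bar> \<le> (u x)\<^sup>2 + (v x)\<^sup>2"
      using sum_squares_bound[of "\<bar>u x\<bar>" "\<bar>v x\<bar>"] by (simp add: abs_mult mult.assoc)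
    thus ?thesis using abs_ge_zero[of "u x * v x"] by linarith
  qed
  thus "AE x in M. norm (u x * v x) \<le> norm ((u x)\<^sup>2 + (v x)\<^sup>2)"
    by (auto simp: intro!: AE_I2)
qed measurable

lemma integral_Cauchy_Schwarz:
  fixes u v :: "'a \<Rightarrow> real"
  assumes [measurable]: "u \<in> borel_measurable M" "v \<in> borel_measurable M"
    and u: "integrable M (\<lambda>x. (u x)\<^sup>2)" and v: "integrable M (\<lambda>x. (v x)\<^sup>2)"
  shows "(LINT x|M. u x * v x)\<^sup>2 \<le> (LINT x|M. (u x)\<^sup>2) * (LINT x|M. (v x)\<^sup>2)"
proof -
  define A B C where "A = (LINT x|M. (u x)\<^sup>2)" and "B = (LINT x|M. (v x)\<^sup>2)" and "C = (LINT x|M. u x * v x)"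
  note uv = integrable_mult_of_sq[OF assms]
  have A: "0 \<le> A" unfolding A_def by (intro integral_nonneg_AE) auto
  have q: "0 \<le> A * t\<^sup>2 + 2 * C * t + B" for t
  proof -
    have "0 \<le> (LINT x|M. (u x * t + v x)\<^sup>2)" by (intro integral_nonneg_AE) auto
    also have "\<dots> = (LINT x|M. t\<^sup>2 * (u x)\<^sup>2 + (2 * t * (u x * v x) + (v x)\<^sup>2))"
      by (intro Bochner_Integration.integral_cong) (auto simp: power2_eq_square algebra_simps)
    also have "\<dots> = t\<^sup>2 * A + (2 * t * C + B)"
      unfolding A_def B_def C_def using u v uv by simp
    finally show ?thesis by (simp add: algebra_simps)
  qed
  have "C\<^sup>2 \<le> A * B"
  proof (cases "A = 0")
    case True
    have "C = 0"
    proof (rule ccontr)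
      assume "C \<noteq> 0"
      \<comment> \<open>With A = 0 the quadratic is affine; a nonzero slope would give it the value
        -1 at this point.\<close>
      thus False using q[of "- (B + 1) / (2 * C)"] True by simp
    qed
    thus ?thesis using True by simp
  next
    case False
    have "0 \<le> A * (- C / A)\<^sup>2 + 2 * C * (- C / A) + B" by (rule q)
    also have "\<dots> = B - C\<^sup>2 / A" using False by (simp add: power2_eq_square field_simps)
    finally show ?thesis using False A by (simp add: field_simps)
  qed
  thus ?thesis by (simp add: A_def B_def C_def)
qed

lemma lborel_integral_minus:
  fixes f :: "'a::euclidean_space \<Rightarrow> 'b::{banach, second_countable_topology}"
  assumes [measurable]: "f \<in> borel_measurable borel"
  shows "(LINT y|lborel. f (x + y)) = (LINT y|lborel. f y)"
    and "integrable lborel (\<lambda>y. f (x + y)) \<longleftrightarrow> integrable lborel f"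
proof -
  have l: "lborel = distr lborel borel (\<lambda>y::'a. x + y)" by (rule lborel_distr_plus[symmetric])
  show "(LINT y|lborel. f (x + y)) = (LINT y|lborel. f y)"
    by (subst (2) l) (simp add: integral_distr)
  show "integrable lborel (\<lambda>y. f (x + y)) \<longleftrightarrow> integrable lborel f"
    by (subst (2) l) (simp add: integrable_distr_eq)
qed

lemma integrable_gauss:
  fixes x :: "'a::euclidean_space"
  assumes "0 < w"
  shows "integrable lborel (\<lambda>\<xi>::'a. exp (- w * (norm \<xi>)\<^sup>2))"
  using gaussian_integral(1)[of "1/w" "0::'a"] assms by (simp add: mult.commute)

lemma exp_neg_sq: "(exp (- w * r\<^sup>2))\<^sup>2 = exp (- (2 * w) * r\<^sup>2)" for w r :: real
  by (simp add: power2_eq_square exp_add[symmetric])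

lemma cis_measurable [measurable]: "cis \<in> borel_measurable borel"
  by (intro borel_measurable_continuous_onI continuous_intros)

text \<open>Restricting f to a ball makes it integrable, and the Gaussian factor makes the double
  integral absolutely convergent, so Fubini turns the left-hand side into f averaged against a
  Gaussian around x.\<close>

lemma truncated_fourier_smoothed:
  fixes f :: "'a::euclidean_space \<Rightarrow> real"
  assumes sq: "square_integrable f" and \<epsilon>: "0 < \<epsilon>"
  shows "integrable lborel (\<lambda>\<xi>. truncated_fourier f R \<xi> * (complex_of_real (exp (- \<epsilon> * (norm \<xi>)\<^sup>2)) * cis (inner x \<xi>)))"
    and "(LINT \<xi>|lborel. truncated_fourier f R \<xi> * (complex_of_real (exp (- \<epsilon> * (norm \<xi>)\<^sup>2)) * cis (inner x \<xi>)))
      = complex_of_real ((pi / \<epsilon>) powr (real DIM('a) / 2) * (LINT y:cball 0 R|lborel. f y * exp (- (norm (x - y))\<^sup>2 / (4 * \<epsilon>))))"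
    and "truncated_fourier f R \<in> borel_measurable borel"
    and "norm (truncated_fourier f R \<xi>) \<le> (LINT y:cball 0 R|lborel. \<bar>f y\<bar>)"
proof -
  have fm [measurable]: "f \<in> borel_measurable borel" and fi: "integrable lborel (\<lambda>y. (f y)\<^sup>2)"
    using sq by (auto simp: square_integrable_def)
  define F where "F = (\<lambda>y::'a. indicator (cball 0 R) y * f y)"
  have im [measurable]: "(indicator (cball 0 R) :: 'a \<Rightarrow> real) \<in> borel_measurable borel"
    by (intro borel_measurable_indicator) auto
  have Fm [measurable]: "F \<in> borel_measurable borel" unfolding F_def by measurable
  have Fi: "integrable lborel F"
    unfolding F_def
  proof (rule integrable_mult_of_sq)
    show "integrable lborel (\<lambda>y::'a. (indicator (cball 0 R) y :: real)\<^sup>2)"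
      using emeasure_lborel_cball_finite[of "0::'a" R]
      by (simp add: power2_eq_square indicator_inter_arith[symmetric] integrable_indicator_iff)
  qed (use fi in simp_all)
  have tf: "truncated_fourier f R \<xi> = (LINT y|lborel. complex_of_real (F y) * cis (- inner y \<xi>))" for \<xi>
    unfolding truncated_fourier_def set_lebesgue_integral_def F_def
    by (intro Bochner_Integration.integral_cong) (auto simp: cis_conv_exp indicator_def)
  show "norm (truncated_fourier f R \<xi>) \<le> (LINT y:cball 0 R|lborel. \<bar>f y\<bar>)"
    unfolding tf set_lebesgue_integral_def
    by (rule order_trans[OF integral_norm_bound]) (simp add: norm_mult F_def abs_mult)
  show tm [measurable]: "truncated_fourier f R \<in> borel_measurable borel"
    unfolding tf[abs_def] by measurable
  define G where "G = (\<lambda>\<xi>::'a. complex_of_real (exp (- \<epsilon> * (norm \<xi>)\<^sup>2)) * cis (inner x \<xi>))"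
  have Gm [measurable]: "G \<in> borel_measurable borel" unfolding G_def by (intro borel_measurable_continuous_onI continuous_intros)
  have nG: "norm (G \<xi>) = exp (- \<epsilon> * (norm \<xi>)\<^sup>2)" for \<xi> by (simp add: G_def norm_mult)
  have Gi: "integrable lborel G" using gaussian_fourier(1)[OF \<epsilon>] by (simp add: G_def)
  define h where "h = (\<lambda>\<xi> y. complex_of_real (F y) * cis (- inner y \<xi>) * G \<xi>)"
  have hm: "(\<lambda>(\<xi>, y). h \<xi> y) \<in> borel_measurable (lborel \<Otimes>\<^sub>M lborel)"
    unfolding h_def by measurable
  have hi1: "integrable lborel (h \<xi>)" for \<xi>
    unfolding h_def
    by (intro integrable_mult_left, rule Bochner_Integration.integrable_bound[OF Fi])
       (auto simp: norm_mult cis_conv_exp)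
  have hn: "norm (h \<xi> y) = \<bar>F y\<bar> * norm (G \<xi>)" for \<xi> y by (simp add: h_def norm_mult)
  have hI: "integrable (lborel \<Otimes>\<^sub>M lborel) (\<lambda>(\<xi>, y). h \<xi> y)"
  proof (rule lborel_pair.Fubini_integrable[OF hm])
    show "integrable lborel (\<lambda>\<xi>. LINT y|lborel. norm (case (\<xi>, y) of (\<xi>, y) \<Rightarrow> h \<xi> y))"
      by (simp add: hn Gi)
  qed (use hi1 in auto)
  have s1: "(LINT y|lborel. h \<xi> y) = truncated_fourier f R \<xi> * G \<xi>" for \<xi>
    unfolding h_def tf by (rule integral_mult_left_zero)
  have s2: "(LINT \<xi>|lborel. h \<xi> y) = complex_of_real ((pi / \<epsilon>) powr (real DIM('a) / 2) * (F y * exp (- (norm (x - y))\<^sup>2 / (4 * \<epsilon>))))" for y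
  proof -
    have "h \<xi> y = complex_of_real (F y) * (complex_of_real (exp (- \<epsilon> * (norm \<xi>)\<^sup>2)) * cis (inner (x - y) \<xi>))" for \<xi>
      by (simp add: h_def G_def cis_mult inner_diff_left)
    thus ?thesis using gaussian_fourier(2)[OF \<epsilon>, of "x - y"] by simp
  qed
  show "integrable lborel (\<lambda>\<xi>. truncated_fourier f R \<xi> * (complex_of_real (exp (- \<epsilon> * (norm \<xi>)\<^sup>2)) * cis (inner x \<xi>)))"
    using lborel_pair.integrable_fst[OF hI] unfolding s1 G_def .
  have "(LINT \<xi>|lborel. truncated_fourier f R \<xi> * G \<xi>) = (LINT y|lborel. complex_of_real ((pi / \<epsilon>) powr (real DIM('a) / 2) * (F y * exp (- (norm (x - y))\<^sup>2 / (4 * \<epsilon>)))))"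
    using lborel_pair.Fubini_integral[OF hI] unfolding s1 s2 by simp
  also have "\<dots> = complex_of_real (LINT y|lborel. (pi / \<epsilon>) powr (real DIM('a) / 2) * (F y * exp (- (norm (x - y))\<^sup>2 / (4 * \<epsilon>))))"
    by (rule integral_complex_of_real)
  also have "(LINT y|lborel. (pi / \<epsilon>) powr (real DIM('a) / 2) * (F y * exp (- (norm (x - y))\<^sup>2 / (4 * \<epsilon>))))
     = (pi / \<epsilon>) powr (real DIM('a) / 2) * (LINT y:cball 0 R|lborel. f y * exp (- (norm (x - y))\<^sup>2 / (4 * \<epsilon>)))"
    unfolding set_lebesgue_integral_def F_def by (subst integral_mult_right_zero) (simp add: mult_ac)
  finally show "(LINT \<xi>|lborel. truncated_fourier f R \<xi> * (complex_of_real (exp (- \<epsilon> * (norm \<xi>)\<^sup>2)) * cis (inner x \<xi>)))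
      = complex_of_real ((pi / \<epsilon>) powr (real DIM('a) / 2) * (LINT y:cball 0 R|lborel. f y * exp (- (norm (x - y))\<^sup>2 / (4 * \<epsilon>))))"
    unfolding G_def .
qed

text \<open>The truncation radius tends to infinity on both sides: on the Fourier side by
  mean-square convergence and Cauchy-Schwarz against the Gaussian, on the space side by dominated
  convergence.\<close>

lemma fourier_smoothed:
  fixes f :: "'a::euclidean_space \<Rightarrow> real"
  assumes ft: "is_fourier_transform f g" and \<epsilon>: "0 < \<epsilon>"
  shows "(LINT \<xi>|lborel. g \<xi> * (complex_of_real (exp (- \<epsilon> * (norm \<xi>)\<^sup>2)) * cis (inner x \<xi>)))
      = complex_of_real ((pi / \<epsilon>) powr (real DIM('a) / 2) * (LINT y|lborel. f y * exp (- (norm (x - y))\<^sup>2 / (4 * \<epsilon>))))" (is "?L = ?R")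
    and "integrable lborel (\<lambda>\<xi>. g \<xi> * (complex_of_real (exp (- \<epsilon> * (norm \<xi>)\<^sup>2)) * cis (inner x \<xi>)))"
    and "integrable lborel (\<lambda>y. f y * exp (- (norm (x - y))\<^sup>2 / (4 * \<epsilon>)))"
proof -
  have sq: "square_integrable f" and sg: "square_integrable g"
    and lim: "((\<lambda>R. \<integral>\<^sup>+ \<xi>. ennreal ((norm (g \<xi> - truncated_fourier f R \<xi>))\<^sup>2) \<partial>lborel) \<longlongrightarrow> 0) at_top"
    using ft by (auto simp: is_fourier_transform_def)
  have fm [measurable]: "f \<in> borel_measurable borel" and fi: "integrable lborel (\<lambda>y. (f y)\<^sup>2)"
    using sq by (auto simp: square_integrable_def)
  have gm [measurable]: "g \<in> borel_measurable borel" and gi: "integrable lborel (\<lambda>y. (norm (g y))\<^sup>2)"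
    using sg by (auto simp: square_integrable_def)
  note [measurable] = truncated_fourier_smoothed(3)[OF sq \<epsilon>]
  define G where "G = (\<lambda>\<xi>::'a. complex_of_real (exp (- \<epsilon> * (norm \<xi>)\<^sup>2)) * cis (inner x \<xi>))"
  have Gm [measurable]: "G \<in> borel_measurable borel" unfolding G_def by (intro borel_measurable_continuous_onI continuous_intros)
  have nG: "norm (G \<xi>) = exp (- \<epsilon> * (norm \<xi>)\<^sup>2)" for \<xi> by (simp add: G_def norm_mult)
  have Gi: "integrable lborel (\<lambda>\<xi>. (norm (G \<xi>))\<^sup>2)"
    unfolding nG exp_neg_sq using \<epsilon> by (intro integrable_gauss) auto
  have gG: "integrable lborel (\<lambda>\<xi>. g \<xi> * G \<xi>)"
    by (rule Bochner_Integration.integrable_bound[OF integrable_mult_of_sq[OF _ _ gi Gi]]) (auto simp: norm_mult)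
  show "integrable lborel (\<lambda>\<xi>. g \<xi> * (complex_of_real (exp (- \<epsilon> * (norm \<xi>)\<^sup>2)) * cis (inner x \<xi>)))"
    using gG by (simp add: G_def)
  have fG: "integrable lborel (\<lambda>y. f y * exp (- (norm (x - y))\<^sup>2 / (4 * \<epsilon>)))"
  proof (rule integrable_mult_of_sq[OF _ _ fi])
    have "(exp (- (norm (x - y))\<^sup>2 / (4 * \<epsilon>)))\<^sup>2 = exp (- (norm (y - x))\<^sup>2 / (2 * \<epsilon>))" for y
      by (simp add: power2_eq_square exp_add[symmetric] norm_minus_commute)
    thus "integrable lborel (\<lambda>y. (exp (- (norm (x - y))\<^sup>2 / (4 * \<epsilon>)))\<^sup>2)"
      using gaussian_integral(1)[of "2 * \<epsilon>" x] \<epsilon> by simp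
  qed measurable
  show "integrable lborel (\<lambda>y. f y * exp (- (norm (x - y))\<^sup>2 / (4 * \<epsilon>)))" by (rule fG)
  define T where "T = (\<lambda>n::nat. truncated_fourier f (real n))"
  have [measurable]: "T n \<in> borel_measurable borel" for n by (simp add: T_def)
  have limn: "(\<lambda>n. \<integral>\<^sup>+ \<xi>. ennreal ((norm (g \<xi> - T n \<xi>))\<^sup>2) \<partial>lborel) \<longlonglongrightarrow> 0"
    unfolding T_def using filterlim_compose[OF lim filterlim_real_sequentially] .
  have TG: "integrable lborel (\<lambda>\<xi>. T n \<xi> * G \<xi>)" for n
    unfolding T_def G_def by (rule truncated_fourier_smoothed[OF sq \<epsilon>])
  have "(\<lambda>n. LINT \<xi>|lborel. T n \<xi> * G \<xi>) \<longlonglongrightarrow> (LINT \<xi>|lborel. g \<xi> * G \<xi>)"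
  proof (rule Lim_null[THEN iffD2])
    define K where "K = (LINT \<xi>|lborel. (norm (G \<xi>))\<^sup>2)"
    define e where "e = (\<lambda>n. enn2real (\<integral>\<^sup>+ \<xi>. ennreal ((norm (g \<xi> - T n \<xi>))\<^sup>2) \<partial>lborel))"
    have e0: "e \<longlonglongrightarrow> 0"
      unfolding e_def using tendsto_enn2real[OF limn[folded ennreal_0]] by simp
    have ev: "eventually (\<lambda>n. (\<integral>\<^sup>+ \<xi>. ennreal ((norm (g \<xi> - T n \<xi>))\<^sup>2) \<partial>lborel) < 1) sequentially"
      using order_tendstoD(2)[OF limn, of 1] by simp
    show "(\<lambda>n. (LINT \<xi>|lborel. T n \<xi> * G \<xi>) - (LINT \<xi>|lborel. g \<xi> * G \<xi>)) \<longlonglongrightarrow> 0"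
    proof (rule tendsto_norm_zero_cancel, rule tendsto_sandwich[OF _ _ tendsto_const])
      show "(\<lambda>n. sqrt (e n * K)) \<longlonglongrightarrow> 0"
        using tendsto_real_sqrt[OF tendsto_mult_left_zero[OF e0, of K]] by simp
      show "eventually (\<lambda>n. norm ((LINT \<xi>|lborel. T n \<xi> * G \<xi>) - (LINT \<xi>|lborel. g \<xi> * G \<xi>)) \<le> sqrt (e n * K)) sequentially"
        using ev
      proof eventually_elim
        case (elim n)
        have i: "integrable lborel (\<lambda>\<xi>. (norm (g \<xi> - T n \<xi>))\<^sup>2)"
          using elim by (intro integrableI_bounded) (auto intro: le_less_trans less_trans[of _ 1])
        have en: "e n = (LINT \<xi>|lborel. (norm (g \<xi> - T n \<xi>))\<^sup>2)"
          unfolding e_def by (rule integral_eq_nn_integral[symmetric]) auto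
        have "norm ((LINT \<xi>|lborel. T n \<xi> * G \<xi>) - (LINT \<xi>|lborel. g \<xi> * G \<xi>))
          = norm (LINT \<xi>|lborel. (T n \<xi> - g \<xi>) * G \<xi>)"
          unfolding left_diff_distrib by (simp add: Bochner_Integration.integral_diff[OF TG gG])
        also have "\<dots> \<le> (LINT \<xi>|lborel. norm (g \<xi> - T n \<xi>) * norm (G \<xi>))"
          by (rule order_trans[OF integral_norm_bound]) (simp add: norm_mult norm_minus_commute)
        also have "\<dots> \<le> sqrt (e n * K)"
          unfolding en K_def by (intro real_le_rsqrt integral_Cauchy_Schwarz i Gi) measurable
        finally show ?case .
      qed
    qed simp
  qed
  moreover have "(LINT \<xi>|lborel. T n \<xi> * G \<xi>) = complex_of_real ((pi / \<epsilon>) powr (real DIM('a) / 2) * (LINT y:cball 0 (real n)|lborel. f y * exp (- (norm (x - y))\<^sup>2 / (4 * \<epsilon>))))" for n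
    unfolding T_def G_def by (rule truncated_fourier_smoothed[OF sq \<epsilon>])
  moreover have "(\<lambda>n. LINT y:cball 0 (real n)|lborel. f y * exp (- (norm (x - y))\<^sup>2 / (4 * \<epsilon>))) \<longlonglongrightarrow> (LINT y|lborel. f y * exp (- (norm (x - y))\<^sup>2 / (4 * \<epsilon>)))"
    unfolding set_lebesgue_integral_def
  proof (rule integral_dominated_convergence[where w = "\<lambda>y. norm (f y * exp (- (norm (x - y))\<^sup>2 / (4 * \<epsilon>)))"])
    have "(\<lambda>n. indicator (cball 0 (real n)) y *\<^sub>R (f y * exp (- (norm (x - y))\<^sup>2 / (4 * \<epsilon>)))) \<longlonglongrightarrow> f y * exp (- (norm (x - y))\<^sup>2 / (4 * \<epsilon>))" for y :: 'a
    proof (rule tendsto_eventually)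
      obtain N :: nat where N: "norm y < real N" using reals_Archimedean2 by blast
      show "eventually (\<lambda>n. indicator (cball 0 (real n)) y *\<^sub>R (f y * exp (- (norm (x - y))\<^sup>2 / (4 * \<epsilon>))) = f y * exp (- (norm (x - y))\<^sup>2 / (4 * \<epsilon>))) sequentially"
        using eventually_ge_at_top[of N] by eventually_elim (use N in auto)
    qed
    thus "AE y in lborel. (\<lambda>n. indicator (cball 0 (real n)) y *\<^sub>R (f y * exp (- (norm (x - y))\<^sup>2 / (4 * \<epsilon>)))) \<longlonglongrightarrow> f y * exp (- (norm (x - y))\<^sup>2 / (4 * \<epsilon>))"
      by simp
  qed (use fG in \<open>auto simp: indicator_def\<close>)
  ultimately have "(\<lambda>n. LINT \<xi>|lborel. T n \<xi> * G \<xi>) \<longlonglongrightarrow> (LINT \<xi>|lborel. g \<xi> * G \<xi>)"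
      "(\<lambda>n. LINT \<xi>|lborel. T n \<xi> * G \<xi>) \<longlonglongrightarrow> ?R"
    by (auto intro!: tendsto_intros)
  from LIMSEQ_unique[OF this] show "?L = ?R" unfolding G_def .
qed

text \<open>The heat semigroup at time \<epsilon>.\<close>

definition gauss_avg :: "('a::euclidean_space \<Rightarrow> real) \<Rightarrow> real \<Rightarrow> 'a \<Rightarrow> real" where
  "gauss_avg f \<epsilon> x = (4 * pi * \<epsilon>) powr (- real DIM('a) / 2) * (LINT y|lborel. f y * exp (- (norm (x - y))\<^sup>2 / (4 * \<epsilon>)))"

text \<open>The contribution from outside a ball of radius \<delta> in the next proof:
  exp(-\<delta>^2/(8 \<epsilon>)) beats every power of \<epsilon>.\<close>

lemma gauss_avg_far_tendsto_0:
  fixes d \<delta> A B :: real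
  assumes "0 < \<delta>"
  shows "((\<lambda>\<epsilon>. (4 * pi * \<epsilon>) powr (- d / 2) * exp (- \<delta>\<^sup>2 / (8 * \<epsilon>)) * (A + B * (8 * pi * \<epsilon>) powr (d / 2))) \<longlongrightarrow> 0) (at_right 0)"
  using assms by real_asymp

text \<open>Inside a small ball continuity at x suffices. Outside, f is only square integrable, so
  |f y - f x| is bounded by (f y)^2 + 1 + |f x|; half of the Gaussian exponent is spent on a factor
  exp(-\<delta>^2/(8 \<epsilon>)), and the other half makes the constant part integrable.\<close>

lemma gauss_avg_tendsto:
  fixes f :: "'a::euclidean_space \<Rightarrow> real"
  assumes sq: "square_integrable f" and cont: "isCont f x"
  shows "((\<lambda>\<epsilon>. gauss_avg f \<epsilon> x) \<longlongrightarrow> f x) (at_right 0)"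
proof (rule tendstoI)
  fix e :: real assume e: "0 < e"
  let ?d = "real DIM('a)"
  have fm [measurable]: "f \<in> borel_measurable borel" and fi: "integrable lborel (\<lambda>y. (f y)\<^sup>2)"
    using sq by (auto simp: square_integrable_def)
  obtain \<delta> where \<delta>: "0 < \<delta>" "\<And>y. norm (y - x) < \<delta> \<Longrightarrow> \<bar>f y - f x\<bar> < e / 2"
    using cont e unfolding continuous_at_eps_delta by (metis dist_norm half_gt_zero real_norm_def)
  define A where "A = (LINT y|lborel. (f y)\<^sup>2)"
  define B where "B = 1 + \<bar>f x\<bar>"
  have "eventually (\<lambda>\<epsilon>. (4 * pi * \<epsilon>) powr (- ?d / 2) * exp (- \<delta>\<^sup>2 / (8 * \<epsilon>)) * (A + B * (8 * pi * \<epsilon>) powr (?d / 2)) < e / 2) (at_right 0)"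
    using order_tendstoD(2)[OF gauss_avg_far_tendsto_0[OF \<delta>(1)], of "e / 2"] e by simp
  moreover have "eventually (\<lambda>\<epsilon>. 0 < \<epsilon>) (at_right (0::real))" by (simp add: eventually_at_filter)
  ultimately show "eventually (\<lambda>\<epsilon>. dist (gauss_avg f \<epsilon> x) (f x) < e) (at_right 0)"
  proof eventually_elim
    case (elim \<epsilon>)
    define c where "c = (4 * pi * \<epsilon>) powr (- ?d / 2)"
    have c: "0 < c" unfolding c_def using elim by simp
    define g where "g = (\<lambda>y. exp (- (norm (x - y))\<^sup>2 / (4 * \<epsilon>)))"
    define h where "h = (\<lambda>y. exp (- (norm (y - x))\<^sup>2 / (8 * \<epsilon>)))"
    have gi: "integrable lborel g" and gI: "(LINT y|lborel. g y) = 1 / c"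
      using gaussian_integral[of "4 * \<epsilon>" x] elim unfolding g_def c_def
      by (simp_all add: norm_minus_commute powr_minus field_simps)
    have hi: "integrable lborel h" and hI: "(LINT y|lborel. h y) = (8 * pi * \<epsilon>) powr (?d / 2)"
      using gaussian_integral[of "8 * \<epsilon>" x] elim unfolding h_def by (simp_all add: mult_ac)
    have fg: "integrable lborel (\<lambda>y. f y * g y)"
      unfolding g_def
    proof (rule integrable_mult_of_sq[OF _ _ fi])
      have "(exp (- (norm (x - y))\<^sup>2 / (4 * \<epsilon>)))\<^sup>2 = exp (- (norm (y - x))\<^sup>2 / (2 * \<epsilon>))" for y
        by (simp add: power2_eq_square exp_add[symmetric] norm_minus_commute)
      thus "integrable lborel (\<lambda>y. (exp (- (norm (x - y))\<^sup>2 / (4 * \<epsilon>)))\<^sup>2)"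
        using gaussian_integral(1)[of "2 * \<epsilon>" x] elim by simp
    qed measurable
    have "gauss_avg f \<epsilon> x - f x = c * (LINT y|lborel. f y * g y) - c * (LINT y|lborel. f x * g y)"
      using c gI by (simp add: gauss_avg_def c_def g_def)
    also have "\<dots> = c * (LINT y|lborel. f y * g y - f x * g y)"
      using fg gi by (simp add: right_diff_distrib)
    also have "\<bar>\<dots>\<bar> \<le> c * (LINT y|lborel. \<bar>f y * g y - f x * g y\<bar>)"
      using c by (simp add: abs_mult)
    also have "\<dots> \<le> c * (LINT y|lborel. e / 2 * g y + exp (- \<delta>\<^sup>2 / (8 * \<epsilon>)) * ((f y)\<^sup>2 + B * h y))"
    proof (intro mult_left_mono integral_mono)
      fix y
      show "\<bar>f y * g y - f x * g y\<bar> \<le> e / 2 * g y + exp (- \<delta>\<^sup>2 / (8 * \<epsilon>)) * ((f y)\<^sup>2 + B * h y)"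
      proof (cases "norm (y - x) < \<delta>")
        case True
        have "\<bar>f y * g y - f x * g y\<bar> = \<bar>f y - f x\<bar> * g y"
          by (simp add: left_diff_distrib[symmetric] abs_mult g_def)
        also have "\<dots> \<le> e / 2 * g y" using \<delta>(2)[OF True] by (intro mult_right_mono) (auto simp: g_def)
        also have "\<dots> \<le> \<dots> + exp (- \<delta>\<^sup>2 / (8 * \<epsilon>)) * ((f y)\<^sup>2 + B * h y)"
          by (simp add: B_def h_def)
        finally show ?thesis .
      next
        case False
        have "\<delta>\<^sup>2 \<le> (norm (y - x))\<^sup>2" using False \<delta> by (intro power_mono) auto
        hence "g y \<le> exp (- \<delta>\<^sup>2 / (8 * \<epsilon>)) * h y"
          unfolding g_def h_def exp_add[symmetric] norm_minus_commute[of x y] using elim by (simp add: field_simps)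
        moreover have "\<bar>f y - f x\<bar> \<le> (f y)\<^sup>2 + B"
        proof -
          have "\<bar>f y\<bar> \<le> (f y)\<^sup>2 + 1" using sum_squares_bound[of "\<bar>f y\<bar>" 1] by simp
          thus ?thesis unfolding B_def by linarith
        qed
        ultimately have "\<bar>f y - f x\<bar> * g y \<le> ((f y)\<^sup>2 + B) * (exp (- \<delta>\<^sup>2 / (8 * \<epsilon>)) * h y)"
          by (intro mult_mono) (auto simp: B_def g_def)
        also have "\<dots> = exp (- \<delta>\<^sup>2 / (8 * \<epsilon>)) * ((f y)\<^sup>2 * h y + B * h y)" by (simp add: algebra_simps)
        also have "\<dots> \<le> exp (- \<delta>\<^sup>2 / (8 * \<epsilon>)) * ((f y)\<^sup>2 * 1 + B * h y)"
          using elim by (intro mult_left_mono add_right_mono) (auto simp: h_def)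
        finally have "\<bar>f y - f x\<bar> * g y \<le> exp (- \<delta>\<^sup>2 / (8 * \<epsilon>)) * ((f y)\<^sup>2 + B * h y)" by simp
        moreover have "\<bar>f y * g y - f x * g y\<bar> = \<bar>f y - f x\<bar> * g y"
          by (simp add: left_diff_distrib[symmetric] abs_mult g_def)
        moreover have "0 \<le> e / 2 * g y" using e by (simp add: g_def)
        ultimately show ?thesis by linarith
      qed
    qed (use c fg gi hi fi in auto)
    also have "(LINT y|lborel. e / 2 * g y + exp (- \<delta>\<^sup>2 / (8 * \<epsilon>)) * ((f y)\<^sup>2 + B * h y))
        = e / 2 * (1 / c) + exp (- \<delta>\<^sup>2 / (8 * \<epsilon>)) * (A + B * (8 * pi * \<epsilon>) powr (?d / 2))"
      unfolding A_def hI[symmetric] gI[symmetric] using fi hi gi by simp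
    also have "c * \<dots> = e / 2 + c * exp (- \<delta>\<^sup>2 / (8 * \<epsilon>)) * (A + B * (8 * pi * \<epsilon>) powr (?d / 2))"
      using c by (simp add: algebra_simps)
    also have "\<dots> < e" using elim by (simp add: c_def)
    finally show ?case by (simp add: dist_real_def)
  qed
qed

text \<open>The L2 Fourier transform has no pointwise inversion formula; the sample values are recovered
  as limits of Gaussian averages, which are integrals against g.\<close>

lemma sample_duality:
  fixes f :: "'a::euclidean_space \<Rightarrow> real" and V :: "'a \<Rightarrow> real"
  assumes ft: "is_fourier_transform f g" and cont: "continuous_on UNIV f"
    and Vm [measurable]: "V \<in> borel_measurable borel" and Vpos: "\<And>\<xi>. 0 < V \<xi>"
    and gV: "integrable lborel (\<lambda>\<xi>. (norm (g \<xi>))\<^sup>2 / V \<xi>)"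
    and TV: "integrable lborel (\<lambda>\<xi>. V \<xi> * (norm (trig_sum p a I \<xi>))\<^sup>2)"
  shows "(\<Sum>i\<in>I. a i * f (p i))\<^sup>2
    \<le> (2 * pi) powr (- 2 * real DIM('a)) * (LINT \<xi>|lborel. (norm (g \<xi>))\<^sup>2 / V \<xi>) * (LINT \<xi>|lborel. V \<xi> * (norm (trig_sum p a I \<xi>))\<^sup>2)"
proof -
  let ?d = "real DIM('a)"
  have sq: "square_integrable f" and sg: "square_integrable g"
    using ft by (auto simp: is_fourier_transform_def)
  have gm [measurable]: "g \<in> borel_measurable borel" using sg by (auto simp: square_integrable_def)
  define S where "S = (\<lambda>\<epsilon>. \<Sum>i\<in>I. a i * gauss_avg f \<epsilon> (p i))"
  define K where "K = (LINT \<xi>|lborel. (norm (g \<xi>))\<^sup>2 / V \<xi>) * (LINT \<xi>|lborel. V \<xi> * (norm (trig_sum p a I \<xi>))\<^sup>2)"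
  have lim: "((\<lambda>\<epsilon>. (S \<epsilon>)\<^sup>2) \<longlongrightarrow> (\<Sum>i\<in>I. a i * f (p i))\<^sup>2) (at_right 0)"
    unfolding S_def using cont
    by (intro tendsto_intros gauss_avg_tendsto sq) (simp add: continuous_on_eq_continuous_at)
  have bound: "(S \<epsilon>)\<^sup>2 \<le> (2 * pi) powr (- 2 * ?d) * K" if \<epsilon>: "0 < \<epsilon>" for \<epsilon>
  proof -
    \<comment> \<open>The normalisation of the heat kernel is the inversion constant (2 \<pi>)^(-d)
      times the factor produced by \<open>fourier_smoothed\<close>.\<close>
    have c: "(4 * pi * \<epsilon>) powr (- ?d / 2) = (2 * pi) powr (- ?d) * (pi / \<epsilon>) powr (?d / 2)"
    proof -
      have "(2 * pi) powr (- ?d) = ((2 * pi)\<^sup>2) powr (- ?d / 2)"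
      proof -
        have "((2 * pi)\<^sup>2) powr (- ?d / 2) = ((2 * pi) powr 2) powr (- ?d / 2)" by simp
        thus ?thesis unfolding powr_powr by simp
      qed
      moreover have "(pi / \<epsilon>) powr (?d / 2) = (\<epsilon> / pi) powr (- ?d / 2)"
        using \<epsilon> by (simp add: powr_minus powr_divide field_simps)
      ultimately show ?thesis using \<epsilon> by (simp add: powr_mult[symmetric] power2_eq_square field_simps)
    qed
    have "complex_of_real (S \<epsilon>) = complex_of_real ((2 * pi) powr (- ?d)) *
       (\<Sum>i\<in>I. complex_of_real (a i) * complex_of_real ((pi / \<epsilon>) powr (?d / 2) * (LINT y|lborel. f y * exp (- (norm (p i - y))\<^sup>2 / (4 * \<epsilon>)))))"
      unfolding S_def gauss_avg_def c of_real_sum sum_distrib_left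
      by (intro sum.cong refl) (simp add: mult_ac)
    also have "(\<Sum>i\<in>I. complex_of_real (a i) * complex_of_real ((pi / \<epsilon>) powr (?d / 2) * (LINT y|lborel. f y * exp (- (norm (p i - y))\<^sup>2 / (4 * \<epsilon>)))))
       = (\<Sum>i\<in>I. LINT \<xi>|lborel. complex_of_real (a i) * (g \<xi> * (complex_of_real (exp (- \<epsilon> * (norm \<xi>)\<^sup>2)) * cis (inner (p i) \<xi>))))"
      unfolding fourier_smoothed(1)[OF ft \<epsilon>, symmetric] by simp
    also have "\<dots> = (LINT \<xi>|lborel. (\<Sum>i\<in>I. complex_of_real (a i) * (g \<xi> * (complex_of_real (exp (- \<epsilon> * (norm \<xi>)\<^sup>2)) * cis (inner (p i) \<xi>)))))"
      by (rule Bochner_Integration.integral_sum[symmetric]) (intro integrable_mult_right fourier_smoothed[OF ft \<epsilon>])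
    also have "\<dots> = (LINT \<xi>|lborel. complex_of_real (exp (- \<epsilon> * (norm \<xi>)\<^sup>2)) * g \<xi> * trig_sum p a I \<xi>)"
      unfolding trig_sum_def sum_distrib_left by (intro Bochner_Integration.integral_cong sum.cong refl) (simp add: mult_ac)
    finally have S: "complex_of_real (S \<epsilon>) = complex_of_real ((2 * pi) powr (- ?d)) * (LINT \<xi>|lborel. complex_of_real (exp (- \<epsilon> * (norm \<xi>)\<^sup>2)) * g \<xi> * trig_sum p a I \<xi>)" .
    have u: "integrable lborel (\<lambda>\<xi>. (norm (g \<xi>) / sqrt (V \<xi>))\<^sup>2)"
      and v: "integrable lborel (\<lambda>\<xi>. (sqrt (V \<xi>) * norm (trig_sum p a I \<xi>))\<^sup>2)"
      using gV TV Vpos by (simp_all add: power_divide power_mult_distrib less_imp_le)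
    let ?F = "\<lambda>\<xi>. complex_of_real (exp (- \<epsilon> * (norm \<xi>)\<^sup>2)) * g \<xi> * trig_sum p a I \<xi>"
    let ?B = "\<lambda>\<xi>. (norm (g \<xi>) / sqrt (V \<xi>)) * (sqrt (V \<xi>) * norm (trig_sum p a I \<xi>))"
    \<comment> \<open>The Gaussian factor is at most 1 and is dropped, which makes the bound
      independent of \<epsilon> and lets it survive the limit.\<close>
    have FB: "norm (?F \<xi>) \<le> ?B \<xi>" for \<xi>
    proof -
      have "sqrt (V \<xi>) \<noteq> 0" using Vpos[of \<xi>] by simp
      hence "?B \<xi> = norm (g \<xi>) * norm (trig_sum p a I \<xi>)" by simp
      moreover have "exp (- \<epsilon> * (norm \<xi>)\<^sup>2) * (norm (g \<xi>) * norm (trig_sum p a I \<xi>)) \<le> norm (g \<xi>) * norm (trig_sum p a I \<xi>)"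
        using \<epsilon> by (intro mult_left_le_one_le) auto
      ultimately show ?thesis by (simp add: norm_mult mult.assoc)
    qed
    have Bi: "integrable lborel ?B"
      by (rule integrable_mult_of_sq[OF _ _ u v]) measurable
    have Fi: "integrable lborel ?F"
      by (rule Bochner_Integration.integrable_bound[OF Bi])
         (use order_trans[OF FB abs_ge_self] in \<open>measurable, simp\<close>)
    have "norm (LINT \<xi>|lborel. ?F \<xi>) \<le> (LINT \<xi>|lborel. norm (?F \<xi>))" by (rule integral_norm_bound)
    also have "\<dots> \<le> (LINT \<xi>|lborel. ?B \<xi>)"
      using Fi Bi FB by (intro integral_mono) (auto intro: integrable_norm)
    also have "\<dots> \<le> sqrt ((LINT \<xi>|lborel. (norm (g \<xi>) / sqrt (V \<xi>))\<^sup>2) * (LINT \<xi>|lborel. (sqrt (V \<xi>) * norm (trig_sum p a I \<xi>))\<^sup>2))"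
      by (intro real_le_rsqrt integral_Cauchy_Schwarz u v) measurable
    also have "\<dots> = sqrt K" using Vpos by (simp add: K_def power_divide power_mult_distrib less_imp_le)
    finally have "\<bar>S \<epsilon>\<bar> \<le> (2 * pi) powr (- ?d) * sqrt K"
      using arg_cong[OF S, of norm] by (simp add: norm_mult)
    hence "(S \<epsilon>)\<^sup>2 \<le> ((2 * pi) powr (- ?d) * sqrt K)\<^sup>2" by (metis abs_ge_zero power2_abs power_mono)
    also have "\<dots> = (2 * pi) powr (- 2 * ?d) * K"
    proof -
      have "0 \<le> K" unfolding K_def using Vpos by (intro mult_nonneg_nonneg integral_nonneg_AE) (auto simp: less_imp_le)
      moreover have "((2 * pi) powr (- ?d))\<^sup>2 = (2 * pi) powr (- 2 * ?d)"
        unfolding power2_eq_square powr_add[symmetric] by simp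
      ultimately show ?thesis by (simp add: power_mult_distrib)
    qed
    finally show ?thesis .
  qed
  have "(\<Sum>i\<in>I. a i * f (p i))\<^sup>2 \<le> (2 * pi) powr (- 2 * ?d) * K"
  proof (rule tendsto_upperbound[OF lim])
    show "eventually (\<lambda>\<epsilon>. (S \<epsilon>)\<^sup>2 \<le> (2 * pi) powr (- 2 * ?d) * K) (at_right 0)"
      using eventually_at_right_less[of 0] by eventually_elim (rule bound)
  qed simp
  thus ?thesis by (simp add: K_def mult_ac)
qed

section \<open>Determinants of positive definite matrices\<close>

definition qform :: "nat \<Rightarrow> (nat \<Rightarrow> nat \<Rightarrow> real) \<Rightarrow> (nat \<Rightarrow> real) \<Rightarrow> real" where
  "qform n k a = (\<Sum>i<n. \<Sum>j<n. a i * a j * k i j)"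

definition posdef :: "nat \<Rightarrow> (nat \<Rightarrow> nat \<Rightarrow> real) \<Rightarrow> bool" where
  "posdef n k \<longleftrightarrow> (\<forall>i<n. \<forall>j<n. k i j = k j i) \<and> (\<forall>a. (\<exists>i<n. a i \<noteq> 0) \<longrightarrow> 0 < qform n k a)"

abbreviation kmat :: "nat \<Rightarrow> (nat \<Rightarrow> nat \<Rightarrow> real) \<Rightarrow> real Matrix.mat" where
  "kmat n k \<equiv> Matrix.mat n n (\<lambda>(i, j). k i j)"

lemma posdef_sym: "posdef n k \<Longrightarrow> i < n \<Longrightarrow> j < n \<Longrightarrow> k i j = k j i"
  by (auto simp: posdef_def)

lemma posdef_pos: "posdef n k \<Longrightarrow> i < n \<Longrightarrow> a i \<noteq> 0 \<Longrightarrow> 0 < qform n k a"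
  by (auto simp: posdef_def)

lemma qform_nonneg: "posdef n k \<Longrightarrow> 0 \<le> qform n k a"
  by (cases "\<exists>i<n. a i \<noteq> 0") (auto simp: posdef_def less_imp_le qform_def)

lemma qform_Suc_0: "qform (Suc n) k (a(n := 0)) = qform n k a"
  by (simp add: qform_def lessThan_Suc)

lemma qform_solution:
  assumes "\<And>i. i < n \<Longrightarrow> (\<Sum>j<n. k i j * b j) = y i"
  shows "qform n k b = (\<Sum>i<n. y i * b i)"
  unfolding qform_def
proof (rule sum.cong[OF refl])
  fix i assume i: "i \<in> {..<n}"
  have "(\<Sum>j<n. b i * b j * k i j) = b i * (\<Sum>j<n. k i j * b j)"
    by (simp add: sum_distrib_left mult_ac)
  thus "(\<Sum>j<n. b i * b j * k i j) = y i * b i" using assms[of i] i by simp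
qed

lemma posdef_restrict: "posdef (Suc n) k \<Longrightarrow> posdef n k"
  unfolding posdef_def
proof (intro conjI allI impI, goal_cases)
  case (2 a)
  then obtain i where i: "i < n" "a i \<noteq> 0" by auto
  hence "(a(n := 0)) i \<noteq> 0" "i < Suc n" by auto
  with 2 have "0 < qform (Suc n) k (a(n := 0))" by blast
  thus ?case by (simp only: qform_Suc_0)
qed auto

section \<open>Linear systems, Schur complements and Hadamard's inequality\<close>

lemma kmat_solve:
  assumes "Determinant.det (kmat n k) \<noteq> 0"
  shows "\<exists>B. mat_inverse (kmat n k) = Some B \<and> B \<in> carrier_mat n n \<and> kmat n k * B = 1\<^sub>m n"
proof (cases "mat_inverse (kmat n k)")
  case None
  have "kmat n k \<notin> Units (ring_mat TYPE(real) n ())"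
    by (rule mat_inverse(1)[OF _ None]) simp
  moreover have "kmat n k \<in> Units (ring_mat TYPE(real) n ())"
    by (rule det_non_zero_imp_unit[OF _ assms]) simp
  ultimately show ?thesis by blast
next
  case (Some B)
  thus ?thesis using mat_inverse(2)[OF _ Some, of n] by auto
qed

text \<open>Replaces the inverse matrix in the likelihood by the solution \<open>b\<close> of the
  linear system with right-hand side y, so that the data term can be handled as a quadratic form in
  \<open>b\<close>.\<close>

lemma kmat_inverse_solution:
  fixes y :: "nat \<Rightarrow> real"
  assumes d: "Determinant.det (kmat n k) \<noteq> 0"
  defines "b \<equiv> \<lambda>j. (the (mat_inverse (kmat n k)) *\<^sub>v Matrix.vec n y) $ j"
  shows "i < n \<Longrightarrow> (\<Sum>j<n. k i j * b j) = y i"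
    and "scalar_prod (Matrix.vec n y) (the (mat_inverse (kmat n k)) *\<^sub>v Matrix.vec n y) = (\<Sum>i<n. y i * b i)"
proof -
  obtain B where B: "mat_inverse (kmat n k) = Some B" "B \<in> carrier_mat n n" "kmat n k * B = 1\<^sub>m n"
    using kmat_solve[OF d] by auto
  have b: "b = (\<lambda>j. (B *\<^sub>v Matrix.vec n y) $ j)" by (simp add: b_def B)
  show "scalar_prod (Matrix.vec n y) (the (mat_inverse (kmat n k)) *\<^sub>v Matrix.vec n y) = (\<Sum>i<n. y i * b i)"
    using B(2) unfolding b B(1) by (simp add: scalar_prod_def lessThan_atLeast0)
  assume i: "i < n"
  have "kmat n k *\<^sub>v (B *\<^sub>v Matrix.vec n y) = Matrix.vec n y"
    using B by (simp flip: assoc_mult_mat_vec[of _ n n _ n])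
  hence "(kmat n k *\<^sub>v (B *\<^sub>v Matrix.vec n y)) $ i = y i" using i by simp
  thus "(\<Sum>j<n. k i j * b j) = y i"
    using i B(2) unfolding b by (simp add: mult_mat_vec_def scalar_prod_def lessThan_atLeast0)
qed

text \<open>A column operation: subtracting the combination \<open>c\<close> of the first n columns
  from the last one leaves only its bottom entry, the Schur complement, and Laplace expansion along
  that column finishes.\<close>

lemma det_kmat_Suc:
  assumes d: "Determinant.det (kmat n k) \<noteq> 0"
  obtains c where "\<And>i. i < n \<Longrightarrow> (\<Sum>j<n. k i j * c j) = k i n"
    and "Determinant.det (kmat (Suc n) k) = Determinant.det (kmat n k) * (k n n - (\<Sum>j<n. k n j * c j))"
proof -
  obtain c where c: "\<And>i. i < n \<Longrightarrow> (\<Sum>j<n. k i j * c j) = k i n"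
    using kmat_inverse_solution(1)[OF d, of _ "\<lambda>i. k i n"] by blast
  define U where "U = Matrix.mat (Suc n) (Suc n) (\<lambda>(i, j). if i = j then 1 else if j = n then - c i else (0::real))"
  have Uc: "U \<in> carrier_mat (Suc n) (Suc n)" by (simp add: U_def)
  have detU: "Determinant.det U = 1"
  proof -
    have "Determinant.det U = prod_list (diag_mat U)"
      by (rule det_upper_triangular[OF _ Uc]) (auto simp: U_def upper_triangular_def)
    also have "diag_mat U = map (\<lambda>_. 1) [0..<Suc n]"
      by (auto simp: diag_mat_def U_def)
    finally show ?thesis by (simp only: map_replicate_const prod_list_replicate power_one)
  qed
  define M where "M = kmat (Suc n) k * U"
  have Mc: "M \<in> carrier_mat (Suc n) (Suc n)" unfolding M_def by (rule mult_carrier_mat[OF _ Uc]) simp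
  have Mij: "M $$ (i, j) = (if j = n then k i n - (\<Sum>l<n. k i l * c l) else k i j)" if "i < Suc n" "j < Suc n" for i j
  proof -
    have "M $$ (i, j) = (\<Sum>l<Suc n. k i l * U $$ (l, j))"
      using that Uc by (simp add: M_def scalar_prod_def lessThan_atLeast0)
    also have "\<dots> = (if j = n then k i n - (\<Sum>l<n. k i l * c l) else k i j)"
    proof (cases "j = n")
      case True
      have "(\<Sum>l<Suc n. k i l * U $$ (l, j)) = (\<Sum>l<n. k i l * (- c l)) + k i n"
        unfolding True sum.lessThan_Suc by (simp add: U_def)
      thus ?thesis using True by (simp add: sum_negf)
    next
      case False
      have "(\<Sum>l<Suc n. k i l * U $$ (l, j)) = (\<Sum>l<Suc n. if l = j then k i l else 0)"
        using False that by (intro sum.cong) (auto simp: U_def)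
      thus ?thesis using False that by simp
    qed
    finally show ?thesis .
  qed
  have "Determinant.det (kmat (Suc n) k) = Determinant.det M"
    unfolding M_def by (subst det_mult[of _ "Suc n"]) (simp_all add: Uc detU)
  also have "\<dots> = (\<Sum>i<Suc n. M $$ (i, n) * cofactor M i n)"
    by (rule laplace_expansion_column[OF Mc]) simp
  also have "\<dots> = M $$ (n, n) * cofactor M n n"
    unfolding sum.lessThan_Suc using c by (simp add: Mij)
  also have "cofactor M n n = Determinant.det (kmat n k)"
  proof -
    have "mat_delete M n n = kmat n k"
      by (rule eq_matI) (use Mc in \<open>auto simp: mat_delete_def Mij\<close>)
    thus ?thesis by (simp add: cofactor_def)
  qed
  finally have "Determinant.det (kmat (Suc n) k) = Determinant.det (kmat n k) * (k n n - (\<Sum>j<n. k n j * c j))"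
    by (simp add: Mij)
  with c that show ?thesis by blast
qed

text \<open>The pivot is the value of the form at w = (-c, 1), since the first n rows annihilate
  that vector. Hence lower bounds for the form pass to the pivot; the upper bound holds because the
  term subtracted from \<open>k n n\<close> is itself a nonnegative value of the form.\<close>

lemma posdef_det_step:
  assumes pd: "posdef (Suc n) k" and d: "Determinant.det (kmat n k) \<noteq> 0"
  obtains P w where "Determinant.det (kmat (Suc n) k) = Determinant.det (kmat n k) * P"
    "P = qform (Suc n) k w" "w n = 1" "P \<le> k n n"
proof -
  obtain c where c: "\<And>i. i < n \<Longrightarrow> (\<Sum>j<n. k i j * c j) = k i n"
    and D: "Determinant.det (kmat (Suc n) k) = Determinant.det (kmat n k) * (k n n - (\<Sum>j<n. k n j * c j))"
    using det_kmat_Suc[OF d] by blast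
  define P where "P = k n n - (\<Sum>j<n. k n j * c j)"
  define w where "w = (\<lambda>i. if i = n then 1 else - c i)"
  have "qform (Suc n) k w = (\<Sum>i<Suc n. (if i = n then P else 0) * w i)"
  proof (rule qform_solution)
    fix i assume "i < Suc n"
    have "(\<Sum>j<Suc n. k i j * w j) = k i n - (\<Sum>j<n. k i j * c j)"
      unfolding sum.lessThan_Suc by (simp add: w_def sum_negf)
    thus "(\<Sum>j<Suc n. k i j * w j) = (if i = n then P else 0)"
      using c \<open>i < Suc n\<close> by (auto simp: P_def)
  qed
  hence "P = qform (Suc n) k w" by (simp add: w_def)
  moreover have "P \<le> k n n"
  proof -
    have "0 \<le> qform n k c" by (rule qform_nonneg[OF posdef_restrict[OF pd]])
    also have "qform n k c = (\<Sum>j<n. k j n * c j)" by (rule qform_solution[OF c])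
    also have "\<dots> = (\<Sum>j<n. k n j * c j)" by (intro sum.cong refl) (use posdef_sym[OF pd] in auto)
    finally show ?thesis by (simp add: P_def)
  qed
  ultimately show ?thesis using that[of P w] D by (simp add: P_def w_def)
qed

text \<open>Hadamard's inequality, by induction over the pivots.\<close>

lemma posdef_det:
  assumes "posdef n k"
  shows "0 < Determinant.det (kmat n k) \<and> Determinant.det (kmat n k) \<le> (\<Prod>i<n. k i i)"
  using assms
proof (induction n)
  case 0
  show ?case by (simp add: det_def)
next
  case (Suc n)
  note IH = Suc.IH[OF posdef_restrict[OF Suc.prems]]
  obtain P w where P: "Determinant.det (kmat (Suc n) k) = Determinant.det (kmat n k) * P"
    "P = qform (Suc n) k w" "w n = 1" "P \<le> k n n"
    using posdef_det_step[OF Suc.prems] IH by (metis less_irrefl)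
  have "0 < P" unfolding P(2) by (rule posdef_pos[OF Suc.prems, of n]) (use P in auto)
  thus ?case using IH P(1,4) by (auto simp: lessThan_Suc mult.commute intro!: mult_mono)
qed

lemma coercive_posdef:
  assumes sym: "\<And>i j. i < n \<Longrightarrow> j < n \<Longrightarrow> k i j = k j i" and l: "0 < l"
    and co: "\<And>a. l * (\<Sum>i<n. (a i)\<^sup>2) \<le> qform n k a"
  shows "posdef n k"
  unfolding posdef_def
proof (intro conjI allI impI sym)
  fix a :: "nat \<Rightarrow> real" assume "\<exists>i<n. a i \<noteq> 0"
  then obtain i where i: "i < n" "a i \<noteq> 0" by auto
  have "0 < (a i)\<^sup>2" using i by simp
  also have "\<dots> \<le> (\<Sum>i<n. (a i)\<^sup>2)" using i by (intro member_le_sum) auto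
  finally show "0 < qform n k a" using co[of a] l by (smt (verit) mult_pos_pos)
qed

text \<open>Pivots take the place of eigenvalues: each is the value of the form at a vector whose
  last entry is 1, hence at least l.\<close>

lemma coercive_det:
  assumes sym: "\<And>i j. i < n \<Longrightarrow> j < n \<Longrightarrow> k i j = k j i" and l: "0 < l"
    and co: "\<And>a. l * (\<Sum>i<n. (a i)\<^sup>2) \<le> qform n k a"
  shows "l ^ n \<le> Determinant.det (kmat n k)"
  using sym co
proof (induction n)
  case 0
  show ?case by (simp add: det_def)
next
  case (Suc n)
  have pd: "posdef (Suc n) k" by (rule coercive_posdef[OF Suc.prems(1) l Suc.prems(2)])
  have "l * (\<Sum>i<n. (a i)\<^sup>2) \<le> qform n k a" for a
    using Suc.prems(2)[of "a(n := 0)"] unfolding qform_Suc_0 by (simp add: lessThan_Suc)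
  with Suc have IH: "l ^ n \<le> Determinant.det (kmat n k)" by auto
  have "0 < l ^ n" using l by simp
  with IH have d: "0 < Determinant.det (kmat n k)" by linarith
  obtain P w where P: "Determinant.det (kmat (Suc n) k) = Determinant.det (kmat n k) * P"
    "P = qform (Suc n) k w" "w n = 1" "P \<le> k n n"
    using posdef_det_step[OF pd] d by (metis less_irrefl)
  have "l * 1 \<le> l * (\<Sum>i<Suc n. (w i)\<^sup>2)"
    using l P(3) by (intro mult_left_mono) (auto simp: lessThan_Suc intro: sum_nonneg)
  also have "\<dots> \<le> P" unfolding P(2) by (rule Suc.prems(2))
  finally show ?case using IH P(1) l d by (simp add: mult_mono' mult.commute)
qed

text \<open>Rows of a block triangular matrix with unit diagonal: index i outside J has a
  combination of indices in J subtracted from it, while indices in J stay as they are.\<close>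

definition elim_row :: "nat set \<Rightarrow> (nat \<Rightarrow> nat \<Rightarrow> real) \<Rightarrow> nat \<Rightarrow> nat \<Rightarrow> real" where
  "elim_row J c i = (\<lambda>l. (if l = i then 1 else 0) - (if i \<notin> J \<and> l \<in> J then c i l else 0))"

text \<open>A permutation p with p i distinct from i meets a zero entry: the entries (i, p i) and (p i, p (p i))
  lie off the diagonal, and off the diagonal only columns in J and rows outside J are occupied.\<close>

lemma det_elim:
  "Determinant.det (Matrix.mat n n (\<lambda>(i, l). elim_row J c i l)) = 1"
proof -
  let ?L = "Matrix.mat n n (\<lambda>(i, l). elim_row J c i l)"
  have "Determinant.det ?L = (\<Sum>p\<in>{p. p permutes {0..<n}}. signof p * (\<Prod>i=0..<n. ?L $$ (i, p i)))"
    by (rule det_def') simp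
  also have "\<dots> = (\<Sum>p\<in>{id}. signof p * (\<Prod>i=0..<n. ?L $$ (i, p i)))"
  proof (rule sum.mono_neutral_right)
    show "finite {p. p permutes {0..<n}}" by (simp add: finite_permutations)
    show "{id} \<subseteq> {p. p permutes {0..<n}}" by (simp add: permutes_id)
    show "\<forall>p\<in>{p. p permutes {0..<n}} - {id}. signof p * (\<Prod>i=0..<n. ?L $$ (i, p i)) = 0"
    proof
      fix p assume p: "p \<in> {p. p permutes {0..<n}} - {id}"
      hence pp: "p permutes {0..<n}" by auto
      obtain i where i: "p i \<noteq> i" using p by (auto simp: fun_eq_iff)
      have in1: "i < n" using pp i by (metis atLeastLessThan_iff permutes_not_in zero_le)
      have in2: "p i < n" using pp in1 by (metis atLeastLessThan_iff permutes_in_image zero_le)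
      have in3: "p (p i) < n" using pp in2 by (metis atLeastLessThan_iff permutes_in_image zero_le)
      have i2: "p (p i) \<noteq> p i" using i permutes_inj[OF pp] by (metis injD)
      have "?L $$ (i, p i) = 0 \<or> ?L $$ (p i, p (p i)) = 0"
        using i i2 in1 in2 in3 by (auto simp: elim_row_def)
      hence "(\<Prod>i=0..<n. ?L $$ (i, p i)) = 0"
      proof
        assume "?L $$ (i, p i) = 0"
        thus ?thesis using in1 by (intro prod_zero bexI[of _ i]) auto
      next
        assume "?L $$ (p i, p (p i)) = 0"
        thus ?thesis using in2 by (intro prod_zero bexI[of _ "p i"]) auto
      qed
      thus "signof p * (\<Prod>i=0..<n. ?L $$ (i, p i)) = 0" by simp
    qed
  qed
  also have "\<dots> = 1" by (simp add: elim_row_def)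
  finally show ?thesis .
qed

text \<open>Conjugating with the elimination matrix keeps the determinant, and the diagonal of the
  new matrix consists of the values of the form at the elimination rows. Hadamard's inequality then
  profits from rows at which the form is small.\<close>

lemma det_le_elim:
  assumes pd: "posdef n k" and J: "J \<subseteq> {..<n}"
  shows "Determinant.det (kmat n k) \<le> (\<Prod>i<n. qform n k (elim_row J c i))"
proof -
  define r where "r = elim_row J c"
  define k' where "k' = (\<lambda>i j. \<Sum>l<n. \<Sum>m<n. r i l * r j m * k l m)"
  let ?L = "Matrix.mat n n (\<lambda>(i, l). r i l)"
  have Lc: "?L \<in> carrier_mat n n" by simp
  have k': "kmat n k' = ?L * kmat n k * transpose_mat ?L"
  proof (rule eq_matI)
    fix i j assume "i < dim_row (?L * kmat n k * transpose_mat ?L)" "j < dim_col (?L * kmat n k * transpose_mat ?L)"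
    hence ij: "i < n" "j < n" by auto
    have "(?L * kmat n k * transpose_mat ?L) $$ (i, j) = (\<Sum>m<n. (\<Sum>l<n. r i l * k l m) * r j m)"
      using ij by (simp add: scalar_prod_def lessThan_atLeast0)
    also have "\<dots> = k' i j"
    proof -
      have "(\<Sum>m<n. (\<Sum>l<n. r i l * k l m) * r j m) = (\<Sum>m<n. \<Sum>l<n. r i l * r j m * k l m)"
        unfolding sum_distrib_right by (intro sum.cong refl) (simp only: mult_ac)
      also have "\<dots> = k' i j" unfolding k'_def by (rule sum.swap)
      finally show ?thesis .
    qed
    finally show "kmat n k' $$ (i, j) = (?L * kmat n k * transpose_mat ?L) $$ (i, j)" using ij by simp
  qed auto
  have dL: "Determinant.det ?L = 1" unfolding r_def by (rule det_elim)
  have "Determinant.det (kmat n k') = Determinant.det (kmat n k)"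
    unfolding k' using Lc
    by (subst det_mult[of _ n]) (auto simp: det_mult[of _ n] det_transpose[OF Lc] dL intro!: mult_carrier_mat[of _ n n])
  moreover have "posdef n k'"
    unfolding posdef_def
  proof (intro conjI allI impI)
    fix i j assume "i < n" "j < n"
    show "k' i j = k' j i"
      unfolding k'_def by (subst sum.swap) (intro sum.cong refl, use posdef_sym[OF pd] in auto)
  next
    fix a :: "nat \<Rightarrow> real" assume "\<exists>i<n. a i \<noteq> 0"
    then obtain i0 where i0: "i0 < n" "a i0 \<noteq> 0" by auto
    define b where "b = (\<lambda>l. \<Sum>i<n. a i * r i l)"
    have "qform n k' a = (\<Sum>i<n. \<Sum>j<n. \<Sum>l<n. \<Sum>m<n. (a i * r i l) * (a j * r j m) * k l m)"
      unfolding qform_def k'_def sum_distrib_left by (intro sum.cong refl) (simp add: mult_ac)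
    also have "\<dots> = (\<Sum>l<n. \<Sum>m<n. \<Sum>i<n. \<Sum>j<n. (a i * r i l) * (a j * r j m) * k l m)"
    proof -
      have "(\<Sum>i<n. \<Sum>j<n. \<Sum>l<n. \<Sum>m<n. (a i * r i l) * (a j * r j m) * k l m)
         = (\<Sum>i<n. \<Sum>l<n. \<Sum>j<n. \<Sum>m<n. (a i * r i l) * (a j * r j m) * k l m)"
        by (rule sum.cong[OF refl], rule sum.swap)
      also have "\<dots> = (\<Sum>l<n. \<Sum>i<n. \<Sum>j<n. \<Sum>m<n. (a i * r i l) * (a j * r j m) * k l m)"
        by (rule sum.swap)
      also have "\<dots> = (\<Sum>l<n. \<Sum>i<n. \<Sum>m<n. \<Sum>j<n. (a i * r i l) * (a j * r j m) * k l m)"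
        by (rule sum.cong[OF refl], rule sum.cong[OF refl], rule sum.swap)
      also have "\<dots> = (\<Sum>l<n. \<Sum>m<n. \<Sum>i<n. \<Sum>j<n. (a i * r i l) * (a j * r j m) * k l m)"
        by (rule sum.cong[OF refl], rule sum.swap)
      finally show ?thesis .
    qed
    also have "\<dots> = qform n k b"
      unfolding qform_def
      by (rule sum.cong[OF refl], rule sum.cong[OF refl]) (unfold b_def, unfold sum_product, unfold sum_distrib_right, rule refl)
    finally have q: "qform n k' a = qform n k b" .
    \<comment> \<open>The transposed elimination matrix is injective: it leaves entries outside J
      alone, and if a vanishes there, it changes nothing at all.\<close>
    have bJ: "b l = a l" if "l < n" "l \<notin> J" for l
    proof -
      have "b l = (\<Sum>i<n. if i = l then a i else 0)"
        unfolding b_def r_def elim_row_def using that by (intro sum.cong) auto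
      thus ?thesis using that by simp
    qed
    have "\<exists>l<n. b l \<noteq> 0"
    proof (cases "\<exists>l<n. l \<notin> J \<and> a l \<noteq> 0")
      case True thus ?thesis using bJ by metis
    next
      case False
      have "b i0 = (\<Sum>i<n. if i = i0 then a i else 0)"
        unfolding b_def r_def elim_row_def using False by (intro sum.cong) auto
      thus ?thesis using i0 by auto
    qed
    thus "0 < qform n k' a" unfolding q using posdef_pos[OF pd] by blast
  qed
  ultimately show ?thesis
    using posdef_det[of n k'] by (simp add: k'_def qform_def r_def)
qed

text \<open>Pivoting on the entry of largest modulus at each step keeps the coefficients bounded by powers
  of 2, independently of the vectors.\<close>

lemma pivot_subset:
  fixes v :: "'i \<Rightarrow> 'f \<Rightarrow> real"
  assumes "finite F" and S: "finite S"
  shows "\<exists>J c. J \<subseteq> S \<and> card J \<le> card F \<and>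
    (\<forall>i\<in>S. (\<forall>f\<in>F. v i f = (\<Sum>j\<in>J. c i j * v j f)) \<and> (\<Sum>j\<in>J. \<bar>c i j\<bar>) \<le> 2 ^ card F - 1)"
  using assms(1)
proof (induction F arbitrary: v)
  case empty
  show ?case by (intro exI[of _ "{}"]) auto
next
  case (insert f F)
  show ?case
  proof (cases "\<forall>i\<in>S. v i f = 0")
    case True
    obtain J c where J: "J \<subseteq> S" "card J \<le> card F"
      and c: "\<And>i g. i \<in> S \<Longrightarrow> g \<in> F \<Longrightarrow> v i g = (\<Sum>j\<in>J. c i j * v j g)"
      and cs: "\<And>i. i \<in> S \<Longrightarrow> (\<Sum>j\<in>J. \<bar>c i j\<bar>) \<le> 2 ^ card F - 1"
      using insert.IH[of v] by blast
    show ?thesis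
    proof (intro exI[of _ J] exI[of _ c] conjI ballI)
      show "card J \<le> card (insert f F)" using J insert by simp
      fix i assume i: "i \<in> S"
      show "(\<Sum>j\<in>J. \<bar>c i j\<bar>) \<le> 2 ^ card (insert f F) - 1"
        using cs[OF i] insert by (simp add: order_trans)
      fix g assume "g \<in> insert f F"
      then consider "g = f" | "g \<in> F" by auto
      thus "v i g = (\<Sum>j\<in>J. c i j * v j g)"
      proof cases
        case 1
        moreover have "(\<Sum>j\<in>J. c i j * v j f) = 0" using True J by (intro sum.neutral) auto
        ultimately show ?thesis using True i by simp
      qed (rule c[OF i])
    qed (use J in auto)
  next
    case False
    hence "S \<noteq> {}" by auto
    have "Max ((\<lambda>i. \<bar>v i f\<bar>) ` S) \<in> (\<lambda>i. \<bar>v i f\<bar>) ` S"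
      using S \<open>S \<noteq> {}\<close> by (intro Max_in) auto
    then obtain j where j1: "j \<in> S" "Max ((\<lambda>i. \<bar>v i f\<bar>) ` S) = \<bar>v j f\<bar>" by auto
    have j: "j \<in> S" "\<And>i. i \<in> S \<Longrightarrow> \<bar>v i f\<bar> \<le> \<bar>v j f\<bar>"
      unfolding j1(2)[symmetric] using j1(1) S by (auto intro!: Max_ge)
    have vj: "v j f \<noteq> 0" using False j(2) by (metis abs_eq_0 abs_le_zero_iff)
    define t where "t = (\<lambda>i. v i f / v j f)"
    have t: "\<bar>t i\<bar> \<le> 1" if "i \<in> S" for i using j(2)[OF that] vj by (simp add: t_def)
    define v' where "v' = (\<lambda>i g. v i g - t i * v j g)"
    have v'j: "v' j g = 0" for g using vj by (simp add: v'_def t_def)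
    have v'f: "v' i f = 0" for i using vj by (simp add: v'_def t_def)
    obtain J c where J: "J \<subseteq> S" "card J \<le> card F"
      and c: "\<And>i g. i \<in> S \<Longrightarrow> g \<in> F \<Longrightarrow> v' i g = (\<Sum>j\<in>J. c i j * v' j g)"
      and cs: "\<And>i. i \<in> S \<Longrightarrow> (\<Sum>j\<in>J. \<bar>c i j\<bar>) \<le> 2 ^ card F - 1"
      using insert.IH[of v'] by blast
    have fJ: "finite J" using J S finite_subset by auto
    define J0 where "J0 = J - {j}"
    define C where "C = (\<lambda>i l. if l = j then t i - (\<Sum>l\<in>J0. c i l * t l) else c i l)"
    have s: "(\<Sum>l\<in>insert j J. F l) = F j + (\<Sum>l\<in>J0. F l)" for F :: "'i \<Rightarrow> real"
      using fJ by (simp add: J0_def sum.insert_remove)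
    have cJ0: "(\<Sum>l\<in>J0. \<bar>c i l\<bar>) \<le> 2 ^ card F - 1" if "i \<in> S" for i
      using sum_mono2[OF fJ, of J0 "\<lambda>l. \<bar>c i l\<bar>"] cs[OF that] by (auto simp: J0_def)
    show ?thesis
    proof (intro exI[of _ "insert j J"] exI[of _ C] conjI ballI)
      show "insert j J \<subseteq> S" using J j by auto
      show "card (insert j J) \<le> card (insert f F)"
        using J insert fJ by (simp add: card_insert_if)
      fix i assume i: "i \<in> S"
      have "\<bar>C i j\<bar> \<le> \<bar>t i\<bar> + (\<Sum>l\<in>J0. \<bar>c i l * t l\<bar>)"
      proof -
        have "\<bar>C i j\<bar> \<le> \<bar>t i\<bar> + \<bar>\<Sum>l\<in>J0. c i l * t l\<bar>"
          unfolding C_def by (simp add: abs_triangle_ineq4)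
        also have "\<bar>\<Sum>l\<in>J0. c i l * t l\<bar> \<le> (\<Sum>l\<in>J0. \<bar>c i l * t l\<bar>)" by (rule sum_abs)
        finally show ?thesis by simp
      qed
      also have "(\<Sum>l\<in>J0. \<bar>c i l * t l\<bar>) \<le> (\<Sum>l\<in>J0. \<bar>c i l\<bar> * 1)"
        unfolding abs_mult by (intro sum_mono mult_left_mono t) (use J in \<open>auto simp: J0_def\<close>)
      \<comment> \<open>The new coefficient is at most 2^m and the old ones sum to at most 2^m - 1,
        where m is the number of functionals in F; together this is the required 2^(m+1) -
        1.\<close>
      finally have "\<bar>C i j\<bar> \<le> 1 + (2 ^ card F - 1)" using t[OF i] cJ0[OF i] by simp
      moreover have "(\<Sum>l\<in>J0. \<bar>C i l\<bar>) = (\<Sum>l\<in>J0. \<bar>c i l\<bar>)"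
        by (intro sum.cong) (auto simp: C_def J0_def)
      ultimately show "(\<Sum>l\<in>insert j J. \<bar>C i l\<bar>) \<le> 2 ^ card (insert f F) - 1"
        unfolding s using cJ0[OF i] insert by simp
      fix g assume g: "g \<in> insert f F"
      have v'g: "v' i g = (\<Sum>l\<in>J0. c i l * v' l g)"
      proof (cases "g = f")
        case False
        hence "v' i g = (\<Sum>l\<in>J. c i l * v' l g)" using c[OF i] g by auto
        also have "\<dots> = (\<Sum>l\<in>J0. c i l * v' l g)"
          unfolding J0_def using fJ by (intro sum.mono_neutral_right) (auto simp: v'j)
        finally show ?thesis .
      qed (simp add: v'f)
      have "(\<Sum>l\<in>insert j J. C i l * v l g) = (t i - (\<Sum>l\<in>J0. c i l * t l)) * v j g + (\<Sum>l\<in>J0. c i l * v l g)"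
      proof -
        have "(\<Sum>l\<in>J0. C i l * v l g) = (\<Sum>l\<in>J0. c i l * v l g)"
          by (intro sum.cong) (auto simp: C_def J0_def)
        moreover have "C i j = t i - (\<Sum>l\<in>J0. c i l * t l)" by (simp add: C_def)
        ultimately show ?thesis unfolding s by simp
      qed
      also have "\<dots> = t i * v j g + (\<Sum>l\<in>J0. c i l * v' l g)"
        unfolding v'_def left_diff_distrib right_diff_distrib sum_subtractf sum_distrib_right
        by (simp add: mult.assoc)
      also have "\<dots> = v i g" unfolding v'g[symmetric] by (simp add: v'_def)
      finally show "v i g = (\<Sum>l\<in>insert j J. C i l * v l g)" by simp
    qed
  qed
qed

section \<open>Upper bound for the log-determinant\<close>

text \<open>A monomial is a list of basis vectors, so a given one occurs once for each ordering of its
  factors.\<close>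

definition monomials :: "nat \<Rightarrow> 'a::euclidean_space list set" where
  "monomials k = {L. set L \<subseteq> Basis \<and> length L < k}"

definition monom_at :: "'a::euclidean_space \<Rightarrow> 'a list \<Rightarrow> real" where
  "monom_at y L = prod_list (map (inner y) L)"

lemma finite_monomials: "finite (monomials k :: 'a::euclidean_space list set)"
  by (rule finite_subset[OF _ finite_lists_length_le[of Basis k]]) (auto simp: monomials_def)

text \<open>The multinomial theorem; with ordered lists as monomials no multinomial coefficients
  appear.\<close>

lemma inner_power_monomials:
  fixes y \<xi> :: "'a::euclidean_space"
  shows "inner y \<xi> ^ m = (\<Sum>L | set L \<subseteq> Basis \<and> length L = m. monom_at \<xi> L * monom_at y L)"
proof (induction m)
  case 0
  have "{L :: 'a list. set L \<subseteq> Basis \<and> length L = 0} = {[]}" by auto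
  thus ?case by (simp add: monom_at_def)
next
  case (Suc m)
  let ?A = "{L :: 'a list. set L \<subseteq> Basis \<and> length L = m}"
  have inj: "inj_on (\<lambda>(L, b). b # L) (?A \<times> Basis)" by (auto simp: inj_on_def)
  have "(\<Sum>L | set L \<subseteq> Basis \<and> length L = Suc m. monom_at \<xi> L * monom_at y L)
      = (\<Sum>(L, b)\<in>?A \<times> Basis. (monom_at \<xi> L * monom_at y L) * (inner \<xi> b * inner y b))"
    unfolding lists_length_Suc_eq by (subst sum.reindex[OF inj]) (auto simp: monom_at_def mult_ac intro!: sum.cong)
  also have "\<dots> = (\<Sum>L\<in>?A. monom_at \<xi> L * monom_at y L) * (\<Sum>b\<in>Basis. inner \<xi> b * inner y b)"
    by (simp add: sum.cartesian_product[symmetric] sum_product)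
  also have "(\<Sum>b\<in>Basis. inner \<xi> b * inner y b) = inner y \<xi>"
    by (subst euclidean_inner) (simp add: mult.commute)
  finally show ?case by (simp add: Suc mult.commute)
qed

text \<open>After factoring out the phase at z, every power of the phase below k sums to zero, being
  a combination of vanishing moments. Only the Taylor remainder of the exponential is left, which is
  of order k in h |\<xi>|.\<close>

lemma trig_sum_annihilating:
  fixes p :: "'i \<Rightarrow> 'a::euclidean_space"
  assumes k: "0 < k" and I: "finite I"
    and near: "\<And>i. i \<in> I \<Longrightarrow> a i \<noteq> 0 \<Longrightarrow> norm (p i - z) \<le> h"
    and ann: "\<And>L. L \<in> monomials k \<Longrightarrow> (\<Sum>i\<in>I. a i * monom_at (p i - z) L) = 0"
    and B: "(\<Sum>i\<in>I. \<bar>a i\<bar>) \<le> B" and h: "0 \<le> h"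
  shows "norm (trig_sum p a I \<xi>) \<le> B * (h * norm \<xi>) ^ k"
proof -
  obtain n where n: "k = Suc n" using k by (cases k) auto
  define \<theta> where "\<theta> = (\<lambda>i. inner (p i - z) \<xi>)"
  have zero: "(\<Sum>i\<in>I. complex_of_real (a i) * (\<i> * complex_of_real (\<theta> i)) ^ m / fact m) = 0" if "m < k" for m
  proof -
    have "(\<Sum>i\<in>I. a i * \<theta> i ^ m) = (\<Sum>i\<in>I. \<Sum>L | set L \<subseteq> Basis \<and> length L = m. monom_at \<xi> L * (a i * monom_at (p i - z) L))"
      unfolding \<theta>_def inner_power_monomials sum_distrib_left by (intro sum.cong refl) (simp add: mult_ac)
    also have "\<dots> = (\<Sum>L | set L \<subseteq> Basis \<and> length L = m. monom_at \<xi> L * (\<Sum>i\<in>I. a i * monom_at (p i - z) L))"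
      by (subst sum.swap) (simp add: sum_distrib_left)
    also have "\<dots> = 0" using that by (intro sum.neutral) (auto simp: ann monomials_def)
    finally have "complex_of_real (\<Sum>i\<in>I. a i * \<theta> i ^ m) = 0" by simp
    moreover have "(\<Sum>i\<in>I. complex_of_real (a i) * (\<i> * complex_of_real (\<theta> i)) ^ m / fact m)
        = \<i> ^ m / fact m * complex_of_real (\<Sum>i\<in>I. a i * \<theta> i ^ m)"
      unfolding of_real_sum sum_distrib_left by (intro sum.cong refl) (simp add: power_mult_distrib)
    ultimately show ?thesis by simp
  qed
  have "trig_sum p a I \<xi> = cis (inner z \<xi>) * (\<Sum>i\<in>I. complex_of_real (a i) * cis (\<theta> i))"
    unfolding trig_sum_def sum_distrib_left
    by (intro sum.cong refl) (simp add: \<theta>_def cis_mult inner_diff_left mult.left_commute)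
  hence "norm (trig_sum p a I \<xi>) = norm (\<Sum>i\<in>I. complex_of_real (a i) * cis (\<theta> i))"
    by (simp add: norm_mult)
  also have "(\<Sum>i\<in>I. complex_of_real (a i) * cis (\<theta> i))
     = (\<Sum>i\<in>I. complex_of_real (a i) * (cis (\<theta> i) - (\<Sum>m\<le>n. (\<i> * complex_of_real (\<theta> i)) ^ m / fact m)))"
  proof -
    have "(\<Sum>i\<in>I. complex_of_real (a i) * (\<Sum>m\<le>n. (\<i> * complex_of_real (\<theta> i)) ^ m / fact m))
       = (\<Sum>m\<le>n. \<Sum>i\<in>I. complex_of_real (a i) * (\<i> * complex_of_real (\<theta> i)) ^ m / fact m)"
      unfolding sum_distrib_left by (subst sum.swap) simp
    also have "\<dots> = 0" using zero n by simp
    finally show ?thesis by (simp add: right_diff_distrib sum_subtractf)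
  qed
  also have "norm \<dots> \<le> (\<Sum>i\<in>I. \<bar>a i\<bar> * (h * norm \<xi>) ^ k)"
  proof (rule sum_norm_le)
    fix i assume i: "i \<in> I"
    show "norm (complex_of_real (a i) * (cis (\<theta> i) - (\<Sum>m\<le>n. (\<i> * complex_of_real (\<theta> i)) ^ m / fact m))) \<le> \<bar>a i\<bar> * (h * norm \<xi>) ^ k"
    proof (cases "a i = 0")
      case False
      have "\<bar>\<theta> i\<bar> \<le> norm (p i - z) * norm \<xi>" unfolding \<theta>_def by (rule Cauchy_Schwarz_ineq2)
      also have "\<dots> \<le> h * norm \<xi>" using near[OF i False] by (intro mult_right_mono) auto
      finally have t: "\<bar>\<theta> i\<bar> ^ k \<le> (h * norm \<xi>) ^ k" by (intro power_mono) auto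
      have "norm (cis (\<theta> i) - (\<Sum>m\<le>n. (\<i> * complex_of_real (\<theta> i)) ^ m / fact m)) \<le> \<bar>\<theta> i\<bar> ^ k / fact k"
        using iexp_approx1[of "\<theta> i" n] by (simp add: n cis_conv_exp)
      also have "\<dots> \<le> \<bar>\<theta> i\<bar> ^ k / 1" by (intro divide_left_mono) (auto simp: fact_ge_1)
      also have "\<dots> \<le> (h * norm \<xi>) ^ k" using t by simp
      finally show ?thesis by (simp add: norm_mult mult_left_mono)
    qed simp
  qed
  also have "\<dots> \<le> B * (h * norm \<xi>) ^ k"
    unfolding sum_distrib_right[symmetric] using B h by (intro mult_right_mono) auto
  finally show ?thesis .
qed

lemma gauss_form_le_abs: "0 < w \<Longrightarrow> gauss_form w p a I \<le> (\<Sum>i\<in>I. \<bar>a i\<bar>)\<^sup>2"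
  unfolding gauss_form_def power2_eq_square sum_product
proof (intro sum_mono)
  fix i j assume "0 < w"
  have "a i * a j * exp (- (norm (p i - p j))\<^sup>2 / (4 * w)) \<le> \<bar>a i * a j\<bar> * exp (- (norm (p i - p j))\<^sup>2 / (4 * w))"
    by (intro mult_right_mono) auto
  also have "\<dots> \<le> \<bar>a i * a j\<bar> * 1" using \<open>0 < w\<close> by (intro mult_left_mono) auto
  finally show "a i * a j * exp (- (norm (p i - p j) * norm (p i - p j)) / (4 * w)) \<le> \<bar>a i\<bar> * \<bar>a j\<bar>"
    by (simp add: abs_mult power2_eq_square)
qed

text \<open>The constant of \<open>gauss_form_annihilating\<close>: half of the Gaussian exponent
  absorbs |\<xi>|^(2k) at the price of k! (2/w)^k, and the integral of the other half contributes
  2^(d/2).\<close>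

definition ann_const :: "nat \<Rightarrow> real \<Rightarrow> real" where
  "ann_const k d = fact k * 2 ^ k * 2 powr (d / 2)"

lemma gauss_form_annihilating:
  fixes p :: "'i \<Rightarrow> 'a::euclidean_space"
  assumes w: "0 < w" and T: "\<And>\<xi>. norm (trig_sum p a I \<xi>) \<le> B * (h * norm \<xi>) ^ k" and h: "0 \<le> h"
  shows "gauss_form w p a I \<le> B\<^sup>2 * ann_const k (real DIM('a)) * (h\<^sup>2 / w) ^ k"
proof -
  let ?d = "real DIM('a) / 2"
  define C where "C = B\<^sup>2 * (h\<^sup>2) ^ k * (fact k * (2 / w) ^ k)"
  have "(pi / w) powr ?d * gauss_form w p a I = (LINT \<xi>|lborel. exp (- w * (norm \<xi>)\<^sup>2) * (norm (trig_sum p a I \<xi>))\<^sup>2)"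
    by (rule gaussian_trig_sum(2)[OF w, symmetric])
  also have "\<dots> \<le> (LINT \<xi>::'a|lborel. C * exp (- (w / 2) * (norm \<xi>)\<^sup>2))"
  proof (rule integral_mono[OF gaussian_trig_sum(1)[OF w]])
    show "integrable lborel (\<lambda>\<xi>::'a. C * exp (- (w / 2) * (norm \<xi>)\<^sup>2))"
      using gaussian_integral(1)[of "2 / w" "0::'a"] w by (simp add: mult.commute)
    fix \<xi> :: 'a
    have "(norm (trig_sum p a I \<xi>))\<^sup>2 \<le> (B * (h * norm \<xi>) ^ k)\<^sup>2" by (intro power_mono T) auto
    also have "\<dots> = B\<^sup>2 * (h\<^sup>2) ^ k * ((norm \<xi>)\<^sup>2) ^ k"
      by (simp add: power_mult_distrib power_mult[symmetric] mult.commute)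
    also have "((norm \<xi>)\<^sup>2) ^ k \<le> fact k * (2 / w) ^ k * exp (w / 2 * (norm \<xi>)\<^sup>2)"
      using power_le_fact_exp[of "w / 2 * (norm \<xi>)\<^sup>2" k] w
      by (simp add: power_mult_distrib power_divide field_simps)
    finally have "(norm (trig_sum p a I \<xi>))\<^sup>2 \<le> C * exp (w / 2 * (norm \<xi>)\<^sup>2)"
      by (simp add: C_def mult_left_mono mult.assoc)
    hence "exp (- w * (norm \<xi>)\<^sup>2) * (norm (trig_sum p a I \<xi>))\<^sup>2 \<le> exp (- w * (norm \<xi>)\<^sup>2) * (C * exp (w / 2 * (norm \<xi>)\<^sup>2))"
      by (intro mult_left_mono) auto
    also have "\<dots> = C * exp (- (w / 2) * (norm \<xi>)\<^sup>2)" by (simp add: exp_add[symmetric] field_simps)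
    finally show "exp (- w * (norm \<xi>)\<^sup>2) * (norm (trig_sum p a I \<xi>))\<^sup>2 \<le> C * exp (- (w / 2) * (norm \<xi>)\<^sup>2)" .
  qed
  also have "\<dots> = C * (2 powr ?d * (pi / w) powr ?d)"
    using gaussian_integral(2)[of "2 / w" "0::'a"] w by (simp add: mult.commute powr_mult[symmetric])
  finally have "gauss_form w p a I \<le> C * 2 powr ?d" using w by (simp add: mult.commute mult.left_commute)
  thus ?thesis using w by (simp add: C_def ann_const_def power_divide mult_ac)
qed

text \<open>The scales are split at h^2. Below, the trivial bound B^2 is used and the weight is
  integrable because \<nu> > 0; above, the vanishing moments give (h^2/w)^k, which is summable
  because k > \<nu>. Both parts are of order h^(2 \<nu>).\<close>

lemma psi_form_annihilating:
  fixes p :: "'i \<Rightarrow> 'a::euclidean_space"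
  assumes \<nu>: "0 < \<nu>" "\<nu> < real k" and \<kappa>: "0 < \<kappa>" and h: "0 < h"
    and T: "\<And>\<xi>. norm (trig_sum p a I \<xi>) \<le> B * (h * norm \<xi>) ^ k"
    and B: "(\<Sum>i\<in>I. \<bar>a i\<bar>) \<le> B"
  shows "psi_form \<nu> \<kappa> p a I \<le> B\<^sup>2 * (1 / \<nu> + ann_const k (real DIM('a)) / (real k - \<nu>)) * h powr (2 * \<nu>)"
proof -
  let ?A = "ann_const k (real DIM('a))"
  define \<tau>0 where "\<tau>0 = ln (h\<^sup>2)"
  have A: "0 < ?A" by (simp add: ann_const_def)
  have E1: "has_bochner_integral lborel (\<lambda>t. indicator {..\<tau>0} t * exp (\<nu> * t)) (exp (\<nu> * \<tau>0) / \<nu>)"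
    by (rule has_bochner_integral_exp_atMost[OF \<nu>(1)])
  have E2: "has_bochner_integral lborel (\<lambda>t. indicator {\<tau>0..} t * exp (- (real k - \<nu>) * t)) (exp (- (real k - \<nu>) * \<tau>0) / (real k - \<nu>))"
    using \<nu> by (intro has_bochner_integral_exp_atLeast) auto
  let ?g = "\<lambda>t. B\<^sup>2 * (indicator {..\<tau>0} t * exp (\<nu> * t)) + B\<^sup>2 * ?A * (h\<^sup>2) ^ k * (indicator {\<tau>0..} t * exp (- (real k - \<nu>) * t))"
  have gi: "integrable lborel ?g"
    using E1 E2 by (intro Bochner_Integration.integrable_add integrable_mult_right) (auto simp: has_bochner_integral_iff)
  have "psi_form \<nu> \<kappa> p a I \<le> (LINT t|lborel. ?g t)"
    unfolding psi_form_eq(2)[OF \<nu>(1) \<kappa>]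
  proof (rule integral_mono[OF psi_form_eq(1)[OF \<nu>(1) \<kappa>] gi])
    fix t :: real
    show "mix \<nu> \<kappa> t * gauss_form (exp t) p a I \<le> ?g t"
    proof (cases "t \<le> \<tau>0")
      case True
      have "0 \<le> (\<Sum>i\<in>I. \<bar>a i\<bar>)" by (intro sum_nonneg) auto
      hence "gauss_form (exp t) p a I \<le> B\<^sup>2"
        using gauss_form_le_abs[of "exp t" p a I] power_mono[OF B, of 2] by simp
      hence "mix \<nu> \<kappa> t * gauss_form (exp t) p a I \<le> exp (\<nu> * t) * B\<^sup>2"
        using mix_le_exp[of \<kappa> \<nu> t] \<kappa> by (intro mult_mono) (auto simp: gauss_form_nonneg)
      thus ?thesis using True A by (auto simp: mult.commute intro: add_increasing2)
    next
      case False
      have "mix \<nu> \<kappa> t * gauss_form (exp t) p a I \<le> exp (\<nu> * t) * (B\<^sup>2 * ?A * (h\<^sup>2 / exp t) ^ k)"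
        using mix_le_exp[of \<kappa> \<nu> t] \<kappa> gauss_form_annihilating[OF exp_gt_zero T, of t] h
        by (intro mult_mono) (auto simp: gauss_form_nonneg)
      also have "\<dots> = B\<^sup>2 * ?A * (h\<^sup>2) ^ k * exp (- (real k - \<nu>) * t)"
        by (simp add: power_divide exp_diff left_diff_distrib exp_of_nat_mult)
      finally show ?thesis using False by simp
    qed
  qed
  also have "(LINT t|lborel. ?g t) = B\<^sup>2 * (exp (\<nu> * \<tau>0) / \<nu>) + B\<^sup>2 * ?A * (h\<^sup>2) ^ k * (exp (- (real k - \<nu>) * \<tau>0) / (real k - \<nu>))"
    using E1 E2 by (simp add: has_bochner_integral_iff)
  also have "exp (\<nu> * \<tau>0) = h powr (2 * \<nu>)"
    using h by (simp add: \<tau>0_def powr_def ln_realpow)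
  also have "exp (- (real k - \<nu>) * \<tau>0) = h powr (2 * \<nu>) / (h\<^sup>2) ^ k"
  proof -
    have "exp (- (real k - \<nu>) * \<tau>0) = exp (\<nu> * \<tau>0) / exp (real k * \<tau>0)"
      by (simp add: exp_diff[symmetric] algebra_simps)
    also have "exp (real k * \<tau>0) = (h\<^sup>2) ^ k" using h by (simp add: \<tau>0_def exp_of_nat_mult)
    finally show ?thesis using h by (simp add: \<tau>0_def powr_def ln_realpow)
  qed
  also have "B\<^sup>2 * (h powr (2 * \<nu>) / \<nu>) + B\<^sup>2 * ?A * (h\<^sup>2) ^ k * (h powr (2 * \<nu>) / (h\<^sup>2) ^ k / (real k - \<nu>))
      = B\<^sup>2 * (1 / \<nu> + ?A / (real k - \<nu>)) * h powr (2 * \<nu>)"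
  proof -
    have "(h\<^sup>2) ^ k \<noteq> 0" using h by simp
    hence "B\<^sup>2 * ?A * (h\<^sup>2) ^ k * (h powr (2 * \<nu>) / (h\<^sup>2) ^ k / (real k - \<nu>)) = B\<^sup>2 * (?A / (real k - \<nu>)) * h powr (2 * \<nu>)"
      by simp
    thus ?thesis by (simp add: algebra_simps)
  qed
  finally show ?thesis .
qed

section \<open>Elimination in small cells and the determinant\<close>

lemma qform_psi_form:
  "qform n (\<lambda>i j. A * Psi \<nu> \<kappa> (norm (x i - x j))) a = A * psi_form \<nu> \<kappa> x a {..<n}"
  unfolding qform_def psi_form_def sum_distrib_left by (intro sum.cong refl) (simp add: mult_ac)

text \<open>In every cell of side h at most N points, one per monomial, serve as pivots; every other
  point is combined with the pivots of its cell so that all moments of order below k vanish. The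
  total number of pivots is bounded by N times the number of cells, whatever n is.\<close>

lemma cell_elimination:
  fixes x :: "nat \<Rightarrow> 'a::euclidean_space" and k n :: nat
  assumes r: "\<And>i. norm (x i) \<le> r" and h: "0 < h"
  defines "N \<equiv> card (monomials k :: 'a list set)" and "d \<equiv> DIM('a)"
  obtains J c where "J \<subseteq> {..<n}" "real (card J) \<le> real N * (2 * r / h + 3) ^ d"
    "\<And>i. i < n \<Longrightarrow> i \<notin> J \<Longrightarrow> (\<Sum>l<n. \<bar>elim_row J c i l\<bar>) \<le> 2 ^ N"
    "\<And>i \<xi>. i < n \<Longrightarrow> i \<notin> J \<Longrightarrow> 0 < k \<Longrightarrow> norm (trig_sum x (elim_row J c i) {..<n} \<xi>) \<le> 2 ^ N * (real d * h * norm \<xi>) ^ k"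
proof -
  define cell where "cell = (\<lambda>y::'a. restrict (\<lambda>b. \<lfloor>inner y b / h\<rfloor>) Basis)"
  define z where "z = (\<lambda>e. \<Sum>b\<in>Basis. (h * of_int (e b)) *\<^sub>R b :: 'a)"
  have near: "norm (y - z (cell y)) \<le> real d * h" for y
  proof -
    have ib: "inner (z e) b = h * of_int (e b)" if "b \<in> Basis" for e b
      unfolding z_def using that by (simp add: inner_sum_left inner_Basis if_distrib cong: if_cong)
    have "\<bar>inner (y - z (cell y)) b\<bar> \<le> h" if b: "b \<in> Basis" for b
    proof -
      have "of_int \<lfloor>inner y b / h\<rfloor> \<le> inner y b / h" "inner y b / h < of_int \<lfloor>inner y b / h\<rfloor> + 1"
        by (rule of_int_floor_le) (rule floor_less_cancel, simp)
      hence "h * of_int \<lfloor>inner y b / h\<rfloor> \<le> inner y b" "inner y b < h * of_int \<lfloor>inner y b / h\<rfloor> + h"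
        using h mult_left_mono[of "of_int \<lfloor>inner y b / h\<rfloor>" "inner y b / h" h] by (simp_all add: field_simps)
      thus ?thesis using b by (simp add: inner_diff_left ib cell_def)
    qed
    hence "(\<Sum>b\<in>Basis. \<bar>inner (y - z (cell y)) b\<bar>) \<le> (\<Sum>b\<in>(Basis::'a set). h)" by (intro sum_mono)
    thus ?thesis using norm_le_l1[of "y - z (cell y)"] by (simp add: d_def)
  qed
  define S where "S = (\<lambda>e. {i\<in>{..<n}. cell (x i) = e})"
  define Q where "Q = (\<lambda>e J c. J \<subseteq> S e \<and> card J \<le> N \<and>
    (\<forall>i\<in>S e. (\<forall>L\<in>monomials k. monom_at (x i - z e) L = (\<Sum>j\<in>J. c i j * monom_at (x j - z e) L)) \<and> (\<Sum>j\<in>J. \<bar>c i j\<bar>) \<le> 2 ^ N - (1::real)))"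
  have "\<exists>J c. Q e J c" for e
    unfolding N_def Q_def by (rule pivot_subset[OF finite_monomials]) (simp add: S_def)
  then obtain Jf cf where Q: "\<And>e. Q e (Jf e) (cf e)" by metis
  have Jf: "\<And>e. Jf e \<subseteq> S e" "\<And>e. card (Jf e) \<le> N"
    and cf: "\<And>e i L. i \<in> S e \<Longrightarrow> L \<in> monomials k \<Longrightarrow> monom_at (x i - z e) L = (\<Sum>j\<in>Jf e. cf e i j * monom_at (x j - z e) L)"
    and cs: "\<And>e i. i \<in> S e \<Longrightarrow> (\<Sum>j\<in>Jf e. \<bar>cf e i j\<bar>) \<le> 2 ^ N - 1"
    using Q unfolding Q_def by blast+
  define E where "E = cell ` x ` {..<n}"
  define J where "J = (\<Union>e\<in>E. Jf e)"
  \<comment> \<open>The coefficients are set to zero outside the cell of i, so that elimination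
    against the union J of all pivots stays within that cell.\<close>
  define c where "c = (\<lambda>i l. if l \<in> Jf (cell (x i)) then cf (cell (x i)) i l else 0)"
  have row: "elim_row J c i l = (if l = i then 1 else 0) - (if l \<in> Jf (cell (x i)) then cf (cell (x i)) i l else 0)"
    if "i < n" "i \<notin> J" for i l
    using that by (auto simp: elim_row_def c_def J_def E_def)
  have fE: "finite E" unfolding E_def by auto
  have JS: "Jf e \<subseteq> {..<n}" for e using Jf(1)[of e] by (auto simp: S_def)
  have fJ: "finite (Jf e)" for e using JS finite_subset by blast
  have combo: "(\<Sum>l<n. elim_row J c i l * m l) = m i - (\<Sum>l\<in>Jf (cell (x i)). cf (cell (x i)) i l * m l)"
    if i: "i < n" "i \<notin> J" for i and m :: "nat \<Rightarrow> real"
  proof -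
    have "(\<Sum>l<n. elim_row J c i l * m l) = (\<Sum>l<n. (if l = i then m i else 0) - (if l \<in> Jf (cell (x i)) then cf (cell (x i)) i l * m l else 0))"
      by (intro sum.cong refl) (auto simp: row[OF i] left_diff_distrib)
    also have "\<dots> = m i - (\<Sum>l\<in>{..<n} \<inter> Jf (cell (x i)). cf (cell (x i)) i l * m l)"
      using i by (simp add: sum_subtractf sum.inter_restrict)
    also have "{..<n} \<inter> Jf (cell (x i)) = Jf (cell (x i))" using JS by auto
    finally show ?thesis .
  qed
  have abs: "(\<Sum>l<n. \<bar>elim_row J c i l\<bar>) \<le> 2 ^ N" if i: "i < n" "i \<notin> J" for i
  proof -
    have "(\<Sum>l<n. \<bar>elim_row J c i l\<bar>) \<le> (\<Sum>l<n. (if l = i then 1 else 0) + (if l \<in> Jf (cell (x i)) then \<bar>cf (cell (x i)) i l\<bar> else 0))"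
      by (intro sum_mono) (auto simp: row[OF i])
    also have "\<dots> = 1 + (\<Sum>l\<in>{..<n} \<inter> Jf (cell (x i)). \<bar>cf (cell (x i)) i l\<bar>)"
      using i by (simp add: sum.distrib sum.inter_restrict)
    also have "{..<n} \<inter> Jf (cell (x i)) = Jf (cell (x i))" using JS by auto
    also have "1 + (\<Sum>l\<in>Jf (cell (x i)). \<bar>cf (cell (x i)) i l\<bar>) \<le> 1 + (2 ^ N - 1)"
      using i by (intro add_left_mono cs) (auto simp: S_def)
    finally show ?thesis by simp
  qed
  show ?thesis
  proof (rule that[of J c])
    show "J \<subseteq> {..<n}" using JS by (auto simp: J_def)
    \<comment> \<open>Coordinates of the points lie between -r and r, so cell indices lie between -M
      and M; this gives at most 2 M + 1 \<le> 2 r/h + 3 cells per coordinate.\<close>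
    define M where "M = \<lceil>r / h\<rceil>"
    have r0: "0 \<le> r" using r[of 0] norm_ge_zero[of "x 0"] by linarith
    have M0: "0 \<le> M" unfolding M_def using r0 h divide_nonneg_pos[of r h] by linarith
    have "E \<subseteq> PiE Basis (\<lambda>_. {-M..M})"
    proof
      fix e assume "e \<in> E"
      then obtain i where i: "e = cell (x i)" by (auto simp: E_def)
      have "\<lfloor>inner (x i) b / h\<rfloor> \<in> {-M..M}" if "b \<in> Basis" for b
      proof -
        have "\<bar>inner (x i) b\<bar> \<le> r" using Basis_le_norm[OF that, of "x i"] r[of i] by linarith
        hence "inner (x i) b / h \<le> r / h" "- (r / h) \<le> inner (x i) b / h" using h by (simp_all add: field_simps abs_le_iff)
        moreover have "r / h \<le> of_int M" unfolding M_def by simp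
        ultimately show ?thesis by (auto simp: le_floor_iff floor_le_iff)
      qed
      thus "e \<in> PiE Basis (\<lambda>_. {-M..M})" by (auto simp: i cell_def)
    qed
    hence "card E \<le> card (PiE (Basis :: 'a set) (\<lambda>_. {-M..M}))" by (intro card_mono finite_PiE) auto
    also have "\<dots> = nat (2 * M + 1) ^ d" using M0 by (simp add: card_PiE d_def)
    finally have "real (card E) \<le> real (nat (2 * M + 1)) ^ d" by (metis of_nat_le_iff of_nat_power)
    also have "real (nat (2 * M + 1)) = 2 * of_int M + 1" using M0 by simp
    also have "(2 * real_of_int M + 1) ^ d \<le> (2 * r / h + 3) ^ d"
    proof (rule power_mono)
      have "real_of_int M \<le> r / h + 1" unfolding M_def by linarith
      thus "2 * real_of_int M + 1 \<le> 2 * r / h + 3" by simp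
    qed (use M0 in simp)
    finally have cE: "real (card E) \<le> (2 * r / h + 3) ^ d" .
    have "card J \<le> (\<Sum>e\<in>E. card (Jf e))" unfolding J_def by (rule card_UN_le[OF fE])
    also have "\<dots> \<le> (\<Sum>e\<in>E. N)" by (intro sum_mono Jf)
    finally have "real (card J) \<le> real N * real (card E)" by (simp add: mult.commute flip: of_nat_mult)
    also have "\<dots> \<le> real N * (2 * r / h + 3) ^ d" by (intro mult_left_mono cE) auto
    finally show "real (card J) \<le> real N * (2 * r / h + 3) ^ d" .
    fix i assume i: "i < n" "i \<notin> J"
    show "(\<Sum>l<n. \<bar>elim_row J c i l\<bar>) \<le> 2 ^ N" by (rule abs[OF i])
    fix \<xi> :: 'a assume k: "0 < k"
    show "norm (trig_sum x (elim_row J c i) {..<n} \<xi>) \<le> 2 ^ N * (real d * h * norm \<xi>) ^ k"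
    proof (rule trig_sum_annihilating[OF k, where z = "z (cell (x i))"])
      show "(\<Sum>l<n. \<bar>elim_row J c i l\<bar>) \<le> 2 ^ N" by (rule abs[OF i])
      fix l assume "l \<in> {..<n}" "elim_row J c i l \<noteq> 0"
      hence "l = i \<or> l \<in> Jf (cell (x i))" by (auto simp: row[OF i] split: if_splits)
      hence "cell (x l) = cell (x i)" using Jf(1)[of "cell (x i)"] by (auto simp: S_def)
      thus "norm (x l - z (cell (x i))) \<le> real d * h" using near[of "x l"] by simp
    next
      fix L :: "'a list" assume L: "L \<in> monomials k"
      have iS: "i \<in> S (cell (x i))" using i by (simp add: S_def)
      show "(\<Sum>l<n. elim_row J c i l * monom_at (x l - z (cell (x i))) L) = 0"
        unfolding combo[OF i] cf[OF iS L, symmetric] by simp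
    qed (use h in auto)
  qed
qed

text \<open>Cells of side h = H n^(-1/d) with a large constant H leave at most \<delta> n pivots,
  which cost a constant each. The remaining (1 - \<delta>) n rows contribute a factor of order h^(2
  \<nu>) each, that is, n^(-2 \<nu>/d).\<close>

lemma logdet_upper:
  fixes x :: "nat \<Rightarrow> 'a::euclidean_space"
  assumes r: "\<And>i. norm (x i) \<le> r" and A: "0 < A" and \<nu>: "0 < \<nu>" and \<kappa>: "0 < \<kappa>"
    and pd: "\<And>n. 0 < n \<Longrightarrow> posdef n (\<lambda>i j. A * Psi \<nu> \<kappa> (norm (x i - x j)))"
    and \<delta>: "0 < \<delta>"
  shows "\<exists>C. \<forall>\<^sub>F n in sequentially. ln (Determinant.det (kmat n (\<lambda>i j. A * Psi \<nu> \<kappa> (norm (x i - x j)))))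
    \<le> C * real n - (1 - \<delta>) * (2 * \<nu> / real DIM('a)) * (real n * ln (real n))"
proof -
  define d where "d = DIM('a)"
  have d: "0 < d" unfolding d_def by simp
  obtain k :: nat where k: "\<nu> < real k" using reals_Archimedean2 by blast
  hence k0: "0 < k" using \<nu> by (cases k) auto
  define N where "N = card (monomials k :: 'a list set)"
  define E0 where "E0 = A * ((2 ^ N)\<^sup>2 * (1 / \<nu> + ann_const k (real d) / (real k - \<nu>)))"
  have E0: "0 < E0" unfolding E0_def ann_const_def using A \<nu> k by (intro mult_pos_pos add_pos_pos divide_pos_pos) auto
  define D0 where "D0 = A * Psi \<nu> \<kappa> 0"
  have D0: "0 < D0"
    using posdef_pos[OF pd[of 1], of 0 "\<lambda>_. 1"] by (simp add: qform_def D0_def)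
  have r0: "0 \<le> r" using r[of 0] norm_ge_zero[of "x 0"] by linarith
  \<comment> \<open>Chosen so that N (2 r + 3)^d \<le> \<delta> H \<le> \<delta> H^d, which makes
    the number of pivots at most \<delta> n; the summand 1 ensures H \<ge> 1.\<close>
  define H where "H = (real N * (2 * r + 3) ^ d / \<delta> + 1)"
  have H1: "1 \<le> H" unfolding H_def using r0 \<delta> by simp
  define C where "C = \<bar>ln D0\<bar> + \<bar>ln E0\<bar> + 2 * \<nu> * \<bar>ln (real d * H)\<bar>"
  \<comment> \<open>This makes the cell side h at most 1, so that the summand 3 in the cell count
    can be absorbed into (2 r + 3)/h.\<close>
  have "\<forall>\<^sub>F n in sequentially. H powr real d \<le> real n"
    by (rule eventually_compose_filterlim[OF eventually_ge_at_top filterlim_real_sequentially])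
  moreover have "\<forall>\<^sub>F n::nat in sequentially. 1 \<le> n" by (rule eventually_ge_at_top)
  ultimately show ?thesis
  proof (intro exI[of _ C], eventually_elim)
    case (elim n)
    let ?k = "\<lambda>i j. A * Psi \<nu> \<kappa> (norm (x i - x j))"
    define m where "m = real n powr (1 / real d)"
    have m: "0 < m" "m powr real d = real n" using elim d by (auto simp: m_def powr_powr)
    have mH: "H \<le> m"
    proof -
      have "H = (H powr real d) powr (1 / real d)" using d H1 by (simp add: powr_powr)
      also have "\<dots> \<le> m" unfolding m_def using elim by (intro powr_mono2) auto
      finally show ?thesis .
    qed
    define h where "h = H / m"
    have h: "0 < h" "h \<le> 1" using m mH H1 by (auto simp: h_def)
    obtain J c where J: "J \<subseteq> {..<n}" "real (card J) \<le> real N * (2 * r / h + 3) ^ d"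
      and c1: "\<And>i. i < n \<Longrightarrow> i \<notin> J \<Longrightarrow> (\<Sum>l<n. \<bar>elim_row J c i l\<bar>) \<le> 2 ^ N"
      and c2: "\<And>i \<xi>. i < n \<Longrightarrow> i \<notin> J \<Longrightarrow> 0 < k \<Longrightarrow> norm (trig_sum x (elim_row J c i) {..<n} \<xi>) \<le> 2 ^ N * (real d * h * norm \<xi>) ^ k"
      by (rule cell_elimination[OF r h(1), of n k, folded N_def d_def]) (rule that)
    have "2 * r / h + 3 \<le> (2 * r + 3) / h" using h r0 by (simp add: field_simps)
    hence "(2 * r / h + 3) ^ d \<le> ((2 * r + 3) / h) ^ d" using h r0 by (intro power_mono) auto
    also have "\<dots> = (2 * r + 3) ^ d * (m ^ d / H ^ d)" by (simp add: h_def power_divide power_mult_distrib)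
    also have "m ^ d = real n" using m by (simp add: powr_realpow)
    finally have "real N * (2 * r / h + 3) ^ d \<le> real N * ((2 * r + 3) ^ d * (real n / H ^ d))"
      by (intro mult_left_mono) auto
    also have "\<dots> = real N * (2 * r + 3) ^ d / H ^ d * real n" by simp
    also have "\<dots> \<le> \<delta> * real n"
    proof (rule mult_right_mono)
      have "real N * (2 * r + 3) ^ d \<le> \<delta> * H" using \<delta> by (simp add: H_def field_simps)
      also have "H \<le> H ^ d" using H1 d by (simp add: self_le_power)
      finally show "real N * (2 * r + 3) ^ d / H ^ d \<le> \<delta>" using H1 \<delta> by (simp add: field_simps)
    qed simp
    finally have cJ: "real (card J) \<le> \<delta> * real n" using J(2) by linarith
    have cJn: "card J \<le> n" using card_mono[OF _ J(1)] by simp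
    define E where "E = E0 * (real d * h) powr (2 * \<nu>)"
    have E: "0 < E" unfolding E_def using E0 d h by simp
    have pdn: "posdef n ?k" using pd elim by simp
    have "Determinant.det (kmat n ?k) \<le> (\<Prod>i<n. qform n ?k (elim_row J c i))"
      by (rule det_le_elim[OF pdn J(1)])
    also have "\<dots> \<le> (\<Prod>i<n. if i \<in> J then D0 else E)"
    proof (rule prod_mono, rule conjI[OF qform_nonneg[OF pdn]])
      fix i assume i: "i \<in> {..<n}"
      show "qform n ?k (elim_row J c i) \<le> (if i \<in> J then D0 else E)"
      proof (cases "i \<in> J")
        case True
        have "elim_row J c i = (\<lambda>l. if l = i then 1 else 0)" using True by (auto simp: elim_row_def)
        moreover have "qform n ?k (\<lambda>l. if l = i then 1 else 0) = (\<Sum>l<n. \<Sum>m<n. if l = i then (if m = i then ?k i i else 0) else 0)"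
          unfolding qform_def by (intro sum.cong refl) auto
        moreover have "\<dots> = (\<Sum>l<n. if l = i then ?k i i else 0)"
          by (intro sum.cong refl) (use i in auto)
        ultimately show ?thesis using True i by (simp add: D0_def)
      next
        case False
        have "psi_form \<nu> \<kappa> x (elim_row J c i) {..<n} \<le> (2 ^ N)\<^sup>2 * (1 / \<nu> + ann_const k (real DIM('a)) / (real k - \<nu>)) * (real d * h) powr (2 * \<nu>)"
          using i False d h by (intro psi_form_annihilating \<nu> k \<kappa> c1 c2 k0) auto
        hence "A * psi_form \<nu> \<kappa> x (elim_row J c i) {..<n} \<le> E"
          using A unfolding E_def E0_def d_def by (simp add: mult.assoc)
        thus ?thesis using False by (simp add: qform_psi_form)
      qed
    qed
    also have "\<dots> = D0 ^ card J * E ^ (n - card J)"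
      using J(1) finite_subset[OF J(1)] by (simp add: prod.If_cases Int_absorb1 card_Diff_subset Diff_eq[symmetric])
    finally have "ln (Determinant.det (kmat n ?k)) \<le> ln (D0 ^ card J * E ^ (n - card J))"
      using posdef_det[OF pdn] D0 E by (intro ln_mono) auto
    also have "\<dots> = real (card J) * ln D0 + real (n - card J) * ln E"
      using D0 E by (simp add: ln_mult ln_realpow)
    also have "ln E = ln E0 + 2 * \<nu> * ln (real d * H) - (2 * \<nu> / real d) * ln (real n)"
    proof -
      have "ln ((real d * h) powr (2 * \<nu>)) = 2 * \<nu> * (ln (real d * H) - ln m)"
        using d h H1 m by (simp add: ln_powr h_def ln_div)
      moreover have "ln m = ln (real n) / real d" using elim by (simp add: m_def ln_powr)
      ultimately show ?thesis unfolding E_def using E0 d h by (simp add: ln_mult right_diff_distrib)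
    qed
    \<comment> \<open>Only the term with ln n has to keep its sign; there n - |J| \<ge> (1 -
      \<delta>) n is used. All other terms are estimated by absolute values and are O(n).\<close>
    also have "real (card J) * ln D0 + real (n - card J) * \<dots>
      \<le> real n * \<bar>ln D0\<bar> + (real n * (\<bar>ln E0\<bar> + 2 * \<nu> * \<bar>ln (real d * H)\<bar>) - (1 - \<delta>) * real n * ((2 * \<nu> / real d) * ln (real n)))"
    proof -
      have "real (card J) * ln D0 \<le> real n * \<bar>ln D0\<bar>" using cJn
        by (intro order_trans[OF mult_left_mono[OF abs_ge_self] mult_right_mono]) auto
      moreover have "real (n - card J) * (ln E0 + 2 * \<nu> * ln (real d * H)) \<le> real n * (\<bar>ln E0\<bar> + 2 * \<nu> * \<bar>ln (real d * H)\<bar>)"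
      proof -
        have "ln E0 + 2 * \<nu> * ln (real d * H) \<le> \<bar>ln E0\<bar> + 2 * \<nu> * \<bar>ln (real d * H)\<bar>"
          using \<nu> by (intro add_mono mult_left_mono) auto
        moreover have "0 \<le> \<bar>ln E0\<bar> + 2 * \<nu> * \<bar>ln (real d * H)\<bar>" using \<nu> by simp
        ultimately show ?thesis
          by (meson mult_left_mono mult_right_mono of_nat_0_le_iff of_nat_le_iff diff_le_self order_trans)
      qed
      moreover have "(1 - \<delta>) * real n * ((2 * \<nu> / real d) * ln (real n)) \<le> real (n - card J) * ((2 * \<nu> / real d) * ln (real n))"
        using cJ cJn \<nu> elim by (intro mult_right_mono mult_nonneg_nonneg) (auto simp: of_nat_diff left_diff_distrib)
      ultimately show ?thesis by (simp add: right_diff_distrib)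
    qed
    also have "\<dots> = C * real n - (1 - \<delta>) * (2 * \<nu> / real DIM('a)) * (real n * ln (real n))"
      unfolding C_def d_def by (simp add: algebra_simps)
    finally show ?case .
  qed
qed

section \<open>Quasi-uniform points and the likelihood\<close>

lemma separation_radius_le:
  assumes "i < n" "j < n" "i \<noteq> j"
  shows "2 * separation_radius x n \<le> norm (x i - x j)"
proof -
  let ?S = "{(i, j). i < n \<and> j < n \<and> i \<noteq> j}"
  have fin: "finite ?S" by (rule finite_subset[of _ "{..<n} \<times> {..<n}"]) auto
  have "Min ((\<lambda>(i, j). norm (x i - x j)) ` ?S) \<le> norm (x i - x j)"
    using assms fin by (intro Min_le) (auto intro!: image_eqI[of _ _ "(i, j)"])
  thus ?thesis by (simp add: separation_radius_def)
qed

lemma separation_radius_pos: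
  assumes "inj x" "2 \<le> n"
  shows "0 < separation_radius x n"
proof -
  let ?S = "{(i, j). i < n \<and> j < n \<and> i \<noteq> j}"
  have fin: "finite ?S" by (rule finite_subset[of _ "{..<n} \<times> {..<n}"]) auto
  have "(0, 1) \<in> ?S" using assms by auto
  hence "Min ((\<lambda>(i, j). norm (x i - x j)) ` ?S) \<in> (\<lambda>(i, j). norm (x i - x j)) ` ?S"
    using fin by (intro Min_in) auto
  moreover have "\<forall>v\<in>(\<lambda>(i, j). norm (x i - x j)) ` ?S. 0 < v"
    using assms(1) by (auto simp: inj_def)
  ultimately show ?thesis by (auto simp: separation_radius_def)
qed

text \<open>Boundedness of \<Omega> makes the supremum in \<open>fill_distance\<close> one of a
  bounded set of reals, hence a genuine upper bound.\<close>

lemma fill_distance_cover: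
  fixes x :: "nat \<Rightarrow> 'a::euclidean_space"
  assumes b: "bounded \<Omega>" and n: "0 < n" and y: "y \<in> \<Omega>"
  shows "\<exists>i<n. norm (y - x i) \<le> fill_distance \<Omega> x n"
proof -
  obtain R where R: "\<And>y. y \<in> \<Omega> \<Longrightarrow> norm y \<le> R" using b by (auto simp: bounded_iff)
  let ?m = "\<lambda>y. MIN i\<in>{..<n}. norm (y - x i)"
  have "?m y \<le> R + norm (x 0)" if "y \<in> \<Omega>" for y
  proof -
    have "?m y \<le> norm (y - x 0)" using n by (intro Min_le) auto
    also have "\<dots> \<le> R + norm (x 0)" using norm_triangle_ineq4[of y "x 0"] R[OF that] by linarith
    finally show ?thesis .
  qed
  hence "?m y \<le> fill_distance \<Omega> x n"
    unfolding fill_distance_def by (intro cSUP_upper2[OF _ y] bdd_aboveI2[of _ _ "R + norm (x 0)"]) auto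
  moreover have "?m y \<in> (\<lambda>i. norm (y - x i)) ` {..<n}" using n by (intro Min_in) auto
  ultimately show ?thesis by auto
qed

lemma powr_root_bound:
  assumes d: "0 < d" and n: "0 < n" and a: "0 \<le> a" and b: "0 \<le> b" and le: "a ^ d \<le> real n * b ^ d"
  shows "a * real n powr (- 1 / real d) \<le> b"
proof -
  have "(a * real n powr (- 1 / real d)) ^ d = a ^ d * (real n powr (- 1 / real d)) powr real d"
    using n by (simp add: power_mult_distrib powr_realpow)
  also have "\<dots> = a ^ d / real n" unfolding powr_powr using d n by (simp add: powr_minus field_simps)
  also have "\<dots> \<le> b ^ d" using le n by (simp add: field_simps)
  finally show ?thesis using b d by (rule_tac power_le_imp_le_base[of _ "d - 1"]) auto
qed

text \<open>Two volume comparisons: n balls of radius the fill distance cover a fixed ball inside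
  \<Omega>, and n disjoint balls of radius the separation radius fit into a fixed ball.
  Quasi-uniformity transfers each bound to the other quantity.\<close>

lemma quasi_uniform_bounds:
  fixes x :: "nat \<Rightarrow> 'a::euclidean_space"
  assumes b: "bounded \<Omega>" and o: "open \<Omega>" and sub: "range x \<subseteq> \<Omega>" and inj: "inj x" and qu: "quasi_uniform \<Omega> x"
  shows "\<exists>c>0. \<exists>C>0. \<forall>n\<ge>2. c * real n powr (- 1 / real DIM('a)) \<le> separation_radius x n
    \<and> separation_radius x n \<le> fill_distance \<Omega> x n \<and> fill_distance \<Omega> x n \<le> C * real n powr (- 1 / real DIM('a))"
proof -
  let ?d = "DIM('a)"
  obtain cq where cq: "0 < cq" and q: "\<And>n. 2 \<le> n \<Longrightarrow> separation_radius x n \<le> fill_distance \<Omega> x n"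
      "\<And>n. 2 \<le> n \<Longrightarrow> fill_distance \<Omega> x n \<le> cq * separation_radius x n"
    using qu by (auto simp: quasi_uniform_def)
  obtain R where R: "\<And>y. y \<in> \<Omega> \<Longrightarrow> norm y \<le> R" using b by (auto simp: bounded_iff)
  have R0: "0 \<le> R" using R[of "x 0"] sub norm_ge_zero[of "x 0"] by (meson order_trans rangeI subsetD)
  have ub: "0 < unit_ball_vol (real ?d)" by simp
  obtain e where e: "0 < e" "ball (x 0) e \<subseteq> \<Omega>" using o sub by (meson open_contains_ball rangeI subsetD)
  have low: "e * real n powr (- 1 / real ?d) \<le> fill_distance \<Omega> x n" if n: "2 \<le> n" for n
  proof (rule powr_root_bound)
    let ?h = "fill_distance \<Omega> x n"
    show h0: "0 \<le> ?h" using q(1)[OF n] separation_radius_pos[OF inj n] by linarith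
    have "ball (x 0) e \<subseteq> (\<Union>i<n. cball (x i) ?h)"
    proof
      fix y assume "y \<in> ball (x 0) e"
      hence "y \<in> \<Omega>" using e by auto
      from fill_distance_cover[OF b _ this, of n x] n show "y \<in> (\<Union>i<n. cball (x i) ?h)"
        by (auto simp: dist_norm norm_minus_commute)
    qed
    hence "measure lborel (ball (x 0) e) \<le> measure lborel (\<Union>i<n. cball (x i) ?h)"
      by (intro measure_mono_fmeasurable) (auto intro!: fmeasurable_UN fmeasurable_compact)
    also have "\<dots> \<le> (\<Sum>i<n. measure lborel (cball (x i) ?h))" by (rule measure_UNION_le) auto
    finally have "unit_ball_vol (real ?d) * e ^ ?d \<le> real n * (unit_ball_vol (real ?d) * ?h ^ ?d)"
      using e h0 by (simp add: content_ball content_cball)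
    thus "e ^ ?d \<le> real n * ?h ^ ?d" using ub by (simp add: mult.left_commute)
  qed (use n e in auto)
  have up: "separation_radius x n \<le> 2 * R * real n powr (- 1 / real ?d)" if n: "2 \<le> n" for n
  proof -
    let ?q = "separation_radius x n"
    have q0: "0 < ?q" by (rule separation_radius_pos[OF inj n])
    have "2 * ?q \<le> norm (x 0 - x 1)" using n by (intro separation_radius_le) auto
    also have "\<dots> \<le> 2 * R" using norm_triangle_ineq4[of "x 0" "x 1"] R[of "x 0"] R[of "x 1"] sub by (smt (verit) rangeI subsetD)
    \<comment> \<open>Two points of \<Omega> are at most 2 R apart, so the balls around the points
      stay within radius 2 R of the origin.\<close>
    finally have qR: "?q \<le> R" by simp
    have dis: "disjoint_family_on (\<lambda>i. ball (x i) ?q) {..<n}"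
    proof (unfold disjoint_family_on_def, intro ballI impI)
      fix i j assume "i \<in> {..<n}" "j \<in> {..<n}" "i \<noteq> j"
      hence "2 * ?q \<le> norm (x i - x j)" by (intro separation_radius_le) auto
      thus "ball (x i) ?q \<inter> ball (x j) ?q = {}" by (intro disjoint_ballI) (simp add: dist_norm)
    qed
    have "real n * (unit_ball_vol (real ?d) * ?q ^ ?d) = (\<Sum>i<n. measure lborel (ball (x i) ?q))"
      using q0 by (simp add: content_ball)
    also have "\<dots> = measure lborel (\<Union>i<n. ball (x i) ?q)"
      using dis emeasure_lborel_ball_finite by (intro measure_finite_Union[symmetric]) (auto simp: less_top[symmetric])
    also have "\<dots> \<le> measure lborel (cball (0::'a) (2 * R))"
    proof (intro measure_mono_fmeasurable)
      show "(\<Union>i<n. ball (x i) ?q) \<subseteq> cball 0 (2 * R)"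
      proof
        fix y assume "y \<in> (\<Union>i<n. ball (x i) ?q)"
        then obtain i where "norm (x i - y) < ?q" by (auto simp: dist_norm)
        moreover have "norm (x i) \<le> R" using R sub by auto
        ultimately show "y \<in> cball 0 (2 * R)" using qR norm_triangle_ineq4[of "x i" "x i - y"] by simp
      qed
    qed (auto intro!: fmeasurable_compact)
    also have "\<dots> = unit_ball_vol (real ?d) * (2 * R) ^ ?d" using R0 by (simp add: content_cball)
    finally have "real n * ?q ^ ?d \<le> (2 * R) ^ ?d" using ub by (simp add: mult.left_commute)
    hence le: "?q ^ ?d \<le> (2 * R * real n powr (- 1 / real ?d)) ^ ?d"
    proof -
      have "(2 * R * real n powr (- 1 / real ?d)) ^ ?d = (2 * R) ^ ?d * (real n powr (- 1 / real ?d)) powr real ?d"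
        using n by (simp add: power_mult_distrib powr_realpow)
      also have "\<dots> = (2 * R) ^ ?d / real n" unfolding powr_powr using n by (simp add: powr_minus field_simps)
      finally have eq: "(2 * R * real n powr (- 1 / real ?d)) ^ ?d = (2 * R) ^ ?d / real n" .
      show ?thesis unfolding eq using \<open>real n * ?q ^ ?d \<le> (2 * R) ^ ?d\<close> n by (simp add: field_simps)
    qed
    show ?thesis using power_le_imp_le_base[of ?q "?d - 1" "2 * R * real n powr (- 1 / real ?d)"] le R0 by simp
  qed
  show ?thesis
  proof (rule exI[of _ "e / cq"], intro conjI, goal_cases)
    case 2
    show ?case
    proof (rule exI[of _ "cq * (2 * R + 1)"], intro conjI allI impI)
    fix n :: nat assume n: "2 \<le> n"
    have "e * real n powr (- 1 / real ?d) \<le> cq * separation_radius x n" using low[OF n] q(2)[OF n] by linarith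
    thus "e / cq * real n powr (- 1 / real ?d) \<le> separation_radius x n" using cq by (simp add: field_simps)
    show "separation_radius x n \<le> fill_distance \<Omega> x n" by (rule q(1)[OF n])
    have "fill_distance \<Omega> x n \<le> cq * (2 * R * real n powr (- 1 / real ?d))"
      using q(2)[OF n] mult_left_mono[OF up[OF n], of cq] cq by linarith
    also have "\<dots> \<le> cq * ((2 * R + 1) * real n powr (- 1 / real ?d))" using cq by (intro mult_left_mono mult_right_mono) auto
    finally show "fill_distance \<Omega> x n \<le> cq * (2 * R + 1) * real n powr (- 1 / real ?d)" by (simp add: mult.assoc)
    qed (use e cq R0 in auto)
  qed (use e cq in simp)
qed

section \<open>The two terms of the likelihood along the sampling sequence\<close>

locale matern_sampling =
  fixes \<nu>min \<nu>max \<sigma> \<rho> :: real and c :: "real \<Rightarrow> real"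
    and \<Omega> :: "'a::euclidean_space set" and x :: "nat \<Rightarrow> 'a"
  assumes \<nu>min: "0 < \<nu>min" and \<nu>le: "\<nu>min \<le> \<nu>max" and \<sigma>: "0 < \<sigma>" and \<rho>: "0 < \<rho>"
    and cpos: "\<And>\<nu>. \<nu> \<in> {\<nu>min..\<nu>max} \<Longrightarrow> 0 < c \<nu>"
    and cinf: "0 < (INF \<nu>\<in>{\<nu>min..\<nu>max}. c \<nu>)"
    and bdd: "bounded \<Omega>" and opn: "open \<Omega>"
    and sub: "range x \<subseteq> \<Omega>" and inj: "inj x" and qu: "quasi_uniform \<Omega> x"
begin

abbreviation "amp \<equiv> matern_amp \<sigma> \<rho> c"
definition kap :: "real \<Rightarrow> real" where "kap \<nu> = 2 * \<nu> / \<rho>\<^sup>2"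
abbreviation "kern \<nu> \<equiv> (\<lambda>i j. amp \<nu> * Psi \<nu> (kap \<nu>) (norm (x i - x j)))"
abbreviation "ldet \<nu> n \<equiv> ln (Determinant.det (kmat n (kern \<nu>)))"
abbreviation sscale :: "nat \<Rightarrow> real" where
  "sscale n \<equiv> sep_const (real DIM('a)) * (separation_radius x n)\<^sup>2"

lemma kap_pos: "\<nu> \<in> {\<nu>min..\<nu>max} \<Longrightarrow> 0 < kap \<nu>" and nu_pos: "\<nu> \<in> {\<nu>min..\<nu>max} \<Longrightarrow> 0 < \<nu>"
  using \<nu>min \<rho> by (auto simp: kap_def)

lemma amp_pos: "\<nu> \<in> {\<nu>min..\<nu>max} \<Longrightarrow> 0 < amp \<nu>"
  using cpos[of \<nu>] \<sigma> \<rho> nu_pos[of \<nu>] by (simp add: matern_amp_def)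

text \<open>The scaling c need not be continuous, so the bound comes from its infimum. Replacing
  \<kappa> by a number k0 \<le> 1 makes the power of k0 decreasing in the exponent, and \<nu>max is
  then the worst case.\<close>

lemma amp_lower: "\<exists>m>0. \<forall>\<nu>\<in>{\<nu>min..\<nu>max}. m \<le> amp \<nu>"
proof -
  define c0 where "c0 = (INF \<nu>\<in>{\<nu>min..\<nu>max}. c \<nu>)"
  define k0 where "k0 = min 1 (kap \<nu>min)"
  have k0: "0 < k0" "k0 \<le> 1" using \<nu>min \<rho> by (auto simp: k0_def kap_def)
  have m: "\<sigma>\<^sup>2 * c0 * 2 powr (- 1) * k0 powr \<nu>max \<le> amp \<nu>" if \<nu>: "\<nu> \<in> {\<nu>min..\<nu>max}" for \<nu>
    unfolding matern_amp_def kap_def[symmetric]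
  proof (intro mult_mono)
    show "c0 \<le> c \<nu>" unfolding c0_def
      by (rule cINF_lower[OF _ \<nu>]) (use cpos in \<open>auto intro!: bdd_belowI2[of _ 0] less_imp_le\<close>)
    show "2 powr - 1 \<le> 2 powr (\<nu> - 1)" using nu_pos[OF \<nu>] by (intro powr_mono) auto
    have "k0 powr \<nu>max \<le> k0 powr \<nu>" using \<nu> k0 by (intro powr_mono') auto
    also have "\<dots> \<le> kap \<nu> powr \<nu>"
    proof (rule powr_mono2)
      show "k0 \<le> kap \<nu>" unfolding k0_def kap_def using \<nu> \<rho> by (auto simp: min_def field_simps intro: order_trans)
    qed (use nu_pos[OF \<nu>] k0 in auto)
    finally show "k0 powr \<nu>max \<le> kap \<nu> powr \<nu>" .
  qed (use cpos[OF \<nu>] cinf in \<open>auto simp: c0_def intro!: mult_nonneg_nonneg less_imp_le\<close>)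
  have "0 < \<sigma>\<^sup>2 * c0 * 2 powr (- 1) * k0 powr \<nu>max" using \<sigma> cinf k0 by (simp add: c0_def)
  with m show ?thesis by blast
qed

lemma separated:
  assumes "i \<in> {..<n}" "j \<in> {..<n}" "i \<noteq> j" shows "2 * separation_radius x n \<le> norm (x i - x j)"
  using assms by (intro separation_radius_le) auto

text \<open>The separation q is left free: for n = 1 the separation radius is a minimum over the
  empty set, and \<open>kern_posdef\<close> takes q = 1 instead.\<close>

lemma kern_coercive_sep:
  assumes \<nu>: "\<nu> \<in> {\<nu>min..\<nu>max}" and q: "0 < q"
    and sep: "\<And>i j. i \<in> {..<n} \<Longrightarrow> j \<in> {..<n} \<Longrightarrow> i \<noteq> j \<Longrightarrow> 2 * q \<le> norm (x i - x j)"
  defines "s \<equiv> sep_const (real DIM('a)) * q\<^sup>2"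
  shows "amp \<nu> * (1 / 2 * exp (- kap \<nu> * s - \<nu>) * s powr \<nu>) * (\<Sum>i<n. (a i)\<^sup>2) \<le> qform n (kern \<nu>) a"
    and "0 < amp \<nu> * (1 / 2 * exp (- kap \<nu> * s - \<nu>) * s powr \<nu>)"
proof -
  have "0 < s" using q sep_const_pos[of "real DIM('a)"] by (simp add: s_def)
  thus "0 < amp \<nu> * (1 / 2 * exp (- kap \<nu> * s - \<nu>) * s powr \<nu>)" using amp_pos[OF \<nu>] by simp
  have "amp \<nu> * (1 / 2 * exp (- kap \<nu> * s - \<nu>) * s powr \<nu> * (\<Sum>i<n. (a i)\<^sup>2)) \<le> amp \<nu> * psi_form \<nu> (kap \<nu>) x a {..<n}"
    unfolding s_def
    by (rule mult_left_mono[OF psi_form_coercive[OF finite_lessThan q sep nu_pos[OF \<nu>] kap_pos[OF \<nu>]] less_imp_le[OF amp_pos[OF \<nu>]]])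
  thus "amp \<nu> * (1 / 2 * exp (- kap \<nu> * s - \<nu>) * s powr \<nu>) * (\<Sum>i<n. (a i)\<^sup>2) \<le> qform n (kern \<nu>) a"
    by (simp only: qform_psi_form mult.assoc)
qed

lemmas kern_coercive = kern_coercive_sep[OF _ separation_radius_pos[OF inj] separated]

lemma kern_posdef:
  assumes \<nu>: "\<nu> \<in> {\<nu>min..\<nu>max}" and n: "0 < n"
  shows "posdef n (kern \<nu>)"
proof -
  define q where "q = (if 2 \<le> n then separation_radius x n else 1)"
  have q: "0 < q" unfolding q_def using separation_radius_pos[OF inj] by simp
  have sep: "2 * q \<le> norm (x i - x j)" if "i \<in> {..<n}" "j \<in> {..<n}" "i \<noteq> j" for i j
    using separated[OF that] that n by (auto simp: q_def)
  show ?thesis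
    by (rule coercive_posdef[OF _ kern_coercive_sep(2)[OF \<nu> q sep] kern_coercive_sep(1)[OF \<nu> q sep]])
      (auto simp: norm_minus_commute)
qed

text \<open>Coefficients of the kernel interpolant of f at the first n points; \<open>fit\<close>
  below is its squared native norm.\<close>

definition coef :: "('a \<Rightarrow> real) \<Rightarrow> real \<Rightarrow> nat \<Rightarrow> nat \<Rightarrow> real" where
  "coef f \<nu> n = (\<lambda>j. (the (mat_inverse (kmat n (kern \<nu>))) *\<^sub>v Matrix.vec n (\<lambda>i. f (x i))) $ j)"

definition fit :: "('a \<Rightarrow> real) \<Rightarrow> real \<Rightarrow> nat \<Rightarrow> real" where
  "fit f \<nu> n = (\<Sum>i<n. f (x i) * coef f \<nu> n i)"

lemma coef_solution:
  assumes "\<nu> \<in> {\<nu>min..\<nu>max}" "i < n"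
  shows "(\<Sum>j<n. kern \<nu> i j * coef f \<nu> n j) = f (x i)"
  using posdef_det[OF kern_posdef[OF assms(1), of n]] assms(2)
  unfolding coef_def by (intro kmat_inverse_solution(1)) auto

lemma fit_eq: "\<nu> \<in> {\<nu>min..\<nu>max} \<Longrightarrow> fit f \<nu> n = qform n (kern \<nu>) (coef f \<nu> n)"
  unfolding fit_def by (rule qform_solution[symmetric]) (rule coef_solution)

lemma fit_nonneg: "\<nu> \<in> {\<nu>min..\<nu>max} \<Longrightarrow> 0 < n \<Longrightarrow> 0 \<le> fit f \<nu> n"
  unfolding fit_eq by (rule qform_nonneg[OF kern_posdef])

lemma neg_log_lik_eq:
  assumes \<nu>: "\<nu> \<in> {\<nu>min..\<nu>max}" and n: "0 < n"
  shows "neg_log_lik f (matern \<sigma> \<rho> c \<nu>) x n = fit f \<nu> n + ldet \<nu> n"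
proof -
  have K: "kernel_matrix (matern \<sigma> \<rho> c \<nu>) x n = kmat n (kern \<nu>)"
    unfolding kernel_matrix_def by (intro cong_mat) (auto simp: matern_Psi[OF nu_pos[OF \<nu>] \<rho>] kap_def)
  have "Determinant.det (kmat n (kern \<nu>)) \<noteq> 0" using posdef_det[OF kern_posdef[OF \<nu> n]] by simp
  from kmat_inverse_solution(2)[OF this, of "\<lambda>i. f (x i)"] show ?thesis
    unfolding neg_log_lik_def K data_vector_def fit_def coef_def by simp
qed

lemma scale_bounds:
  "\<exists>s1>0. \<exists>s2>0. \<forall>n\<ge>2. s1 * real n powr (- 2 / real DIM('a)) \<le> sscale n \<and> sscale n \<le> s2"
proof -
  obtain c1 C1 where c1: "0 < c1" "0 < C1"
    and b: "\<And>n. 2 \<le> n \<Longrightarrow> c1 * real n powr (- 1 / real DIM('a)) \<le> separation_radius x n"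
      "\<And>n. 2 \<le> n \<Longrightarrow> separation_radius x n \<le> C1 * real n powr (- 1 / real DIM('a))"
    using quasi_uniform_bounds[OF bdd opn sub inj qu] by (meson order_trans)
  let ?s = "sep_const (real DIM('a))"
  have s: "0 < ?s" by (simp add: sep_const_pos)
  show ?thesis
  proof (rule exI[of _ "?s * c1\<^sup>2"], intro conjI, goal_cases)
    case 2
    show ?case
    proof (rule exI[of _ "?s * C1\<^sup>2"], intro conjI allI impI)
      fix n :: nat assume n: "2 \<le> n"
      have "real n powr (- 2 / real DIM('a)) = (real n powr (- 1 / real DIM('a)))\<^sup>2"
        unfolding power2_eq_square powr_add[symmetric] by simp
      hence "?s * c1\<^sup>2 * real n powr (- 2 / real DIM('a)) = ?s * (c1 * real n powr (- 1 / real DIM('a)))\<^sup>2"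
        by (simp add: power_mult_distrib)
      also have "\<dots> \<le> sscale n" using s c1 b(1)[OF n] by (intro mult_left_mono power_mono) auto
      finally show "?s * c1\<^sup>2 * real n powr (- 2 / real DIM('a)) \<le> sscale n" .
      have "real n powr (- 1 / real DIM('a)) \<le> real n powr 0" using n by (intro powr_mono) auto
      hence "C1 * real n powr (- 1 / real DIM('a)) \<le> C1 * 1" using n c1 by (intro mult_left_mono) auto
      hence "separation_radius x n \<le> C1" using b(2)[OF n] by linarith
      thus "sscale n \<le> ?s * C1\<^sup>2" using s separation_radius_pos[OF inj n] by (intro mult_left_mono power_mono) auto
    qed (use s c1 in simp)
  qed (use s c1 in simp)
qed

text \<open>All pivots are at least the coercivity constant, of order s^\<nu> with s at least of
  order n^(-2/d). The constant C serves all \<nu> at once, because \<nu> will be the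
  estimator.\<close>

lemma ldet_lower:
  "\<exists>C. \<forall>n\<ge>2. \<forall>\<nu>\<in>{\<nu>min..\<nu>max}. - (2 * \<nu> / real DIM('a)) * (real n * ln (real n)) - C * real n \<le> ldet \<nu> n"
proof -
  obtain s1 s2 where s: "0 < s1" "0 < s2" and sb: "\<And>n. 2 \<le> n \<Longrightarrow> s1 * real n powr (- 2 / real DIM('a)) \<le> sscale n" "\<And>n. 2 \<le> n \<Longrightarrow> sscale n \<le> s2"
    using scale_bounds by blast
  obtain m where m: "0 < m" "\<And>\<nu>. \<nu> \<in> {\<nu>min..\<nu>max} \<Longrightarrow> m \<le> amp \<nu>" using amp_lower by blast
  define C where "C = \<bar>ln (m / 2)\<bar> + (kap \<nu>max * s2 + \<nu>max) + \<nu>max * \<bar>ln s1\<bar>"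
  show ?thesis
  proof (intro exI[of _ C] allI impI ballI)
    fix n :: nat and \<nu> assume n: "2 \<le> n" and \<nu>: "\<nu> \<in> {\<nu>min..\<nu>max}"
    have sc: "0 < sscale n" using sep_const_pos[of "real DIM('a)"] separation_radius_pos[OF inj n] by simp
    define l where "l = amp \<nu> * (1 / 2 * exp (- kap \<nu> * sscale n - \<nu>) * sscale n powr \<nu>)"
    have l: "0 < l" unfolding l_def by (rule kern_coercive[OF \<nu> n])
    have "l ^ n \<le> Determinant.det (kmat n (kern \<nu>))"
      by (rule coercive_det[OF _ l kern_coercive(1)[OF \<nu> n, folded l_def]]) (auto simp: norm_minus_commute)
    hence "ln (l ^ n) \<le> ldet \<nu> n" using l by (intro ln_mono) auto
    hence 1: "real n * ln l \<le> ldet \<nu> n" using l by (simp add: ln_realpow)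
    have "ln l = ln (amp \<nu> / 2) + (- kap \<nu> * sscale n - \<nu>) + \<nu> * ln (sscale n)"
    proof -
      have "ln (a * (1 / 2 * exp e * s powr \<nu>)) = ln (a / 2) + e + \<nu> * ln s" if "0 < a" "0 < s" for a e s :: real
        using that by (simp add: ln_mult ln_powr ln_div)
      from this[OF amp_pos[OF \<nu>] sc] show ?thesis unfolding l_def .
    qed
    moreover have "- \<bar>ln (m / 2)\<bar> \<le> ln (amp \<nu> / 2)"
    proof -
      have "ln (m / 2) \<le> ln (amp \<nu> / 2)" using m(1) m(2)[OF \<nu>] amp_pos[OF \<nu>] by simp
      thus ?thesis by linarith
    qed
    moreover have "kap \<nu> * sscale n \<le> kap \<nu>max * s2"
      unfolding kap_def using \<nu> \<rho> sb(2)[OF n] sc nu_pos[OF \<nu>] by (intro mult_mono divide_right_mono) auto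
    moreover have "- \<nu>max * \<bar>ln s1\<bar> - (2 * \<nu> / real DIM('a)) * ln (real n) \<le> \<nu> * ln (sscale n)"
    proof -
      have "ln s1 - 2 / real DIM('a) * ln (real n) = ln (s1 * real n powr (- 2 / real DIM('a)))"
        using s n by (simp add: ln_mult ln_powr)
      also have "\<dots> \<le> ln (sscale n)" using sb(1)[OF n] s n by (intro ln_mono) auto
      finally have "\<nu> * (ln s1 - 2 / real DIM('a) * ln (real n)) \<le> \<nu> * ln (sscale n)" using nu_pos[OF \<nu>] by simp
      moreover have "- \<nu>max * \<bar>ln s1\<bar> \<le> \<nu> * ln s1"
      proof -
        have "- (\<nu> * ln s1) \<le> \<nu> * \<bar>ln s1\<bar>" using nu_pos[OF \<nu>] abs_ge_minus_self[of "\<nu> * ln s1"] by (simp add: abs_mult)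
        also have "\<dots> \<le> \<nu>max * \<bar>ln s1\<bar>" using \<nu> by (intro mult_right_mono) auto
        finally show ?thesis by simp
      qed
      moreover have "(2 * \<nu> / real DIM('a)) * ln (real n) = \<nu> * (2 / real DIM('a) * ln (real n))" by simp
      ultimately show ?thesis unfolding right_diff_distrib by linarith
    qed
    moreover have "\<nu> \<le> \<nu>max" using \<nu> by simp
    ultimately have "- C - (2 * \<nu> / real DIM('a)) * ln (real n) \<le> ln l" unfolding C_def by linarith
    hence "real n * (- C - (2 * \<nu> / real DIM('a)) * ln (real n)) \<le> real n * ln l" by (intro mult_left_mono) auto
    with 1 show "- (2 * \<nu> / real DIM('a)) * (real n * ln (real n)) - C * real n \<le> ldet \<nu> n"
      by (simp add: algebra_simps)
  qed
qed

text \<open>With b the interpolation coefficients, (fit)^2 is the square of \<Sum> b i f (x i),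
  which duality bounds by the form of order \<mu> = \<alpha> - d/2 at b. The Bernstein inequality
  raises the order to \<nu> at the cost s^(\<mu>-\<nu>), and the form of order \<nu> at b is
  \<open>fit\<close> up to the amplitude, so one factor cancels.\<close>

lemma fit_upper:
  assumes \<nu>: "\<nu> \<in> {\<nu>min..\<nu>max}" and \<alpha>: "real DIM('a) / 2 < \<alpha>" "\<alpha> - real DIM('a) / 2 \<le> \<nu>"
    and f: "f \<in> sobolev_on \<alpha> \<Omega>"
  shows "\<exists>C. \<forall>n\<ge>2. fit f \<nu> n \<le> C * real n powr (1 + 2 * (\<nu> - \<alpha>) / real DIM('a))"
proof -
  let ?d = "real DIM('a)" and ?\<kappa> = "kap \<nu>"
  define \<mu> where "\<mu> = \<alpha> - ?d / 2"
  have \<mu>: "0 < \<mu>" "\<mu> \<le> \<nu>" using \<alpha> by (auto simp: \<mu>_def)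
  have \<alpha>0: "0 < \<alpha>" using \<alpha>(1) DIM_positive[where 'a = 'a] by linarith
  have \<kappa>: "0 < ?\<kappa>" by (rule kap_pos[OF \<nu>])
  obtain fe where fe: "fe \<in> sobolev \<alpha>" and fe_eq: "\<And>y. y \<in> \<Omega> \<Longrightarrow> fe y = f y"
    using f by (auto simp: sobolev_on_def)
  obtain g where ft: "is_fourier_transform fe g"
    and gi: "integrable lborel (\<lambda>\<xi>. (1 + (norm \<xi>)\<^sup>2) powr \<alpha> * (norm (g \<xi>))\<^sup>2)"
    and cont: "continuous_on UNIV fe"
    using fe \<alpha>(1) by (auto simp: sobolev_def)
  have gm [measurable]: "g \<in> borel_measurable borel"
    using ft by (auto simp: is_fourier_transform_def square_integrable_def)
  note [measurable] = spec_measurable[OF \<alpha>0 \<kappa>]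
  \<comment> \<open>Dividing by the spectral density of order \<alpha> is, up to constants,
    multiplying by the Sobolev weight of order \<alpha>.\<close>
  have gV: "integrable lborel (\<lambda>\<xi>. (norm (g \<xi>))\<^sup>2 / spec \<alpha> ?\<kappa> \<xi>)"
  proof (rule Bochner_Integration.integrable_bound)
    define m where "m = max 1 ?\<kappa>"
    show "integrable lborel (\<lambda>\<xi>. m powr \<alpha> / Gam \<alpha> * ((1 + (norm \<xi>)\<^sup>2) powr \<alpha> * (norm (g \<xi>))\<^sup>2))"
      using gi by simp
    show "AE \<xi> in lborel. norm ((norm (g \<xi>))\<^sup>2 / spec \<alpha> ?\<kappa> \<xi>) \<le> norm (m powr \<alpha> / Gam \<alpha> * ((1 + (norm \<xi>)\<^sup>2) powr \<alpha> * (norm (g \<xi>))\<^sup>2))"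
    proof (rule AE_I2)
      fix \<xi> :: 'a
      have p: "0 < ?\<kappa> + (norm \<xi>)\<^sup>2" using \<kappa> by (intro add_pos_nonneg) auto
      have "?\<kappa> + (norm \<xi>)\<^sup>2 \<le> m * (1 + (norm \<xi>)\<^sup>2)"
        unfolding distrib_left by (intro add_mono) (auto simp: m_def mult_le_cancel_right1)
      hence "(?\<kappa> + (norm \<xi>)\<^sup>2) powr \<alpha> \<le> m powr \<alpha> * (1 + (norm \<xi>)\<^sup>2) powr \<alpha>"
        using powr_mono2[of \<alpha> "?\<kappa> + (norm \<xi>)\<^sup>2" "m * (1 + (norm \<xi>)\<^sup>2)"] p \<alpha>0 by (simp add: powr_mult m_def)
      hence "(norm (g \<xi>))\<^sup>2 * (?\<kappa> + (norm \<xi>)\<^sup>2) powr \<alpha> / Gam \<alpha> \<le> (norm (g \<xi>))\<^sup>2 * (m powr \<alpha> * (1 + (norm \<xi>)\<^sup>2) powr \<alpha>) / Gam \<alpha>"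
        using Gam_pos[OF \<alpha>0] by (intro divide_right_mono mult_left_mono) auto
      moreover have "(norm (g \<xi>))\<^sup>2 / spec \<alpha> ?\<kappa> \<xi> = (norm (g \<xi>))\<^sup>2 * (?\<kappa> + (norm \<xi>)\<^sup>2) powr \<alpha> / Gam \<alpha>"
        unfolding spec_eq[OF \<alpha>0 \<kappa>] by (simp add: powr_minus field_simps)
      ultimately show "norm ((norm (g \<xi>))\<^sup>2 / spec \<alpha> ?\<kappa> \<xi>) \<le> norm (m powr \<alpha> / Gam \<alpha> * ((1 + (norm \<xi>)\<^sup>2) powr \<alpha> * (norm (g \<xi>))\<^sup>2))"
        using Gam_pos[OF \<alpha>0] spec_pos[OF \<alpha>0 \<kappa>, of \<xi>] by (simp add: mult_ac)
    qed
  qed measurable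
  define G where "G = (2 * pi) powr (- 2 * ?d) * (LINT \<xi>|lborel. (norm (g \<xi>))\<^sup>2 / spec \<alpha> ?\<kappa> \<xi>) * pi powr (?d / 2)"
  have G: "0 \<le> G" unfolding G_def using spec_pos[OF \<alpha>0 \<kappa>]
    by (intro mult_nonneg_nonneg integral_nonneg_AE) (auto intro!: AE_I2 divide_nonneg_nonneg less_imp_le[OF spec_pos[OF \<alpha>0 \<kappa>]])
  have x\<Omega>: "x i \<in> \<Omega>" for i using sub by auto
  have dual: "(\<Sum>i<n. a i * f (x i))\<^sup>2 \<le> G * psi_form \<mu> ?\<kappa> x a {..<n}" for a n
  proof -
    have "(\<Sum>i<n. a i * f (x i)) = (\<Sum>i<n. a i * fe (x i))"
      by (simp add: fe_eq[OF x\<Omega>])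
    thus ?thesis
      using sample_duality[OF ft cont spec_measurable[OF \<alpha>0 \<kappa>] spec_pos[OF \<alpha>0 \<kappa>] gV spec_trig_sum(1)[OF \<alpha>(1) \<kappa>], where p = x and a = a and I = "{..<n}"]
      unfolding spec_trig_sum(2)[OF \<alpha>(1) \<kappa>] G_def \<mu>_def by (simp add: mult_ac)
  qed
  obtain s1 s2 where s: "0 < s1" "0 < s2" and sb: "\<And>n. 2 \<le> n \<Longrightarrow> s1 * real n powr (- 2 / real DIM('a)) \<le> sscale n" "\<And>n. 2 \<le> n \<Longrightarrow> sscale n \<le> s2"
    using scale_bounds by blast
  define E where "E = s1 powr (\<mu> - \<nu>) * (1 + 3 * exp (?\<kappa> * s2 + \<nu>) / \<mu>)"
  have E: "0 \<le> E" unfolding E_def using \<mu> by (intro mult_nonneg_nonneg) auto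
  show ?thesis
  proof (intro exI[of _ "G * E / amp \<nu>"] allI impI)
    fix n :: nat assume n: "2 \<le> n"
    define b where "b = coef f \<nu> n"
    let ?r = "real n powr (1 + 2 * (\<nu> - \<alpha>) / real DIM('a))"
    have sc: "0 < sscale n" using sep_const_pos[of "real DIM('a)"] separation_radius_pos[OF inj n] by simp
    have F: "fit f \<nu> n = amp \<nu> * psi_form \<nu> ?\<kappa> x b {..<n}"
      unfolding fit_eq[OF \<nu>] qform_psi_form b_def ..
    have pnn: "0 \<le> psi_form \<nu> ?\<kappa> x b {..<n}" using nu_pos[OF \<nu>] \<kappa> by (rule psi_form_nonneg)
    have "(fit f \<nu> n)\<^sup>2 = (\<Sum>i<n. b i * f (x i))\<^sup>2" unfolding fit_def b_def by (simp add: mult.commute)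
    also have "\<dots> \<le> G * psi_form \<mu> ?\<kappa> x b {..<n}" by (rule dual)
    also have "psi_form \<mu> ?\<kappa> x b {..<n} \<le> sscale n powr (\<mu> - \<nu>) * (1 + 3 * exp (?\<kappa> * sscale n + \<nu>) / \<mu>) * psi_form \<nu> ?\<kappa> x b {..<n}"
      by (rule psi_form_bernstein[OF finite_lessThan separation_radius_pos[OF inj n] separated \<mu> \<kappa>])
    also have "sscale n powr (\<mu> - \<nu>) * (1 + 3 * exp (?\<kappa> * sscale n + \<nu>) / \<mu>) \<le> (s1 powr (\<mu> - \<nu>) * ?r) * (1 + 3 * exp (?\<kappa> * s2 + \<nu>) / \<mu>)"
    proof (rule mult_mono)
      have "sscale n powr (\<mu> - \<nu>) \<le> (s1 * real n powr (- 2 / real DIM('a))) powr (\<mu> - \<nu>)"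
        using sb(1)[OF n] s n \<mu> sc by (intro powr_mono2') auto
      also have "\<dots> = s1 powr (\<mu> - \<nu>) * ?r"
      proof -
        \<comment> \<open>The summand 1 in the exponent is the shift d/2 in \<mu>, multiplied by
          2/d.\<close>
        have "- 2 / ?d * (\<mu> - \<nu>) = 1 + 2 * (\<nu> - \<alpha>) / ?d" unfolding \<mu>_def by (simp add: field_simps)
        thus ?thesis using s by (simp add: powr_mult powr_powr)
      qed
      finally show "sscale n powr (\<mu> - \<nu>) \<le> s1 powr (\<mu> - \<nu>) * ?r" .
      show "1 + 3 * exp (?\<kappa> * sscale n + \<nu>) / \<mu> \<le> 1 + 3 * exp (?\<kappa> * s2 + \<nu>) / \<mu>"
        using \<mu> \<kappa> sb(2)[OF n] by (intro add_left_mono divide_right_mono mult_left_mono) (auto intro!: mult_left_mono)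
    qed (use \<mu> in auto)
    finally have "(fit f \<nu> n)\<^sup>2 \<le> G * (s1 powr (\<mu> - \<nu>) * ?r * (1 + 3 * exp (?\<kappa> * s2 + \<nu>) / \<mu>) * psi_form \<nu> ?\<kappa> x b {..<n})"
      using G pnn by (simp add: mult_left_mono mult_right_mono)
    also have "\<dots> = G * E / amp \<nu> * ?r * fit f \<nu> n"
      unfolding F E_def using amp_pos[OF \<nu>] by (simp add: mult_ac)
    finally have le: "fit f \<nu> n * fit f \<nu> n \<le> G * E / amp \<nu> * ?r * fit f \<nu> n" by (simp add: power2_eq_square)
    show "fit f \<nu> n \<le> G * E / amp \<nu> * ?r"
    proof (cases "fit f \<nu> n = 0")
      case True
      thus ?thesis using G E amp_pos[OF \<nu>] by simp
    next
      case False
      hence "0 < fit f \<nu> n" using fit_nonneg[OF \<nu>, of n f] n by simp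
      with le show ?thesis by (rule mult_right_le_imp_le)
    qed
  qed
qed

lemma ldet_upper:
  assumes \<nu>: "\<nu> \<in> {\<nu>min..\<nu>max}" and \<delta>: "0 < \<delta>"
  shows "\<exists>C. \<forall>\<^sub>F n in sequentially. ldet \<nu> n \<le> C * real n - (1 - \<delta>) * (2 * \<nu> / real DIM('a)) * (real n * ln (real n))"
proof -
  obtain R where R: "\<And>y. y \<in> \<Omega> \<Longrightarrow> norm y \<le> R" using bdd by (auto simp: bounded_iff)
  show ?thesis
    by (rule logdet_upper[of x R]) (use R sub in \<open>auto intro: amp_pos[OF \<nu>] nu_pos[OF \<nu>] kap_pos[OF \<nu>] kern_posdef[OF \<nu>] \<delta>\<close>)
qed

text \<open>At \<nu> = \<alpha> the data term is O(n). At any \<nu> \<le> \<alpha> - \<eta> it is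
  nonnegative and log det is larger by (2 \<eta>/d) n ln n, up to the loss \<delta> in the upper
  bound at \<alpha>. For large n this contradicts minimality.\<close>

lemma estimate_ge:
  assumes argmin: "\<And>n. 1 \<le> n \<Longrightarrow> is_arg_min (\<lambda>\<nu>. neg_log_lik f (matern \<sigma> \<rho> c \<nu>) x n) (\<lambda>\<nu>. \<nu> \<in> {\<nu>min..\<nu>max}) (\<nu>hat n)"
    and \<alpha>: "real DIM('a) / 2 < \<alpha>" "\<alpha> \<le> \<nu>max" and f: "f \<in> sobolev_on \<alpha> \<Omega>" and \<eta>: "0 < \<eta>"
  shows "\<forall>\<^sub>F n in sequentially. \<alpha> - \<eta> \<le> \<nu>hat n"
\<comment> \<open>In this case \<alpha> is not an admissible competitor, but every admissible value
  already exceeds it.\<close>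
proof (cases "\<alpha> < \<nu>min")
  case True
  show ?thesis
    using eventually_ge_at_top[of 1]
  proof eventually_elim
    case (elim n)
    thus ?case using argmin[of n] True \<eta> by (auto simp: is_arg_min_def)
  qed
next
  case False
  hence \<alpha>\<Theta>: "\<alpha> \<in> {\<nu>min..\<nu>max}" using \<alpha> by simp
  let ?d = "real DIM('a)"
  have d: "0 < ?d" by simp
  have \<alpha>0: "0 < \<alpha>" by (rule nu_pos[OF \<alpha>\<Theta>])
  obtain C1 where C1: "\<And>n. 2 \<le> n \<Longrightarrow> fit f \<alpha> n \<le> C1 * real n powr (1 + 2 * (\<alpha> - \<alpha>) / ?d)"
    using fit_upper[OF \<alpha>\<Theta> \<alpha>(1) _ f] by auto
  \<comment> \<open>The loss \<delta> (2 \<alpha>/d) equals \<eta>/d, half of the gain 2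
    \<eta>/d.\<close>
  define \<delta> where "\<delta> = \<eta> / (2 * \<alpha>)"
  have \<delta>: "0 < \<delta>" using \<eta> \<alpha>0 by (simp add: \<delta>_def)
  obtain C2 where C2: "\<forall>\<^sub>F n in sequentially. ldet \<alpha> n \<le> C2 * real n - (1 - \<delta>) * (2 * \<alpha> / ?d) * (real n * ln (real n))"
    using ldet_upper[OF \<alpha>\<Theta> \<delta>] by blast
  obtain C3 where C3: "\<And>n \<nu>. 2 \<le> n \<Longrightarrow> \<nu> \<in> {\<nu>min..\<nu>max} \<Longrightarrow> - (2 * \<nu> / ?d) * (real n * ln (real n)) - C3 * real n \<le> ldet \<nu> n"
    using ldet_lower by blast
  have "filterlim (\<lambda>n. ln (real n)) at_top sequentially"
    by (rule filterlim_compose[OF ln_at_top filterlim_real_sequentially])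
  hence "\<forall>\<^sub>F n in sequentially. (C1 + C2 + C3) * ?d / \<eta> < ln (real n)" by (rule filterlim_at_top_dense[THEN iffD1, rule_format])
  with C2 eventually_ge_at_top[of 2] show ?thesis
  proof eventually_elim
    case (elim n)
    have am: "\<nu>hat n \<in> {\<nu>min..\<nu>max}" "neg_log_lik f (matern \<sigma> \<rho> c (\<nu>hat n)) x n \<le> neg_log_lik f (matern \<sigma> \<rho> c \<alpha>) x n"
      using argmin[of n] elim \<alpha>\<Theta> by (auto simp: is_arg_min_def not_less)
    show ?case
    proof (rule ccontr)
      assume "\<not> \<alpha> - \<eta> \<le> \<nu>hat n"
      hence lt: "\<nu>hat n \<le> \<alpha> - \<eta>" by simp
      define L where "L = real n * ln (real n)"
      have L: "0 \<le> L" using elim by (simp add: L_def)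
      have "- (2 * (\<alpha> - \<eta>) / ?d) * L - C3 * real n \<le> - (2 * \<nu>hat n / ?d) * L - C3 * real n"
        using lt L d by (intro diff_right_mono mult_right_mono) (auto simp: divide_right_mono)
      also have "\<dots> \<le> ldet (\<nu>hat n) n" unfolding L_def using C3[of n "\<nu>hat n"] elim am by simp
      also have "\<dots> \<le> neg_log_lik f (matern \<sigma> \<rho> c (\<nu>hat n)) x n"
        using neg_log_lik_eq[OF am(1), of n f] fit_nonneg[OF am(1), of n f] elim by simp
      also have "\<dots> \<le> fit f \<alpha> n + ldet \<alpha> n" using am(2) neg_log_lik_eq[OF \<alpha>\<Theta>, of n f] elim by simp
      also have "\<dots> \<le> C1 * real n + (C2 * real n - (1 - \<delta>) * (2 * \<alpha> / ?d) * L)"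
        using C1[of n] elim unfolding L_def by (intro add_mono) auto
      finally have "(2 * \<eta> / ?d - \<delta> * (2 * \<alpha> / ?d)) * L \<le> (C1 + C2 + C3) * real n" by (simp add: algebra_simps diff_divide_distrib)
      moreover have "2 * \<eta> / ?d - \<delta> * (2 * \<alpha> / ?d) = \<eta> / ?d" using \<alpha>0 by (simp add: \<delta>_def field_simps)
      ultimately have "real n * (\<eta> / ?d * ln (real n)) \<le> real n * (C1 + C2 + C3)" by (simp add: L_def mult_ac)
      hence "\<eta> / ?d * ln (real n) \<le> C1 + C2 + C3" using elim by (subst (asm) mult_le_cancel_left_pos) auto
      hence "ln (real n) \<le> (C1 + C2 + C3) * ?d / \<eta>" using \<eta> d by (simp add: field_simps)
      thus False using elim by linarith
    qed
  qed
qed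

end

section \<open>Functions with dense zeros\<close>

definition lattice_pt :: "real \<Rightarrow> ('a::euclidean_space \<Rightarrow> int) \<Rightarrow> 'a" where
  "lattice_pt r m = (\<Sum>b\<in>Basis. (r * of_int (m b)) *\<^sub>R b)"

lemma inner_lattice_pt: "b \<in> Basis \<Longrightarrow> inner (lattice_pt r m) b = r * of_int (m b)"
  unfolding lattice_pt_def by (simp add: inner_sum_left inner_Basis if_distrib cong: if_cong)

lemma norm_le_cube:
  fixes y :: "'a::euclidean_space"
  assumes "\<And>b. b \<in> Basis \<Longrightarrow> \<bar>inner y b\<bar> \<le> r"
  shows "norm y \<le> real DIM('a) * r"
  using order_trans[OF norm_le_l1 sum_mono[of Basis "\<lambda>b. \<bar>inner y b\<bar>" "\<lambda>_. r"]] assms by simp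

lemma measure_cube:
  fixes p :: "'a::euclidean_space"
  assumes r: "0 \<le> r"
  shows "measure lborel (box p (p + r *\<^sub>R One)) = r ^ DIM('a)"
    and "measure lborel (cbox p (p + r *\<^sub>R One)) = r ^ DIM('a)"
  using r by (simp_all add: measure_lborel_box_eq measure_lborel_cbox_eq inner_add_left inner_sum_left inner_Basis
      if_distrib cong: if_cong)

text \<open>Points attached to different cubes may be arbitrarily close, so there is no separation;
  the open cubes themselves are disjoint and feed the packing bound and the Schur test. For w \<le>
  r^2 the kernel is first increased to the one at scale r^2, which gives a constant independent of
  w. Extensionality ensures that distinct indices differ on a basis vector and hence name disjoint
  cubes.\<close>

lemma gauss_form_cubes:
  fixes p :: "('a::euclidean_space \<Rightarrow> int) \<Rightarrow> 'a"
  assumes r: "0 < r" and w: "0 < w" and fin: "finite I" and ext: "\<And>m. m \<in> I \<Longrightarrow> m \<in> extensional Basis"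
    and near: "\<And>m. m \<in> I \<Longrightarrow> norm (p m - lattice_pt r m) \<le> real DIM('a) * r"
  defines "d \<equiv> real DIM('a)"
  shows "gauss_form w p a I \<le> exp (d\<^sup>2 * r\<^sup>2 / w) * (8 * pi * w) powr (d / 2) / r ^ DIM('a) * (\<Sum>m\<in>I. (a m)\<^sup>2)"
    and "w \<le> r\<^sup>2 \<Longrightarrow> gauss_form w p a I \<le> exp (d\<^sup>2) * (8 * pi) powr (d / 2) * (\<Sum>m\<in>I. (a m)\<^sup>2)"
proof -
  let ?Q = "\<lambda>m. box (lattice_pt r m) (lattice_pt r m + r *\<^sub>R One)"
  have inQ: "r * of_int (m b) < inner y b \<and> inner y b < r * of_int (m b) + r" if "y \<in> ?Q m" "b \<in> Basis" for y m b
    using that by (simp add: box_def inner_add_left inner_lattice_pt)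
  have dis: "disjoint_family_on ?Q I"
  proof (unfold disjoint_family_on_def, intro ballI impI)
    fix m m' assume m: "m \<in> I" "m' \<in> I" "m \<noteq> m'"
    then obtain b where b: "b \<in> Basis" "m b \<noteq> m' b"
      using ext[OF m(1)] ext[OF m(2)] extensionalityI[of m Basis m'] by blast
    have *: False if lt: "k b < l b" and y: "y \<in> ?Q k" "y \<in> ?Q l" for k l :: "'a \<Rightarrow> int" and y
    proof -
      have "r * of_int (l b) < r * of_int (k b) + r"
        using inQ[OF y(1) b(1)] inQ[OF y(2) b(1)] by linarith
      also have "\<dots> = r * of_int (k b + 1)" by (simp add: algebra_simps)
      finally have "real_of_int (l b) < of_int (k b + 1)" using r by simp
      thus False using lt by linarith
    qed
    show "?Q m \<inter> ?Q m' = {}"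
    proof (rule ccontr)
      assume "?Q m \<inter> ?Q m' \<noteq> {}"
      then obtain y where y: "y \<in> ?Q m" "y \<in> ?Q m'" by blast
      from b(2) have "m b < m' b \<or> m' b < m b" by linarith
      thus False using *[OF _ y] *[OF _ y(2,1)] by blast
    qed
  qed
  have dist: "norm (y - p m) \<le> 2 * d * r" if "m \<in> I" "y \<in> ?Q m" for y m
  proof -
    have "norm (y - lattice_pt r m) \<le> real DIM('a) * r"
    proof (rule norm_le_cube)
      fix b :: 'a assume "b \<in> Basis"
      thus "\<bar>inner (y - lattice_pt r m) b\<bar> \<le> r"
        using inQ[OF that(2), of b] by (auto simp: inner_diff_left inner_lattice_pt)
    qed
    moreover have "norm (y - p m) \<le> norm (y - lattice_pt r m) + norm (p m - lattice_pt r m)"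
      by norm
    ultimately show ?thesis using near[OF that(1)] by (simp add: d_def)
  qed
  have row: "(\<Sum>m'\<in>I. exp (- (norm (z - p m'))\<^sup>2 / (4 * v))) \<le> exp (d\<^sup>2 * r\<^sup>2 / v) * (8 * pi * v) powr (d / 2) / r ^ DIM('a)"
    if v: "0 < v" for v z
  proof -
    have "(\<Sum>m'\<in>I. exp (- (norm (z - p m'))\<^sup>2 / (4 * v))) \<le> exp ((2 * d * r)\<^sup>2 / (4 * v)) * (8 * pi * v) powr (real DIM('a) / 2) / r ^ DIM('a)"
    proof (rule gaussian_packing_sum[where Q = ?Q])
      show "r ^ DIM('a) \<le> measure lborel (?Q m)" for m :: "'a \<Rightarrow> int"
        using measure_cube(1)[of r "lattice_pt r m"] r by simp
      show "emeasure lborel (?Q m) < \<infinity>" for m :: "'a \<Rightarrow> int" by (rule emeasure_lborel_box_finite)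
    qed (use r v fin dis dist in auto)
    thus ?thesis by (simp add: d_def power_mult_distrib)
  qed
  have schur: "gauss_form w p a I \<le> C * (\<Sum>m\<in>I. (a m)\<^sup>2)"
    if "\<And>m. m \<in> I \<Longrightarrow> (\<Sum>m'\<in>I. exp (- (norm (p m - p m'))\<^sup>2 / (4 * w))) \<le> C" for C
    unfolding gauss_form_def
    by (rule order_trans[OF abs_ge_self schur_test]) (use that in \<open>auto simp: norm_minus_commute\<close>)
  show "gauss_form w p a I \<le> exp (d\<^sup>2 * r\<^sup>2 / w) * (8 * pi * w) powr (d / 2) / r ^ DIM('a) * (\<Sum>m\<in>I. (a m)\<^sup>2)"
    by (rule schur[OF row[OF w]])
  assume wr: "w \<le> r\<^sup>2"
  have rr: "(r\<^sup>2) powr (d / 2) = r ^ DIM('a)"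
  proof -
    have "(r\<^sup>2) powr (d / 2) = (r powr 2) powr (d / 2)" using r by simp
    thus ?thesis unfolding powr_powr using r by (simp add: d_def powr_realpow)
  qed
  show "gauss_form w p a I \<le> exp (d\<^sup>2) * (8 * pi) powr (d / 2) * (\<Sum>m\<in>I. (a m)\<^sup>2)"
  proof (rule schur)
    fix m
    have "(\<Sum>m'\<in>I. exp (- (norm (p m - p m'))\<^sup>2 / (4 * w))) \<le> (\<Sum>m'\<in>I. exp (- (norm (p m - p m'))\<^sup>2 / (4 * r\<^sup>2)))"
      using w wr r by (intro sum_mono) (auto intro!: divide_left_mono)
    also have "\<dots> \<le> exp (d\<^sup>2 * r\<^sup>2 / r\<^sup>2) * (8 * pi * r\<^sup>2) powr (d / 2) / r ^ DIM('a)" using r by (intro row) auto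
    also have "(8 * pi * r\<^sup>2) powr (d / 2) = (8 * pi) powr (d / 2) * r ^ DIM('a)"
      using rr by (simp only: powr_mult)
    also have "exp (d\<^sup>2 * r\<^sup>2 / r\<^sup>2) * ((8 * pi) powr (d / 2) * r ^ DIM('a)) / r ^ DIM('a) = exp (d\<^sup>2) * (8 * pi) powr (d / 2)"
      using r by simp
    finally show "(\<Sum>m'\<in>I. exp (- (norm (p m - p m'))\<^sup>2 / (4 * w))) \<le> exp (d\<^sup>2) * (8 * pi) powr (d / 2)" .
  qed
qed

text \<open>The points are moved from z to y along segments. The derivative in t is linear in \<xi>,
  with coefficients that are again trigonometric sums, over the intermediate points. This trades the
  difference for a factor |\<xi>|^2 and sums to which the cube bounds still apply.\<close>

lemma trig_sum_diff_le:
  fixes y z :: "'i \<Rightarrow> 'a::euclidean_space" and \<xi> :: 'a and b :: "'i \<Rightarrow> real" and I :: "'i set"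
  defines "S \<equiv> \<lambda>t k. trig_sum (\<lambda>m. z m + t *\<^sub>R (y m - z m)) (\<lambda>m. b m * inner (y m - z m) k) I \<xi>"
  shows "(norm (trig_sum y b I \<xi> - trig_sum z b I \<xi>))\<^sup>2
    \<le> (norm \<xi>)\<^sup>2 * (LINT t|lborel. indicator {0..1} t * (\<Sum>k\<in>Basis. (norm (S t k))\<^sup>2))"
proof -
  define F where "F = (\<lambda>t. \<Sum>m\<in>I. complex_of_real (b m) * cis (inner (z m + t *\<^sub>R (y m - z m)) \<xi>))"
  define F' where "F' = (\<lambda>t. \<i> * (\<Sum>k\<in>Basis. complex_of_real (inner \<xi> k) * S t k))"
  have der: "(F has_vector_derivative F' t) (at t within {0..1})" for t
  proof -
    have "(F has_vector_derivative (\<Sum>m\<in>I. complex_of_real (b m) * (inner (y m - z m) \<xi> *\<^sub>R (\<i> * cis (inner (z m + t *\<^sub>R (y m - z m)) \<xi>))))) (at t within {0..1})"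
      unfolding F_def has_vector_derivative_def
      by (rule derivative_eq_intros refl ext)+ (simp add: scaleR_conv_of_real sum_distrib_left mult_ac)
    also have "(\<Sum>m\<in>I. complex_of_real (b m) * (inner (y m - z m) \<xi> *\<^sub>R (\<i> * cis (inner (z m + t *\<^sub>R (y m - z m)) \<xi>)))) = F' t"
    proof -
      have e: "inner (y m - z m) \<xi> = (\<Sum>k\<in>Basis. inner \<xi> k * inner (y m - z m) k)" for m
        by (subst euclidean_inner) (simp add: mult.commute)
      show ?thesis
        unfolding F'_def S_def trig_sum_def sum_distrib_left e scaleR_conv_of_real of_real_sum sum_distrib_right
        by (subst sum.swap) (intro sum.cong refl, simp add: mult_ac)
    qed
    finally show ?thesis .
  qed
  have contS: "continuous_on UNIV (\<lambda>t. S t k)" for k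
    unfolding S_def trig_sum_def by (intro continuous_intros)
  have contF': "continuous_on UNIV F'"
    unfolding F'_def by (intro continuous_intros contS)
  have Sm [measurable]: "(\<lambda>t. S t k) \<in> borel_measurable borel" for k
    by (rule borel_measurable_continuous_onI[OF contS])
  have F'm [measurable]: "F' \<in> borel_measurable borel"
    by (rule borel_measurable_continuous_onI[OF contF'])
  have ci: "integrable lborel (\<lambda>t. indicator {0..1} t *\<^sub>R g t)" if "continuous_on UNIV g" for g :: "real \<Rightarrow> real"
    using borel_integrable_atLeastAtMost'[OF continuous_on_subset[OF that, of "{0..1}"]] by (simp add: set_integrable_def)
  have "trig_sum y b I \<xi> - trig_sum z b I \<xi> = F 1 - F 0" by (simp add: F_def trig_sum_def)
  also have "\<dots> = (LINT t|lborel. indicator {0..1} t *\<^sub>R F' t)"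
    by (rule integral_FTC_atLeastAtMost[symmetric]) (auto intro: der continuous_on_subset[OF contF'])
  finally have "norm (trig_sum y b I \<xi> - trig_sum z b I \<xi>) \<le> (LINT t|lborel. norm (indicator {0..1} t *\<^sub>R F' t))"
    by (simp only: integral_norm_bound)
  \<comment> \<open>The indicator is doubled so that Cauchy-Schwarz in t can pair one copy with the
    derivative; the first copy has square integral 1.\<close>
  also have "\<dots> = (LINT t|lborel. (indicator {0..1::real} t :: real) * (indicator {0..1} t * norm (F' t)))"
    by (intro Bochner_Integration.integral_cong) (auto simp: indicator_def)
  finally have "(norm (trig_sum y b I \<xi> - trig_sum z b I \<xi>))\<^sup>2 \<le> (LINT t|lborel. (indicator {0..1} t :: real) * (indicator {0..1} t * norm (F' t)))\<^sup>2"
    by (intro power_mono) auto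
  also have "\<dots> \<le> (LINT t|lborel. (indicator {0..1::real} t :: real)\<^sup>2) * (LINT t|lborel. (indicator {0..1} t * norm (F' t))\<^sup>2)"
  proof (rule integral_Cauchy_Schwarz)
    show "integrable lborel (\<lambda>t. (indicator {0..1} t * norm (F' t))\<^sup>2)"
      using ci[of "\<lambda>t. (norm (F' t))\<^sup>2"] contF' by (simp add: power_mult_distrib power2_eq_square[of "indicator _ _"] indicator_inter_arith[symmetric] continuous_intros)
  qed (auto simp: power2_eq_square indicator_inter_arith[symmetric])
  also have "(LINT t|lborel. (indicator {0..1::real} t :: real)\<^sup>2) = 1"
    by (simp add: power2_eq_square indicator_inter_arith[symmetric])
  also have "1 * (LINT t|lborel. (indicator {0..1} t * norm (F' t))\<^sup>2) \<le> (LINT t|lborel. (norm \<xi>)\<^sup>2 * (indicator {0..1} t * (\<Sum>k\<in>Basis. (norm (S t k))\<^sup>2)))"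
    unfolding mult_1
  proof (rule integral_mono)
    show "integrable lborel (\<lambda>t. (indicator {0..1} t * norm (F' t))\<^sup>2)"
      using ci[of "\<lambda>t. (norm (F' t))\<^sup>2"] contF' by (simp add: power_mult_distrib power2_eq_square[of "indicator _ _"] indicator_inter_arith[symmetric] continuous_intros)
    show "integrable lborel (\<lambda>t. (norm \<xi>)\<^sup>2 * (indicator {0..1} t * (\<Sum>k\<in>Basis. (norm (S t k))\<^sup>2)))"
      using ci[of "\<lambda>t. \<Sum>k\<in>Basis. (norm (S t k))\<^sup>2"] contS by (simp add: continuous_intros)
    fix t :: real
    have "norm (F' t) \<le> (\<Sum>k\<in>Basis. \<bar>inner \<xi> k\<bar> * norm (S t k))"
      unfolding F'_def by (simp add: norm_mult) (rule order_trans[OF norm_sum], simp add: norm_mult)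
    hence "(norm (F' t))\<^sup>2 \<le> (\<Sum>k\<in>Basis. \<bar>inner \<xi> k\<bar> * norm (S t k))\<^sup>2" by (intro power_mono) auto
    also have "\<dots> \<le> (\<Sum>k\<in>Basis. \<bar>inner \<xi> k\<bar>\<^sup>2) * (\<Sum>k\<in>Basis. (norm (S t k))\<^sup>2)"
      by (rule Cauchy_Schwarz_ineq_sum)
    also have "(\<Sum>k\<in>Basis. \<bar>inner \<xi> k\<bar>\<^sup>2) = (norm \<xi>)\<^sup>2"
      unfolding power2_norm_eq_inner by (subst euclidean_inner) (simp add: power2_eq_square)
    finally show "(indicator {0..1} t * norm (F' t))\<^sup>2 \<le> (norm \<xi>)\<^sup>2 * (indicator {0..1} t * (\<Sum>k\<in>Basis. (norm (S t k))\<^sup>2))"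
      by (auto simp: indicator_def)
  qed
  also have "\<dots> = (norm \<xi>)\<^sup>2 * (LINT t|lborel. indicator {0..1} t * (\<Sum>k\<in>Basis. (norm (S t k))\<^sup>2))" by simp
  finally show ?thesis .
qed

text \<open>The signed measure with mass b at y and -b at z, indexed by a sum type; results for a
  single trigonometric sum then apply to differences.\<close>

lemma trig_sum_diff_Plus:
  assumes "finite I"
  shows "trig_sum y b I \<xi> - trig_sum z b I \<xi> = trig_sum (case_sum y z) (case_sum b (\<lambda>m. - b m)) (I <+> I) \<xi>"
  using assms by (simp add: trig_sum_def sum.Plus o_def sum_negf)

lemma integrable_gauss_trig_diff:
  fixes y z :: "'i \<Rightarrow> 'a::euclidean_space"
  assumes "finite I" "0 < w"
  shows "integrable lborel (\<lambda>\<xi>. exp (- w * (norm \<xi>)\<^sup>2) * (norm (trig_sum y b I \<xi> - trig_sum z b I \<xi>))\<^sup>2)"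
  unfolding trig_sum_diff_Plus[OF assms(1)] by (rule gaussian_trig_sum(1)[OF assms(2)])

text \<open>Half of the Gaussian absorbs the factor |\<xi>|^2 at the price 2/w, the other half is a
  Gaussian form at scale w/2 over the intermediate points. The net gain is D^2/w, which is small for
  w far above D^2.\<close>

lemma gauss_trig_diff_near:
  fixes y z :: "'i \<Rightarrow> 'a::euclidean_space"
  assumes fin: "finite I" and w: "0 < w" and D: "\<And>m. m \<in> I \<Longrightarrow> norm (y m - z m) \<le> D"
    and K: "\<And>t a. 0 \<le> t \<Longrightarrow> t \<le> 1 \<Longrightarrow> gauss_form (w / 2) (\<lambda>m. z m + t *\<^sub>R (y m - z m)) a I \<le> K * (\<Sum>m\<in>I. (a m)\<^sup>2)"
    and K0: "0 \<le> K"
  shows "(LINT \<xi>|lborel. exp (- w * (norm \<xi>)\<^sup>2) * (norm (trig_sum y b I \<xi> - trig_sum z b I \<xi>))\<^sup>2)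
    \<le> 2 / w * ((2 * pi / w) powr (real DIM('a) / 2) * (K * (D\<^sup>2 * (\<Sum>m\<in>I. (b m)\<^sup>2))))"
proof -
  let ?d = "real DIM('a) / 2"
  define S where "S = (\<lambda>t k. trig_sum (\<lambda>m. z m + t *\<^sub>R (y m - z m)) (\<lambda>m. b m * inner (y m - z m) k) I)"
  define f where "f = (\<lambda>(t::real) \<xi>. indicator {0..1} t * (\<Sum>k\<in>Basis. exp (- (w / 2) * (norm \<xi>)\<^sup>2) * (norm (S t k \<xi>))\<^sup>2))"
  define G where "G = (\<lambda>t. \<Sum>k\<in>Basis. gauss_form (w / 2) (\<lambda>m. z m + t *\<^sub>R (y m - z m)) (\<lambda>m. b m * inner (y m - z m) k) I)"
  have i1: "integrable lborel (f t)" for t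
    unfolding f_def S_def using gaussian_trig_sum(1)[of "w / 2"] w
    by (intro integrable_mult_right Bochner_Integration.integrable_sum) auto
  have I1: "(LINT \<xi>|lborel. f t \<xi>) = (2 * pi / w) powr ?d * (indicator {0..1} t * G t)" for t
  proof -
    have "(LINT \<xi>|lborel. f t \<xi>) = indicator {0..1} t * (\<Sum>k\<in>Basis. (pi / (w / 2)) powr ?d * gauss_form (w / 2) (\<lambda>m. z m + t *\<^sub>R (y m - z m)) (\<lambda>m. b m * inner (y m - z m) k) I)"
    proof -
      have w2: "0 < w / 2" using w by simp
      show ?thesis unfolding f_def S_def integral_mult_right_zero
        by (subst Bochner_Integration.integral_sum, rule gaussian_trig_sum(1)[OF w2]) (simp only: gaussian_trig_sum(2)[OF w2])
    qed
    also have "\<dots> = (2 * pi / w) powr ?d * (indicator {0..1} t * G t)"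
      unfolding G_def sum_distrib_left[symmetric] by (simp add: mult_ac)
    finally show ?thesis .
  qed
  have contG: "continuous_on {0..1} G" unfolding G_def gauss_form_def using w by (intro continuous_intros) auto
  have iG: "integrable lborel (\<lambda>t. indicator {0..1} t * G t)"
    using borel_integrable_atLeastAtMost'[OF contG] by (simp add: set_integrable_def)
  have i2: "integrable lborel (\<lambda>t. LINT \<xi>|lborel. f t \<xi>)"
    unfolding I1 by (intro integrable_mult_right iG)
  have Sm: "(\<lambda>x. S (fst x) k (snd x)) \<in> borel_measurable (lborel \<Otimes>\<^sub>M lborel)" for k
    unfolding S_def trig_sum_def by measurable
  have m: "(\<lambda>(t, \<xi>). f t \<xi>) \<in> borel_measurable (lborel \<Otimes>\<^sub>M lborel)"
    unfolding f_def split_beta' using Sm by measurable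
  have nn: "0 \<le> f t \<xi>" for t \<xi> unfolding f_def by (intro mult_nonneg_nonneg sum_nonneg) auto
  note T = tonelli_real[OF m nn i1 i2]
  have Gle: "indicator {0..1} t * G t \<le> indicator {0..1} t * (K * (D\<^sup>2 * (\<Sum>m\<in>I. (b m)\<^sup>2)))" for t :: real
  proof (cases "t \<in> {0..1}")
    case True
    have "G t \<le> (\<Sum>k\<in>Basis. K * (\<Sum>m\<in>I. (b m * inner (y m - z m) k)\<^sup>2))"
      unfolding G_def using True by (intro sum_mono K) auto
    also have "\<dots> = K * (\<Sum>m\<in>I. (b m)\<^sup>2 * (\<Sum>k\<in>Basis. (inner (y m - z m) k)\<^sup>2))"
      unfolding sum_distrib_left[symmetric] by (subst sum.swap) (simp add: power_mult_distrib sum_distrib_left)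
    also have "\<dots> = K * (\<Sum>m\<in>I. (b m)\<^sup>2 * (norm (y m - z m))\<^sup>2)"
    proof -
      have "(\<Sum>k\<in>Basis. (inner v k)\<^sup>2) = (norm v)\<^sup>2" for v :: 'a
        unfolding power2_norm_eq_inner by (subst euclidean_inner) (simp add: power2_eq_square)
      thus ?thesis by simp
    qed
    also have "\<dots> \<le> K * (\<Sum>m\<in>I. (b m)\<^sup>2 * D\<^sup>2)"
      by (intro mult_left_mono sum_mono K0 power_mono D) auto
    finally show ?thesis using True by (simp add: sum_distrib_left sum_distrib_right mult_ac)
  qed simp
  have "(LINT \<xi>|lborel. exp (- w * (norm \<xi>)\<^sup>2) * (norm (trig_sum y b I \<xi> - trig_sum z b I \<xi>))\<^sup>2)
     \<le> (LINT \<xi>|lborel. 2 / w * (LINT t|lborel. f t \<xi>))"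
  proof (rule integral_mono[OF integrable_gauss_trig_diff[OF fin w]])
    show "integrable lborel (\<lambda>\<xi>. 2 / w * (LINT t|lborel. f t \<xi>))" by (intro integrable_mult_right T)
    fix \<xi> :: 'a
    have "w / 2 * (norm \<xi>)\<^sup>2 \<le> exp (w / 2 * (norm \<xi>)\<^sup>2)" using exp_ge_add_one_self[of "w / 2 * (norm \<xi>)\<^sup>2"] by linarith
    hence "exp (- w * (norm \<xi>)\<^sup>2) * (w / 2 * (norm \<xi>)\<^sup>2) \<le> exp (- w * (norm \<xi>)\<^sup>2) * exp (w / 2 * (norm \<xi>)\<^sup>2)" by (intro mult_left_mono) auto
    also have "\<dots> = exp (- (w / 2) * (norm \<xi>)\<^sup>2)" by (simp add: exp_add[symmetric] field_simps)
    finally have e: "exp (- w * (norm \<xi>)\<^sup>2) * (norm \<xi>)\<^sup>2 \<le> 2 / w * exp (- (w / 2) * (norm \<xi>)\<^sup>2)" using w by (simp add: field_simps)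
    define X where "X = (LINT t|lborel. indicator {0..1} t * (\<Sum>k\<in>Basis. (norm (S t k \<xi>))\<^sup>2))"
    have X: "0 \<le> X" unfolding X_def by (intro integral_nonneg_AE) (auto intro!: AE_I2 mult_nonneg_nonneg sum_nonneg)
    have "exp (- w * (norm \<xi>)\<^sup>2) * (norm (trig_sum y b I \<xi> - trig_sum z b I \<xi>))\<^sup>2 \<le> exp (- w * (norm \<xi>)\<^sup>2) * ((norm \<xi>)\<^sup>2 * X)"
      unfolding X_def S_def by (intro mult_left_mono trig_sum_diff_le) auto
    also have "\<dots> \<le> 2 / w * exp (- (w / 2) * (norm \<xi>)\<^sup>2) * X"
      using mult_right_mono[OF e X] by (simp add: mult.assoc)
    also have "\<dots> = 2 / w * (LINT t|lborel. exp (- (w / 2) * (norm \<xi>)\<^sup>2) * (indicator {0..1} t * (\<Sum>k\<in>Basis. (norm (S t k \<xi>))\<^sup>2)))"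
      unfolding X_def by simp
    also have "(\<lambda>t. exp (- (w / 2) * (norm \<xi>)\<^sup>2) * (indicator {0..1} t * (\<Sum>k\<in>Basis. (norm (S t k \<xi>))\<^sup>2))) = (\<lambda>t. f t \<xi>)"
      unfolding f_def sum_distrib_left[symmetric] by (simp add: mult_ac)
    finally show "exp (- w * (norm \<xi>)\<^sup>2) * (norm (trig_sum y b I \<xi> - trig_sum z b I \<xi>))\<^sup>2 \<le> 2 / w * (LINT t|lborel. f t \<xi>)" .
  qed
  also have "\<dots> = 2 / w * (LINT \<xi>|lborel. LINT t|lborel. f t \<xi>)" by simp
  also have "(LINT \<xi>|lborel. LINT t|lborel. f t \<xi>) = (2 * pi / w) powr ?d * (LINT t|lborel. indicator {0..1} t * G t)"
    unfolding T(3) I1 by simp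
  also have "2 / w * ((2 * pi / w) powr ?d * (LINT t|lborel. indicator {0..1} t * G t))
      \<le> 2 / w * ((2 * pi / w) powr ?d * (LINT t|lborel. indicator {0..1::real} t * (K * (D\<^sup>2 * (\<Sum>m\<in>I. (b m)\<^sup>2)))))"
    using w by (intro mult_left_mono integral_mono[OF iG _ Gle] integrable_mult_left integrable_real_indicator) auto
  finally show ?thesis by simp
qed

text \<open>A spectral weight of the type of spec at high frequencies, whose inverse is still small, namely
  at most of the order of zero_weight, for frequencies below 1/r.  This smallness is what allows the
  low frequencies to be absorbed later on.\<close>

definition zero_mix :: "real \<Rightarrow> real \<Rightarrow> real" where
  "zero_mix \<alpha> \<tau> = (if \<tau> \<le> 0 then exp (\<alpha> * \<tau>) else exp (\<tau> / 4))"

text \<open>At \<xi> = 0 the mixture diverges; the value 1 keeps the weight positive everywhere, as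
  \<open>sample_duality\<close> demands, and changes it on a null set only.\<close>

definition zero_spec :: "real \<Rightarrow> real \<Rightarrow> 'a::euclidean_space \<Rightarrow> real" where
  "zero_spec \<alpha> r \<xi> = (if \<xi> = 0 then 1 else (LINT \<tau>|lborel. zero_mix \<alpha> \<tau> * exp (- exp \<tau> * (r * norm \<xi>)\<^sup>2)))"

definition zero_weight :: "real \<Rightarrow> real \<Rightarrow> real" where
  "zero_weight \<alpha> \<eta> = (if \<eta> \<le> 1 then \<eta> powr (1 / 2) else \<eta> powr (2 * \<alpha>))"

lemma zero_mix_measurable [measurable]: "zero_mix \<alpha> \<in> borel_measurable borel"
  unfolding zero_mix_def by measurable

lemma zero_mix_pos: "0 < zero_mix \<alpha> \<tau>" by (simp add: zero_mix_def)

lemma zero_spec_measurable [measurable]: "zero_spec \<alpha> r \<in> borel_measurable borel"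
  unfolding zero_spec_def by measurable

lemma integrable_zero_spec:
  assumes \<alpha>: "0 < \<alpha>" and s: "0 < s"
  shows "integrable lborel (\<lambda>\<tau>. zero_mix \<alpha> \<tau> * exp (- exp \<tau> * s\<^sup>2))"
proof (rule Bochner_Integration.integrable_bound)
  show "integrable lborel (\<lambda>\<tau>. indicator {..0} \<tau> * exp (\<alpha> * \<tau>) + mix (1 / 4) (s\<^sup>2) \<tau>)"
    using has_bochner_integral_exp_atMost[OF \<alpha>, of 0] s
    by (intro Bochner_Integration.integrable_add integrable_mix) (auto simp: has_bochner_integral_iff)
  show "AE \<tau> in lborel. norm (zero_mix \<alpha> \<tau> * exp (- exp \<tau> * s\<^sup>2)) \<le> norm (indicator {..0} \<tau> * exp (\<alpha> * \<tau>) + mix (1 / 4) (s\<^sup>2) \<tau>)"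
  proof (rule AE_I2)
    fix \<tau> :: real
    show "norm (zero_mix \<alpha> \<tau> * exp (- exp \<tau> * s\<^sup>2)) \<le> norm (indicator {..0} \<tau> * exp (\<alpha> * \<tau>) + mix (1 / 4) (s\<^sup>2) \<tau>)"
    proof (cases "\<tau> \<le> 0")
      case True
      hence "zero_mix \<alpha> \<tau> * exp (- exp \<tau> * s\<^sup>2) \<le> exp (\<alpha> * \<tau>)" by (simp add: zero_mix_def)
      thus ?thesis using True mix_nonneg[of "1/4" "s\<^sup>2" \<tau>] zero_mix_pos[of \<alpha> \<tau>] by simp
    next
      case False
      thus ?thesis by (simp add: zero_mix_def mix_def exp_add[symmetric] mult.commute)
    qed
  qed
qed measurable

text \<open>Only a window of logarithmic scales of length one next to \<tau>0 is kept, where exp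
  \<tau> times (r |\<xi>|)^2 is about 1. It lies above \<tau>0 when r |\<xi>| \<le> 1 and below
  \<tau>0 otherwise, so the relevant branch of \<open>zero_mix\<close> applies. The losses exp(-3)
  and exp(-1-\<alpha>) are both covered by exp(3+\<alpha>).\<close>

lemma zero_spec_lower:
  assumes \<alpha>: "0 < \<alpha>" and r: "0 < r" and \<xi>: "\<xi> \<noteq> 0"
  shows "1 \<le> exp (3 + \<alpha>) * zero_weight \<alpha> (r * norm \<xi>) * zero_spec \<alpha> r \<xi>"
proof -
  define \<eta> where "\<eta> = r * norm \<xi>"
  have \<eta>: "0 < \<eta>" using r \<xi> by (simp add: \<eta>_def)
  define \<tau>0 where "\<tau>0 = - 2 * ln \<eta>"
  have e\<tau>0: "exp \<tau>0 * \<eta>\<^sup>2 = 1"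
  proof -
    have "\<tau>0 = - ln (\<eta>\<^sup>2)" unfolding \<tau>0_def using \<eta> by (simp add: ln_realpow)
    thus ?thesis using \<eta> by (simp add: exp_minus)
  qed
  have low: "v \<le> zero_spec \<alpha> r \<xi>"
    if v: "\<And>\<tau>. l \<le> \<tau> \<Longrightarrow> \<tau> \<le> l + 1 \<Longrightarrow> v \<le> zero_mix \<alpha> \<tau> * exp (- exp \<tau> * \<eta>\<^sup>2)" and "0 \<le> v" for v l
  proof -
    have "v = (LINT \<tau>|lborel. indicator {l..l + 1} \<tau> * v)" by simp
    also have "\<dots> \<le> (LINT \<tau>|lborel. zero_mix \<alpha> \<tau> * exp (- exp \<tau> * \<eta>\<^sup>2))"
    proof (rule integral_mono[OF _ integrable_zero_spec[OF \<alpha> \<eta>]])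
      show "indicator {l..l + 1} \<tau> * v \<le> zero_mix \<alpha> \<tau> * exp (- exp \<tau> * \<eta>\<^sup>2)" for \<tau>
        using v[of \<tau>] zero_mix_pos[of \<alpha> \<tau>] by (cases "\<tau> \<in> {l..l + 1}") (auto simp: less_imp_le)
    qed (intro integrable_mult_left integrable_real_indicator, auto)
    finally show ?thesis using \<xi> by (simp add: zero_spec_def \<eta>_def)
  qed
  show ?thesis
  proof (cases "\<eta> \<le> 1")
    case True
    hence t0: "0 \<le> \<tau>0" using \<eta> by (simp add: \<tau>0_def)
    have "exp (- 3) * \<eta> powr (- 1 / 2) \<le> zero_spec \<alpha> r \<xi>"
    proof (rule low)
      fix \<tau> assume \<tau>: "\<tau>0 \<le> \<tau>" "\<tau> \<le> \<tau>0 + 1"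
      have "exp \<tau> * \<eta>\<^sup>2 \<le> exp (\<tau>0 + 1) * \<eta>\<^sup>2" using \<tau> by (intro mult_right_mono) auto
      also have "\<dots> = exp 1" using e\<tau>0 by (simp add: exp_add mult_ac)
      also have "\<dots> \<le> 3" by (rule exp_le)
      finally have 1: "exp (- 3) \<le> exp (- exp \<tau> * \<eta>\<^sup>2)" by simp
      have "\<eta> powr (- 1 / 2) = exp (\<tau>0 / 4)" using \<eta> by (simp add: powr_def \<tau>0_def)
      also have "\<dots> \<le> zero_mix \<alpha> \<tau>"
      proof (cases "\<tau> \<le> 0")
        case True
        hence "\<tau> = 0" "\<tau>0 = 0" using \<tau> t0 by auto
        thus ?thesis by (simp add: zero_mix_def)
      qed (use \<tau> in \<open>simp add: zero_mix_def\<close>)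
      finally have 2: "\<eta> powr (- 1 / 2) \<le> zero_mix \<alpha> \<tau>" .
      have "exp (- 3) * \<eta> powr (- 1 / 2) \<le> exp (- exp \<tau> * \<eta>\<^sup>2) * zero_mix \<alpha> \<tau>"
        using 1 2 by (intro mult_mono) auto
      thus "exp (- 3) * \<eta> powr (- 1 / 2) \<le> zero_mix \<alpha> \<tau> * exp (- exp \<tau> * \<eta>\<^sup>2)" by (simp only: mult.commute)
    qed simp
    hence "exp (3 + \<alpha>) * \<eta> powr (1 / 2) * (exp (- 3) * \<eta> powr (- 1 / 2)) \<le> exp (3 + \<alpha>) * zero_weight \<alpha> \<eta> * zero_spec \<alpha> r \<xi>"
      using True by (intro mult_mono) (auto simp: zero_weight_def)
    moreover have "exp (3 + \<alpha>) * \<eta> powr (1 / 2) * (exp (- 3) * \<eta> powr (- 1 / 2)) = exp \<alpha>"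
    proof -
      have "\<eta> powr (1 / 2) * \<eta> powr (- 1 / 2) = 1" unfolding powr_add[symmetric] using \<eta> by simp
      moreover have "exp (3 + \<alpha>) * exp (- 3) = exp \<alpha>" by (simp add: exp_add[symmetric])
      ultimately show ?thesis by (metis (no_types, opaque_lifting) mult.assoc mult.commute mult.right_neutral)
    qed
    moreover have "1 \<le> exp \<alpha>" using \<alpha> by simp
    ultimately show ?thesis unfolding \<eta>_def by linarith
  next
    case False
    hence t0: "\<tau>0 \<le> 0" using \<eta> by (simp add: \<tau>0_def)
    have "exp (- 1) * (exp (- \<alpha>) * \<eta> powr (- 2 * \<alpha>)) \<le> zero_spec \<alpha> r \<xi>"
    proof (rule low)
      fix \<tau> assume \<tau>: "\<tau>0 - 1 \<le> \<tau>" "\<tau> \<le> \<tau>0 - 1 + 1"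
      have "exp \<tau> * \<eta>\<^sup>2 \<le> exp \<tau>0 * \<eta>\<^sup>2" using \<tau> by (intro mult_right_mono) auto
      hence 1: "exp (- 1) \<le> exp (- exp \<tau> * \<eta>\<^sup>2)" using e\<tau>0 by simp
      have "exp (- \<alpha>) * \<eta> powr (- 2 * \<alpha>) = exp (\<alpha> * (\<tau>0 - 1))" using \<eta> by (simp add: powr_def \<tau>0_def exp_add[symmetric] algebra_simps)
      also have "\<dots> \<le> zero_mix \<alpha> \<tau>" using \<tau> t0 \<alpha> by (auto simp: zero_mix_def)
      finally have 2: "exp (- \<alpha>) * \<eta> powr (- 2 * \<alpha>) \<le> zero_mix \<alpha> \<tau>" .
      have "exp (- 1) * (exp (- \<alpha>) * \<eta> powr (- 2 * \<alpha>)) \<le> exp (- exp \<tau> * \<eta>\<^sup>2) * zero_mix \<alpha> \<tau>"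
        using 1 2 by (intro mult_mono) auto
      thus "exp (- 1) * (exp (- \<alpha>) * \<eta> powr (- 2 * \<alpha>)) \<le> zero_mix \<alpha> \<tau> * exp (- exp \<tau> * \<eta>\<^sup>2)" by (simp only: mult.commute)
    qed simp
    hence "exp (3 + \<alpha>) * \<eta> powr (2 * \<alpha>) * (exp (- 1) * (exp (- \<alpha>) * \<eta> powr (- 2 * \<alpha>))) \<le> exp (3 + \<alpha>) * zero_weight \<alpha> \<eta> * zero_spec \<alpha> r \<xi>"
      using False by (intro mult_mono) (auto simp: zero_weight_def)
    moreover have "exp (3 + \<alpha>) * \<eta> powr (2 * \<alpha>) * (exp (- 1) * (exp (- \<alpha>) * \<eta> powr (- 2 * \<alpha>))) = exp 2"
    proof -
      have "\<eta> powr (2 * \<alpha>) * \<eta> powr (- 2 * \<alpha>) = 1" unfolding powr_add[symmetric] using \<eta> by simp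
      moreover have "exp (3 + \<alpha>) * (exp (- 1) * exp (- \<alpha>)) = exp 2" by (simp add: exp_add[symmetric])
      ultimately show ?thesis by (metis (no_types, opaque_lifting) mult.assoc mult.commute mult.right_neutral)
    qed
    moreover have "(1::real) \<le> exp 2" by simp
    ultimately show ?thesis unfolding \<eta>_def by linarith
  qed
qed

lemma zero_weight_nonneg: "0 \<le> zero_weight \<alpha> \<eta>" by (simp add: zero_weight_def)

lemma zero_spec_pos:
  assumes "0 < \<alpha>" "0 < r" shows "0 < zero_spec \<alpha> r \<xi>"
proof (cases "\<xi> = 0")
  case False
  have "0 \<le> exp (3 + \<alpha>) * zero_weight \<alpha> (r * norm \<xi>)" by (simp add: zero_weight_nonneg)
  thus ?thesis using zero_spec_lower[OF assms False]
    by (smt (verit) mult_nonneg_nonpos)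
qed (simp add: zero_spec_def)

text \<open>Integration over the scales w = r^2 exp \<tau>. For \<tau> \<le> 0 the two sums are
  estimated separately and give exp(-d \<tau>/2), integrable against exp(\<alpha> \<tau>) because
  \<alpha> > d/2. For \<tau> \<ge> 0 the pairing of y with a nearby z gains exp(-\<tau>). The
  constant depends on neither the points nor r, apart from the displayed power.\<close>

lemma zero_weight_trig:
  fixes y z :: "('a::euclidean_space \<Rightarrow> int) \<Rightarrow> 'a"
  assumes \<alpha>: "real DIM('a) / 2 < \<alpha>"
  defines "d \<equiv> real DIM('a)"
  shows "\<exists>C>0. \<forall>r I y z b. 0 < r \<longrightarrow> finite I \<longrightarrow> I \<subseteq> extensional Basis \<longrightarrow>
     (\<forall>m\<in>I. norm (y m - lattice_pt r m) \<le> d * r \<and> norm (z m - lattice_pt r m) \<le> d * r) \<longrightarrow>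
     integrable lborel (\<lambda>\<xi>::'a. zero_spec \<alpha> r \<xi> * (norm (trig_sum y b I \<xi> - trig_sum z b I \<xi>))\<^sup>2) \<and>
     (LINT \<xi>|lborel. zero_spec \<alpha> r \<xi> * (norm (trig_sum y b I \<xi> - trig_sum z b I \<xi>))\<^sup>2) \<le> C / r ^ DIM('a) * (\<Sum>m\<in>I. (b m)\<^sup>2)"
proof -
  have d1: "1 \<le> d" unfolding d_def by (simp add: Suc_leI)
  define C1 where "C1 = 4 * pi powr (d / 2) * (exp (d\<^sup>2) * (8 * pi) powr (d / 2))"
  define C2 where "C2 = 8 * d\<^sup>2 * (8 * pi\<^sup>2) powr (d / 2) * exp (2 * d\<^sup>2)"
  have C1: "0 < C1" unfolding C1_def by simp
  have C2: "0 < C2" unfolding C2_def using d1 by simp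
  define C where "C = C1 / (\<alpha> - d / 2) + C2 / (3 / 4)"
  have C: "0 < C" unfolding C_def using C1 C2 \<alpha> by (intro add_pos_pos divide_pos_pos) (auto simp: d_def)
  have \<alpha>0: "0 < \<alpha>" using \<alpha> d1 unfolding d_def by linarith
  show ?thesis
  proof (rule exI[of _ C], rule conjI[OF C], intro allI impI)
    fix r :: real and I :: "('a \<Rightarrow> int) set" and y z :: "('a \<Rightarrow> int) \<Rightarrow> 'a" and b :: "('a \<Rightarrow> int) \<Rightarrow> real"
    assume r: "0 < r" and fin: "finite I" and ext: "I \<subseteq> extensional Basis"
      and near: "\<forall>m\<in>I. norm (y m - lattice_pt r m) \<le> d * r \<and> norm (z m - lattice_pt r m) \<le> d * r"
    define B where "B = (\<Sum>m\<in>I. (b m)\<^sup>2)"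
    have B: "0 \<le> B" unfolding B_def by (intro sum_nonneg) auto
    define R where "R = r ^ DIM('a)"
    have R: "0 < R" unfolding R_def using r by simp
    have Rp: "(r\<^sup>2) powr (d / 2) = R"
    proof -
      have "(r\<^sup>2) powr (d / 2) = (r powr 2) powr (d / 2)" using r by simp
      thus ?thesis unfolding powr_powr using r by (simp add: d_def R_def powr_realpow)
    qed
    define T where "T = (\<lambda>\<xi>. (norm (trig_sum y b I \<xi> - trig_sum z b I \<xi>))\<^sup>2)"
    have Tm [measurable]: "T \<in> borel_measurable borel" unfolding T_def by measurable
    define J where "J = (\<lambda>\<tau>. LINT \<xi>|lborel. exp (- (r\<^sup>2 * exp \<tau>) * (norm \<xi>)\<^sup>2) * T \<xi>)"
    have wpos: "0 < r\<^sup>2 * exp \<tau>" for \<tau> using r by simp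
    have iJ: "integrable lborel (\<lambda>\<xi>. exp (- (r\<^sup>2 * exp \<tau>) * (norm \<xi>)\<^sup>2) * T \<xi>)" for \<tau>
      unfolding T_def by (rule integrable_gauss_trig_diff[OF fin wpos])
    have J0: "0 \<le> J \<tau>" for \<tau> unfolding J_def T_def by (intro integral_nonneg_AE) auto
    have Jm [measurable]: "J \<in> borel_measurable borel" unfolding J_def by measurable
    have nearI: "norm (p m - lattice_pt r m) \<le> real DIM('a) * r"
      if "m \<in> I" "p = y \<or> p = z" for m p using near that by (auto simp: d_def)
    \<comment> \<open>Scales w \<le> r^2: the form is bounded independently of w, so only the factor
      (\<pi>/w)^(d/2) remains.\<close>
    have J1: "J \<tau> \<le> C1 / R * B * exp (- (d / 2) * \<tau>)" if \<tau>: "\<tau> \<le> 0" for \<tau>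
    proof -
      define w where "w = r\<^sup>2 * exp \<tau>"
      have w: "0 < w" "w \<le> r\<^sup>2" unfolding w_def using r \<tau> by (auto simp: mult_left_le)
      have "J \<tau> \<le> (LINT \<xi>|lborel. 2 * (exp (- w * (norm \<xi>)\<^sup>2) * (norm (trig_sum y b I \<xi>))\<^sup>2) + 2 * (exp (- w * (norm \<xi>)\<^sup>2) * (norm (trig_sum z b I \<xi>))\<^sup>2))"
        unfolding J_def w_def[symmetric]
      proof (rule integral_mono)
        show "integrable lborel (\<lambda>\<xi>. exp (- w * (norm \<xi>)\<^sup>2) * T \<xi>)" unfolding w_def by (rule iJ)
        show "integrable lborel (\<lambda>\<xi>. 2 * (exp (- w * (norm \<xi>)\<^sup>2) * (norm (trig_sum y b I \<xi>))\<^sup>2) + 2 * (exp (- w * (norm \<xi>)\<^sup>2) * (norm (trig_sum z b I \<xi>))\<^sup>2))"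
          by (intro Bochner_Integration.integrable_add integrable_mult_right gaussian_trig_sum w)
        fix \<xi> :: 'a
        have "T \<xi> \<le> (norm (trig_sum y b I \<xi>) + norm (trig_sum z b I \<xi>))\<^sup>2"
          unfolding T_def by (intro power_mono norm_triangle_ineq4) auto
        also have "\<dots> \<le> 2 * (norm (trig_sum y b I \<xi>))\<^sup>2 + 2 * (norm (trig_sum z b I \<xi>))\<^sup>2"
          using sum_squares_bound[of "norm (trig_sum y b I \<xi>)" "norm (trig_sum z b I \<xi>)"] by (simp add: power2_sum)
        finally have "exp (- w * (norm \<xi>)\<^sup>2) * T \<xi> \<le> exp (- w * (norm \<xi>)\<^sup>2) * (2 * (norm (trig_sum y b I \<xi>))\<^sup>2 + 2 * (norm (trig_sum z b I \<xi>))\<^sup>2)"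
          by (intro mult_left_mono) auto
        thus "exp (- w * (norm \<xi>)\<^sup>2) * T \<xi> \<le> 2 * (exp (- w * (norm \<xi>)\<^sup>2) * (norm (trig_sum y b I \<xi>))\<^sup>2) + 2 * (exp (- w * (norm \<xi>)\<^sup>2) * (norm (trig_sum z b I \<xi>))\<^sup>2)"
          by (simp add: distrib_left mult.left_commute)
      qed
      also have "\<dots> = 2 * ((pi / w) powr (d / 2) * gauss_form w y b I) + 2 * ((pi / w) powr (d / 2) * gauss_form w z b I)"
        unfolding d_def using gaussian_trig_sum[OF w(1), of y b I] gaussian_trig_sum[OF w(1), of z b I] by simp
      also have "\<dots> \<le> 2 * ((pi / w) powr (d / 2) * (exp (d\<^sup>2) * (8 * pi) powr (d / 2) * B)) + 2 * ((pi / w) powr (d / 2) * (exp (d\<^sup>2) * (8 * pi) powr (d / 2) * B))"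
        unfolding B_def d_def
        using ext by (intro add_mono mult_left_mono gauss_form_cubes(2)[OF r w(1) fin _ nearI w(2)]) auto
      also have "\<dots> = (pi / w) powr (d / 2) * (4 * (exp (d\<^sup>2) * (8 * pi) powr (d / 2)) * B)" by simp
      also have "(pi / w) powr (d / 2) = pi powr (d / 2) / R * exp (- (d / 2) * \<tau>)"
      proof -
        have "exp \<tau> powr (d / 2) = exp (d / 2 * \<tau>)" by (simp add: powr_def)
        thus ?thesis unfolding w_def using r Rp by (simp add: powr_divide powr_mult exp_minus field_simps)
      qed
      finally show ?thesis unfolding C1_def by (simp add: mult_ac)
    qed
    \<comment> \<open>Scales w \<ge> r^2: the packing bound grows like (w/r^2)^(d/2), which cancels
      against the factor (2 \<pi>/w)^(d/2), up to the power of r; the difference contributes the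
      additional r^2/w = exp(-\<tau>).\<close>
    have J2: "J \<tau> \<le> C2 / R * B * exp (- \<tau>)" if \<tau>: "0 \<le> \<tau>" for \<tau>
    proof -
      define w where "w = r\<^sup>2 * exp \<tau>"
      have w: "0 < w" "r\<^sup>2 \<le> w" unfolding w_def using r \<tau> by (auto simp: mult_le_cancel_left1)
      define K where "K = exp (d\<^sup>2 * r\<^sup>2 / (w / 2)) * (8 * pi * (w / 2)) powr (d / 2) / R"
      have "J \<tau> \<le> 2 / w * ((2 * pi / w) powr (d / 2) * (K * ((2 * d * r)\<^sup>2 * B)))"
        unfolding J_def T_def w_def[symmetric] B_def d_def
      proof (rule gauss_trig_diff_near[OF fin w(1)])
        fix m assume m: "m \<in> I"
        have "norm (y m - z m) \<le> norm (y m - lattice_pt r m) + norm (z m - lattice_pt r m)" by norm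
        thus "norm (y m - z m) \<le> 2 * real DIM('a) * r" using nearI[OF m, of y] nearI[OF m, of z] by simp
      next
        fix t :: real and a :: "('a \<Rightarrow> int) \<Rightarrow> real" assume t: "0 \<le> t" "t \<le> 1"
        show "gauss_form (w / 2) (\<lambda>m. z m + t *\<^sub>R (y m - z m)) a I \<le> K * (\<Sum>m\<in>I. (a m)\<^sup>2)"
          unfolding K_def R_def d_def
        proof (rule gauss_form_cubes(1)[OF r _ fin])
          fix m assume m: "m \<in> I"
          have "z m + t *\<^sub>R (y m - z m) - lattice_pt r m = (1 - t) *\<^sub>R (z m - lattice_pt r m) + t *\<^sub>R (y m - lattice_pt r m)"
            by (simp add: algebra_simps)
          also have "norm \<dots> \<le> (1 - t) * norm (z m - lattice_pt r m) + t * norm (y m - lattice_pt r m)"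
            using t by (intro order_trans[OF norm_triangle_ineq]) simp
          also have "\<dots> \<le> (1 - t) * (real DIM('a) * r) + t * (real DIM('a) * r)"
            using t nearI[OF m, of y] nearI[OF m, of z] by (intro add_mono mult_left_mono) auto
          also have "\<dots> = real DIM('a) * r" by (simp add: algebra_simps)
          finally show "norm (z m + t *\<^sub>R (y m - z m) - lattice_pt r m) \<le> real DIM('a) * r" .
        qed (use w ext in auto)
      qed (use R w in \<open>simp add: K_def\<close>)
      also have "\<dots> = 8 * d\<^sup>2 * ((2 * pi / w) powr (d / 2) * (8 * pi * (w / 2)) powr (d / 2)) * exp (d\<^sup>2 * r\<^sup>2 / (w / 2)) / R * B * (r\<^sup>2 / w)"
        unfolding K_def by (simp add: power_mult_distrib mult_ac)
      also have "(2 * pi / w) powr (d / 2) * (8 * pi * (w / 2)) powr (d / 2) = (8 * pi\<^sup>2) powr (d / 2)"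
        unfolding powr_mult[symmetric] using w by (simp add: power2_eq_square)
      also have "r\<^sup>2 / w = exp (- \<tau>)" unfolding w_def using r by (simp add: exp_minus field_simps)
      also have "8 * d\<^sup>2 * (8 * pi\<^sup>2) powr (d / 2) * exp (d\<^sup>2 * r\<^sup>2 / (w / 2)) / R * B * exp (- \<tau>) \<le> 8 * d\<^sup>2 * (8 * pi\<^sup>2) powr (d / 2) * exp (2 * d\<^sup>2) / R * B * exp (- \<tau>)"
      proof -
        have "d\<^sup>2 * r\<^sup>2 / (w / 2) \<le> 2 * d\<^sup>2" using w mult_left_mono[OF w(2), of "d\<^sup>2"] by (simp add: field_simps)
        thus ?thesis using R B by (intro mult_right_mono divide_right_mono mult_left_mono) auto
      qed
      finally show ?thesis unfolding C2_def .
    qed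
    have E1: "has_bochner_integral lborel (\<lambda>t. indicator {..0} t * exp ((\<alpha> - d / 2) * t)) (exp ((\<alpha> - d / 2) * 0) / (\<alpha> - d / 2))"
      using \<alpha> by (intro has_bochner_integral_exp_atMost) (simp add: d_def)
    have E2: "has_bochner_integral lborel (\<lambda>t::real. indicator {0..} t * exp (- (3 / 4) * t)) (exp (- (3 / 4) * 0) / (3 / 4))"
      by (intro has_bochner_integral_exp_atLeast) simp
    let ?g = "\<lambda>t. C1 / R * B * (indicator {..0} t * exp ((\<alpha> - d / 2) * t)) + C2 / R * B * (indicator {0..} t * exp (- (3 / 4) * t))"
    have gi: "integrable lborel ?g"
      using E1 E2 by (intro Bochner_Integration.integrable_add integrable_mult_right) (auto simp: has_bochner_integral_iff)
    have gI: "(LINT t|lborel. ?g t) = C / R * B"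
      using E1 E2 R by (simp add: has_bochner_integral_iff C_def field_simps)
    have gle: "zero_mix \<alpha> \<tau> * J \<tau> \<le> ?g \<tau>" for \<tau>
    proof (cases "\<tau> \<le> 0")
      case True
      have "zero_mix \<alpha> \<tau> * J \<tau> \<le> exp (\<alpha> * \<tau>) * (C1 / R * B * exp (- (d / 2) * \<tau>))"
        using True mult_left_mono[OF J1[OF True], of "exp (\<alpha> * \<tau>)"] by (simp add: zero_mix_def)
      also have "\<dots> = C1 / R * B * exp ((\<alpha> - d / 2) * \<tau>)"
      proof -
        have "exp (\<alpha> * \<tau>) * exp (- (d / 2) * \<tau>) = exp ((\<alpha> - d / 2) * \<tau>)"
          unfolding exp_add[symmetric] by (simp add: algebra_simps)
        thus ?thesis by (metis (no_types, opaque_lifting) mult.assoc mult.commute)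
      qed
      also have "\<dots> \<le> ?g \<tau>" using True R B C2 by simp
      finally show ?thesis .
    next
      case False
      \<comment> \<open>The growth exponent 1/4 of \<open>zero_mix\<close> is below the decay rate 1
        of \<open>J\<close>, so the product is integrable.\<close>
      have "zero_mix \<alpha> \<tau> * J \<tau> \<le> exp (\<tau> / 4) * (C2 / R * B * exp (- \<tau>))"
        using False mult_left_mono[OF J2[of \<tau>], of "exp (\<tau> / 4)"] by (simp add: zero_mix_def)
      also have "\<dots> = C2 / R * B * exp (- (3 / 4) * \<tau>)"
      proof -
        have "exp (\<tau> / 4) * exp (- \<tau>) = exp (- (3 / 4) * \<tau>)"
          unfolding exp_add[symmetric] by (simp add: algebra_simps)
        thus ?thesis by (metis (no_types, opaque_lifting) mult.assoc mult.commute)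
      qed
      also have "\<dots> \<le> ?g \<tau>" using False R B C1 by simp
      finally show ?thesis .
    qed
    have iz: "integrable lborel (\<lambda>\<tau>. zero_mix \<alpha> \<tau> * J \<tau>)"
    proof (rule Bochner_Integration.integrable_bound[OF gi])
      have "0 \<le> zero_mix \<alpha> \<tau> * J \<tau>" for \<tau> using zero_mix_pos[of \<alpha> \<tau>] J0[of \<tau>] by simp
      thus "AE \<tau> in lborel. norm (zero_mix \<alpha> \<tau> * J \<tau>) \<le> norm (?g \<tau>)"
        using gle by (intro AE_I2) (metis abs_ge_self abs_of_nonneg order_trans real_norm_def)
    qed measurable
    define f where "f = (\<lambda>\<tau> \<xi>. zero_mix \<alpha> \<tau> * (exp (- (r\<^sup>2 * exp \<tau>) * (norm \<xi>)\<^sup>2) * T \<xi>))"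
    have fJ: "(LINT \<xi>|lborel. f \<tau> \<xi>) = zero_mix \<alpha> \<tau> * J \<tau>" for \<tau> unfolding f_def J_def by simp
    have m: "(\<lambda>(\<tau>, \<xi>). f \<tau> \<xi>) \<in> borel_measurable (lborel \<Otimes>\<^sub>M lborel)"
      unfolding f_def split_beta' by measurable
    have nn: "0 \<le> f \<tau> \<xi>" for \<tau> \<xi> unfolding f_def T_def using zero_mix_pos[of \<alpha> \<tau>] by simp
    have f\<xi>: "(LINT \<tau>|lborel. f \<tau> \<xi>) = zero_spec \<alpha> r \<xi> * T \<xi>" for \<xi>
    proof (cases "\<xi> = 0")
      case True
      thus ?thesis by (simp add: f_def T_def trig_sum_def)
    next
      case False
      have "f \<tau> \<xi> = zero_mix \<alpha> \<tau> * exp (- exp \<tau> * (r * norm \<xi>)\<^sup>2) * T \<xi>" for \<tau>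
        by (simp add: f_def power_mult_distrib mult_ac)
      thus ?thesis using False by (simp add: zero_spec_def)
    qed
    note TT = tonelli_real[OF m nn, unfolded fJ f\<xi>, OF _ iz]
    have i1: "integrable lborel (f \<tau>)" for \<tau> unfolding f_def by (intro integrable_mult_right iJ)
    show "integrable lborel (\<lambda>\<xi>::'a. zero_spec \<alpha> r \<xi> * (norm (trig_sum y b I \<xi> - trig_sum z b I \<xi>))\<^sup>2) \<and>
     (LINT \<xi>|lborel. zero_spec \<alpha> r \<xi> * (norm (trig_sum y b I \<xi> - trig_sum z b I \<xi>))\<^sup>2) \<le> C / r ^ DIM('a) * (\<Sum>m\<in>I. (b m)\<^sup>2)"
    proof
      show "integrable lborel (\<lambda>\<xi>::'a. zero_spec \<alpha> r \<xi> * (norm (trig_sum y b I \<xi> - trig_sum z b I \<xi>))\<^sup>2)"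
        using TT(2)[OF i1] unfolding T_def .
      have "(LINT \<xi>|lborel. zero_spec \<alpha> r \<xi> * T \<xi>) \<le> C / R * B"
      proof -
        have "(LINT \<xi>|lborel. zero_spec \<alpha> r \<xi> * T \<xi>) = (LINT \<tau>|lborel. zero_mix \<alpha> \<tau> * J \<tau>)" by (rule TT(3)[OF i1])
        also have "\<dots> \<le> C / R * B"
          using integral_mono[OF iz gi gle] gI by (rule order_trans[OF _ eq_refl])
        finally show ?thesis .
      qed
      thus "(LINT \<xi>|lborel. zero_spec \<alpha> r \<xi> * (norm (trig_sum y b I \<xi> - trig_sum z b I \<xi>))\<^sup>2) \<le> C / r ^ DIM('a) * (\<Sum>m\<in>I. (b m)\<^sup>2)"
        unfolding T_def R_def B_def .
    qed
  qed
qed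

text \<open>On a shifted lattice, each sample of u is paired with a zero of u near the same lattice
  point. Duality for the signed sum bounds the sum of squared samples by the weighted frequency
  integral, uniformly in the shift; integrating over shifts in one cube recovers the L2
  norm.\<close>

lemma dense_zeros_bound:
  assumes \<alpha>: "real DIM('a::euclidean_space) / 2 < \<alpha>"
  shows "\<exists>C>0. \<forall>(u :: 'a \<Rightarrow> real) U r. 0 < r \<longrightarrow> continuous_on UNIV u \<longrightarrow> bounded {y. u y \<noteq> 0} \<longrightarrow>
     is_fourier_transform u U \<longrightarrow> (\<forall>y. \<exists>z. norm (z - y) \<le> r \<and> u z = 0) \<longrightarrow>
     integrable lborel (\<lambda>\<xi>. (norm (U \<xi>))\<^sup>2 * zero_weight \<alpha> (r * norm \<xi>)) \<longrightarrow>
     (LINT y|lborel. (u y)\<^sup>2) \<le> C * (LINT \<xi>|lborel. (norm (U \<xi>))\<^sup>2 * zero_weight \<alpha> (r * norm \<xi>))"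
proof -
  from zero_weight_trig[OF \<alpha>] obtain C1 where C1W: "0 < C1 \<and> (\<forall>r I (y :: ('a \<Rightarrow> int) \<Rightarrow> 'a) (z :: ('a \<Rightarrow> int) \<Rightarrow> 'a) b. 0 < r \<longrightarrow> finite I \<longrightarrow> I \<subseteq> extensional Basis \<longrightarrow>
     (\<forall>m\<in>I. norm (y m - lattice_pt r m) \<le> real DIM('a) * r \<and> norm (z m - lattice_pt r m) \<le> real DIM('a) * r) \<longrightarrow>
     integrable lborel (\<lambda>\<xi>::'a. zero_spec \<alpha> r \<xi> * (norm (trig_sum y b I \<xi> - trig_sum z b I \<xi>))\<^sup>2) \<and>
     (LINT \<xi>|lborel. zero_spec \<alpha> r \<xi> * (norm (trig_sum y b I \<xi> - trig_sum z b I \<xi>))\<^sup>2) \<le> C1 / r ^ DIM('a) * (\<Sum>m\<in>I. (b m)\<^sup>2))"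
    by (rule exE)
  note C1 = C1W[THEN conjunct1] and W = C1W[THEN conjunct2, rule_format]
  have \<alpha>0: "0 < \<alpha>" using \<alpha> DIM_positive[where 'a = 'a] by linarith
  define P where "P = (2 * pi) powr (- 2 * real DIM('a))"
  have P: "0 < P" by (simp add: P_def)
  define C where "C = P * exp (3 + \<alpha>) * C1"
  show ?thesis
  proof (intro exI[of _ C] conjI allI impI)
    show "0 < C" unfolding C_def using P C1 by simp
    fix u :: "'a \<Rightarrow> real" and U :: "'a \<Rightarrow> complex" and r :: real
    assume r: "0 < r" and cont: "continuous_on UNIV u" and bd: "bounded {y. u y \<noteq> 0}"
      and ft: "is_fourier_transform u U" and zero: "\<forall>y. \<exists>z. norm (z - y) \<le> r \<and> u z = 0"
      and iU: "integrable lborel (\<lambda>\<xi>. (norm (U \<xi>))\<^sup>2 * zero_weight \<alpha> (r * norm \<xi>))"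
    let ?V = "zero_spec \<alpha> r :: 'a \<Rightarrow> real"
    have Um [measurable]: "U \<in> borel_measurable borel" using ft by (auto simp: is_fourier_transform_def square_integrable_def)
    have um [measurable]: "u \<in> borel_measurable borel" by (rule borel_measurable_continuous_onI[OF cont])
    have ui: "integrable lborel (\<lambda>y. (u y)\<^sup>2)" using ft by (auto simp: is_fourier_transform_def square_integrable_def)
    define X where "X = (LINT \<xi>|lborel. (norm (U \<xi>))\<^sup>2 * zero_weight \<alpha> (r * norm \<xi>))"
    have Vle: "AE \<xi> in lborel. (norm (U \<xi>))\<^sup>2 / ?V \<xi> \<le> exp (3 + \<alpha>) * ((norm (U \<xi>))\<^sup>2 * zero_weight \<alpha> (r * norm \<xi>))"
      using AE_lborel_singleton[of "0::'a"]
    proof eventually_elim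
      case (elim \<xi>)
      have "(norm (U \<xi>))\<^sup>2 * 1 \<le> (norm (U \<xi>))\<^sup>2 * (exp (3 + \<alpha>) * zero_weight \<alpha> (r * norm \<xi>) * ?V \<xi>)"
        using zero_spec_lower[OF \<alpha>0 r elim] by (intro mult_left_mono) auto
      thus ?case using zero_spec_pos[OF \<alpha>0 r, of \<xi>] by (simp add: field_simps)
    qed
    have Vnn: "0 \<le> (norm (U \<xi>))\<^sup>2 / ?V \<xi>" for \<xi> using zero_spec_pos[OF \<alpha>0 r, of \<xi>] by simp
    have iV: "integrable lborel (\<lambda>\<xi>. (norm (U \<xi>))\<^sup>2 / ?V \<xi>)"
    proof (rule Bochner_Integration.integrable_bound)
      show "integrable lborel (\<lambda>\<xi>. exp (3 + \<alpha>) * ((norm (U \<xi>))\<^sup>2 * zero_weight \<alpha> (r * norm \<xi>)))" using iU by simp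
      show "AE \<xi> in lborel. norm ((norm (U \<xi>))\<^sup>2 / ?V \<xi>) \<le> norm (exp (3 + \<alpha>) * ((norm (U \<xi>))\<^sup>2 * zero_weight \<alpha> (r * norm \<xi>)))"
        using Vle
      proof eventually_elim
        case (elim \<xi>)
        thus ?case using Vnn[of \<xi>] by (metis abs_ge_self abs_of_nonneg order_trans real_norm_def)
      qed
    qed measurable
    have VX: "(LINT \<xi>|lborel. (norm (U \<xi>))\<^sup>2 / ?V \<xi>) \<le> exp (3 + \<alpha>) * X"
      unfolding X_def integral_mult_right_zero[symmetric]
      by (rule integral_mono_AE[OF iV _ Vle]) (use iU in simp)
    have X0: "0 \<le> X" unfolding X_def by (intro integral_nonneg_AE) (auto simp: zero_weight_nonneg)
    have pt: "(\<Sum>m\<in>I. (u (lattice_pt r m + \<theta>))\<^sup>2) \<le> C * X / r ^ DIM('a)"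
      if I: "finite I" "I \<subseteq> extensional Basis" and \<theta>: "\<theta> \<in> cbox 0 (r *\<^sub>R One)" for I and \<theta> :: 'a
    proof -
      define y where "y = (\<lambda>m. lattice_pt r m + \<theta>)"
      define z where "z = (\<lambda>m. SOME z. norm (z - lattice_pt r m) \<le> r \<and> u z = 0)"
      have z: "norm (z m - lattice_pt r m) \<le> r \<and> u (z m) = 0" for m
        unfolding z_def by (rule someI_ex) (use zero in blast)
      have n1: "norm (y m - lattice_pt r m) \<le> real DIM('a) * r" for m
        unfolding y_def by (rule norm_le_cube) (use \<theta> in \<open>auto simp: mem_box inner_sum_left inner_Basis if_distrib cong: if_cong\<close>)
      have n2: "norm (z m - lattice_pt r m) \<le> real DIM('a) * r" for m
      proof -
        have "1 * r \<le> real DIM('a) * r" using r by (intro mult_right_mono) (auto simp: Suc_leI)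
        thus ?thesis using z[of m] by linarith
      qed
      \<comment> \<open>With the samples as coefficients, and zeros at the points z, the dual
        pairing is exactly the sum of squares S; one factor S cancels in the end.\<close>
      define b where "b = (\<lambda>m. u (y m))"
      define S where "S = (\<Sum>m\<in>I. (b m)\<^sup>2)"
      have S0: "0 \<le> S" unfolding S_def by (intro sum_nonneg) auto
      note WW = W[OF r I, of y z b, unfolded trig_sum_diff_Plus[OF I(1)], folded S_def]
      have TV: "integrable lborel (\<lambda>\<xi>. ?V \<xi> * (norm (trig_sum (case_sum y z) (case_sum b (\<lambda>m. - b m)) (I <+> I) \<xi>))\<^sup>2)"
        and TL: "(LINT \<xi>|lborel. ?V \<xi> * (norm (trig_sum (case_sum y z) (case_sum b (\<lambda>m. - b m)) (I <+> I) \<xi>))\<^sup>2) \<le> C1 / r ^ DIM('a) * S"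
        using WW n1 n2 by simp_all
      have "(\<Sum>i\<in>I <+> I. case_sum b (\<lambda>m. - b m) i * u (case_sum y z i)) = S"
        using I(1) z by (simp add: sum.Plus o_def S_def b_def power2_eq_square)
      hence "S\<^sup>2 \<le> P * (LINT \<xi>|lborel. (norm (U \<xi>))\<^sup>2 / ?V \<xi>) * (LINT \<xi>|lborel. ?V \<xi> * (norm (trig_sum (case_sum y z) (case_sum b (\<lambda>m. - b m)) (I <+> I) \<xi>))\<^sup>2)"
        using sample_duality[OF ft cont zero_spec_measurable zero_spec_pos[OF \<alpha>0 r] iV TV] unfolding P_def by simp
      also have "\<dots> \<le> P * (exp (3 + \<alpha>) * X) * (C1 / r ^ DIM('a) * S)"
        using VX TL P X0 zero_spec_pos[OF \<alpha>0 r]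
        by (intro mult_mono mult_left_mono mult_nonneg_nonneg integral_nonneg_AE)
          (auto intro!: AE_I2 mult_nonneg_nonneg divide_nonneg_nonneg less_imp_le[OF zero_spec_pos[OF \<alpha>0 r]])
      also have "\<dots> = C * X / r ^ DIM('a) * S" by (simp add: C_def)
      finally have le: "S * S \<le> C * X / r ^ DIM('a) * S" by (simp add: power2_eq_square)
      have "S \<le> C * X / r ^ DIM('a)"
      proof (cases "S = 0")
        case True thus ?thesis using X0 r C1 P by (simp add: C_def)
      next
        case False
        show ?thesis by (rule mult_right_le_imp_le[OF le]) (use False S0 in simp)
      qed
      thus ?thesis by (simp add: S_def b_def y_def)
    qed
    obtain R where R: "\<And>y. u y \<noteq> 0 \<Longrightarrow> norm y \<le> R" using bd by (auto simp: bounded_iff)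
    define M where "M = \<lceil>R / r\<rceil>"
    define I where "I = PiE (Basis :: 'a set) (\<lambda>_. {- M..M})"
    have fI: "finite I" unfolding I_def by (intro finite_PiE) auto
    have eI: "I \<subseteq> extensional Basis" unfolding I_def by (auto simp: PiE_def)
    let ?Q = "\<lambda>m. cbox (lattice_pt r m) (lattice_pt r m + r *\<^sub>R One)"
    have cover: "\<exists>m\<in>I. y \<in> ?Q m" if "u y \<noteq> 0" for y
    proof -
      define m where "m = restrict (\<lambda>b. \<lfloor>inner y b / r\<rfloor>) Basis"
      have fl: "of_int \<lfloor>inner y b / r\<rfloor> \<le> inner y b / r" "inner y b / r < of_int \<lfloor>inner y b / r\<rfloor> + 1" for b
        by linarith+
      have "m \<in> I"
      proof -
        have "\<lfloor>inner y b / r\<rfloor> \<in> {- M..M}" if b: "b \<in> Basis" for b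
        proof -
          have "\<bar>inner y b\<bar> \<le> R" using Basis_le_norm[OF b, of y] R[OF \<open>u y \<noteq> 0\<close>] by linarith
          hence "inner y b / r \<le> R / r" "- (R / r) \<le> inner y b / r" using r by (simp_all add: field_simps abs_le_iff)
          moreover have "R / r \<le> of_int M" unfolding M_def by simp
          ultimately show ?thesis by (auto simp: le_floor_iff floor_le_iff)
        qed
        thus ?thesis by (auto simp: I_def m_def)
      qed
      moreover have "y \<in> ?Q m"
      proof -
        have "r * of_int \<lfloor>inner y b / r\<rfloor> \<le> inner y b \<and> inner y b \<le> r * of_int \<lfloor>inner y b / r\<rfloor> + r" for b
          using mult_left_mono[OF fl(1)[of b], of r] mult_left_mono[OF less_imp_le[OF fl(2)[of b]], of r] r by (simp add: algebra_simps)
        thus ?thesis by (auto simp: mem_box inner_add_left inner_lattice_pt m_def inner_sum_left inner_Basis if_distrib cong: if_cong)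
      qed
      ultimately show ?thesis by blast
    qed
    have si: "integrable lborel (\<lambda>y. indicator (?Q m) y * (u y)\<^sup>2)" for m
      using integrable_mult_indicator[OF _ ui, of "?Q m"] by simp
    have "(LINT y|lborel. (u y)\<^sup>2) \<le> (LINT y|lborel. (\<Sum>m\<in>I. indicator (?Q m) y * (u y)\<^sup>2))"
    proof (rule integral_mono[OF ui])
      show "integrable lborel (\<lambda>y. \<Sum>m\<in>I. indicator (?Q m) y * (u y)\<^sup>2)" by (intro Bochner_Integration.integrable_sum si)
      fix y
      show "(u y)\<^sup>2 \<le> (\<Sum>m\<in>I. indicator (?Q m) y * (u y)\<^sup>2)"
      proof (cases "u y = 0")
        case False
        then obtain m where m: "m \<in> I" "y \<in> ?Q m" using cover by blast
        have "(u y)\<^sup>2 = indicator (?Q m) y * (u y)\<^sup>2" using m by simp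
        also have "\<dots> \<le> (\<Sum>m\<in>I. indicator (?Q m) y * (u y)\<^sup>2)" using m fI by (intro member_le_sum) auto
        finally show ?thesis .
      qed (simp add: sum_nonneg)
    qed
    also have "\<dots> = (\<Sum>m\<in>I. LINT y|lborel. indicator (?Q m) y * (u y)\<^sup>2)" by (rule Bochner_Integration.integral_sum[OF si])
    \<comment> \<open>All cubes are translated to the one at the origin, so that the sum over cubes
      becomes, for fixed \<theta>, the sum over one shifted lattice.\<close>
    also have "\<dots> = (\<Sum>m\<in>I. LINT \<theta>|lborel. indicator (cbox 0 (r *\<^sub>R One)) \<theta> * (u (lattice_pt r m + \<theta>))\<^sup>2)"
    proof (rule sum.cong[OF refl])
      fix m :: "'a \<Rightarrow> int"
      have "indicator (?Q m) (lattice_pt r m + \<theta>) = (indicator (cbox 0 (r *\<^sub>R One)) \<theta> :: real)" for \<theta>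
        by (auto simp: indicator_def mem_box inner_add_left)
      thus "(LINT y|lborel. indicator (?Q m) y * (u y)\<^sup>2) = (LINT \<theta>|lborel. indicator (cbox 0 (r *\<^sub>R One)) \<theta> * (u (lattice_pt r m + \<theta>))\<^sup>2)"
        by (subst lborel_integral_minus(1)[of _ "lattice_pt r m", symmetric]) (auto intro!: borel_measurable_times)
    qed
    also have "\<dots> = (LINT \<theta>|lborel. (\<Sum>m\<in>I. indicator (cbox 0 (r *\<^sub>R One)) \<theta> * (u (lattice_pt r m + \<theta>))\<^sup>2))"
    proof (rule Bochner_Integration.integral_sum[symmetric])
      fix m :: "'a \<Rightarrow> int"
      have "integrable lborel (\<lambda>\<theta>. (u (lattice_pt r m + \<theta>))\<^sup>2)"
        using lborel_integral_minus(2)[of "\<lambda>y. (u y)\<^sup>2" "lattice_pt r m"] ui by simp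
      thus "integrable lborel (\<lambda>\<theta>. indicator (cbox 0 (r *\<^sub>R One)) \<theta> * (u (lattice_pt r m + \<theta>))\<^sup>2)"
        using integrable_mult_indicator[of "cbox 0 (r *\<^sub>R One)" lborel "\<lambda>\<theta>. (u (lattice_pt r m + \<theta>))\<^sup>2"] by simp
    qed
    also have "\<dots> \<le> (LINT \<theta>|lborel. indicator (cbox 0 (r *\<^sub>R (One::'a))) \<theta> * (C * X / r ^ DIM('a)))"
    proof (rule Bochner_Integration.integral_mono')
      show "integrable lborel (\<lambda>\<theta>::'a. indicator (cbox 0 (r *\<^sub>R One)) \<theta> * (C * X / r ^ DIM('a)))"
        using emeasure_lborel_cbox_finite[of "0::'a" "r *\<^sub>R One"] by (intro integrable_mult_left integrable_real_indicator) auto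
      fix \<theta> :: 'a
      show "(\<Sum>m\<in>I. indicator (cbox 0 (r *\<^sub>R One)) \<theta> * (u (lattice_pt r m + \<theta>))\<^sup>2) \<le> indicator (cbox 0 (r *\<^sub>R One)) \<theta> * (C * X / r ^ DIM('a))"
        using pt[OF fI eI, of \<theta>] by (cases "\<theta> \<in> cbox 0 (r *\<^sub>R One)") (auto simp: sum_distrib_left[symmetric])
      show "0 \<le> indicator (cbox 0 (r *\<^sub>R One)) \<theta> * (C * X / r ^ DIM('a))"
        using r X0 C1 P by (simp add: C_def)
    qed
    also have "\<dots> = C * X"
      using measure_cube(2)[of r "0::'a"] r by simp
    finally show "(LINT y|lborel. (u y)\<^sup>2) \<le> C * (LINT \<xi>|lborel. (norm (U \<xi>))\<^sup>2 * zero_weight \<alpha> (r * norm \<xi>))"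
      by (simp add: X_def)
  qed
qed

section \<open>Compactly supported functions and cutoffs\<close>

definition cont_cs :: "('a::euclidean_space \<Rightarrow> real) \<Rightarrow> bool" where
  "cont_cs f \<longleftrightarrow> continuous_on UNIV f \<and> bounded {x. f x \<noteq> 0}"

text \<open>The pointwise Fourier integral. For functions in \<open>cont_cs\<close> it is a concrete
  representative of the relation \<open>is_fourier_transform\<close>.\<close>

definition ft :: "('a::euclidean_space \<Rightarrow> real) \<Rightarrow> 'a \<Rightarrow> complex" where
  "ft f \<xi> = (LINT x|lborel. complex_of_real (f x) * cis (- inner x \<xi>))"

lemma cont_cs_measurable: "cont_cs f \<Longrightarrow> f \<in> borel_measurable borel"
  unfolding cont_cs_def by (intro borel_measurable_continuous_onI) auto

lemma cont_cs_integrable: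
  fixes f :: "'a::euclidean_space \<Rightarrow> real"
  assumes "cont_cs f" shows "integrable lborel f"
proof -
  obtain R where R: "\<And>x. f x \<noteq> 0 \<Longrightarrow> norm x \<le> R" using assms by (auto simp: cont_cs_def bounded_iff)
  have "integrable lborel (\<lambda>x. indicator (cball 0 R) x *\<^sub>R f x)"
    using assms by (intro borel_integrable_compact) (auto simp: cont_cs_def intro: continuous_on_subset)
  also have "(\<lambda>x. indicator (cball 0 R) x *\<^sub>R f x) = f"
    using R by (auto simp: indicator_def fun_eq_iff)
  finally show ?thesis .
qed

lemma cont_cs_mult:
  assumes "cont_cs f" "continuous_on UNIV g" shows "cont_cs (\<lambda>x. f x * g x)"
  using assms unfolding cont_cs_def
  by (auto intro!: continuous_intros intro: bounded_subset[of "{x. f x \<noteq> 0}"])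

lemma cont_cs_diff: "cont_cs f \<Longrightarrow> cont_cs g \<Longrightarrow> cont_cs (\<lambda>x. f x - g x)"
  unfolding cont_cs_def
  by (auto intro!: continuous_intros intro: bounded_subset[of "{x. f x \<noteq> 0} \<union> {x. g x \<noteq> 0}"])

lemma cont_cs_sq_integrable: "cont_cs f \<Longrightarrow> integrable lborel (\<lambda>x. (f x)\<^sup>2)"
  unfolding power2_eq_square by (intro cont_cs_integrable cont_cs_mult) (auto simp: cont_cs_def)

section \<open>Fourier integrals and the Plancherel inequality\<close>

lemma ft_integrand:
  assumes "integrable lborel f"
  shows "integrable lborel (\<lambda>x. complex_of_real (f x) * cis (inner x \<xi>))"
    and "integrable lborel (\<lambda>x. complex_of_real (f x) * cis (- inner x \<xi>))"
  by (rule Bochner_Integration.integrable_bound[OF assms]; (use assms in measurable)?; simp add: norm_mult)+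

lemma ft_bound: "norm (ft f \<xi>) \<le> (LINT x|lborel. \<bar>f x\<bar>)"
  unfolding ft_def by (rule order_trans[OF integral_norm_bound]) (simp add: norm_mult)

lemma ft_measurable [measurable (raw)]:
  assumes [measurable]: "f \<in> borel_measurable borel" shows "ft f \<in> borel_measurable borel"
  unfolding ft_def[abs_def] by measurable

lemma ft_diff:
  assumes "integrable lborel f" "integrable lborel g"
  shows "ft (\<lambda>x. f x - g x) \<xi> = ft f \<xi> - ft g \<xi>"
  unfolding ft_def using ft_integrand(2)[OF assms(1), of \<xi>] ft_integrand(2)[OF assms(2), of \<xi>]
  by (simp add: left_diff_distrib)

lemma ft_cnj: "(LINT x|lborel. complex_of_real (f x) * cis (inner x \<xi>)) = cnj (ft f \<xi>)"
  unfolding ft_def Bochner_Integration.integral_cnj[symmetric] by (simp add: cis_cnj)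

lemma truncated_fourier_eq_ft:
  assumes "\<And>x. f x \<noteq> 0 \<Longrightarrow> norm x \<le> R"
  shows "truncated_fourier f R = ft f"
proof
  fix \<xi>
  show "truncated_fourier f R \<xi> = ft f \<xi>"
    unfolding truncated_fourier_def ft_def set_lebesgue_integral_def
    by (intro Bochner_Integration.integral_cong) (use assms in \<open>auto simp: indicator_def cis_conv_exp\<close>)
qed

lemma cont_cs_square_integrable: "cont_cs f \<Longrightarrow> square_integrable f"
  unfolding square_integrable_def using cont_cs_sq_integrable[of f] cont_cs_measurable[of f] by simp

text \<open>The continuous Schur test: 2 f(x) f(y) \<le> f(x)^2 + f(y)^2 under a symmetric kernel
  whose integral in either variable is c.\<close>

lemma gauss_bilinear_le:
  fixes f :: "'a::euclidean_space \<Rightarrow> real"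
  assumes f: "cont_cs f" and e: "0 < e"
  shows "(LINT x|lborel. f x * (LINT y|lborel. f y * exp (- (norm (x - y))\<^sup>2 / (4 * e)))) \<le> (4 * pi * e) powr (real DIM('a) / 2) * (LINT x|lborel. (f x)\<^sup>2)"
    and "integrable lborel (\<lambda>x. f x * (LINT y|lborel. f y * exp (- (norm (x - y))\<^sup>2 / (4 * e))))"
proof -
  define G where "G = (\<lambda>x y::'a. exp (- (norm (x - y))\<^sup>2 / (4 * e)))"
  define c where "c = (4 * pi * e) powr (real DIM('a) / 2)"
  have Gs: "G x y = G y x" for x y unfolding G_def by (simp add: norm_minus_commute)
  have Gi: "integrable lborel (G x)" and GI: "(LINT y|lborel. G x y) = c" for x
    using gaussian_integral[of "4 * e" x] e unfolding G_def c_def by (simp_all add: norm_minus_commute mult_ac)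
  have G1: "0 \<le> G x y" "G x y \<le> 1" for x y unfolding G_def using e by auto
  have fi: "integrable lborel f" and f2: "integrable lborel (\<lambda>x. (f x)\<^sup>2)"
    by (intro cont_cs_integrable cont_cs_sq_integrable f)+
  note fm [measurable] = cont_cs_measurable[OF f]
  have Gm [measurable]: "(\<lambda>p. G (fst p) (snd p)) \<in> borel_measurable (borel \<Otimes>\<^sub>M borel)"
    unfolding G_def by measurable
  have Gm1 [measurable]: "G x \<in> borel_measurable borel" for x unfolding G_def by measurable
  have fG: "integrable lborel (\<lambda>y. f y * G x y)" for x
    by (rule Bochner_Integration.integrable_bound[OF fi]) (auto simp: abs_mult G1 intro!: AE_I2 mult_left_le)
  define h where "h = (\<lambda>x. LINT y|lborel. f y * G x y)"
  have hb: "\<bar>h x\<bar> \<le> (LINT y|lborel. \<bar>f y\<bar>)" for x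
  proof -
    have "\<bar>h x\<bar> \<le> (LINT y|lborel. \<bar>f y * G x y\<bar>)" unfolding h_def by (rule integral_abs_bound)
    also have "\<dots> \<le> (LINT y|lborel. \<bar>f y\<bar>)"
      by (rule integral_mono[OF integrable_abs[OF fG] integrable_abs[OF fi]]) (auto simp: abs_mult G1 intro!: mult_left_le)
    finally show ?thesis .
  qed
  have hm [measurable]: "h \<in> borel_measurable borel" unfolding h_def G_def by measurable
  have ih: "integrable lborel (\<lambda>x. f x * h x)"
  proof (rule Bochner_Integration.integrable_bound)
    show "integrable lborel (\<lambda>x. f x * (LINT y|lborel. \<bar>f y\<bar>))" using fi by simp
    show "AE x in lborel. norm (f x * h x) \<le> norm (f x * (LINT y|lborel. \<bar>f y\<bar>))"
      using hb by (auto simp: abs_mult intro!: AE_I2 mult_left_mono order_trans[OF hb abs_ge_self])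
  qed measurable
  thus "integrable lborel (\<lambda>x. f x * (LINT y|lborel. f y * exp (- (norm (x - y))\<^sup>2 / (4 * e))))"
    unfolding h_def G_def .
  have m: "(\<lambda>(y, x). (f y)\<^sup>2 * G y x) \<in> borel_measurable (lborel \<Otimes>\<^sub>M lborel)"
    unfolding split_beta' by measurable
  have T: "AE x in lborel. integrable lborel (\<lambda>y. (f y)\<^sup>2 * G y x)"
      "integrable lborel (\<lambda>x. LINT y|lborel. (f y)\<^sup>2 * G y x)"
      "(LINT x|lborel. LINT y|lborel. (f y)\<^sup>2 * G y x) = (LINT y|lborel. LINT x|lborel. (f y)\<^sup>2 * G y x)"
    using Gi f2 GI by (intro tonelli_real[OF m]; simp add: G1)+
  have "(LINT x|lborel. f x * h x) \<le> (LINT x|lborel. c / 2 * (f x)\<^sup>2 + 1 / 2 * (LINT y|lborel. (f y)\<^sup>2 * G y x))"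
  proof (rule integral_mono_AE)
    show "integrable lborel (\<lambda>x. f x * h x)" by (rule ih)
    show "integrable lborel (\<lambda>x. c / 2 * (f x)\<^sup>2 + 1 / 2 * (LINT y|lborel. (f y)\<^sup>2 * G y x))"
      by (intro Bochner_Integration.integrable_add integrable_mult_right f2 T)
    show "AE x in lborel. f x * h x \<le> c / 2 * (f x)\<^sup>2 + 1 / 2 * (LINT y|lborel. (f y)\<^sup>2 * G y x)"
      using T(1)
    proof eventually_elim
      case (elim x)
      have "f x * h x = (LINT y|lborel. f x * (f y * G x y))" unfolding h_def by simp
      also have "\<dots> \<le> (LINT y|lborel. (f x)\<^sup>2 / 2 * G x y + 1 / 2 * ((f y)\<^sup>2 * G y x))"
      proof (rule integral_mono)
        show "integrable lborel (\<lambda>y. (f x)\<^sup>2 / 2 * G x y + 1 / 2 * ((f y)\<^sup>2 * G y x))"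
          by (intro Bochner_Integration.integrable_add integrable_mult_right Gi elim)
        show "f x * (f y * G x y) \<le> (f x)\<^sup>2 / 2 * G x y + 1 / 2 * ((f y)\<^sup>2 * G y x)" for y
          using mult_right_mono[OF sum_squares_bound[of "f x" "f y"] G1(1)[of x y]] Gs[of y x] by (simp add: algebra_simps)
      qed (intro integrable_mult_right fG)
      also have "\<dots> = c / 2 * (f x)\<^sup>2 + 1 / 2 * (LINT y|lborel. (f y)\<^sup>2 * G y x)"
        using Gi GI elim by simp
      finally show ?case .
    qed
  qed
  also have "\<dots> = c / 2 * (LINT x|lborel. (f x)\<^sup>2) + 1 / 2 * (LINT x|lborel. LINT y|lborel. (f y)\<^sup>2 * G y x)"
    using f2 T(2) by simp
  also have "\<dots> = c * (LINT x|lborel. (f x)\<^sup>2)" unfolding T(3) using GI by simp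
  finally show "(LINT x|lborel. f x * (LINT y|lborel. f y * exp (- (norm (x - y))\<^sup>2 / (4 * e)))) \<le> (4 * pi * e) powr (real DIM('a) / 2) * (LINT x|lborel. (f x)\<^sup>2)"
    unfolding h_def G_def c_def .
qed

text \<open>With a factor exp(-e |\<xi>|^2), Fubini turns the integral into the Gaussian bilinear
  form of f. The constants (\<pi>/e)^(d/2) and (4 \<pi> e)^(d/2) multiply to (2 \<pi>)^d for every
  e, and monotone convergence removes the factor.\<close>

lemma plancherel_le:
  fixes f :: "'a::euclidean_space \<Rightarrow> real"
  assumes f: "cont_cs f"
  shows "integrable lborel (\<lambda>\<xi>. (norm (ft f \<xi>))\<^sup>2)"
    and "(LINT \<xi>|lborel. (norm (ft f \<xi>))\<^sup>2) \<le> (2 * pi) powr real DIM('a) * (LINT x|lborel. (f x)\<^sup>2)"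
proof -
  let ?d = "real DIM('a)"
  have fi: "integrable lborel f" by (rule cont_cs_integrable[OF f])
  note fm [measurable] = cont_cs_measurable[OF f]
  obtain R where R: "\<And>x. f x \<noteq> 0 \<Longrightarrow> norm x \<le> R" using f by (auto simp: cont_cs_def bounded_iff)
  have tf: "truncated_fourier f R = ft f" by (rule truncated_fourier_eq_ft[OF R])
  define B where "B = (LINT x|lborel. \<bar>f x\<bar>)"
  define W where "W = (2 * pi) powr ?d * (LINT x|lborel. (f x)\<^sup>2)"
  have key: "integrable lborel (\<lambda>\<xi>. exp (- e * (norm \<xi>)\<^sup>2) * (norm (ft f \<xi>))\<^sup>2)"
    "(LINT \<xi>|lborel. exp (- e * (norm \<xi>)\<^sup>2) * (norm (ft f \<xi>))\<^sup>2) \<le> W" if e: "0 < e" for e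
  proof -
    define E where "E = (\<lambda>\<xi>::'a. exp (- e * (norm \<xi>)\<^sup>2))"
    have Em [measurable]: "E \<in> borel_measurable borel" unfolding E_def by measurable
    have Ei: "integrable lborel E" unfolding E_def by (rule integrable_gauss[OF e])
    have ftm [measurable]: "ft f \<in> borel_measurable borel" by measurable
    have E0: "0 \<le> E \<xi>" for \<xi> by (simp add: E_def)
    have i: "integrable lborel (\<lambda>\<xi>. E \<xi> * (norm (ft f \<xi>))\<^sup>2)"
    proof (rule Bochner_Integration.integrable_bound)
      show "integrable lborel (\<lambda>\<xi>. E \<xi> * B\<^sup>2)" using Ei by simp
      show "AE \<xi> in lborel. norm (E \<xi> * (norm (ft f \<xi>))\<^sup>2) \<le> norm (E \<xi> * B\<^sup>2)"
        using ft_bound[of f] by (auto simp: abs_mult E0 B_def intro!: AE_I2 mult_left_mono power_mono)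
    qed measurable
    thus "integrable lborel (\<lambda>\<xi>. exp (- e * (norm \<xi>)\<^sup>2) * (norm (ft f \<xi>))\<^sup>2)" by (simp add: E_def)
    define H where "H = (\<lambda>x \<xi>. complex_of_real (f x) * (ft f \<xi> * (complex_of_real (E \<xi>) * cis (inner x \<xi>))))"
    have Hm: "(\<lambda>(x, \<xi>). H x \<xi>) \<in> borel_measurable (lborel \<Otimes>\<^sub>M lborel)"
      unfolding H_def split_beta' by measurable
    have sq: "square_integrable f" by (rule cont_cs_square_integrable[OF f])
    note ts = truncated_fourier_smoothed[OF sq e, of R, unfolded tf, folded E_def]
    have ts1: "integrable lborel (\<lambda>\<xi>. ft f \<xi> * (complex_of_real (E \<xi>) * cis (inner x \<xi>)))" for x
      using ts(1)[of x] by (simp add: E_def)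
    have HI: "integrable (lborel \<Otimes>\<^sub>M lborel) (\<lambda>(x, \<xi>). H x \<xi>)"
    proof (rule lborel_pair.Fubini_integrable[OF Hm])
      have "norm (H x \<xi>) = \<bar>f x\<bar> * (norm (ft f \<xi>) * E \<xi>)" for x \<xi>
        by (simp add: H_def norm_mult E0)
      thus "integrable lborel (\<lambda>x. LINT \<xi>|lborel. norm (case (x, \<xi>) of (x, \<xi>) \<Rightarrow> H x \<xi>))"
        using fi by simp
      show "AE x in lborel. integrable lborel (\<lambda>\<xi>. case (x, \<xi>) of (x, \<xi>) \<Rightarrow> H x \<xi>)"
        unfolding H_def using ts1 by simp
    qed
    have H1: "(LINT \<xi>|lborel. H x \<xi>) = complex_of_real ((pi / e) powr (?d / 2) * (f x * (LINT y|lborel. f y * exp (- (norm (x - y))\<^sup>2 / (4 * e)))))" for x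
    proof -
      have c: "(LINT y:cball 0 R|lborel. f y * exp (- (norm (x - y))\<^sup>2 / (4 * e))) = (LINT y|lborel. f y * exp (- (norm (x - y))\<^sup>2 / (4 * e)))"
        unfolding set_lebesgue_integral_def
        by (intro Bochner_Integration.integral_cong) (use R in \<open>auto simp: indicator_def\<close>)
      have "(LINT \<xi>|lborel. H x \<xi>) = complex_of_real (f x) * (LINT \<xi>|lborel. ft f \<xi> * (complex_of_real (exp (- e * (norm \<xi>)\<^sup>2)) * cis (inner x \<xi>)))"
        unfolding H_def E_def by simp
      also have "\<dots> = complex_of_real (f x) * complex_of_real ((pi / e) powr (?d / 2) * (LINT y|lborel. f y * exp (- (norm (x - y))\<^sup>2 / (4 * e))))"
        using truncated_fourier_smoothed(2)[OF sq e, of R x] unfolding tf c by simp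
      finally show ?thesis by (simp add: mult_ac)
    qed
    have H2: "(LINT x|lborel. H x \<xi>) = complex_of_real (E \<xi> * (norm (ft f \<xi>))\<^sup>2)" for \<xi>
    proof -
      have "(LINT x|lborel. H x \<xi>) = (LINT x|lborel. (ft f \<xi> * complex_of_real (E \<xi>)) * (complex_of_real (f x) * cis (inner x \<xi>)))"
        unfolding H_def by (intro Bochner_Integration.integral_cong) (auto simp: mult_ac)
      also have "\<dots> = ft f \<xi> * complex_of_real (E \<xi>) * cnj (ft f \<xi>)" by (simp add: ft_cnj)
      also have "\<dots> = complex_of_real (E \<xi>) * (ft f \<xi> * cnj (ft f \<xi>))" by (simp add: mult_ac)
      finally show ?thesis by (simp add: complex_norm_square[symmetric])
    qed
    have "complex_of_real (LINT \<xi>|lborel. E \<xi> * (norm (ft f \<xi>))\<^sup>2) = (LINT \<xi>|lborel. LINT x|lborel. H x \<xi>)"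
      unfolding H2 by (rule integral_complex_of_real[symmetric])
    also have "\<dots> = (LINT x|lborel. LINT \<xi>|lborel. H x \<xi>)" by (rule lborel_pair.Fubini_integral[OF HI])
    also have "\<dots> = complex_of_real (LINT x|lborel. (pi / e) powr (?d / 2) * (f x * (LINT y|lborel. f y * exp (- (norm (x - y))\<^sup>2 / (4 * e)))))"
      unfolding H1 by (rule integral_complex_of_real)
    finally have "(LINT \<xi>|lborel. E \<xi> * (norm (ft f \<xi>))\<^sup>2) = (pi / e) powr (?d / 2) * (LINT x|lborel. f x * (LINT y|lborel. f y * exp (- (norm (x - y))\<^sup>2 / (4 * e))))"
      unfolding of_real_eq_iff by simp
    also have "\<dots> \<le> (pi / e) powr (?d / 2) * ((4 * pi * e) powr (?d / 2) * (LINT x|lborel. (f x)\<^sup>2))"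
      by (intro mult_left_mono gauss_bilinear_le f e) auto
    also have "\<dots> = W"
    proof -
      have "(pi / e) powr (?d / 2) * (4 * pi * e) powr (?d / 2) = (pi / e * (4 * pi * e)) powr (?d / 2)"
        by (rule powr_mult[symmetric])
      also have "pi / e * (4 * pi * e) = (2 * pi) powr 2" using e by (simp add: power2_eq_square)
      also have "((2 * pi) powr 2) powr (?d / 2) = (2 * pi) powr ?d" unfolding powr_powr by simp
      finally show ?thesis by (simp add: W_def)
    qed
    finally show "(LINT \<xi>|lborel. exp (- e * (norm \<xi>)\<^sup>2) * (norm (ft f \<xi>))\<^sup>2) \<le> W" by (simp add: E_def)
  qed
  have W0: "0 \<le> W" unfolding W_def by (intro mult_nonneg_nonneg integral_nonneg_AE) auto
  \<comment> \<open>Take e = 1/(n+1), so that the regularised integrands increase with n.\<close>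
  define F where "F = (\<lambda>n \<xi>::'a. ennreal (exp (- (1 / real (Suc n)) * (norm \<xi>)\<^sup>2) * (norm (ft f \<xi>))\<^sup>2))"
  have inc: "incseq F"
    unfolding F_def incseq_def le_fun_def
  proof (intro allI impI ennreal_leI mult_right_mono)
    fix m n :: nat and \<xi> :: 'a assume "m \<le> n"
    hence "1 / real (Suc n) * (norm \<xi>)\<^sup>2 \<le> 1 / real (Suc m) * (norm \<xi>)\<^sup>2"
      by (intro mult_right_mono) (auto simp: field_simps)
    thus "exp (- (1 / real (Suc m)) * (norm \<xi>)\<^sup>2) \<le> exp (- (1 / real (Suc n)) * (norm \<xi>)\<^sup>2)" by simp
  qed simp
  have sup: "(SUP n. F n \<xi>) = ennreal ((norm (ft f \<xi>))\<^sup>2)" for \<xi>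
  proof (rule LIMSEQ_unique[OF LIMSEQ_SUP])
    show "incseq (\<lambda>n. F n \<xi>)" using inc by (auto simp: incseq_def le_fun_def)
    have "(\<lambda>n. exp (- (1 / real (Suc n)) * (norm \<xi>)\<^sup>2) * (norm (ft f \<xi>))\<^sup>2) \<longlonglongrightarrow> exp (- 0 * (norm \<xi>)\<^sup>2) * (norm (ft f \<xi>))\<^sup>2"
      by (intro tendsto_intros LIMSEQ_Suc[OF lim_1_over_n, unfolded o_def])
    thus "(\<lambda>n. F n \<xi>) \<longlonglongrightarrow> ennreal ((norm (ft f \<xi>))\<^sup>2)" unfolding F_def by (intro tendsto_ennrealI) simp
  qed
  have "(\<integral>\<^sup>+ \<xi>. ennreal ((norm (ft f \<xi>))\<^sup>2) \<partial>lborel) = (SUP n. \<integral>\<^sup>+ \<xi>. F n \<xi> \<partial>lborel)"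
    unfolding sup[symmetric] by (rule nn_integral_monotone_convergence_SUP[OF inc]) (simp add: F_def)
  also have "\<dots> \<le> ennreal W"
  proof (rule SUP_least)
    fix n
    have "(\<integral>\<^sup>+ \<xi>. F n \<xi> \<partial>lborel) = ennreal (LINT \<xi>|lborel. exp (- (1 / real (Suc n)) * (norm \<xi>)\<^sup>2) * (norm (ft f \<xi>))\<^sup>2)"
      unfolding F_def by (rule nn_integral_eq_integral[OF key(1)]) auto
    also have "\<dots> \<le> ennreal W" by (intro ennreal_leI key(2)) simp
    finally show "(\<integral>\<^sup>+ \<xi>. F n \<xi> \<partial>lborel) \<le> ennreal W" .
  qed
  finally have le: "(\<integral>\<^sup>+ \<xi>. ennreal ((norm (ft f \<xi>))\<^sup>2) \<partial>lborel) \<le> ennreal W" .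
  show i: "integrable lborel (\<lambda>\<xi>. (norm (ft f \<xi>))\<^sup>2)"
    using le by (intro integrableI_bounded) (auto intro: le_less_trans)
  have "ennreal (LINT \<xi>|lborel. (norm (ft f \<xi>))\<^sup>2) \<le> ennreal W"
    using le nn_integral_eq_integral[OF i] by simp
  thus "(LINT \<xi>|lborel. (norm (ft f \<xi>))\<^sup>2) \<le> (2 * pi) powr ?d * (LINT x|lborel. (f x)\<^sup>2)"
    using W0 by (simp add: W_def[symmetric] ennreal_le_iff)
qed

text \<open>Once the ball contains the support, truncation changes nothing and the mean-square limit
  is attained.\<close>

lemma is_fourier_transform_ft:
  assumes f: "cont_cs f" shows "is_fourier_transform f (ft f)"
proof -
  obtain R where R: "\<And>x. f x \<noteq> 0 \<Longrightarrow> norm x \<le> R" using f by (auto simp: cont_cs_def bounded_iff)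
  have "\<forall>\<^sub>F S in at_top. (\<integral>\<^sup>+ \<xi>. ennreal ((norm (ft f \<xi> - truncated_fourier f S \<xi>))\<^sup>2) \<partial>lborel) = 0"
    using eventually_ge_at_top[of R]
  proof eventually_elim
    case (elim S)
    have "truncated_fourier f S = ft f" by (rule truncated_fourier_eq_ft) (use R elim in fastforce)
    thus ?case by simp
  qed
  moreover have "square_integrable (ft f)"
    unfolding square_integrable_def using plancherel_le(1)[OF f] cont_cs_measurable[OF f] by simp
  ultimately show ?thesis
    using cont_cs_square_integrable[OF f] by (simp add: is_fourier_transform_def tendsto_eventually)
qed

text \<open>Transfers the decay and tail hypotheses of self-similarity, which speak of some g, to
  the concrete \<open>ft f\<close>.\<close>

lemma is_fourier_transform_unique:
  assumes f: "cont_cs f" and g: "is_fourier_transform f g" shows "AE \<xi> in lborel. g \<xi> = ft f \<xi>"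
proof -
  obtain R where R: "\<And>x. f x \<noteq> 0 \<Longrightarrow> norm x \<le> R" using f by (auto simp: cont_cs_def bounded_iff)
  have [measurable]: "g \<in> borel_measurable borel" using g by (auto simp: is_fourier_transform_def square_integrable_def)
  note [measurable] = cont_cs_measurable[OF f]
  have "\<forall>\<^sub>F S in at_top. (\<integral>\<^sup>+ \<xi>. ennreal ((norm (g \<xi> - truncated_fourier f S \<xi>))\<^sup>2) \<partial>lborel) = (\<integral>\<^sup>+ \<xi>. ennreal ((norm (g \<xi> - ft f \<xi>))\<^sup>2) \<partial>lborel)"
    using eventually_ge_at_top[of R]
  proof eventually_elim
    case (elim S)
    have "truncated_fourier f S = ft f" by (rule truncated_fourier_eq_ft) (use R elim in fastforce)
    thus ?case by simp
  qed
  hence "((\<lambda>S. \<integral>\<^sup>+ \<xi>. ennreal ((norm (g \<xi> - truncated_fourier f S \<xi>))\<^sup>2) \<partial>lborel) \<longlongrightarrow> (\<integral>\<^sup>+ \<xi>. ennreal ((norm (g \<xi> - ft f \<xi>))\<^sup>2) \<partial>lborel)) at_top"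
    by (rule tendsto_eventually)
  moreover have "((\<lambda>S. \<integral>\<^sup>+ \<xi>. ennreal ((norm (g \<xi> - truncated_fourier f S \<xi>))\<^sup>2) \<partial>lborel) \<longlongrightarrow> 0) at_top"
    using g by (simp add: is_fourier_transform_def)
  ultimately have "(\<integral>\<^sup>+ \<xi>. ennreal ((norm (g \<xi> - ft f \<xi>))\<^sup>2) \<partial>lborel) = 0"
    using tendsto_unique[OF trivial_limit_at_top_linorder] by blast
  thus ?thesis by (simp add: nn_integral_0_iff_AE)
qed

text \<open>Instead of a smooth bump function, a Lipschitz cutoff is averaged repeatedly over segments in
  each basis direction: every average multiplies the Fourier transform by a factor that decays like
  the inverse of that frequency component.\<close>

definition avg :: "real \<Rightarrow> 'a::euclidean_space \<Rightarrow> ('a \<Rightarrow> real) \<Rightarrow> 'a \<Rightarrow> real" where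
  "avg \<delta> e \<psi> x = 1 / 2 * (LINT s|lborel. indicator {-1..1} s * \<psi> (x + (s * \<delta>) *\<^sub>R e))"

text \<open>A majorant of |sin a / a|, the Fourier multiplier of averaging over a segment.\<close>

definition damp :: "real \<Rightarrow> real" where "damp a = 1 / max 1 \<bar>a\<bar>"

lemma damp_bounds: "0 < damp a" "damp a \<le> 1" by (auto simp: damp_def divide_le_eq)

lemma cis_average: "norm (1 / 2 * (LINT s|lborel. indicator {-1..1::real} s *\<^sub>R cis (s * a))) \<le> damp a"
proof -
  have m: "norm (LINT s|lborel. indicator {-1..1::real} s *\<^sub>R cis (s * a)) \<le> 2"
  proof -
    have "norm (LINT s|lborel. indicator {-1..1::real} s *\<^sub>R cis (s * a)) \<le> (LINT s|lborel. norm (indicator {-1..1::real} s *\<^sub>R cis (s * a)))"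
      by (rule integral_norm_bound)
    also have "\<dots> = 2" by (simp add: norm_scaleR)
    finally show ?thesis .
  qed
  have k: "norm (LINT s|lborel. indicator {-1..1::real} s *\<^sub>R cis (s * a)) \<le> 2 / \<bar>a\<bar>" if "a \<noteq> 0"
  proof -
    define K where "K = inverse (\<i> * complex_of_real a)"
    have der: "((\<lambda>s. cis (s * a) * K) has_vector_derivative cis (s * a)) (at s within {-1..1})" for s
      unfolding has_vector_derivative_def
      by (rule derivative_eq_intros refl ext)+ (use that in \<open>simp add: scaleR_conv_of_real K_def field_simps\<close>)
    have "(LINT s|lborel. indicator {-1..1::real} s *\<^sub>R cis (s * a)) = cis (1 * a) * K - cis ((-1) * a) * K"
      by (rule integral_FTC_atLeastAtMost[OF _ der]) (auto intro!: continuous_intros)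
    also have "norm \<dots> \<le> norm (cis (1 * a) * K) + norm (cis ((-1) * a) * K)"
      by (rule norm_triangle_ineq4)
    also have "\<dots> = 2 / \<bar>a\<bar>" by (simp add: norm_mult K_def norm_inverse divide_inverse)
    finally show ?thesis .
  qed
  show ?thesis
  proof (cases "\<bar>a\<bar> \<le> 1")
    case True
    thus ?thesis using m by (simp add: damp_def norm_mult norm_divide)
  next
    case False
    hence "a \<noteq> 0" by auto
    thus ?thesis using False k by (simp add: damp_def norm_mult norm_divide field_simps max_def)
  qed
qed

text \<open>The margin r is a budget: an average over segments of half-length \<delta> lowers it by
  \<delta>. Lipschitz continuity is the regularity carried along because averaging preserves it with
  the same constant.\<close>

definition cut :: "'a::euclidean_space set \<Rightarrow> 'a set \<Rightarrow> real \<Rightarrow> ('a \<Rightarrow> real) \<Rightarrow> bool" where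
  "cut S \<Omega> r \<psi> \<longleftrightarrow> (\<exists>L. L-lipschitz_on UNIV \<psi>) \<and> (\<forall>x. 0 \<le> \<psi> x \<and> \<psi> x \<le> 1) \<and>
     (\<forall>x\<in>S. \<forall>y. norm (y - x) \<le> r \<longrightarrow> \<psi> y = 1) \<and> (\<forall>x. x \<notin> \<Omega> \<longrightarrow> (\<forall>y. norm (y - x) \<le> r \<longrightarrow> \<psi> y = 0))"

lemma cut_mono: "cut S \<Omega> r \<psi> \<Longrightarrow> r' \<le> r \<Longrightarrow> cut S \<Omega> r' \<psi>"
  unfolding cut_def by (meson order_trans)

lemma cut_cont: "cut S \<Omega> r \<psi> \<Longrightarrow> continuous_on UNIV \<psi>"
  unfolding cut_def by (auto intro: lipschitz_on_continuous_on)

lemma cut_cs: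
  assumes "cut S \<Omega> r \<psi>" "bounded \<Omega>" "0 \<le> r" shows "cont_cs \<psi>"
proof -
  have "\<psi> x = 0" if "x \<notin> \<Omega>" for x using assms(1,3) that unfolding cut_def by (metis cancel_comm_monoid_add_class.diff_cancel norm_zero)
  hence "{x. \<psi> x \<noteq> 0} \<subseteq> \<Omega>" by auto
  thus ?thesis using cut_cont[OF assms(1)] assms(2) by (auto simp: cont_cs_def intro: bounded_subset)
qed

text \<open>By Fubini the average may be taken after the transform, where a translation is
  multiplication by a character; the averaged character is bounded by
  \<open>cis_average\<close>.\<close>

lemma ft_avg:
  fixes \<psi> :: "'a::euclidean_space \<Rightarrow> real"
  assumes \<psi>: "cont_cs \<psi>"
  shows "norm (ft (avg \<delta> e \<psi>) \<xi>) \<le> norm (ft \<psi> \<xi>) * damp (\<delta> * inner e \<xi>)"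
proof -
  note [measurable] = cont_cs_measurable[OF \<psi>]
  have \<psi>i: "integrable lborel \<psi>" by (rule cont_cs_integrable[OF \<psi>])
  define h where "h = (\<lambda>s x. complex_of_real (indicator {-1..1::real} s * \<psi> (x + (s * \<delta>) *\<^sub>R e)) * cis (- inner x \<xi>))"
  have hm: "(\<lambda>(s, x). h s x) \<in> borel_measurable (lborel \<Otimes>\<^sub>M lborel)"
    unfolding h_def split_beta' by measurable
  have sh: "integrable lborel (\<lambda>x. \<psi> (x + t *\<^sub>R e))" "(LINT x|lborel. \<bar>\<psi> (x + t *\<^sub>R e)\<bar>) = (LINT x|lborel. \<bar>\<psi> x\<bar>)" for t
    using lborel_integral_minus(2)[of \<psi> "t *\<^sub>R e"] lborel_integral_minus(1)[of "\<lambda>x. \<bar>\<psi> x\<bar>" "t *\<^sub>R e"] \<psi>i by (simp_all add: add.commute)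
  have hI: "integrable (lborel \<Otimes>\<^sub>M lborel) (\<lambda>(s, x). h s x)"
  proof (rule lborel_pair.Fubini_integrable[OF hm])
    have "norm (h s x) = indicator {-1..1} s * \<bar>\<psi> (x + (s * \<delta>) *\<^sub>R e)\<bar>" for s x
      by (simp add: h_def norm_mult abs_mult)
    hence "(LINT x|lborel. norm (h s x)) = indicator {-1..1} s * (LINT x|lborel. \<bar>\<psi> x\<bar>)" for s
      using sh(2) by simp
    thus "integrable lborel (\<lambda>s. LINT x|lborel. norm (case (s, x) of (s, x) \<Rightarrow> h s x))"
      by simp
    have "integrable lborel (h s)" for s
    proof (rule Bochner_Integration.integrable_bound[OF sh(1)[of "s * \<delta>"]])
      show "AE x in lborel. norm (h s x) \<le> norm (\<psi> (x + (s * \<delta>) *\<^sub>R e))"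
        by (auto simp: h_def norm_mult abs_mult indicator_def)
    qed (unfold h_def, measurable)
    thus "AE s in lborel. integrable lborel (\<lambda>x. case (s, x) of (s, x) \<Rightarrow> h s x)" by simp
  qed
  have h1: "(LINT s|lborel. h s x) = 2 * (complex_of_real (avg \<delta> e \<psi> x) * cis (- inner x \<xi>))" for x
  proof -
    have "(LINT s|lborel. h s x) = (LINT s|lborel. complex_of_real (indicator {-1..1::real} s * \<psi> (x + (s * \<delta>) *\<^sub>R e))) * cis (- inner x \<xi>)"
      unfolding h_def by (rule integral_mult_left_zero)
    also have "(LINT s|lborel. complex_of_real (indicator {-1..1::real} s * \<psi> (x + (s * \<delta>) *\<^sub>R e))) = complex_of_real (2 * avg \<delta> e \<psi> x)"
      unfolding avg_def by (subst integral_complex_of_real) simp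
    finally show ?thesis by simp
  qed
  have h2: "(LINT x|lborel. h s x) = ft \<psi> \<xi> * (indicator {-1..1::real} s *\<^sub>R cis (s * (\<delta> * inner e \<xi>)))" for s
  proof -
    define t where "t = s * \<delta>"
    have "(LINT x|lborel. complex_of_real (\<psi> (x + t *\<^sub>R e)) * cis (- inner x \<xi>))
        = (LINT x|lborel. (\<lambda>y. complex_of_real (\<psi> y) * cis (- inner (y - t *\<^sub>R e) \<xi>)) (t *\<^sub>R e + x))"
      by (simp add: add.commute)
    also have "\<dots> = (LINT y|lborel. complex_of_real (\<psi> y) * cis (- inner (y - t *\<^sub>R e) \<xi>))"
      by (rule lborel_integral_minus(1)) measurable
    also have "\<dots> = (LINT y|lborel. complex_of_real (\<psi> y) * cis (- inner y \<xi>) * cis (t * inner e \<xi>))"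
      by (intro Bochner_Integration.integral_cong refl) (simp add: inner_diff_left cis_mult mult.assoc)
    also have "\<dots> = ft \<psi> \<xi> * cis (t * inner e \<xi>)" unfolding ft_def by (rule integral_mult_left_zero)
    finally have *: "(LINT x|lborel. complex_of_real (\<psi> (x + t *\<^sub>R e)) * cis (- inner x \<xi>)) = ft \<psi> \<xi> * cis (t * inner e \<xi>)" .
    have "(LINT x|lborel. h s x) = (LINT x|lborel. complex_of_real (indicator {-1..1::real} s) * (complex_of_real (\<psi> (x + t *\<^sub>R e)) * cis (- inner x \<xi>)))"
      unfolding h_def t_def by (intro Bochner_Integration.integral_cong refl) (simp add: mult.assoc)
    also have "\<dots> = complex_of_real (indicator {-1..1::real} s) * (ft \<psi> \<xi> * cis (t * inner e \<xi>))"
      unfolding integral_mult_right_zero * ..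
    finally show ?thesis by (simp add: t_def scaleR_conv_of_real mult_ac)
  qed
  have "2 * ft (avg \<delta> e \<psi>) \<xi> = (LINT x|lborel. LINT s|lborel. h s x)"
    unfolding h1 ft_def by simp
  also have "\<dots> = (LINT s|lborel. LINT x|lborel. h s x)" by (rule lborel_pair.Fubini_integral[OF hI])
  also have "\<dots> = ft \<psi> \<xi> * (LINT s|lborel. indicator {-1..1::real} s *\<^sub>R cis (s * (\<delta> * inner e \<xi>)))"
    unfolding h2 by (rule integral_mult_right_zero)
  finally have "ft (avg \<delta> e \<psi>) \<xi> = ft \<psi> \<xi> * (1 / 2 * (LINT s|lborel. indicator {-1..1::real} s *\<^sub>R cis (s * (\<delta> * inner e \<xi>))))"
    by (simp add: field_simps)
  hence "norm (ft (avg \<delta> e \<psi>) \<xi>) = norm (ft \<psi> \<xi>) * norm (1 / 2 * (LINT s|lborel. indicator {-1..1::real} s *\<^sub>R cis (s * (\<delta> * inner e \<xi>))))"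
    by (simp only: norm_mult)
  also have "\<dots> \<le> norm (ft \<psi> \<xi>) * damp (\<delta> * inner e \<xi>)"
    by (rule mult_left_mono[OF cis_average norm_ge_zero])
  finally show ?thesis .
qed

lemma cut_avg:
  fixes \<psi> :: "'a::euclidean_space \<Rightarrow> real"
  assumes c: "cut S \<Omega> (r + \<delta>) \<psi>" and \<delta>: "0 \<le> \<delta>" and e: "norm e \<le> 1"
  shows "cut S \<Omega> r (avg \<delta> e \<psi>)"
proof -
  obtain L where L: "L-lipschitz_on UNIV \<psi>" using c by (auto simp: cut_def)
  have L0: "0 \<le> L" using L by (rule lipschitz_on_nonneg)
  have rng: "0 \<le> \<psi> x" "\<psi> x \<le> 1" for x using c by (auto simp: cut_def)
  have contx: "continuous_on {-1..1} (\<lambda>s. \<psi> (x + (s * \<delta>) *\<^sub>R e))" for x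
    by (rule continuous_on_compose2[OF cut_cont[OF c]]) (auto intro!: continuous_intros)
  have i: "integrable lborel (\<lambda>s. indicator {-1..1} s * \<psi> (x + (s * \<delta>) *\<^sub>R e))" for x
    using borel_integrable_atLeastAtMost'[OF contx[of x]] by (simp add: set_integrable_def)
  have const: "avg \<delta> e \<psi> x = v" if "\<And>s. s \<in> {-1..1} \<Longrightarrow> \<psi> (x + (s * \<delta>) *\<^sub>R e) = v" for x v
  proof -
    have "(LINT s|lborel. indicator {-1..1} s * \<psi> (x + (s * \<delta>) *\<^sub>R e)) = (LINT s|lborel. indicator {-1..1::real} s * v)"
      using that by (intro Bochner_Integration.integral_cong refl) (auto simp: indicator_def)
    thus ?thesis by (simp add: avg_def)
  qed
  have small: "norm ((s * \<delta>) *\<^sub>R e) \<le> \<delta>" if "s \<in> {-1..1}" for s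
  proof -
    have "\<bar>s\<bar> * \<delta> * norm e \<le> 1 * \<delta> * 1" using that \<delta> e by (intro mult_mono) auto
    thus ?thesis using \<delta> by (simp add: abs_mult)
  qed
  have near: "norm (y + (s * \<delta>) *\<^sub>R e - x) \<le> r + \<delta>" if "norm (y - x) \<le> r" "s \<in> {-1..1}" for x y s
  proof -
    have "norm (y + (s * \<delta>) *\<^sub>R e - x) \<le> norm (y - x) + norm ((s * \<delta>) *\<^sub>R e)"
      using norm_triangle_ineq[of "y - x" "(s * \<delta>) *\<^sub>R e"] by (simp add: algebra_simps)
    thus ?thesis using that(1) small[OF that(2)] by linarith
  qed
  have lip: "L-lipschitz_on UNIV (avg \<delta> e \<psi>)"
  proof (rule lipschitz_onI[OF _ L0])
    fix x y :: 'a
    have "\<bar>avg \<delta> e \<psi> x - avg \<delta> e \<psi> y\<bar> = 1 / 2 * \<bar>LINT s|lborel. indicator {-1..1} s * \<psi> (x + (s * \<delta>) *\<^sub>R e) - indicator {-1..1} s * \<psi> (y + (s * \<delta>) *\<^sub>R e)\<bar>"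
    proof -
      have *: "1 / 2 * a - 1 / 2 * b = 1 / 2 * (a - b)" "\<bar>1 / 2 * a\<bar> = 1 / 2 * \<bar>a\<bar>" for a b :: real by auto
      show ?thesis unfolding Bochner_Integration.integral_diff[OF i i] avg_def * ..
    qed
    also have "\<dots> \<le> 1 / 2 * (LINT s|lborel. \<bar>indicator {-1..1} s * \<psi> (x + (s * \<delta>) *\<^sub>R e) - indicator {-1..1} s * \<psi> (y + (s * \<delta>) *\<^sub>R e)\<bar>)"
      by (intro mult_left_mono integral_abs_bound) auto
    also have "\<dots> \<le> 1 / 2 * (LINT s|lborel. indicator {-1..1::real} s * (L * norm (x - y)))"
    proof (intro mult_left_mono integral_mono)
      show "\<bar>indicator {-1..1} s * \<psi> (x + (s * \<delta>) *\<^sub>R e) - indicator {-1..1} s * \<psi> (y + (s * \<delta>) *\<^sub>R e)\<bar> \<le> indicator {-1..1} s * (L * norm (x - y))" for s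
        using lipschitz_onD[OF L, of "x + (s * \<delta>) *\<^sub>R e" "y + (s * \<delta>) *\<^sub>R e"] by (simp add: indicator_def dist_norm)
    qed (use i in auto)
    also have "\<dots> = L * norm (x - y)" by simp
    finally show "dist (avg \<delta> e \<psi> x) (avg \<delta> e \<psi> y) \<le> L * dist x y" by (simp add: dist_norm)
  qed
  have ge: "0 \<le> avg \<delta> e \<psi> x" for x unfolding avg_def using rng by (intro mult_nonneg_nonneg integral_nonneg_AE) auto
  have le: "avg \<delta> e \<psi> x \<le> 1" for x
  proof -
    have "(LINT s|lborel. indicator {-1..1} s * \<psi> (x + (s * \<delta>) *\<^sub>R e)) \<le> (LINT s|lborel. indicator {-1..1::real} s)"
    proof (rule integral_mono[OF i])
      show "integrable lborel (indicator {-1..1::real} :: real \<Rightarrow> real)" by (rule integrable_real_indicator) auto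
      show "indicator {-1..1} s * \<psi> (x + (s * \<delta>) *\<^sub>R e) \<le> indicator {-1..1::real} s" for s
        using rng(2) by (simp add: indicator_def)
    qed
    thus ?thesis by (simp add: avg_def)
  qed
  show ?thesis
    unfolding cut_def
  proof (intro conjI allI ballI impI)
    show "\<exists>L. L-lipschitz_on UNIV (avg \<delta> e \<psi>)" using lip by blast
    fix x y :: 'a assume "x \<in> S" "norm (y - x) \<le> r"
    thus "avg \<delta> e \<psi> y = 1" using near c by (intro const) (auto simp: cut_def)
  next
    fix x y :: 'a assume "x \<notin> \<Omega>" "norm (y - x) \<le> r"
    thus "avg \<delta> e \<psi> y = 0" using near c by (intro const) (auto simp: cut_def)
  qed (use ge le in auto)
qed

lemma cut_avg_power:
  fixes \<psi> :: "'a::euclidean_space \<Rightarrow> real"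
  assumes "cut S \<Omega> (r + real N * \<delta>) \<psi>" "0 \<le> \<delta>" "norm e \<le> 1" "bounded \<Omega>" "0 \<le> r"
  shows "\<exists>\<psi>'. cut S \<Omega> r \<psi>' \<and> (\<forall>\<xi>. norm (ft \<psi>' \<xi>) \<le> norm (ft \<psi> \<xi>) * damp (\<delta> * inner e \<xi>) ^ N)"
  using assms(1)
proof (induction N arbitrary: \<psi>)
  case 0
  thus ?case by (intro exI[of _ \<psi>]) simp
next
  case (Suc N)
  have c: "cut S \<Omega> ((r + real N * \<delta>) + \<delta>) \<psi>" using Suc.prems by (simp add: algebra_simps)
  have cs: "cont_cs \<psi>" using cut_cs[OF c assms(4)] assms by simp
  obtain \<psi>' where \<psi>': "cut S \<Omega> r \<psi>'" "\<And>\<xi>. norm (ft \<psi>' \<xi>) \<le> norm (ft (avg \<delta> e \<psi>) \<xi>) * damp (\<delta> * inner e \<xi>) ^ N"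
    using Suc.IH[OF cut_avg[OF c assms(2,3)]] by blast
  have "norm (ft \<psi>' \<xi>) \<le> norm (ft \<psi> \<xi>) * damp (\<delta> * inner e \<xi>) ^ Suc N" for \<xi>
    using order_trans[OF \<psi>'(2) mult_right_mono[OF ft_avg[OF cs, of \<delta> e \<xi>], of "damp (\<delta> * inner e \<xi>) ^ N"]]
      damp_bounds(1)[of "\<delta> * inner e \<xi>"] by (simp add: mult.assoc)
  with \<psi>'(1) show ?case by blast
qed

lemma cut_avg_basis:
  fixes \<psi> :: "'a::euclidean_space \<Rightarrow> real"
  assumes "finite B" "B \<subseteq> Basis" "cut S \<Omega> (r + real (card B) * (real N * \<delta>)) \<psi>" "0 \<le> \<delta>" "bounded \<Omega>" "0 \<le> r"
  shows "\<exists>\<psi>'. cut S \<Omega> r \<psi>' \<and> (\<forall>\<xi>. norm (ft \<psi>' \<xi>) \<le> norm (ft \<psi> \<xi>) * (\<Prod>b\<in>B. damp (\<delta> * inner b \<xi>) ^ N))"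
  using assms(1-3)
proof (induction B arbitrary: \<psi> rule: finite_induct)
  case empty
  thus ?case by (intro exI[of _ \<psi>]) simp
next
  case (insert b B)
  have "cut S \<Omega> ((r + real (card B) * (real N * \<delta>)) + real N * \<delta>) \<psi>"
    using insert.prems(2) insert.hyps by (simp add: algebra_simps)
  then obtain \<psi>1 where 1: "cut S \<Omega> (r + real (card B) * (real N * \<delta>)) \<psi>1" "\<And>\<xi>. norm (ft \<psi>1 \<xi>) \<le> norm (ft \<psi> \<xi>) * damp (\<delta> * inner b \<xi>) ^ N"
    using cut_avg_power[of S \<Omega> "r + real (card B) * (real N * \<delta>)" N \<delta> \<psi> b] assms insert.prems by auto
  obtain \<psi>' where \<psi>': "cut S \<Omega> r \<psi>'" "\<And>\<xi>. norm (ft \<psi>' \<xi>) \<le> norm (ft \<psi>1 \<xi>) * (\<Prod>b\<in>B. damp (\<delta> * inner b \<xi>) ^ N)"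
    using insert.IH[OF _ 1(1)] insert.prems by auto
  have "norm (ft \<psi>' \<xi>) \<le> norm (ft \<psi> \<xi>) * (\<Prod>b\<in>insert b B. damp (\<delta> * inner b \<xi>) ^ N)" for \<xi>
  proof -
    have "norm (ft \<psi>' \<xi>) \<le> norm (ft \<psi>1 \<xi>) * (\<Prod>b\<in>B. damp (\<delta> * inner b \<xi>) ^ N)" by (rule \<psi>'(2))
    also have "\<dots> \<le> (norm (ft \<psi> \<xi>) * damp (\<delta> * inner b \<xi>) ^ N) * (\<Prod>b\<in>B. damp (\<delta> * inner b \<xi>) ^ N)"
      using damp_bounds by (intro mult_right_mono 1 prod_nonneg) (auto intro: less_imp_le)
    finally show ?thesis using insert.hyps by (simp add: mult.assoc)
  qed
  with \<psi>'(1) show ?case by blast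
qed

text \<open>Finitely many averages in each basis direction give any prescribed polynomial decay. A
  Lipschitz function of the distance to S provides the initial cutoff and the margin that the
  averages use up.\<close>

lemma cutoff_exists:
  fixes S \<Omega> :: "'a::euclidean_space set" and k :: nat
  assumes S: "compact S" "S \<noteq> {}" "S \<subseteq> \<Omega>" and \<Omega>: "open \<Omega>" "bounded \<Omega>"
  shows "\<exists>\<psi>. cont_cs \<psi> \<and> (\<forall>x\<in>S. \<psi> x = 1) \<and> (\<forall>x. x \<notin> \<Omega> \<longrightarrow> \<psi> x = 0) \<and>
    (\<exists>A>0. \<forall>\<xi>. norm (ft \<psi> \<xi>) \<le> A * (1 + (norm \<xi>)\<^sup>2) powr (- real k))"
proof -
  let ?d = "real DIM('a)"
  obtain \<epsilon> where \<epsilon>: "0 < \<epsilon>" "\<And>x y. x \<in> S \<Longrightarrow> norm (y - x) < \<epsilon> \<Longrightarrow> y \<in> \<Omega>"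
  proof -
    obtain e where e: "0 < e" "(\<Union>x\<in>S. ball x e) \<subseteq> \<Omega>"
      using compact_subset_open_imp_ball_epsilon_subset[OF S(1) \<Omega>(1) S(3)] by blast
    show ?thesis
    proof (rule that[OF e(1)])
      fix x y assume "x \<in> S" "norm (y - x) < e"
      hence "y \<in> (\<Union>x\<in>S. ball x e)" by (auto simp: dist_norm norm_minus_commute)
      thus "y \<in> \<Omega>" using e(2) by blast
    qed
  qed
  \<comment> \<open>Equal to 1 up to distance \<epsilon>/3 from S and to 0 from distance 2
    \<epsilon>/3 on. As the complement of \<Omega> is at distance at least \<epsilon>, both margins
    are \<epsilon>/3.\<close>
  define \<psi>0 where "\<psi>0 = (\<lambda>x. min 1 (max 0 (2 - 3 / \<epsilon> * infdist x S)))"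
  have inf_lip: "\<bar>infdist x S - infdist y S\<bar> \<le> dist x y" for x y :: 'a
    using infdist_triangle[of x S y] infdist_triangle[of y S x] by (simp add: dist_commute abs_le_iff)
  have c0: "cut S \<Omega> (\<epsilon> / 3) \<psi>0"
    unfolding cut_def
  proof (intro conjI allI ballI impI)
    have "(3 / \<epsilon>)-lipschitz_on UNIV \<psi>0"
    proof (rule lipschitz_onI)
      fix x y :: 'a
      have "\<bar>\<psi>0 x - \<psi>0 y\<bar> \<le> \<bar>3 / \<epsilon> * infdist x S - 3 / \<epsilon> * infdist y S\<bar>" unfolding \<psi>0_def by (auto simp: min_def max_def)
      also have "\<dots> = 3 / \<epsilon> * \<bar>infdist x S - infdist y S\<bar>" unfolding right_diff_distrib[symmetric] abs_mult using \<epsilon>(1) by simp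
      also have "\<dots> \<le> 3 / \<epsilon> * dist x y" using \<epsilon> by (intro mult_left_mono inf_lip) auto
      finally show "dist (\<psi>0 x) (\<psi>0 y) \<le> 3 / \<epsilon> * dist x y" by (simp add: dist_norm)
    qed (use \<epsilon> in simp)
    thus "\<exists>L. L-lipschitz_on UNIV \<psi>0" by blast
  next
    fix x y :: 'a assume xy: "x \<in> S" "norm (y - x) \<le> \<epsilon> / 3"
    have "infdist y S \<le> dist y x" using xy by (intro infdist_le) auto
    hence "3 / \<epsilon> * infdist y S \<le> 3 / \<epsilon> * (\<epsilon> / 3)" using xy \<epsilon> by (intro mult_left_mono) (auto simp: dist_norm)
    hence "3 / \<epsilon> * infdist y S \<le> 1" using \<epsilon>(1) by simp
    thus "\<psi>0 y = 1" unfolding \<psi>0_def by linarith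
  next
    fix x y :: 'a assume xy: "x \<notin> \<Omega>" "norm (y - x) \<le> \<epsilon> / 3"
    have "\<epsilon> \<le> infdist x S"
      unfolding infdist_notempty[OF S(2)]
      using \<epsilon>(2) xy(1) S(2) by (intro cINF_greatest) (force simp: dist_norm not_less)+
    hence "2 * \<epsilon> / 3 \<le> infdist y S" using inf_lip[of x y] xy(2) by (simp add: dist_norm norm_minus_commute abs_le_iff)
    hence "3 / \<epsilon> * (2 * \<epsilon> / 3) \<le> 3 / \<epsilon> * infdist y S" using \<epsilon> by (intro mult_left_mono) auto
    thus "\<psi>0 y = 0" using \<epsilon> by (simp add: \<psi>0_def)
  qed (auto simp: \<psi>0_def)
  \<comment> \<open>Each average gains one inverse power of a frequency component; 2 k of them give
    the decay (1 + |\<xi>|^2)^(-k).\<close>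
  define N where "N = 2 * k"
  \<comment> \<open>All d N averages together spend at most \<epsilon>/3. The summand 1 keeps the
    denominator positive when k = 0.\<close>
  define \<delta> where "\<delta> = \<epsilon> / 3 / (?d * (real N + 1))"
  have \<delta>: "0 < \<delta>" unfolding \<delta>_def using \<epsilon> by simp
  have "?d * (real N * \<delta>) \<le> \<epsilon> / 3"
  proof -
    have "?d * (real N * \<delta>) \<le> ?d * ((real N + 1) * \<delta>)" using \<delta> by (intro mult_left_mono mult_right_mono) auto
    also have "\<dots> = \<epsilon> / 3 * (?d * (real N + 1) / (?d * (real N + 1)))" by (simp add: \<delta>_def)
    also have "\<dots> = \<epsilon> / 3" by (subst divide_self) (auto simp: add_eq_0_iff_both_eq_0)
    finally show ?thesis .
  qed
  hence c1: "cut S \<Omega> (0 + real (card (Basis :: 'a set)) * (real N * \<delta>)) \<psi>0"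
    by (intro cut_mono[OF c0]) simp
  obtain \<psi> where \<psi>: "cut S \<Omega> 0 \<psi>" "\<And>\<xi>. norm (ft \<psi> \<xi>) \<le> norm (ft \<psi>0 \<xi>) * (\<Prod>b\<in>Basis. damp (\<delta> * inner b \<xi>) ^ N)"
    using cut_avg_basis[OF finite_Basis subset_refl c1 less_imp_le[OF \<delta>] \<Omega>(2)] by auto
  define A0 where "A0 = (LINT x|lborel. \<bar>\<psi>0 x\<bar>)"
  have A0: "0 \<le> A0" unfolding A0_def by (intro integral_nonneg_AE) auto
  define K where "K = ?d / \<delta>"
  have "norm (ft \<psi> \<xi>) \<le> ((A0 + 1) * (1 + K\<^sup>2) ^ k) * (1 + (norm \<xi>)\<^sup>2) powr (- real k)" for \<xi>
  proof -
    \<comment> \<open>Only the damping along the largest component is kept; it is comparable to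
      |\<xi>|, and the other factors are at most 1.\<close>
    have "Max ((\<lambda>b. \<bar>inner b \<xi>\<bar>) ` Basis) \<in> (\<lambda>b. \<bar>inner b \<xi>\<bar>) ` Basis" by (intro Max_in) auto
    then obtain b :: 'a where b: "b \<in> Basis" "Max ((\<lambda>b. \<bar>inner b \<xi>\<bar>) ` Basis) = \<bar>inner b \<xi>\<bar>" by (rule imageE) blast
    have mx: "\<bar>inner b' \<xi>\<bar> \<le> \<bar>inner b \<xi>\<bar>" if "b' \<in> Basis" for b'
      unfolding b(2)[symmetric] using that by (intro Max_ge) auto
    have "norm \<xi> \<le> (\<Sum>b'\<in>Basis. \<bar>inner \<xi> b'\<bar>)" by (rule norm_le_l1)
    also have "\<dots> \<le> (\<Sum>b'\<in>(Basis::'a set). \<bar>inner b \<xi>\<bar>)" using mx by (intro sum_mono) (simp add: inner_commute)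
    finally have n: "norm \<xi> \<le> ?d * \<bar>inner b \<xi>\<bar>" by simp
    define t where "t = max 1 \<bar>\<delta> * inner b \<xi>\<bar>"
    have t1: "1 \<le> t" by (simp add: t_def)
    have "norm \<xi> \<le> K * t"
    proof -
      have "?d * \<bar>inner b \<xi>\<bar> = K * \<bar>\<delta> * inner b \<xi>\<bar>" using \<delta> by (simp add: K_def abs_mult)
      also have "\<dots> \<le> K * t" unfolding K_def using \<delta> by (intro mult_left_mono) (auto simp: t_def)
      finally show ?thesis using n by linarith
    qed
    hence "(norm \<xi>)\<^sup>2 \<le> (K * t)\<^sup>2" by (intro power_mono) auto
    moreover have "1 \<le> t\<^sup>2" using t1 by (simp add: power_le_one one_le_power)
    ultimately have "1 + (norm \<xi>)\<^sup>2 \<le> (1 + K\<^sup>2) * t\<^sup>2" by (simp add: power_mult_distrib algebra_simps)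
    hence "(1 + (norm \<xi>)\<^sup>2) ^ k \<le> ((1 + K\<^sup>2) * t\<^sup>2) ^ k" by (intro power_mono) auto
    also have "\<dots> = (1 + K\<^sup>2) ^ k * t ^ N" by (simp add: power_mult_distrib N_def power_mult)
    finally have "1 / t ^ N \<le> (1 + K\<^sup>2) ^ k / (1 + (norm \<xi>)\<^sup>2) ^ k"
      using t1 by (simp add: field_simps add_pos_nonneg)
    moreover have "(\<Prod>b\<in>Basis. damp (\<delta> * inner b \<xi>) ^ N) \<le> 1 / t ^ N"
    proof -
      have "(\<Prod>b\<in>Basis. damp (\<delta> * inner b \<xi>) ^ N) = damp (\<delta> * inner b \<xi>) ^ N * (\<Prod>b\<in>Basis - {b}. damp (\<delta> * inner b \<xi>) ^ N)"
        using b by (intro prod.remove) auto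
      also have "\<dots> \<le> damp (\<delta> * inner b \<xi>) ^ N * 1"
        using damp_bounds by (intro mult_left_mono prod_le_1) (auto intro: less_imp_le power_le_one)
      also have "\<dots> = 1 / t ^ N" by (simp add: damp_def t_def power_one_over)
      finally show ?thesis .
    qed
    ultimately have p: "(\<Prod>b\<in>Basis. damp (\<delta> * inner b \<xi>) ^ N) \<le> (1 + K\<^sup>2) ^ k / (1 + (norm \<xi>)\<^sup>2) ^ k" by linarith
    have "norm (ft \<psi> \<xi>) \<le> norm (ft \<psi>0 \<xi>) * (\<Prod>b\<in>Basis. damp (\<delta> * inner b \<xi>) ^ N)" by (rule \<psi>(2))
    also have "\<dots> \<le> (A0 + 1) * ((1 + K\<^sup>2) ^ k / (1 + (norm \<xi>)\<^sup>2) ^ k)"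
      using p A0 order_trans[OF ft_bound[of \<psi>0 \<xi>], of "A0 + 1"] damp_bounds(1)
      by (intro mult_mono prod_nonneg) (auto simp: A0_def intro: less_imp_le)
    also have "\<dots> = ((A0 + 1) * (1 + K\<^sup>2) ^ k) * (1 + (norm \<xi>)\<^sup>2) powr (- real k)"
      by (simp add: powr_minus powr_realpow add_pos_nonneg field_simps)
    finally show ?thesis .
  qed
  moreover have "0 < (A0 + 1) * (1 + K\<^sup>2) ^ k" using A0 by (intro mult_pos_pos zero_less_power) (auto simp: add_pos_nonneg)
  moreover have "\<psi> x = 1" if "x \<in> S" for x using \<psi>(1) that by (auto simp: cut_def)
  moreover have "\<psi> x = 0" if "x \<notin> \<Omega>" for x using \<psi>(1) that by (auto simp: cut_def)
  ultimately show ?thesis using cut_cs[OF \<psi>(1) \<Omega>(2)] by blast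
qed

section \<open>Data terms of self-similar functions\<close>

lemma integrable_squeeze:
  fixes f g :: "'a \<Rightarrow> real"
  assumes "integrable M g" "f \<in> borel_measurable M" "AE x in M. 0 \<le> f x" "AE x in M. f x \<le> g x"
  shows "integrable M f"
  by (rule Bochner_Integration.integrable_bound[OF assms(1,2)]) (use assms(3,4) in eventually_elim, auto)

text \<open>Complements \<open>spec_trig_sum\<close>, which only speaks of quadratic forms: here the
  kernel itself is recovered, as is required to transform the interpolant as a function.\<close>

lemma Psi_fourier:
  fixes z :: "'a::euclidean_space"
  assumes \<alpha>: "real DIM('a) / 2 < \<alpha>" and \<kappa>: "0 < \<kappa>"
  shows "(LINT \<xi>|lborel. complex_of_real (spec \<alpha> \<kappa> \<xi>) * cis (inner z \<xi>))
       = complex_of_real (pi powr (real DIM('a) / 2) * Psi (\<alpha> - real DIM('a) / 2) \<kappa> (norm z))"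
proof -
  let ?d = "real DIM('a) / 2"
  define f where "f = (\<lambda>\<tau> (\<xi>::'a). complex_of_real (mix \<alpha> \<kappa> \<tau>) * (complex_of_real (exp (- exp \<tau> * (norm \<xi>)\<^sup>2)) * cis (inner z \<xi>)))"
  have \<alpha>0: "0 < \<alpha>" using \<alpha> DIM_positive[where 'a = 'a] by linarith
  have sc: "mix \<alpha> \<kappa> \<tau> * (pi / exp \<tau>) powr ?d = pi powr ?d * mix (\<alpha> - ?d) \<kappa> \<tau>" for \<tau>
  proof -
    have "(pi / exp \<tau>) powr ?d = pi powr ?d * exp (- ?d * \<tau>)"
      by (simp add: powr_divide powr_def[of "exp \<tau>"] exp_minus field_simps)
    moreover have "mix \<alpha> \<kappa> \<tau> * exp (- ?d * \<tau>) = mix (\<alpha> - ?d) \<kappa> \<tau>"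
      by (simp add: mix_def exp_add[symmetric] left_diff_distrib)
    ultimately show ?thesis by (simp add: mult_ac)
  qed
  have n0: "(LINT \<xi>|lborel. norm (f \<tau> \<xi>)) = pi powr ?d * mix (\<alpha> - ?d) \<kappa> \<tau>" for \<tau>
  proof -
    have "complex_of_real (LINT \<xi>::'a|lborel. exp (- exp \<tau> * (norm \<xi>)\<^sup>2)) = complex_of_real ((pi / exp \<tau>) powr ?d)"
      using gaussian_fourier(2)[of "exp \<tau>" "0::'a"] by simp
    hence "(LINT \<xi>::'a|lborel. exp (- exp \<tau> * (norm \<xi>)\<^sup>2)) = (pi / exp \<tau>) powr ?d" by (simp only: of_real_eq_iff)
    moreover have "norm (f \<tau> \<xi>) = mix \<alpha> \<kappa> \<tau> * exp (- exp \<tau> * (norm \<xi>)\<^sup>2)" for \<xi>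
      by (simp add: f_def norm_mult mix_nonneg)
    ultimately show ?thesis using sc[of \<tau>] by simp
  qed
  have m: "(\<lambda>(\<tau>, \<xi>). f \<tau> \<xi>) \<in> borel_measurable (lborel \<Otimes>\<^sub>M lborel)"
    unfolding f_def split_beta' by measurable
  have i1: "integrable lborel (f \<tau>)" for \<tau>
    unfolding f_def using gaussian_fourier(1)[of "exp \<tau>" z] by (intro integrable_mult_right) auto
  have I: "integrable (lborel \<Otimes>\<^sub>M lborel) (\<lambda>(\<tau>, \<xi>). f \<tau> \<xi>)"
  proof (rule lborel_pair.Fubini_integrable[OF m])
    show "integrable lborel (\<lambda>\<tau>. LINT \<xi>|lborel. norm (case (\<tau>, \<xi>) of (\<tau>, \<xi>) \<Rightarrow> f \<tau> \<xi>))"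
      using integrable_mix[of "\<alpha> - ?d" \<kappa>] \<alpha> \<kappa> by (simp add: n0)
  qed (use i1 in auto)
  have "(LINT \<tau>|lborel. f \<tau> \<xi>) = complex_of_real (spec \<alpha> \<kappa> \<xi>) * cis (inner z \<xi>)" for \<xi>
  proof -
    have "f \<tau> \<xi> = complex_of_real (mix \<alpha> (\<kappa> + (norm \<xi>)\<^sup>2) \<tau>) * cis (inner z \<xi>)" for \<tau>
      unfolding f_def mult.assoc[symmetric] of_real_mult[symmetric]
      by (simp add: mix_def exp_add[symmetric] algebra_simps del: of_real_mult)
    thus ?thesis by (simp add: spec_def)
  qed
  hence "(LINT \<xi>|lborel. complex_of_real (spec \<alpha> \<kappa> \<xi>) * cis (inner z \<xi>)) = (LINT \<xi>|lborel. LINT \<tau>|lborel. f \<tau> \<xi>)"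
    by simp
  also have "\<dots> = (LINT \<tau>|lborel. LINT \<xi>|lborel. f \<tau> \<xi>)" by (rule lborel_pair.Fubini_integral[OF I])
  also have "\<dots> = (LINT \<tau>|lborel. complex_of_real (pi powr ?d * (mix (\<alpha> - ?d) \<kappa> \<tau> * exp (- (norm z)\<^sup>2 / (4 * exp \<tau>)))))"
  proof (intro Bochner_Integration.integral_cong refl)
    fix \<tau>
    have "(LINT \<xi>|lborel. f \<tau> \<xi>) = complex_of_real (mix \<alpha> \<kappa> \<tau> * ((pi / exp \<tau>) powr ?d * exp (- (norm z)\<^sup>2 / (4 * exp \<tau>))))"
      unfolding f_def integral_mult_right_zero gaussian_fourier(2)[OF exp_gt_zero] by simp
    thus "(LINT \<xi>|lborel. f \<tau> \<xi>) = complex_of_real (pi powr ?d * (mix (\<alpha> - ?d) \<kappa> \<tau> * exp (- (norm z)\<^sup>2 / (4 * exp \<tau>))))"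
      by (simp only: mult.assoc[symmetric] sc)
  qed
  also have "\<dots> = complex_of_real (pi powr ?d * Psi (\<alpha> - ?d) \<kappa> (norm z))"
    unfolding integral_complex_of_real Psi_def by simp
  finally show ?thesis .
qed

lemma Psi_zero: "0 < \<nu> \<Longrightarrow> 0 < \<kappa> \<Longrightarrow> Psi \<nu> \<kappa> 0 = Gam \<nu> * \<kappa> powr (- \<nu>)"
  by (simp add: Psi_def integral_mix)

lemma continuous_on_Psi:
  assumes "0 < \<nu>" "0 < \<kappa>" shows "continuous_on UNIV (Psi \<nu> \<kappa>)"
proof (rule continuous_on_sequentiallyI)
  fix u :: "nat \<Rightarrow> real" and a assume u: "u \<longlonglongrightarrow> a"
  show "(\<lambda>n. Psi \<nu> \<kappa> (u n)) \<longlonglongrightarrow> Psi \<nu> \<kappa> a"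
    unfolding Psi_def
  proof (rule integral_dominated_convergence[OF _ _ integrable_mix[OF assms]])
    show "AE \<tau> in lborel. (\<lambda>n. mix \<nu> \<kappa> \<tau> * exp (- (u n)\<^sup>2 / (4 * exp \<tau>))) \<longlonglongrightarrow> mix \<nu> \<kappa> \<tau> * exp (- a\<^sup>2 / (4 * exp \<tau>))"
      using u by (auto intro!: tendsto_intros)
    show "AE \<tau> in lborel. norm (mix \<nu> \<kappa> \<tau> * exp (- (u n)\<^sup>2 / (4 * exp \<tau>))) \<le> mix \<nu> \<kappa> \<tau>" for n
      by (auto simp: abs_mult mix_nonneg mult_left_le)
  qed measurable
qed

text \<open>Polar coordinates are replaced by a comparison: for |\<xi>| \<ge> R the power is
  dominated by the spectral density of order d/2 + \<gamma> with \<kappa> = R^2, whose total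
  integral scales like R^(-2 \<gamma>).\<close>

lemma powr_tail:
  assumes \<gamma>: "0 < \<gamma>"
  shows "\<exists>C>0. \<forall>R>0. integrable lborel (\<lambda>\<xi>::'a::euclidean_space. indicator {\<xi>. R \<le> norm \<xi>} \<xi> * norm \<xi> powr (- (real DIM('a) + 2 * \<gamma>)))
    \<and> (LINT \<xi>::'a|lborel. indicator {\<xi>. R \<le> norm \<xi>} \<xi> * norm \<xi> powr (- (real DIM('a) + 2 * \<gamma>))) \<le> C * R powr (- 2 * \<gamma>)"
proof -
  let ?d = "real DIM('a) / 2"
  define \<alpha> where "\<alpha> = ?d + \<gamma>"
  have \<alpha>: "?d < \<alpha>" "0 < \<alpha>" using \<gamma> DIM_positive[where 'a = 'a] by (auto simp: \<alpha>_def)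
  define C where "C = 2 powr \<alpha> / Gam \<alpha> * (pi powr ?d * Gam \<gamma>)"
  have C: "0 < C" unfolding C_def using Gam_pos[OF \<alpha>(2)] Gam_pos[OF \<gamma>] by simp
  have "integrable lborel (\<lambda>\<xi>::'a. indicator {\<xi>. R \<le> norm \<xi>} \<xi> * norm \<xi> powr (- (real DIM('a) + 2 * \<gamma>)))
    \<and> (LINT \<xi>::'a|lborel. indicator {\<xi>. R \<le> norm \<xi>} \<xi> * norm \<xi> powr (- (real DIM('a) + 2 * \<gamma>))) \<le> C * R powr (- 2 * \<gamma>)" if R: "0 < R" for R
  proof
    have R2: "0 < R\<^sup>2" using R by simp
    have le: "indicator {\<xi>. R \<le> norm \<xi>} \<xi> * norm \<xi> powr (- (real DIM('a) + 2 * \<gamma>)) \<le> 2 powr \<alpha> / Gam \<alpha> * spec \<alpha> (R\<^sup>2) \<xi>" for \<xi> :: 'a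
    proof (cases "R \<le> norm \<xi>")
      case True
      hence p: "0 < norm \<xi>" using R by linarith
      have "R\<^sup>2 \<le> (norm \<xi>)\<^sup>2" using True R by (intro power_mono) auto
      hence "(2 * (norm \<xi>)\<^sup>2) powr (- \<alpha>) \<le> (R\<^sup>2 + (norm \<xi>)\<^sup>2) powr (- \<alpha>)"
        using R2 \<alpha> p by (intro powr_mono2') (auto simp: add_pos_nonneg)
      moreover have "(norm \<xi>)\<^sup>2 powr (- \<alpha>) = norm \<xi> powr (- (real DIM('a) + 2 * \<gamma>))"
      proof -
        have "(norm \<xi>)\<^sup>2 = norm \<xi> powr 2" using p by simp
        moreover have "2 * - \<alpha> = - (real DIM('a) + 2 * \<gamma>)" by (simp add: \<alpha>_def)
        ultimately show ?thesis by (simp only: powr_powr)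
      qed
      ultimately have "norm \<xi> powr (- (real DIM('a) + 2 * \<gamma>)) \<le> 2 powr \<alpha> * (R\<^sup>2 + (norm \<xi>)\<^sup>2) powr (- \<alpha>)"
      proof -
        assume a: "(2 * (norm \<xi>)\<^sup>2) powr (- \<alpha>) \<le> (R\<^sup>2 + (norm \<xi>)\<^sup>2) powr (- \<alpha>)"
          and b: "(norm \<xi>)\<^sup>2 powr (- \<alpha>) = norm \<xi> powr (- (real DIM('a) + 2 * \<gamma>))"
        have "norm \<xi> powr (- (real DIM('a) + 2 * \<gamma>)) = 2 powr \<alpha> * (2 * (norm \<xi>)\<^sup>2) powr (- \<alpha>)"
          unfolding powr_mult b[symmetric] by (simp add: powr_add[symmetric] mult.assoc[symmetric] del: powr_minus)
        also have "\<dots> \<le> 2 powr \<alpha> * (R\<^sup>2 + (norm \<xi>)\<^sup>2) powr (- \<alpha>)" by (rule mult_left_mono[OF a]) simp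
        finally show ?thesis .
      qed
      thus ?thesis using True Gam_pos[OF \<alpha>(2)] by (simp add: spec_eq[OF \<alpha>(2) R2])
    qed (use spec_pos[OF \<alpha>(2) R2, of \<xi>] Gam_pos[OF \<alpha>(2)] in \<open>simp add: less_imp_le\<close>)
    have i: "integrable lborel (\<lambda>\<xi>::'a. 2 powr \<alpha> / Gam \<alpha> * spec \<alpha> (R\<^sup>2) \<xi>)"
      by (intro integrable_mult_right integrable_spec[OF \<alpha>(1) R2])
    show I: "integrable lborel (\<lambda>\<xi>::'a. indicator {\<xi>. R \<le> norm \<xi>} \<xi> * norm \<xi> powr (- (real DIM('a) + 2 * \<gamma>)))"
      by (rule integrable_squeeze[OF i]) (use le in auto)
    have "(LINT \<xi>::'a|lborel. indicator {\<xi>. R \<le> norm \<xi>} \<xi> * norm \<xi> powr (- (real DIM('a) + 2 * \<gamma>))) \<le> (LINT \<xi>::'a|lborel. 2 powr \<alpha> / Gam \<alpha> * spec \<alpha> (R\<^sup>2) \<xi>)"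
      by (rule integral_mono[OF I i le])
    also have "\<dots> = 2 powr \<alpha> / Gam \<alpha> * (pi powr ?d * Psi (\<alpha> - ?d) (R\<^sup>2) 0)"
      using spec_trig_sum(2)[OF \<alpha>(1) R2, of "\<lambda>_. 0" "\<lambda>_. 1" "{()}"] by (simp add: trig_sum_def psi_form_def)
    also have "Psi (\<alpha> - ?d) (R\<^sup>2) 0 = Gam \<gamma> * R powr (- 2 * \<gamma>)"
    proof -
      have "R\<^sup>2 = R powr 2" using R by simp
      hence "R\<^sup>2 powr (- \<gamma>) = R powr (- 2 * \<gamma>)" by (simp only: powr_powr) simp
      thus ?thesis using Psi_zero[OF \<gamma> R2] by (simp add: \<alpha>_def)
    qed
    finally show "(LINT \<xi>::'a|lborel. indicator {\<xi>. R \<le> norm \<xi>} \<xi> * norm \<xi> powr (- (real DIM('a) + 2 * \<gamma>))) \<le> C * R powr (- 2 * \<gamma>)"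
      by (simp add: C_def mult_ac)
  qed
  with C show ?thesis by blast
qed

text \<open>Peetre's inequality: a weight at \<xi> is distributed over the two arguments of a
  convolution.\<close>

lemma peetre:
  fixes \<xi> \<zeta> :: "'a::real_normed_vector"
  assumes "0 \<le> \<beta>"
  shows "(1 + (norm \<xi>)\<^sup>2) powr \<beta> \<le> 2 powr \<beta> * (1 + (norm \<zeta>)\<^sup>2) powr \<beta> * (1 + (norm (\<xi> - \<zeta>))\<^sup>2) powr \<beta>"
proof -
  have "norm \<xi> \<le> norm \<zeta> + norm (\<xi> - \<zeta>)" using norm_triangle_sub[of \<xi> \<zeta>] by simp
  hence "(norm \<xi>)\<^sup>2 \<le> (norm \<zeta> + norm (\<xi> - \<zeta>))\<^sup>2" by (intro power_mono) auto
  also have "\<dots> \<le> 2 * (norm \<zeta>)\<^sup>2 + 2 * (norm (\<xi> - \<zeta>))\<^sup>2"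
    using sum_squares_ge_zero[of "norm \<zeta> - norm (\<xi> - \<zeta>)" 0] by (simp add: power2_eq_square algebra_simps)
  finally have "1 + (norm \<xi>)\<^sup>2 \<le> 2 * (1 + (norm \<zeta>)\<^sup>2) * (1 + (norm (\<xi> - \<zeta>))\<^sup>2)"
    by (simp add: algebra_simps) (smt (verit) mult_nonneg_nonneg zero_le_power2)
  hence "(1 + (norm \<xi>)\<^sup>2) powr \<beta> \<le> (2 * (1 + (norm \<zeta>)\<^sup>2) * (1 + (norm (\<xi> - \<zeta>))\<^sup>2)) powr \<beta>"
    using assms by (intro powr_mono2) (auto simp: add_nonneg_nonneg)
  thus ?thesis by (simp only: powr_mult)
qed

text \<open>Cauchy-Schwarz with respect to the measure S(\<zeta>) P(\<zeta> - \<xi>) d\<zeta>. By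
  Peetre's inequality and the decay of S, the total mass of that measure times the weight at \<xi>
  is at most \<Phi>; the other factor is integrated in \<xi> by Tonelli.\<close>

lemma weighted_convolution:
  fixes S P :: "'a::euclidean_space \<Rightarrow> real" and T V :: "'a \<Rightarrow> complex"
  assumes [measurable]: "S \<in> borel_measurable borel" "P \<in> borel_measurable borel"
      "T \<in> borel_measurable borel" "V \<in> borel_measurable borel"
    and \<beta>: "0 \<le> \<beta>" and S: "\<And>\<zeta>. 0 \<le> S \<zeta>" "\<And>\<zeta>. S \<zeta> \<le> D * (1 + (norm \<zeta>)\<^sup>2) powr (- \<beta>)" "integrable lborel S"
    and ST: "integrable lborel (\<lambda>\<zeta>. S \<zeta> * (norm (T \<zeta>))\<^sup>2)"
    and P: "\<And>\<eta>. 0 \<le> P \<eta>" "\<And>\<eta>. P \<eta> \<le> A" "integrable lborel P" "integrable lborel (\<lambda>\<eta>. (1 + (norm \<eta>)\<^sup>2) powr \<beta> * P \<eta>)"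
    and even: "\<And>\<eta>. P (- \<eta>) = P \<eta>"
    and V: "\<And>\<xi>. norm (V \<xi>) \<le> (LINT \<zeta>|lborel. S \<zeta> * norm (T \<zeta>) * P (\<zeta> - \<xi>))"
  defines "\<Phi> \<equiv> 2 powr \<beta> * D * (LINT \<eta>|lborel. (1 + (norm \<eta>)\<^sup>2) powr \<beta> * P \<eta>)"
  shows "integrable lborel (\<lambda>\<xi>. (1 + (norm \<xi>)\<^sup>2) powr \<beta> * (norm (V \<xi>))\<^sup>2)"
    and "(LINT \<xi>|lborel. (1 + (norm \<xi>)\<^sup>2) powr \<beta> * (norm (V \<xi>))\<^sup>2) \<le> \<Phi> * (LINT \<eta>|lborel. P \<eta>) * (LINT \<zeta>|lborel. S \<zeta> * (norm (T \<zeta>))\<^sup>2)"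
proof -
  have D: "0 \<le> D" using order_trans[OF S(1)[of 0] S(2)[of 0]] by simp
  have A: "0 \<le> A" using order_trans[OF P(1)[of 0] P(2)[of 0]] .
  have sh: "integrable lborel (\<lambda>\<zeta>. f (\<zeta> - \<xi>))" "(LINT \<zeta>|lborel. f (\<zeta> - \<xi>)) = (LINT \<zeta>|lborel. f \<zeta>)"
    if "integrable lborel f" for f :: "'a \<Rightarrow> real" and \<xi>
    using lborel_integral_minus[of f "- \<xi>"] that by (auto simp: integrable_iff_bounded)
  define F where "F = (\<lambda>\<zeta> \<xi>. S \<zeta> * (norm (T \<zeta>))\<^sup>2 * P (\<zeta> - \<xi>))"
  have Fnn: "0 \<le> F \<zeta> \<xi>" for \<zeta> \<xi> using S P by (simp add: F_def)
  have PP: "P (\<zeta> - \<xi>) = P (\<xi> - \<zeta>)" for \<zeta> \<xi> using even[of "\<xi> - \<zeta>"] by simp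
  have F1: "integrable lborel (F \<zeta>)" "(LINT \<xi>|lborel. F \<zeta> \<xi>) = S \<zeta> * (norm (T \<zeta>))\<^sup>2 * (LINT \<eta>|lborel. P \<eta>)" for \<zeta>
    using sh[OF P(3), of \<zeta>] unfolding F_def PP[of \<zeta>] by auto
  have Fm: "(\<lambda>(\<zeta>, \<xi>). F \<zeta> \<xi>) \<in> borel_measurable (lborel \<Otimes>\<^sub>M lborel)"
    unfolding F_def split_beta' by measurable
  have i2: "integrable lborel (\<lambda>\<zeta>. LINT \<xi>|lborel. F \<zeta> \<xi>)" unfolding F1 using ST by simp
  note ton = tonelli_real[OF Fm Fnn F1(1) i2]
  have F2: "integrable lborel (\<lambda>\<zeta>. F \<zeta> \<xi>)" for \<xi>
  proof (rule Bochner_Integration.integrable_bound[of _ "\<lambda>\<zeta>. S \<zeta> * (norm (T \<zeta>))\<^sup>2 * A"])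
    show "integrable lborel (\<lambda>\<zeta>. S \<zeta> * (norm (T \<zeta>))\<^sup>2 * A)" using ST by simp
    show "AE \<zeta> in lborel. norm (F \<zeta> \<xi>) \<le> norm (S \<zeta> * (norm (T \<zeta>))\<^sup>2 * A)"
      unfolding F_def using S P A by (auto simp: abs_mult intro!: mult_left_mono)
  qed (simp add: F_def)
  have key: "(1 + (norm \<xi>)\<^sup>2) powr \<beta> * (norm (V \<xi>))\<^sup>2 \<le> \<Phi> * (LINT \<zeta>|lborel. F \<zeta> \<xi>)" for \<xi>
  proof -
    have SP: "integrable lborel (\<lambda>\<zeta>. S \<zeta> * P (\<zeta> - \<xi>))"
    proof (rule Bochner_Integration.integrable_bound[of _ "\<lambda>\<zeta>. S \<zeta> * A"])
      show "AE \<zeta> in lborel. norm (S \<zeta> * P (\<zeta> - \<xi>)) \<le> norm (S \<zeta> * A)"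
        using S P A by (auto simp: abs_mult intro!: mult_left_mono)
    qed (use S in auto)
    have "(norm (V \<xi>))\<^sup>2 \<le> (LINT \<zeta>|lborel. sqrt (S \<zeta> * P (\<zeta> - \<xi>)) * (sqrt (S \<zeta> * P (\<zeta> - \<xi>)) * norm (T \<zeta>)))\<^sup>2"
    proof (rule power_mono)
      have "sqrt (S \<zeta> * P (\<zeta> - \<xi>)) * (sqrt (S \<zeta> * P (\<zeta> - \<xi>)) * norm (T \<zeta>)) = S \<zeta> * norm (T \<zeta>) * P (\<zeta> - \<xi>)" for \<zeta>
        unfolding mult.assoc[symmetric] real_sqrt_mult_self using S(1)[of \<zeta>] P(1)[of "\<zeta> - \<xi>"] by (simp add: abs_mult)
      thus "norm (V \<xi>) \<le> (LINT \<zeta>|lborel. sqrt (S \<zeta> * P (\<zeta> - \<xi>)) * (sqrt (S \<zeta> * P (\<zeta> - \<xi>)) * norm (T \<zeta>)))" using V by presburger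
    qed simp
    also have "\<dots> \<le> (LINT \<zeta>|lborel. (sqrt (S \<zeta> * P (\<zeta> - \<xi>)))\<^sup>2) * (LINT \<zeta>|lborel. (sqrt (S \<zeta> * P (\<zeta> - \<xi>)) * norm (T \<zeta>))\<^sup>2)"
    proof (rule integral_Cauchy_Schwarz)
      show "integrable lborel (\<lambda>\<zeta>. (sqrt (S \<zeta> * P (\<zeta> - \<xi>)))\<^sup>2)" using SP S P by simp
      show "integrable lborel (\<lambda>\<zeta>. (sqrt (S \<zeta> * P (\<zeta> - \<xi>)) * norm (T \<zeta>))\<^sup>2)"
        using F2[of \<xi>] S P by (simp add: F_def power_mult_distrib mult_ac)
    qed measurable
    also have "(LINT \<zeta>|lborel. (sqrt (S \<zeta> * P (\<zeta> - \<xi>)) * norm (T \<zeta>))\<^sup>2) = (LINT \<zeta>|lborel. F \<zeta> \<xi>)"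
      using S P by (simp add: F_def power_mult_distrib mult_ac)
    also have "(LINT \<zeta>|lborel. (sqrt (S \<zeta> * P (\<zeta> - \<xi>)))\<^sup>2) = (LINT \<zeta>|lborel. S \<zeta> * P (\<zeta> - \<xi>))"
      using S P by simp
    finally have "(1 + (norm \<xi>)\<^sup>2) powr \<beta> * (norm (V \<xi>))\<^sup>2 \<le> (1 + (norm \<xi>)\<^sup>2) powr \<beta> * ((LINT \<zeta>|lborel. S \<zeta> * P (\<zeta> - \<xi>)) * (LINT \<zeta>|lborel. F \<zeta> \<xi>))"
      by (rule mult_left_mono) simp
    also have "\<dots> = (LINT \<zeta>|lborel. (1 + (norm \<xi>)\<^sup>2) powr \<beta> * (S \<zeta> * P (\<zeta> - \<xi>))) * (LINT \<zeta>|lborel. F \<zeta> \<xi>)"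
      by simp
    also have "\<dots> \<le> \<Phi> * (LINT \<zeta>|lborel. F \<zeta> \<xi>)"
    proof (rule mult_right_mono)
      note s = sh[OF P(4), of \<xi>]
      have "(LINT \<zeta>|lborel. (1 + (norm \<xi>)\<^sup>2) powr \<beta> * (S \<zeta> * P (\<zeta> - \<xi>)))
          \<le> (LINT \<zeta>|lborel. 2 powr \<beta> * D * ((1 + (norm (\<zeta> - \<xi>))\<^sup>2) powr \<beta> * P (\<zeta> - \<xi>)))"
      proof (rule integral_mono)
        fix \<zeta>
        have "(1 + (norm \<xi>)\<^sup>2) powr \<beta> * S \<zeta>
            \<le> (2 powr \<beta> * (1 + (norm \<zeta>)\<^sup>2) powr \<beta> * (1 + (norm (\<xi> - \<zeta>))\<^sup>2) powr \<beta>) * (D * (1 + (norm \<zeta>)\<^sup>2) powr (- \<beta>))"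
          by (rule mult_mono[OF peetre[OF \<beta>] S(2) _ S(1)]) simp
        also have "\<dots> = 2 powr \<beta> * D * (1 + (norm (\<zeta> - \<xi>))\<^sup>2) powr \<beta> * ((1 + (norm \<zeta>)\<^sup>2) powr \<beta> * (1 + (norm \<zeta>)\<^sup>2) powr (- \<beta>))"
          by (simp add: norm_minus_commute mult_ac)
        also have "(1 + (norm \<zeta>)\<^sup>2) powr \<beta> * (1 + (norm \<zeta>)\<^sup>2) powr (- \<beta>) = 1"
          using sum_power2_gt_zero_iff[of 1 "norm \<zeta>"] by (simp add: powr_add[symmetric])
        finally have "(1 + (norm \<xi>)\<^sup>2) powr \<beta> * S \<zeta> * P (\<zeta> - \<xi>) \<le> 2 powr \<beta> * D * (1 + (norm (\<zeta> - \<xi>))\<^sup>2) powr \<beta> * P (\<zeta> - \<xi>)"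
          using P(1) by (intro mult_right_mono) auto
        thus "(1 + (norm \<xi>)\<^sup>2) powr \<beta> * (S \<zeta> * P (\<zeta> - \<xi>)) \<le> 2 powr \<beta> * D * ((1 + (norm (\<zeta> - \<xi>))\<^sup>2) powr \<beta> * P (\<zeta> - \<xi>))"
          by (simp add: mult_ac)
      qed (use SP s in auto)
      also have "\<dots> = \<Phi>" unfolding \<Phi>_def integral_mult_right_zero s ..
      finally show "(LINT \<zeta>|lborel. (1 + (norm \<xi>)\<^sup>2) powr \<beta> * (S \<zeta> * P (\<zeta> - \<xi>))) \<le> \<Phi>" .
      show "0 \<le> (LINT \<zeta>|lborel. F \<zeta> \<xi>)" using Fnn by (intro integral_nonneg_AE) auto
    qed
    finally show ?thesis .
  qed
  have iF: "integrable lborel (\<lambda>\<xi>. \<Phi> * (LINT \<zeta>|lborel. F \<zeta> \<xi>))" using ton(2) by simp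
  show I: "integrable lborel (\<lambda>\<xi>. (1 + (norm \<xi>)\<^sup>2) powr \<beta> * (norm (V \<xi>))\<^sup>2)"
    by (rule integrable_squeeze[OF iF]) (use key in auto)
  have "(LINT \<xi>|lborel. (1 + (norm \<xi>)\<^sup>2) powr \<beta> * (norm (V \<xi>))\<^sup>2) \<le> (LINT \<xi>|lborel. \<Phi> * (LINT \<zeta>|lborel. F \<zeta> \<xi>))"
    by (rule integral_mono[OF I iF key])
  also have "\<dots> = \<Phi> * (LINT \<eta>|lborel. P \<eta>) * (LINT \<zeta>|lborel. S \<zeta> * (norm (T \<zeta>))\<^sup>2)"
    by (simp add: ton(3) F1)
  finally show "(LINT \<xi>|lborel. (1 + (norm \<xi>)\<^sup>2) powr \<beta> * (norm (V \<xi>))\<^sup>2) \<le> \<Phi> * (LINT \<eta>|lborel. P \<eta>) * (LINT \<zeta>|lborel. S \<zeta> * (norm (T \<zeta>))\<^sup>2)" .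
qed

text \<open>The difference u = f - v has h-dense zeros, so its L2 norm is controlled by its frequencies above
  \<rho>/h; the part below is absorbed by the inequality between ft u and u, for \<rho> small.  If M is
  small, u and v together are too small to make up the tail of f above \<rho>1/h.\<close>

lemma spectral_gap:
  fixes f :: "'a::euclidean_space \<Rightarrow> real"
  assumes f: "cont_cs f" and \<nu>0: "real DIM('a) / 2 < \<nu>0" "\<nu>0 \<le> \<beta>"
    and decay: "AE \<xi> in lborel. norm \<xi> powr (2 * \<nu>0 + real DIM('a)) * (norm (ft f \<xi>))\<^sup>2 \<le> B"
    and C0: "0 < C0" and R0: "0 < R0"
    and tail: "\<And>R. R0 \<le> R \<Longrightarrow> C0 * R powr (- 2 * \<nu>0) \<le> (LINT \<xi>|lborel. indicator {\<xi>. R \<le> norm \<xi>} \<xi> * (norm (ft f \<xi>))\<^sup>2)"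
  shows "\<exists>c>0. \<exists>h0>0. \<forall>h v M. 0 < h \<longrightarrow> h \<le> h0 \<longrightarrow> cont_cs v \<longrightarrow>
     integrable lborel (\<lambda>\<xi>. (1 + (norm \<xi>)\<^sup>2) powr \<beta> * (norm (ft v \<xi>))\<^sup>2) \<longrightarrow>
     (LINT \<xi>|lborel. (1 + (norm \<xi>)\<^sup>2) powr \<beta> * (norm (ft v \<xi>))\<^sup>2) \<le> M \<longrightarrow>
     (\<forall>y. \<exists>z. norm (z - y) \<le> h \<and> f z = v z) \<longrightarrow> c * h powr (2 * \<nu>0 - 2 * \<beta>) \<le> M"
proof -
  let ?d = "real DIM('a)"
  \<comment> \<open>Strictly between d/2, as the bound for dense zeros requires, and \<nu>0, so that
    the tail of |\<xi>|^(2 \<alpha>) times the squared transform of f is integrable.\<close>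
  define \<alpha> where "\<alpha> = (?d / 2 + \<nu>0) / 2"
  have \<alpha>: "?d / 2 < \<alpha>" "\<alpha> < \<nu>0" "\<alpha> < \<beta>" "0 < \<alpha>"
    using \<nu>0 DIM_positive[where 'a = 'a] by (auto simp: \<alpha>_def)
  define \<gamma> where "\<gamma> = \<nu>0 - \<alpha>"
  have \<gamma>: "0 < \<gamma>" using \<alpha> by (simp add: \<gamma>_def)
  note [measurable] = cont_cs_measurable[OF f]
  obtain Cz where Cz: "0 < Cz" and zl: "\<And>(u :: 'a \<Rightarrow> real) U r. 0 < r \<Longrightarrow> continuous_on UNIV u \<Longrightarrow> bounded {y. u y \<noteq> 0} \<Longrightarrow>
     is_fourier_transform u U \<Longrightarrow> (\<And>y. \<exists>z. norm (z - y) \<le> r \<and> u z = 0) \<Longrightarrow>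
     integrable lborel (\<lambda>\<xi>. (norm (U \<xi>))\<^sup>2 * zero_weight \<alpha> (r * norm \<xi>)) \<Longrightarrow>
     (LINT y|lborel. (u y)\<^sup>2) \<le> Cz * (LINT \<xi>|lborel. (norm (U \<xi>))\<^sup>2 * zero_weight \<alpha> (r * norm \<xi>))"
    using dense_zeros_bound[OF \<alpha>(1)] by blast
  obtain Ct where Ct: "0 < Ct" and pt: "\<And>R. 0 < R \<Longrightarrow> integrable lborel (\<lambda>\<xi>::'a. indicator {\<xi>. R \<le> norm \<xi>} \<xi> * norm \<xi> powr (- (?d + 2 * \<gamma>)))"
    "\<And>R. 0 < R \<Longrightarrow> (LINT \<xi>::'a|lborel. indicator {\<xi>. R \<le> norm \<xi>} \<xi> * norm \<xi> powr (- (?d + 2 * \<gamma>))) \<le> Ct * R powr (- 2 * \<gamma>)"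
    using powr_tail[OF \<gamma>, where 'a = 'a] by blast
  define B' where "B' = max B 0"
  have B': "0 \<le> B'" by (simp add: B'_def)
  define P where "P = (2 * pi) powr ?d"
  have P: "0 < P" by (simp add: P_def)
  \<comment> \<open>Small enough that the frequencies of u below \<rho>/h contribute at most half of
    its squared L2 norm.\<close>
  define \<rho> where "\<rho> = min 1 ((1 / (2 * Cz * P)) powr 2)"
  have \<rho>: "0 < \<rho>" "\<rho> \<le> 1" using Cz P by (auto simp: \<rho>_def)
  have \<rho>2: "Cz * \<rho> powr (1 / 2) * P \<le> 1 / 2"
  proof -
    have "\<rho> powr (1 / 2) \<le> ((1 / (2 * Cz * P)) powr 2) powr (1 / 2)" using \<rho> by (intro powr_mono2) (auto simp: \<rho>_def)
    also have "\<dots> = 1 / (2 * Cz * P)" using Cz P by (simp only: powr_powr) simp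
    finally have "Cz * \<rho> powr (1 / 2) * P \<le> Cz * (1 / (2 * Cz * P)) * P" using Cz P by (intro mult_left_mono mult_right_mono) auto
    thus ?thesis using Cz P by simp
  qed
  define C3 where "C3 = \<rho> powr (- (2 * \<alpha>))"
  have C3: "1 \<le> C3" unfolding C3_def using \<rho> \<alpha> powr_mono'[of "- (2 * \<alpha>)" 0 \<rho>] by simp
  have zero_weight_low: "zero_weight \<alpha> \<eta> \<le> \<rho> powr (1 / 2)" if "0 \<le> \<eta>" "\<eta> < \<rho>" for \<eta>
    using that \<rho> by (auto simp: zero_weight_def intro!: powr_mono2)
  have zero_weight_high: "zero_weight \<alpha> \<eta> \<le> C3 * \<eta> powr (2 * \<alpha>)" if "\<rho> \<le> \<eta>" for \<eta>
  proof (cases "\<eta> \<le> 1")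
    case True
    have "\<eta> powr (1 / 2) \<le> 1 powr (1 / 2)" using True \<rho> that by (intro powr_mono2) auto
    moreover have "C3 * \<rho> powr (2 * \<alpha>) \<le> C3 * \<eta> powr (2 * \<alpha>)" using that \<rho> \<alpha> C3 by (intro mult_left_mono powr_mono2) auto
    moreover have "C3 * \<rho> powr (2 * \<alpha>) = 1" using \<rho> by (simp add: C3_def powr_add[symmetric])
    ultimately show ?thesis using True by (simp add: zero_weight_def)
  next
    case False
    thus ?thesis using C3 by (simp add: zero_weight_def mult_le_cancel_right1)
  qed
  define K1 where "K1 = 4 * Cz * P * C3 * (B' * Ct * \<rho> powr (- 2 * \<gamma>)) + 1"
  define K2 where "K2 = 4 * Cz * P * C3 * \<rho> powr (2 * \<alpha> - 2 * \<beta>)"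
  have K1: "0 < K1" unfolding K1_def using Cz P C3 B' Ct by (intro add_nonneg_pos) auto
  have K2: "0 \<le> K2" unfolding K2_def using Cz P C3 by auto
  \<comment> \<open>At R1 = \<rho>1/h the lower bound for the tail of f becomes 4 K1 h^(2 \<nu>0),
    twice what the f-part of the bound for u can supply.\<close>
  define \<rho>1 where "\<rho>1 = (4 * K1 / C0) powr (- 1 / (2 * \<nu>0))"
  have \<rho>1: "0 < \<rho>1" using K1 C0 by (simp add: \<rho>1_def)
  have \<rho>1p: "C0 * \<rho>1 powr (- 2 * \<nu>0) = 4 * K1"
    using K1 C0 \<alpha> unfolding \<rho>1_def powr_powr by simp
  define K3 where "K3 = 2 * K2 + 2 * \<rho>1 powr (- 2 * \<beta>)"
  have K3: "0 < K3" unfolding K3_def using K2 \<rho>1 by (intro add_nonneg_pos) auto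
  have main: "2 * K1 / K3 * h powr (2 * \<nu>0 - 2 * \<beta>) \<le> M"
    if h: "0 < h" "h \<le> \<rho>1 / R0" and v: "cont_cs v"
      and vi: "integrable lborel (\<lambda>\<xi>. (1 + (norm \<xi>)\<^sup>2) powr \<beta> * (norm (ft v \<xi>))\<^sup>2)"
      and vM: "(LINT \<xi>|lborel. (1 + (norm \<xi>)\<^sup>2) powr \<beta> * (norm (ft v \<xi>))\<^sup>2) \<le> M"
      and z: "\<And>y. \<exists>z. norm (z - y) \<le> h \<and> f z = v z" for h v M
  proof -
    note [measurable] = cont_cs_measurable[OF v]
    define u where "u = (\<lambda>x. f x - v x)"
    have u: "cont_cs u" unfolding u_def by (rule cont_cs_diff[OF f v])
    note [measurable] = cont_cs_measurable[OF u]
    have U: "ft u \<xi> = ft f \<xi> - ft v \<xi>" for \<xi>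
      unfolding u_def by (rule ft_diff[OF cont_cs_integrable[OF f] cont_cs_integrable[OF v]])
    have two: "(norm (a - b))\<^sup>2 \<le> 2 * (norm a)\<^sup>2 + 2 * (norm b)\<^sup>2" for a b :: complex
    proof -
      have "(norm (a - b))\<^sup>2 \<le> (norm a + norm b)\<^sup>2" by (intro power_mono norm_triangle_ineq4) auto
      also have "\<dots> \<le> 2 * (norm a)\<^sup>2 + 2 * (norm b)\<^sup>2"
        using sum_squares_ge_zero[of "norm a - norm b" 0] by (simp add: power2_eq_square algebra_simps)
      finally show ?thesis .
    qed
    let ?H = "\<lambda>R \<xi>::'a. indicator {\<xi>. R \<le> norm \<xi>} \<xi> :: real"
    define Mv where "Mv = (LINT \<xi>|lborel. (1 + (norm \<xi>)\<^sup>2) powr \<beta> * (norm (ft v \<xi>))\<^sup>2)"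
    \<comment> \<open>Applied with a = \<alpha> in the bound for dense zeros and with a = 0 for the
      plain tail beyond R1.\<close>
    have vtail: "integrable lborel (\<lambda>\<xi>. ?H R \<xi> * (norm \<xi> powr (2 * a) * (norm (ft v \<xi>))\<^sup>2))"
      "(LINT \<xi>|lborel. ?H R \<xi> * (norm \<xi> powr (2 * a) * (norm (ft v \<xi>))\<^sup>2)) \<le> R powr (2 * a - 2 * \<beta>) * Mv"
      if R: "0 < R" and a: "a \<le> \<beta>" for R a
    proof -
      have le: "?H R \<xi> * (norm \<xi> powr (2 * a) * (norm (ft v \<xi>))\<^sup>2) \<le> R powr (2 * a - 2 * \<beta>) * ((1 + (norm \<xi>)\<^sup>2) powr \<beta> * (norm (ft v \<xi>))\<^sup>2)" for \<xi>
      proof (cases "R \<le> norm \<xi>")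
        case True
        hence p: "0 < norm \<xi>" using R by linarith
        have "norm \<xi> powr (2 * a) = norm \<xi> powr (2 * a - 2 * \<beta>) * norm \<xi> powr (2 * \<beta>)" by (simp add: powr_add[symmetric])
        also have "\<dots> \<le> R powr (2 * a - 2 * \<beta>) * (1 + (norm \<xi>)\<^sup>2) powr \<beta>"
        proof (rule mult_mono)
          show "norm \<xi> powr (2 * a - 2 * \<beta>) \<le> R powr (2 * a - 2 * \<beta>)" using True R a by (intro powr_mono2') auto
          have "norm \<xi> powr (2 * \<beta>) = ((norm \<xi>) powr 2) powr \<beta>" by (simp only: powr_powr)
          also have "\<dots> = ((norm \<xi>)\<^sup>2) powr \<beta>" using p by simp
          also have "\<dots> \<le> (1 + (norm \<xi>)\<^sup>2) powr \<beta>" using \<alpha> by (intro powr_mono2) auto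
          finally show "norm \<xi> powr (2 * \<beta>) \<le> (1 + (norm \<xi>)\<^sup>2) powr \<beta>" .
        qed auto
        finally have "norm \<xi> powr (2 * a) * (norm (ft v \<xi>))\<^sup>2 \<le> R powr (2 * a - 2 * \<beta>) * (1 + (norm \<xi>)\<^sup>2) powr \<beta> * (norm (ft v \<xi>))\<^sup>2"
          by (rule mult_right_mono) simp
        thus ?thesis using True by (simp add: mult.assoc)
      qed simp
      have i: "integrable lborel (\<lambda>\<xi>. R powr (2 * a - 2 * \<beta>) * ((1 + (norm \<xi>)\<^sup>2) powr \<beta> * (norm (ft v \<xi>))\<^sup>2))"
        using vi by (rule integrable_mult_right)
      show I: "integrable lborel (\<lambda>\<xi>. ?H R \<xi> * (norm \<xi> powr (2 * a) * (norm (ft v \<xi>))\<^sup>2))"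
        by (rule integrable_squeeze[OF i]) (use le in auto)
      show "(LINT \<xi>|lborel. ?H R \<xi> * (norm \<xi> powr (2 * a) * (norm (ft v \<xi>))\<^sup>2)) \<le> R powr (2 * a - 2 * \<beta>) * Mv"
        unfolding Mv_def integral_mult_right_zero[symmetric] by (rule integral_mono[OF I i le])
    qed
    have ftail: "integrable lborel (\<lambda>\<xi>. ?H R \<xi> * (norm \<xi> powr (2 * \<alpha>) * (norm (ft f \<xi>))\<^sup>2))"
      "(LINT \<xi>|lborel. ?H R \<xi> * (norm \<xi> powr (2 * \<alpha>) * (norm (ft f \<xi>))\<^sup>2)) \<le> B' * (Ct * R powr (- 2 * \<gamma>))"
      if R: "0 < R" for R
    proof -
      have le: "AE \<xi> in lborel. ?H R \<xi> * (norm \<xi> powr (2 * \<alpha>) * (norm (ft f \<xi>))\<^sup>2) \<le> B' * (?H R \<xi> * norm \<xi> powr (- (?d + 2 * \<gamma>)))"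
        using decay
      proof eventually_elim
        fix \<xi> :: 'a assume dec: "norm \<xi> powr (2 * \<nu>0 + ?d) * (norm (ft f \<xi>))\<^sup>2 \<le> B"
        show "?H R \<xi> * (norm \<xi> powr (2 * \<alpha>) * (norm (ft f \<xi>))\<^sup>2) \<le> B' * (?H R \<xi> * norm \<xi> powr (- (?d + 2 * \<gamma>)))"
        proof (cases "R \<le> norm \<xi>")
          case True
          have "norm \<xi> powr (2 * \<alpha>) = norm \<xi> powr (- (?d + 2 * \<gamma>)) * norm \<xi> powr (2 * \<nu>0 + ?d)"
            by (simp add: powr_add[symmetric] \<gamma>_def)
          hence "norm \<xi> powr (2 * \<alpha>) * (norm (ft f \<xi>))\<^sup>2 = norm \<xi> powr (- (?d + 2 * \<gamma>)) * (norm \<xi> powr (2 * \<nu>0 + ?d) * (norm (ft f \<xi>))\<^sup>2)"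
            by (simp only: mult.assoc)
          also have "\<dots> \<le> norm \<xi> powr (- (?d + 2 * \<gamma>)) * B'" using dec by (intro mult_left_mono) (auto simp: B'_def)
          finally show ?thesis using True by (simp add: mult_ac)
        qed simp
      qed
      have i: "integrable lborel (\<lambda>\<xi>. B' * (?H R \<xi> * norm \<xi> powr (- (?d + 2 * \<gamma>))))"
        using pt(1)[OF R] by (rule integrable_mult_right)
      show I: "integrable lborel (\<lambda>\<xi>. ?H R \<xi> * (norm \<xi> powr (2 * \<alpha>) * (norm (ft f \<xi>))\<^sup>2))"
        by (rule integrable_squeeze[OF i _ _ le]) auto
      have "(LINT \<xi>|lborel. ?H R \<xi> * (norm \<xi> powr (2 * \<alpha>) * (norm (ft f \<xi>))\<^sup>2)) \<le> (LINT \<xi>|lborel. B' * (?H R \<xi> * norm \<xi> powr (- (?d + 2 * \<gamma>))))"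
        by (rule integral_mono_AE[OF I i le])
      also have "\<dots> \<le> B' * (Ct * R powr (- 2 * \<gamma>))" unfolding integral_mult_right_zero by (rule mult_left_mono[OF pt(2)[OF R] B'])
      finally show "(LINT \<xi>|lborel. ?H R \<xi> * (norm \<xi> powr (2 * \<alpha>) * (norm (ft f \<xi>))\<^sup>2)) \<le> B' * (Ct * R powr (- 2 * \<gamma>))" .
    qed
    define U0 where "U0 = (LINT y|lborel. (u y)\<^sup>2)"
    define UU where "UU = (LINT \<xi>|lborel. (norm (ft u \<xi>))\<^sup>2)"
    note ui = plancherel_le(1)[OF u]
    have UU: "UU \<le> P * U0" unfolding UU_def U0_def P_def by (rule plancherel_le(2)[OF u])
    have UU0: "0 \<le> UU" unfolding UU_def by simp
    define R where "R = \<rho> / h"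
    have R: "0 < R" using \<rho> h by (simp add: R_def)
    \<comment> \<open>Below R the weight is at most sqrt \<rho> and u is kept whole, to be absorbed;
      above R the weight is a power and u is split into f and v.\<close>
    define w where "w = (\<lambda>\<xi>. \<rho> powr (1 / 2) * (norm (ft u \<xi>))\<^sup>2 + 2 * C3 * h powr (2 * \<alpha>) * (?H R \<xi> * (norm \<xi> powr (2 * \<alpha>) * (norm (ft f \<xi>))\<^sup>2)
        + ?H R \<xi> * (norm \<xi> powr (2 * \<alpha>) * (norm (ft v \<xi>))\<^sup>2)))"
    have wi: "integrable lborel w"
      unfolding w_def using ui ftail(1)[OF R] vtail(1)[OF R, of \<alpha>] \<alpha> by simp
    have wle: "(norm (ft u \<xi>))\<^sup>2 * zero_weight \<alpha> (h * norm \<xi>) \<le> w \<xi>" for \<xi>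
    proof (cases "R \<le> norm \<xi>")
      case True
      hence "\<rho> \<le> h * norm \<xi>" using h by (simp add: R_def field_simps)
      hence "(norm (ft u \<xi>))\<^sup>2 * zero_weight \<alpha> (h * norm \<xi>) \<le> (2 * (norm (ft f \<xi>))\<^sup>2 + 2 * (norm (ft v \<xi>))\<^sup>2) * (C3 * (h * norm \<xi>) powr (2 * \<alpha>))"
        unfolding U by (intro mult_mono two zero_weight_high zero_weight_nonneg) auto
      also have "\<dots> = 2 * C3 * h powr (2 * \<alpha>) * (norm \<xi> powr (2 * \<alpha>) * (norm (ft f \<xi>))\<^sup>2 + norm \<xi> powr (2 * \<alpha>) * (norm (ft v \<xi>))\<^sup>2)"
        by (simp only: powr_mult) (simp add: algebra_simps)
      also have "\<dots> \<le> w \<xi>" unfolding w_def using True by simp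
      finally show ?thesis .
    next
      case False
      hence "h * norm \<xi> < \<rho>" using h by (simp add: R_def field_simps)
      hence "(norm (ft u \<xi>))\<^sup>2 * zero_weight \<alpha> (h * norm \<xi>) \<le> (norm (ft u \<xi>))\<^sup>2 * \<rho> powr (1 / 2)"
        using h by (intro mult_left_mono zero_weight_low) auto
      thus ?thesis unfolding w_def using False by (simp add: mult_ac)
    qed
    have zi: "integrable lborel (\<lambda>\<xi>. (norm (ft u \<xi>))\<^sup>2 * zero_weight \<alpha> (h * norm \<xi>))"
      by (rule integrable_squeeze[OF wi]) (use wle zero_weight_nonneg in \<open>auto simp: zero_weight_def\<close>)
    have "U0 \<le> Cz * (LINT \<xi>|lborel. (norm (ft u \<xi>))\<^sup>2 * zero_weight \<alpha> (h * norm \<xi>))"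
      unfolding U0_def
    proof (rule zl[OF h(1) _ _ is_fourier_transform_ft[OF u] _ zi])
      show "\<exists>z. norm (z - y) \<le> h \<and> u z = 0" for y using z[of y] by (auto simp: u_def)
    qed (use u in \<open>auto simp: cont_cs_def\<close>)
    also have "\<dots> \<le> Cz * (LINT \<xi>|lborel. w \<xi>)" using Cz by (intro mult_left_mono integral_mono[OF zi wi wle]) auto
    also have "(LINT \<xi>|lborel. w \<xi>) = \<rho> powr (1 / 2) * UU + 2 * C3 * h powr (2 * \<alpha>) * ((LINT \<xi>|lborel. ?H R \<xi> * (norm \<xi> powr (2 * \<alpha>) * (norm (ft f \<xi>))\<^sup>2))
        + (LINT \<xi>|lborel. ?H R \<xi> * (norm \<xi> powr (2 * \<alpha>) * (norm (ft v \<xi>))\<^sup>2)))"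
      unfolding w_def UU_def using ui ftail(1)[OF R] vtail(1)[OF R, of \<alpha>] \<alpha> by simp
    also have "Cz * \<dots> \<le> Cz * (\<rho> powr (1 / 2) * (P * U0) + 2 * C3 * h powr (2 * \<alpha>) * (B' * (Ct * R powr (- 2 * \<gamma>)) + R powr (2 * \<alpha> - 2 * \<beta>) * Mv))"
      using Cz C3 \<alpha> by (intro mult_left_mono add_mono UU ftail(2)[OF R] vtail(2)[OF R]) auto
    also have "\<dots> = Cz * \<rho> powr (1 / 2) * P * U0 + 2 * Cz * C3 * h powr (2 * \<alpha>) * (B' * (Ct * R powr (- 2 * \<gamma>)) + R powr (2 * \<alpha> - 2 * \<beta>) * Mv)"
      by (simp add: algebra_simps)
    \<comment> \<open>Absorption: the low-frequency part is at most half of \<open>U0\<close> and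
      moves to the left-hand side.\<close>
    also have "\<dots> \<le> 1 / 2 * U0 + 2 * Cz * C3 * h powr (2 * \<alpha>) * (B' * (Ct * R powr (- 2 * \<gamma>)) + R powr (2 * \<alpha> - 2 * \<beta>) * Mv)"
      by (intro add_right_mono mult_right_mono \<rho>2) (simp add: U0_def)
    finally have U0: "U0 \<le> 4 * Cz * C3 * (B' * Ct * (h powr (2 * \<alpha>) * R powr (- 2 * \<gamma>)) + h powr (2 * \<alpha>) * R powr (2 * \<alpha> - 2 * \<beta>) * Mv)"
      by (simp add: algebra_simps)
    have e1: "h powr (2 * \<alpha>) * R powr (- 2 * \<gamma>) = \<rho> powr (- 2 * \<gamma>) * h powr (2 * \<nu>0)"
    proof -
      have "h powr (2 * \<alpha>) * (inverse h) powr (- 2 * \<gamma>) = h powr (2 * \<nu>0)"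
        using h by (simp add: inverse_powr powr_minus[symmetric] powr_add[symmetric] \<gamma>_def)
      thus ?thesis unfolding R_def divide_inverse powr_mult by (simp add: mult_ac)
    qed
    have e2: "h powr (2 * \<alpha>) * R powr (2 * \<alpha> - 2 * \<beta>) = \<rho> powr (2 * \<alpha> - 2 * \<beta>) * h powr (2 * \<beta>)"
    proof -
      have "h powr (2 * \<alpha>) * (inverse h) powr (2 * \<alpha> - 2 * \<beta>) = h powr (2 * \<beta>)"
        using h by (simp add: inverse_powr powr_minus[symmetric] powr_add[symmetric])
      thus ?thesis unfolding R_def divide_inverse powr_mult by (simp add: mult_ac)
    qed
    have "UU \<le> P * (4 * Cz * C3 * (B' * Ct * (\<rho> powr (- 2 * \<gamma>) * h powr (2 * \<nu>0)) + \<rho> powr (2 * \<alpha> - 2 * \<beta>) * h powr (2 * \<beta>) * Mv))"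
      using UU mult_left_mono[OF U0 less_imp_le[OF P]] unfolding e1 e2 by linarith
    also have "\<dots> = (K1 - 1) * h powr (2 * \<nu>0) + K2 * h powr (2 * \<beta>) * Mv"
      by (simp add: K1_def K2_def algebra_simps)
    also have "\<dots> \<le> K1 * h powr (2 * \<nu>0) + K2 * h powr (2 * \<beta>) * Mv" by (simp add: left_diff_distrib)
    finally have UUb: "UU \<le> K1 * h powr (2 * \<nu>0) + K2 * h powr (2 * \<beta>) * Mv" .
    define R1 where "R1 = \<rho>1 / h"
    have R1: "0 < R1" "R0 \<le> R1" using \<rho>1 h R0 by (auto simp: R1_def field_simps)
    have vt: "integrable lborel (\<lambda>\<xi>. ?H R1 \<xi> * (norm (ft v \<xi>))\<^sup>2)" "(LINT \<xi>|lborel. ?H R1 \<xi> * (norm (ft v \<xi>))\<^sup>2) \<le> R1 powr (- 2 * \<beta>) * Mv"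
    proof -
      \<comment> \<open>At the origin \<open>0 powr 0\<close> is 0 rather than 1; there the
        indicator vanishes because R1 > 0.\<close>
      have eq: "?H R1 \<xi> * (norm \<xi> powr (2 * 0) * (norm (ft v \<xi>))\<^sup>2) = ?H R1 \<xi> * (norm (ft v \<xi>))\<^sup>2" for \<xi>
        using R1(1) by (cases "\<xi> = 0") (auto simp: indicator_def)
      have "(0::real) \<le> \<beta>" using \<alpha> by simp
      from vtail[OF R1(1) this, unfolded eq]
      show "integrable lborel (\<lambda>\<xi>. ?H R1 \<xi> * (norm (ft v \<xi>))\<^sup>2)" "(LINT \<xi>|lborel. ?H R1 \<xi> * (norm (ft v \<xi>))\<^sup>2) \<le> R1 powr (- 2 * \<beta>) * Mv"
        by auto
    qed
    \<comment> \<open>The tail of f beyond R1 has to be carried by u and v together; half of it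
      exceeds the fixed part of the bound for u, so the terms with \<open>Mv\<close> must supply the
      rest.\<close>
    have "C0 * R1 powr (- 2 * \<nu>0) \<le> (LINT \<xi>|lborel. ?H R1 \<xi> * (norm (ft f \<xi>))\<^sup>2)" by (rule tail[OF R1(2)])
    also have "\<dots> \<le> (LINT \<xi>|lborel. 2 * (norm (ft u \<xi>))\<^sup>2 + 2 * (?H R1 \<xi> * (norm (ft v \<xi>))\<^sup>2))"
    proof (rule integral_mono)
      show "integrable lborel (\<lambda>\<xi>. ?H R1 \<xi> * (norm (ft f \<xi>))\<^sup>2)"
        by (rule integrable_squeeze[OF plancherel_le(1)[OF f]]) (auto simp: indicator_def)
      show "integrable lborel (\<lambda>\<xi>. 2 * (norm (ft u \<xi>))\<^sup>2 + 2 * (?H R1 \<xi> * (norm (ft v \<xi>))\<^sup>2))" using ui vt(1) by simp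
      fix \<xi>
      have "(norm (ft f \<xi>))\<^sup>2 \<le> 2 * (norm (ft u \<xi>))\<^sup>2 + 2 * (norm (ft v \<xi>))\<^sup>2"
        using two[of "ft u \<xi>" "- ft v \<xi>"] by (simp add: U)
      thus "?H R1 \<xi> * (norm (ft f \<xi>))\<^sup>2 \<le> 2 * (norm (ft u \<xi>))\<^sup>2 + 2 * (?H R1 \<xi> * (norm (ft v \<xi>))\<^sup>2)"
        by (auto simp: indicator_def)
    qed
    also have "\<dots> = 2 * UU + 2 * (LINT \<xi>|lborel. ?H R1 \<xi> * (norm (ft v \<xi>))\<^sup>2)" unfolding UU_def using ui vt(1) by simp
    also have "\<dots> \<le> 2 * (K1 * h powr (2 * \<nu>0) + K2 * h powr (2 * \<beta>) * Mv) + 2 * (R1 powr (- 2 * \<beta>) * Mv)"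
      by (intro add_mono mult_left_mono UUb vt(2)) auto
    also have "R1 powr (- 2 * \<beta>) = \<rho>1 powr (- 2 * \<beta>) * h powr (2 * \<beta>)"
      using h \<rho>1 unfolding R1_def divide_inverse powr_mult by (simp add: inverse_powr powr_minus[symmetric])
    also have "C0 * R1 powr (- 2 * \<nu>0) = 4 * K1 * h powr (2 * \<nu>0)"
    proof -
      have "R1 powr (- 2 * \<nu>0) = \<rho>1 powr (- 2 * \<nu>0) * h powr (2 * \<nu>0)"
        using h \<rho>1 unfolding R1_def divide_inverse powr_mult by (simp add: inverse_powr powr_minus[symmetric])
      thus ?thesis by (simp only: mult.assoc[symmetric] \<rho>1p)
    qed
    finally have "2 * K1 * h powr (2 * \<nu>0) \<le> K3 * h powr (2 * \<beta>) * Mv"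
      by (simp add: K3_def algebra_simps)
    also have "\<dots> \<le> K3 * h powr (2 * \<beta>) * M" using vM K3 by (intro mult_left_mono) (auto simp: Mv_def)
    finally have fin: "2 * K1 * h powr (2 * \<nu>0) \<le> K3 * M * h powr (2 * \<beta>)" by (simp add: mult_ac)
    have "h powr (2 * \<nu>0) = h powr (2 * \<nu>0 - 2 * \<beta>) * h powr (2 * \<beta>)" by (simp add: powr_add[symmetric])
    with fin have "(2 * K1 * h powr (2 * \<nu>0 - 2 * \<beta>)) * h powr (2 * \<beta>) \<le> (K3 * M) * h powr (2 * \<beta>)" by (simp add: mult_ac)
    moreover have "0 < h powr (2 * \<beta>)" using h by simp
    ultimately have "2 * K1 * h powr (2 * \<nu>0 - 2 * \<beta>) \<le> K3 * M" by (rule mult_right_le_imp_le)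
    thus ?thesis using K3 by (simp add: field_simps)
  qed
  have "0 < 2 * K1 / K3" "0 < \<rho>1 / R0" using K1 K3 \<rho>1 R0 by auto
  with main show ?thesis by blast
qed

lemma cnj_trig_sum_measurable [measurable]: "(\<lambda>\<zeta>. cnj (trig_sum p b I \<zeta>)) \<in> borel_measurable borel"
  unfolding trig_sum_def by (intro borel_measurable_continuous_onI continuous_intros)

text \<open>A product with \<psi> becomes a convolution with its transform; the interpolant has
  spectrum \<open>spec\<close> times the conjugate trigonometric sum by \<open>Psi_fourier\<close>.
  Fubini is applied to the explicit double integral, since the interpolant alone need not be
  compactly supported.\<close>

lemma cutoff_fourier:
  fixes \<psi> :: "'a::euclidean_space \<Rightarrow> real" and p :: "'i \<Rightarrow> 'a"
  assumes \<psi>: "cont_cs \<psi>" and \<alpha>: "real DIM('a) / 2 < \<alpha>" and \<kappa>: "0 < \<kappa>"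
  shows "pi powr (real DIM('a) / 2) * ft (\<lambda>x. \<psi> x * (\<Sum>i\<in>I. b i * Psi (\<alpha> - real DIM('a) / 2) \<kappa> (norm (x - p i)))) \<xi>
       = (LINT \<zeta>|lborel. complex_of_real (spec \<alpha> \<kappa> \<zeta>) * cnj (trig_sum p b I \<zeta>) * ft \<psi> (\<xi> - \<zeta>))"
proof -
  let ?d = "real DIM('a) / 2"
  have \<alpha>0: "0 < \<alpha>" using \<alpha> DIM_positive[where 'a = 'a] by linarith
  note [measurable] = cont_cs_measurable[OF \<psi>] spec_measurable[OF \<alpha>0 \<kappa>]
  define h where "h = (\<lambda>\<zeta> x. complex_of_real (spec \<alpha> \<kappa> \<zeta>) * cnj (trig_sum p b I \<zeta>) * (complex_of_real (\<psi> x) * cis (- inner x (\<xi> - \<zeta>))))"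
  have hm: "(\<lambda>(\<zeta>, x). h \<zeta> x) \<in> borel_measurable (lborel \<Otimes>\<^sub>M lborel)"
    unfolding h_def split_beta' using \<alpha>0 \<kappa> by measurable
  have hn: "norm (h \<zeta> x) = spec \<alpha> \<kappa> \<zeta> * norm (trig_sum p b I \<zeta>) * \<bar>\<psi> x\<bar>" for \<zeta> x
    using spec_pos[OF \<alpha>0 \<kappa>, of \<zeta>] by (simp add: h_def norm_mult)
  have i1: "integrable lborel (h \<zeta>)" for \<zeta>
    unfolding h_def using ft_integrand(2)[OF cont_cs_integrable[OF \<psi>], of "\<xi> - \<zeta>"] by (intro integrable_mult_right) auto
  have I: "integrable (lborel \<Otimes>\<^sub>M lborel) (\<lambda>(\<zeta>, x). h \<zeta> x)"
  proof (rule lborel_pair.Fubini_integrable[OF hm])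
    have "integrable lborel (\<lambda>\<zeta>::'a. spec \<alpha> \<kappa> \<zeta> * norm (trig_sum p b I \<zeta>))"
    proof (rule integrable_squeeze)
      show "integrable lborel (\<lambda>\<zeta>::'a. spec \<alpha> \<kappa> \<zeta> * (\<Sum>i\<in>I. \<bar>b i\<bar>))"
        using integrable_spec[OF \<alpha> \<kappa>] by simp
    qed (use spec_pos[OF \<alpha>0 \<kappa>] norm_trig_sum_le in \<open>auto intro!: AE_I2 mult_left_mono mult_nonneg_nonneg intro: less_imp_le\<close>)
    thus "integrable lborel (\<lambda>\<zeta>. LINT x|lborel. norm (case (\<zeta>, x) of (\<zeta>, x) \<Rightarrow> h \<zeta> x))"
      by (simp add: hn)
  qed (use i1 in auto)
  have h1: "(LINT x|lborel. h \<zeta> x) = complex_of_real (spec \<alpha> \<kappa> \<zeta>) * cnj (trig_sum p b I \<zeta>) * ft \<psi> (\<xi> - \<zeta>)" for \<zeta>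
    unfolding h_def ft_def by (rule integral_mult_right_zero)
  have h2: "(LINT \<zeta>|lborel. h \<zeta> x) = complex_of_real (pi powr ?d) * (complex_of_real (\<psi> x * (\<Sum>i\<in>I. b i * Psi (\<alpha> - ?d) \<kappa> (norm (x - p i)))) * cis (- inner x \<xi>))" for x
  proof -
    have si: "integrable lborel (\<lambda>\<zeta>. complex_of_real (spec \<alpha> \<kappa> \<zeta>) * cis (inner (x - p i) \<zeta>))" for i
      by (rule Bochner_Integration.integrable_bound[OF integrable_spec[OF \<alpha> \<kappa>]]) (auto simp: norm_mult)
    have "h \<zeta> x = complex_of_real (\<psi> x) * cis (- inner x \<xi>) * (\<Sum>i\<in>I. complex_of_real (b i) * (complex_of_real (spec \<alpha> \<kappa> \<zeta>) * cis (inner (x - p i) \<zeta>)))" for \<zeta>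
    proof -
      have g: "s * (a * A) * (t * B) = t * C * (a * (s * D))" if "A * B = C * D" for A B C D s a t :: complex
      proof -
        have "s * (a * A) * (t * B) = s * a * t * (A * B)" by (simp only: mult_ac)
        thus ?thesis unfolding that by (simp only: mult_ac)
      qed
      have "cis (- inner (p i) \<zeta>) * cis (- inner x (\<xi> - \<zeta>)) = cis (- inner x \<xi>) * cis (inner (x - p i) \<zeta>)" for i
        unfolding cis_mult by (rule arg_cong[of _ _ cis]) (simp add: inner_diff_left inner_diff_right)
      hence e: "complex_of_real s * (complex_of_real a * cis (- inner (p i) \<zeta>)) * (complex_of_real t * cis (- inner x (\<xi> - \<zeta>)))
          = complex_of_real t * cis (- inner x \<xi>) * (complex_of_real a * (complex_of_real s * cis (inner (x - p i) \<zeta>)))" for s a t i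
        by (rule g)
      have "cnj (trig_sum p b I \<zeta>) = (\<Sum>i\<in>I. complex_of_real (b i) * cis (- inner (p i) \<zeta>))"
        by (simp add: trig_sum_def cis_cnj)
      thus ?thesis unfolding h_def by (simp only: sum_distrib_left sum_distrib_right e)
    qed
    hence "(LINT \<zeta>|lborel. h \<zeta> x) = complex_of_real (\<psi> x) * cis (- inner x \<xi>) * (\<Sum>i\<in>I. complex_of_real (b i) * (LINT \<zeta>|lborel. complex_of_real (spec \<alpha> \<kappa> \<zeta>) * cis (inner (x - p i) \<zeta>)))"
      using si by (simp add: Bochner_Integration.integral_sum)
    thus ?thesis unfolding Psi_fourier[OF \<alpha> \<kappa>] by (simp add: sum_distrib_left mult_ac)
  qed
  have "pi powr ?d * ft (\<lambda>x. \<psi> x * (\<Sum>i\<in>I. b i * Psi (\<alpha> - ?d) \<kappa> (norm (x - p i)))) \<xi> = (LINT x|lborel. LINT \<zeta>|lborel. h \<zeta> x)"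
    unfolding h2 integral_mult_right_zero ft_def ..
  also have "\<dots> = (LINT \<zeta>|lborel. LINT x|lborel. h \<zeta> x)" by (rule lborel_pair.Fubini_integral[OF I])
  finally show ?thesis unfolding h1 .
qed

text \<open>Cutting off costs a constant in the Sobolev norm of order \<beta>, because the transform
  of \<psi> decays faster than the weight grows. The constant depends on the cutoff and \<beta>
  only; kernel order and \<kappa> enter through D and the native norm, which is what makes the later
  bound uniform in \<nu>.\<close>

lemma cutoff_spectrum:
  fixes \<psi> :: "'a::euclidean_space \<Rightarrow> real"
  assumes \<psi>: "cont_cs \<psi>" and \<beta>: "0 \<le> \<beta>" and k: "\<beta> + real DIM('a) / 2 < real k"
    and decay: "\<And>\<xi>. norm (ft \<psi> \<xi>) \<le> A * (1 + (norm \<xi>)\<^sup>2) powr (- real k)"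
  shows "\<exists>C>0. \<forall>\<alpha> \<kappa> D (p :: 'i \<Rightarrow> 'a) b I. real DIM('a) / 2 < \<alpha> \<longrightarrow> 0 < \<kappa> \<longrightarrow>
     (\<forall>\<zeta>::'a. spec \<alpha> \<kappa> \<zeta> \<le> D * (1 + (norm \<zeta>)\<^sup>2) powr (- \<beta>)) \<longrightarrow>
     (let v = (\<lambda>x. \<psi> x * (\<Sum>i\<in>I. b i * Psi (\<alpha> - real DIM('a) / 2) \<kappa> (norm (x - p i)))) in
       cont_cs v \<and> integrable lborel (\<lambda>\<xi>. (1 + (norm \<xi>)\<^sup>2) powr \<beta> * (norm (ft v \<xi>))\<^sup>2) \<and>
       (LINT \<xi>|lborel. (1 + (norm \<xi>)\<^sup>2) powr \<beta> * (norm (ft v \<xi>))\<^sup>2) \<le> C * D * psi_form (\<alpha> - real DIM('a) / 2) \<kappa> p b I)"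
proof -
  let ?d = "real DIM('a) / 2"
  note [measurable] = cont_cs_measurable[OF \<psi>]
  define P where "P = (\<lambda>\<eta>::'a. A * (1 + (norm \<eta>)\<^sup>2) powr (- real k))"
  have base: "1 \<le> 1 + (norm \<eta>)\<^sup>2" for \<eta> :: 'a by simp
  have A: "0 \<le> A" using order_trans[OF norm_ge_zero decay[of 0]] by simp
  have pwi: "integrable lborel (\<lambda>\<eta>::'a. (1 + (norm \<eta>)\<^sup>2) powr (- s))" if "?d < s" for s
  proof -
    have s: "0 < s" using that DIM_positive[where 'a = 'a] by linarith
    have "integrable lborel (\<lambda>\<eta>::'a. spec s 1 \<eta> / Gam s)" using integrable_spec[OF that, of 1] by simp
    thus ?thesis using Gam_pos[OF s] by (simp add: spec_eq[OF s])
  qed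
  have Pi: "integrable lborel P" unfolding P_def using pwi[of "real k"] k \<beta> by simp
  have P\<beta>: "integrable lborel (\<lambda>\<eta>. (1 + (norm \<eta>)\<^sup>2) powr \<beta> * P \<eta>)"
  proof -
    have "(1 + (norm \<eta>)\<^sup>2) powr \<beta> * P \<eta> = A * (1 + (norm \<eta>)\<^sup>2) powr (- (real k - \<beta>))" for \<eta>
    proof -
      have "- (real k - \<beta>) = \<beta> + - real k" by simp
      thus ?thesis by (simp only: P_def powr_add mult_ac)
    qed
    thus ?thesis using pwi[of "real k - \<beta>"] k by simp
  qed
  have Pnn: "0 \<le> P \<eta>" for \<eta> using A by (simp add: P_def)
  have PA: "P \<eta> \<le> A" for \<eta>
  proof -
    have "(1 + (norm \<eta>)\<^sup>2) powr (- real k) \<le> (1 + (norm \<eta>)\<^sup>2) powr 0" using base[of \<eta>] by (intro powr_mono) auto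
    also have "\<dots> = 1" using sum_power2_gt_zero_iff[of 1 "norm \<eta>"] by simp
    finally show ?thesis using A by (simp add: P_def mult_left_le)
  qed
  \<comment> \<open>The transform of v appears multiplied by \<pi>^(d/2), hence squared by \<pi>^d,
    whereas the form brings in \<pi>^(d/2); the quotient is \<pi>^(-d/2).\<close>
  define C0 where "C0 = pi powr (- ?d) * (2 powr \<beta> * (LINT \<eta>|lborel. (1 + (norm \<eta>)\<^sup>2) powr \<beta> * P \<eta>) * (LINT \<eta>|lborel. P \<eta>))"
  have C0: "0 \<le> C0" unfolding C0_def by (intro mult_nonneg_nonneg integral_nonneg_AE AE_I2 Pnn) auto
  have main: "cont_cs v \<and> integrable lborel (\<lambda>\<xi>. (1 + (norm \<xi>)\<^sup>2) powr \<beta> * (norm (ft v \<xi>))\<^sup>2) \<and>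
       (LINT \<xi>|lborel. (1 + (norm \<xi>)\<^sup>2) powr \<beta> * (norm (ft v \<xi>))\<^sup>2) \<le> (C0 + 1) * D * psi_form (\<alpha> - ?d) \<kappa> p b I"
    if \<alpha>: "?d < \<alpha>" and \<kappa>: "0 < \<kappa>" and D: "\<And>\<zeta>::'a. spec \<alpha> \<kappa> \<zeta> \<le> D * (1 + (norm \<zeta>)\<^sup>2) powr (- \<beta>)"
      and v_def: "v = (\<lambda>x. \<psi> x * (\<Sum>i\<in>I. b i * Psi (\<alpha> - ?d) \<kappa> (norm (x - p i))))"
    for \<alpha> \<kappa> D and p :: "'i \<Rightarrow> 'a" and b I v
  proof (intro conjI)
    have \<alpha>0: "0 < \<alpha>" using \<alpha> DIM_positive[where 'a = 'a] by linarith
    have cP: "continuous_on UNIV (\<lambda>x. Psi (\<alpha> - ?d) \<kappa> (norm (x - p i)))" for i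
      by (rule continuous_on_compose2[OF continuous_on_Psi[of "\<alpha> - ?d" \<kappa>]]) (use \<alpha> \<kappa> in \<open>auto intro!: continuous_intros\<close>)
    show v: "cont_cs v" unfolding v_def
      by (rule cont_cs_mult[OF \<psi>]) (intro continuous_intros cP)
    note [measurable] = cont_cs_measurable[OF v] spec_measurable[OF \<alpha>0 \<kappa>]
    define V where "V = (\<lambda>\<xi>. pi powr ?d * ft v \<xi>)"
    have Vn: "(norm (V \<xi>))\<^sup>2 = (pi powr ?d * pi powr ?d) * (norm (ft v \<xi>))\<^sup>2" for \<xi>
      by (simp add: V_def norm_mult power2_eq_square)
    have D0: "0 \<le> D" using order_trans[OF less_imp_le[OF spec_pos[OF \<alpha>0 \<kappa>, of "0::'a"]] D[of 0]] by simp
    have Vb: "norm (V \<xi>) \<le> (LINT \<zeta>|lborel. spec \<alpha> \<kappa> \<zeta> * norm (cnj (trig_sum p b I \<zeta>)) * P (\<zeta> - \<xi>))" for \<xi>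
    proof -
      have "norm (V \<xi>) = norm (LINT \<zeta>|lborel. complex_of_real (spec \<alpha> \<kappa> \<zeta>) * cnj (trig_sum p b I \<zeta>) * ft \<psi> (\<xi> - \<zeta>))"
        unfolding V_def v_def cutoff_fourier[OF \<psi> \<alpha> \<kappa>] ..
      also have "\<dots> \<le> (LINT \<zeta>|lborel. spec \<alpha> \<kappa> \<zeta> * norm (cnj (trig_sum p b I \<zeta>)) * P (\<zeta> - \<xi>))"
      proof (rule Bochner_Integration.integral_norm_bound_integral)
        have [measurable]: "P \<in> borel_measurable borel" unfolding P_def by measurable
        have [measurable]: "(\<lambda>\<zeta>. ft \<psi> (\<xi> - \<zeta>)) \<in> borel_measurable borel"
          by (rule measurable_compose[OF _ ft_measurable[OF cont_cs_measurable[OF \<psi>]]]) measurable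
        show I: "integrable lborel (\<lambda>\<zeta>. spec \<alpha> \<kappa> \<zeta> * norm (cnj (trig_sum p b I \<zeta>)) * P (\<zeta> - \<xi>))"
        proof (rule integrable_squeeze)
          show "integrable lborel (\<lambda>\<zeta>::'a. spec \<alpha> \<kappa> \<zeta> * (\<Sum>i\<in>I. \<bar>b i\<bar>) * A)"
            using integrable_spec[OF \<alpha> \<kappa>] by simp
          show "AE \<zeta> in lborel. spec \<alpha> \<kappa> \<zeta> * norm (cnj (trig_sum p b I \<zeta>)) * P (\<zeta> - \<xi>) \<le> spec \<alpha> \<kappa> \<zeta> * (\<Sum>i\<in>I. \<bar>b i\<bar>) * A"
            using norm_trig_sum_le PA Pnn A by (intro AE_I2 mult_mono mult_left_mono mult_nonneg_nonneg less_imp_le[OF spec_pos[OF \<alpha>0 \<kappa>]] sum_nonneg) auto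
        qed (use Pnn in \<open>auto intro!: AE_I2 mult_nonneg_nonneg less_imp_le[OF spec_pos[OF \<alpha>0 \<kappa>]]\<close>)
        show "integrable lborel (\<lambda>\<zeta>. complex_of_real (spec \<alpha> \<kappa> \<zeta>) * cnj (trig_sum p b I \<zeta>) * ft \<psi> (\<xi> - \<zeta>))"
        proof (rule Bochner_Integration.integrable_bound[OF I])
          show "AE \<zeta> in lborel. norm (complex_of_real (spec \<alpha> \<kappa> \<zeta>) * cnj (trig_sum p b I \<zeta>) * ft \<psi> (\<xi> - \<zeta>)) \<le> norm (spec \<alpha> \<kappa> \<zeta> * norm (cnj (trig_sum p b I \<zeta>)) * P (\<zeta> - \<xi>))"
          proof (rule AE_I2)
            fix \<zeta> :: 'a
            have "norm (ft \<psi> (\<xi> - \<zeta>)) \<le> P (\<zeta> - \<xi>)" unfolding P_def norm_minus_commute[of \<zeta>] by (rule decay)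
            thus "norm (complex_of_real (spec \<alpha> \<kappa> \<zeta>) * cnj (trig_sum p b I \<zeta>) * ft \<psi> (\<xi> - \<zeta>)) \<le> norm (spec \<alpha> \<kappa> \<zeta> * norm (cnj (trig_sum p b I \<zeta>)) * P (\<zeta> - \<xi>))"
              using spec_pos[OF \<alpha>0 \<kappa>, of \<zeta>] Pnn[of "\<zeta> - \<xi>"] by (simp add: norm_mult mult_left_mono)
          qed
        qed (use \<alpha>0 \<kappa> in measurable)
      next
        fix \<zeta> :: 'a
        have "norm (ft \<psi> (\<xi> - \<zeta>)) \<le> P (\<zeta> - \<xi>)" unfolding P_def norm_minus_commute[of \<zeta>] by (rule decay)
        thus "norm (complex_of_real (spec \<alpha> \<kappa> \<zeta>) * cnj (trig_sum p b I \<zeta>) * ft \<psi> (\<xi> - \<zeta>)) \<le> spec \<alpha> \<kappa> \<zeta> * norm (cnj (trig_sum p b I \<zeta>)) * P (\<zeta> - \<xi>)"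
          using spec_pos[OF \<alpha>0 \<kappa>, of \<zeta>] by (simp add: norm_mult mult_left_mono)
      qed
      finally show ?thesis .
    qed
    have sti: "integrable lborel (\<lambda>\<zeta>. spec \<alpha> \<kappa> \<zeta> * (norm (cnj (trig_sum p b I \<zeta>)))\<^sup>2)"
      using spec_trig_sum(1)[OF \<alpha> \<kappa>] by simp
    have st: "(LINT \<zeta>|lborel. spec \<alpha> \<kappa> \<zeta> * (norm (cnj (trig_sum p b I \<zeta>)))\<^sup>2) = pi powr ?d * psi_form (\<alpha> - ?d) \<kappa> p b I"
      using spec_trig_sum(2)[OF \<alpha> \<kappa>] by simp
    have m: "V \<in> borel_measurable borel" "P \<in> borel_measurable borel" "(\<lambda>\<zeta>. cnj (trig_sum p b I \<zeta>)) \<in> borel_measurable borel"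
      unfolding V_def P_def by measurable
    have ev: "P (- \<eta>) = P \<eta>" for \<eta> by (simp add: P_def)
    note W = weighted_convolution[of "spec \<alpha> \<kappa>" P "\<lambda>\<zeta>. cnj (trig_sum p b I \<zeta>)" V \<beta> D A,
      OF spec_measurable[OF \<alpha>0 \<kappa>] m(2,3,1) \<beta> less_imp_le[OF spec_pos[OF \<alpha>0 \<kappa>]] D integrable_spec[OF \<alpha> \<kappa>] sti Pnn PA Pi P\<beta> ev Vb, unfolded st Vn]
    have "integrable lborel (\<lambda>\<xi>. inverse (pi powr ?d * pi powr ?d) * ((1 + (norm \<xi>)\<^sup>2) powr \<beta> * (pi powr ?d * pi powr ?d * (norm (ft v \<xi>))\<^sup>2)))"
      using W(1) by (rule integrable_mult_right)
    thus "integrable lborel (\<lambda>\<xi>. (1 + (norm \<xi>)\<^sup>2) powr \<beta> * (norm (ft v \<xi>))\<^sup>2)" by (simp add: field_simps)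
    have "(pi powr ?d * pi powr ?d) * (LINT \<xi>|lborel. (1 + (norm \<xi>)\<^sup>2) powr \<beta> * (norm (ft v \<xi>))\<^sup>2)
        = (LINT \<xi>|lborel. (1 + (norm \<xi>)\<^sup>2) powr \<beta> * (pi powr ?d * pi powr ?d * (norm (ft v \<xi>))\<^sup>2))"
      unfolding integral_mult_right_zero[symmetric] by (simp add: mult_ac)
    also have "\<dots> \<le> 2 powr \<beta> * D * (LINT \<eta>|lborel. (1 + (norm \<eta>)\<^sup>2) powr \<beta> * P \<eta>) * (LINT \<eta>|lborel. P \<eta>) * (pi powr ?d * psi_form (\<alpha> - ?d) \<kappa> p b I)"
      by (rule W(2))
    also have "\<dots> = (pi powr ?d * pi powr ?d) * (C0 * D * psi_form (\<alpha> - ?d) \<kappa> p b I)"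
    proof -
      have "pi powr ?d * pi powr (- ?d) = 1" by (simp add: powr_add[symmetric])
      hence "(pi powr ?d * pi powr ?d) * C0 = pi powr ?d * (2 powr \<beta> * (LINT \<eta>|lborel. (1 + (norm \<eta>)\<^sup>2) powr \<beta> * P \<eta>) * (LINT \<eta>|lborel. P \<eta>))"
        unfolding C0_def by (simp add: mult.assoc[symmetric])
      thus ?thesis unfolding mult.assoc[symmetric] by (simp add: mult_ac)
    qed
    finally have le: "(pi powr ?d * pi powr ?d) * (LINT \<xi>|lborel. (1 + (norm \<xi>)\<^sup>2) powr \<beta> * (norm (ft v \<xi>))\<^sup>2) \<le> (pi powr ?d * pi powr ?d) * (C0 * D * psi_form (\<alpha> - ?d) \<kappa> p b I)" .
    have "0 < pi powr ?d * pi powr ?d" by simp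
    from mult_left_le_imp_le[OF le this]
    have "(LINT \<xi>|lborel. (1 + (norm \<xi>)\<^sup>2) powr \<beta> * (norm (ft v \<xi>))\<^sup>2) \<le> C0 * D * psi_form (\<alpha> - ?d) \<kappa> p b I" .
    also have "\<dots> \<le> (C0 + 1) * D * psi_form (\<alpha> - ?d) \<kappa> p b I"
      using D0 psi_form_nonneg[of "\<alpha> - ?d" \<kappa> p b I] \<alpha> \<kappa> by (intro mult_right_mono) auto
    finally show "(LINT \<xi>|lborel. (1 + (norm \<xi>)\<^sup>2) powr \<beta> * (norm (ft v \<xi>))\<^sup>2) \<le> (C0 + 1) * D * psi_form (\<alpha> - ?d) \<kappa> p b I" .
  qed
  have "0 < C0 + 1" using C0 by simp
  with main show ?thesis unfolding Let_def by (intro exI[of _ "C0 + 1"] conjI allI impI) (blast+)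
qed

text \<open>Which endpoint dominates depends on the sign of \<tau>, so their sum always does; this
  bounds \<open>Gam\<close> uniformly on an interval.\<close>

lemma mix_mono_bound:
  assumes "a \<le> \<alpha>" "\<alpha> \<le> b" shows "mix \<alpha> \<kappa> \<tau> \<le> mix a \<kappa> \<tau> + mix b \<kappa> \<tau>"
proof -
  have "exp (\<alpha> * \<tau>) \<le> exp (a * \<tau>) + exp (b * \<tau>)"
  proof (cases "0 \<le> \<tau>")
    case True
    hence "exp (\<alpha> * \<tau>) \<le> exp (b * \<tau>)" using assms by (simp add: mult_right_mono)
    thus ?thesis using exp_ge_zero[of "a * \<tau>"] by linarith
  next
    case False
    hence "exp (\<alpha> * \<tau>) \<le> exp (a * \<tau>)" using assms by (simp add: mult_right_mono_neg)
    thus ?thesis using exp_ge_zero[of "b * \<tau>"] by linarith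
  qed
  from mult_right_mono[OF this exp_ge_zero[of "- \<kappa> * exp \<tau>"]] show ?thesis
    by (simp add: mix_def exp_add[symmetric] distrib_right)
qed

lemma Gam_le:
  assumes "0 < a" "a \<le> \<alpha>" "\<alpha> \<le> b" shows "Gam \<alpha> \<le> Gam a + Gam b"
proof -
  have "Gam \<alpha> \<le> (LINT \<tau>|lborel. mix a 1 \<tau> + mix b 1 \<tau>)"
    unfolding Gam_def using assms integrable_mix mix_mono_bound by (intro integral_mono) auto
  thus ?thesis using assms integrable_mix by (simp add: Gam_def)
qed

section \<open>Lower bound for the data term of a self-similar function\<close>

context matern_sampling
begin

lemma amp_upper:
  assumes "bdd_above (c ` {\<nu>min..\<nu>max})" shows "\<exists>M>0. \<forall>\<nu>\<in>{\<nu>min..\<nu>max}. amp \<nu> \<le> M"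
proof -
  obtain c1 where c1: "\<And>\<nu>. \<nu> \<in> {\<nu>min..\<nu>max} \<Longrightarrow> c \<nu> \<le> c1" using assms unfolding bdd_above_def by blast
  define k1 where "k1 = max 1 (kap \<nu>max)"
  have c1p: "0 < c1" using cpos[of \<nu>min] c1[of \<nu>min] \<nu>le by auto
  have m: "amp \<nu> \<le> \<sigma>\<^sup>2 * c1 * 2 powr \<nu>max * k1 powr \<nu>max" if \<nu>: "\<nu> \<in> {\<nu>min..\<nu>max}" for \<nu>
    unfolding matern_amp_def kap_def[symmetric]
  proof (intro mult_mono)
    show "c \<nu> \<le> c1" by (rule c1[OF \<nu>])
    show "2 powr (\<nu> - 1) \<le> 2 powr \<nu>max" using \<nu> by (intro powr_mono) auto
    have "kap \<nu> \<le> kap \<nu>max" using \<nu> \<rho> by (simp add: kap_def divide_right_mono)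
    hence "kap \<nu> powr \<nu> \<le> k1 powr \<nu>" using nu_pos[OF \<nu>] kap_pos[OF \<nu>] by (intro powr_mono2) (auto simp: k1_def)
    also have "\<dots> \<le> k1 powr \<nu>max" using \<nu> by (intro powr_mono) (auto simp: k1_def)
    finally show "kap \<nu> powr \<nu> \<le> k1 powr \<nu>max" .
  qed (use cpos[OF \<nu>] c1p in auto)
  have "0 < \<sigma>\<^sup>2 * c1 * 2 powr \<nu>max * k1 powr \<nu>max" using \<sigma> c1p by (simp add: k1_def)
  with m show ?thesis by blast
qed

text \<open>One Sobolev weight, of the smallest order \<mu> + d/2, dominates the spectral densities
  of all \<nu> \<ge> \<mu>. Factors below 1 are raised to the largest exponent, factors above 1 to
  the smallest.\<close>

lemma spec_upper:
  assumes \<mu>: "\<mu> \<in> {\<nu>min..\<nu>max}"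
  shows "\<exists>D>0. \<forall>\<nu>\<in>{\<mu>..\<nu>max}. \<forall>\<zeta>::'a. spec (\<nu> + real DIM('a) / 2) (kap \<nu>) \<zeta> \<le> D * (1 + (norm \<zeta>)\<^sup>2) powr (- (\<mu> + real DIM('a) / 2))"
proof -
  let ?d = "real DIM('a) / 2"
  define m where "m = min 1 (kap \<mu>)"
  have m: "0 < m" "m \<le> 1" using kap_pos[OF \<mu>] by (auto simp: m_def)
  define G where "G = Gam (\<mu> + ?d) + Gam (\<nu>max + ?d)"
  have p: "0 < \<mu> + ?d" using nu_pos[OF \<mu>] by (intro add_pos_nonneg) auto
  have G: "0 < G" unfolding G_def using Gam_pos[OF p] Gam_pos[of "\<nu>max + ?d"] p \<mu> by simp
  have "spec (\<nu> + ?d) (kap \<nu>) \<zeta> \<le> G * m powr (- (\<nu>max + ?d)) * (1 + (norm \<zeta>)\<^sup>2) powr (- (\<mu> + ?d))" if \<nu>: "\<nu> \<in> {\<mu>..\<nu>max}" for \<nu> and \<zeta> :: 'a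
  proof -
    have \<nu>': "\<nu> \<in> {\<nu>min..\<nu>max}" using \<nu> \<mu> by simp
    have \<nu>p: "0 < \<nu> + ?d" using \<nu> p by simp
    have z: "1 \<le> 1 + (norm \<zeta>)\<^sup>2" by simp
    have k: "kap \<mu> \<le> kap \<nu>" using \<nu> \<rho> by (simp add: kap_def divide_right_mono)
    have "m * (1 + (norm \<zeta>)\<^sup>2) \<le> kap \<nu> + (norm \<zeta>)\<^sup>2"
      unfolding distrib_left using k m by (intro add_mono) (auto simp: m_def mult_le_cancel_right2)
    hence "(kap \<nu> + (norm \<zeta>)\<^sup>2) powr (- (\<nu> + ?d)) \<le> (m * (1 + (norm \<zeta>)\<^sup>2)) powr (- (\<nu> + ?d))"
      using m z \<nu>p by (intro powr_mono2') (auto intro!: mult_pos_pos add_pos_nonneg)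
    also have "\<dots> = m powr (- (\<nu> + ?d)) * (1 + (norm \<zeta>)\<^sup>2) powr (- (\<nu> + ?d))" by (rule powr_mult)
    also have "\<dots> \<le> m powr (- (\<nu>max + ?d)) * (1 + (norm \<zeta>)\<^sup>2) powr (- (\<mu> + ?d))"
      using \<nu> m z by (intro mult_mono powr_mono powr_mono') auto
    finally have "(kap \<nu> + (norm \<zeta>)\<^sup>2) powr (- (\<nu> + ?d)) \<le> m powr (- (\<nu>max + ?d)) * (1 + (norm \<zeta>)\<^sup>2) powr (- (\<mu> + ?d))" .
    moreover have "Gam (\<nu> + ?d) \<le> G" unfolding G_def using \<nu> by (intro Gam_le p) auto
    ultimately have "Gam (\<nu> + ?d) * (kap \<nu> + (norm \<zeta>)\<^sup>2) powr (- (\<nu> + ?d)) \<le> G * (m powr (- (\<nu>max + ?d)) * (1 + (norm \<zeta>)\<^sup>2) powr (- (\<mu> + ?d)))"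
      using G by (intro mult_mono) auto
    thus ?thesis unfolding spec_eq[OF \<nu>p kap_pos[OF \<nu>']] by (simp only: mult.assoc)
  qed
  moreover have "0 < G * m powr (- (\<nu>max + ?d))" using G m by simp
  ultimately show ?thesis by blast
qed

text \<open>The interpolant times the cutoff has squared Sobolev norm of order \<beta> = \<mu> + d/2
  at most a constant times \<open>fit\<close>, for every \<nu> \<ge> \<mu> at once. It agrees with f
  at the data points and vanishes with f outside \<Omega>, so \<open>spectral_gap\<close> applies
  with h the fill distance and forces that norm above h^(2 \<nu>0 - 2 \<beta>).\<close>

lemma fit_lower:
  assumes f: "f \<in> self_similar_on \<nu>0 \<Omega>" and \<nu>0: "real DIM('a) / 2 < \<nu>0" "\<nu>0 \<le> \<mu>" and \<mu>: "\<mu> \<in> {\<nu>min..\<nu>max}"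
    and c: "bdd_above (c ` {\<nu>min..\<nu>max})"
  shows "\<exists>c0>0. \<forall>\<^sub>F n in sequentially. \<forall>\<nu>\<in>{\<mu>..\<nu>max}. c0 * real n powr (1 + 2 * (\<mu> - \<nu>0) / real DIM('a)) \<le> fit f \<nu> n"
proof -
  let ?d = "real DIM('a)"
  define \<beta> where "\<beta> = \<mu> + ?d / 2"
  have \<beta>: "0 \<le> \<beta>" "\<nu>0 \<le> \<beta>" using nu_pos[OF \<mu>] \<nu>0 by (auto simp: \<beta>_def)
  define S where "S = closure {y. f y \<noteq> 0}"
  have S\<Omega>: "S \<subseteq> \<Omega>" and fc: "continuous_on UNIV f" and ss: "self_similar \<nu>0 f"
    using f \<nu>0 by (auto simp: self_similar_on_def S_def)
  have fS: "f y = 0" if "y \<notin> S" for y using that closure_subset[of "{y. f y \<noteq> 0}"] by (auto simp: S_def)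
  have cpt: "compact S" unfolding S_def using bdd S\<Omega> closure_subset[of "{y. f y \<noteq> 0}"] by (auto simp: compact_closure S_def intro: bounded_subset)
  have fcs: "cont_cs f" unfolding cont_cs_def using fc bounded_subset[OF bdd] S\<Omega> closure_subset[of "{y. f y \<noteq> 0}"] by (auto simp: S_def)
  note [measurable] = cont_cs_measurable[OF fcs]
  obtain g B C0 R0 where g: "is_fourier_transform f g" and B: "AE \<xi> in lborel. norm \<xi> powr (2 * \<nu>0 + ?d) * (norm (g \<xi>))\<^sup>2 \<le> B"
    and C0: "0 < C0" "0 < R0" and tl: "\<And>R. R0 \<le> R \<Longrightarrow> C0 * R powr (- 2 * \<nu>0) \<le> (LINT \<xi>:{\<xi>. R \<le> norm \<xi>}|lborel. (norm (g \<xi>))\<^sup>2)"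
    using ss unfolding self_similar_def by blast
  note gf = is_fourier_transform_unique[OF fcs g]
  have [measurable]: "g \<in> borel_measurable borel" using g by (auto simp: is_fourier_transform_def square_integrable_def)
  have B': "AE \<xi> in lborel. norm \<xi> powr (2 * \<nu>0 + ?d) * (norm (ft f \<xi>))\<^sup>2 \<le> B"
    using B gf by eventually_elim simp
  have tl': "C0 * R powr (- 2 * \<nu>0) \<le> (LINT \<xi>|lborel. indicator {\<xi>. R \<le> norm \<xi>} \<xi> * (norm (ft f \<xi>))\<^sup>2)" if "R0 \<le> R" for R
  proof -
    have "(LINT \<xi>:{\<xi>. R \<le> norm \<xi>}|lborel. (norm (g \<xi>))\<^sup>2) = (LINT \<xi>|lborel. indicator {\<xi>. R \<le> norm \<xi>} \<xi> * (norm (ft f \<xi>))\<^sup>2)"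
      unfolding set_lebesgue_integral_def
    proof (rule integral_cong_AE)
      show "AE \<xi> in lborel. indicator {\<xi>. R \<le> norm \<xi>} \<xi> *\<^sub>R (norm (g \<xi>))\<^sup>2 = indicator {\<xi>. R \<le> norm \<xi>} \<xi> * (norm (ft f \<xi>))\<^sup>2"
        using gf by eventually_elim simp
    qed measurable
    thus ?thesis using tl[OF that] by simp
  qed
  \<comment> \<open>The lower bound on the Fourier tail excludes f = 0; \<open>cutoff_exists\<close>
    is stated for nonempty sets.\<close>
  have Sne: "S \<noteq> {}"
  proof
    assume "S = {}"
    hence "f = (\<lambda>_. 0)" using fS by auto
    hence "ft f = (\<lambda>_. 0)" by (auto simp: ft_def)
    moreover have "0 < C0 * R0 powr (- 2 * \<nu>0)" using C0 by simp
    ultimately show False using tl'[of R0] by simp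
  qed
  obtain k :: nat where k: "\<beta> + ?d / 2 < real k" using reals_Archimedean2 by blast
  obtain \<psi> A where \<psi>: "cont_cs \<psi>" "\<And>y. y \<in> S \<Longrightarrow> \<psi> y = 1" "\<And>y. y \<notin> \<Omega> \<Longrightarrow> \<psi> y = 0"
    and A: "\<And>\<xi>. norm (ft \<psi> \<xi>) \<le> A * (1 + (norm \<xi>)\<^sup>2) powr (- real k)"
    using cutoff_exists[OF cpt Sne S\<Omega> opn bdd, of k] by blast
  obtain c1 h0 where c1: "0 < c1" "0 < h0" and gap: "\<And>h v M. 0 < h \<Longrightarrow> h \<le> h0 \<Longrightarrow> cont_cs v \<Longrightarrow>
     integrable lborel (\<lambda>\<xi>. (1 + (norm \<xi>)\<^sup>2) powr \<beta> * (norm (ft v \<xi>))\<^sup>2) \<Longrightarrow>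
     (LINT \<xi>|lborel. (1 + (norm \<xi>)\<^sup>2) powr \<beta> * (norm (ft v \<xi>))\<^sup>2) \<le> M \<Longrightarrow>
     (\<And>y. \<exists>z. norm (z - y) \<le> h \<and> f z = v z) \<Longrightarrow> c1 * h powr (2 * \<nu>0 - 2 * \<beta>) \<le> M"
    using spectral_gap[OF fcs \<nu>0(1) \<beta>(2) B' C0 tl'] by blast
  obtain D where D: "0 < D" "\<And>\<nu> \<zeta>::'a. \<nu> \<in> {\<mu>..\<nu>max} \<Longrightarrow> spec (\<nu> + ?d / 2) (kap \<nu>) \<zeta> \<le> D * (1 + (norm \<zeta>)\<^sup>2) powr (- \<beta>)"
    using spec_upper[OF \<mu>] unfolding \<beta>_def by blast
  obtain C where C: "0 < C" and cs: "\<And>\<alpha> \<kappa> D (p :: nat \<Rightarrow> 'a) b I. ?d / 2 < \<alpha> \<Longrightarrow> 0 < \<kappa> \<Longrightarrow>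
     (\<And>\<zeta>::'a. spec \<alpha> \<kappa> \<zeta> \<le> D * (1 + (norm \<zeta>)\<^sup>2) powr (- \<beta>)) \<Longrightarrow>
     (let v = (\<lambda>x. \<psi> x * (\<Sum>i\<in>I. b i * Psi (\<alpha> - ?d / 2) \<kappa> (norm (x - p i)))) in
       cont_cs v \<and> integrable lborel (\<lambda>\<xi>. (1 + (norm \<xi>)\<^sup>2) powr \<beta> * (norm (ft v \<xi>))\<^sup>2) \<and>
       (LINT \<xi>|lborel. (1 + (norm \<xi>)\<^sup>2) powr \<beta> * (norm (ft v \<xi>))\<^sup>2) \<le> C * D * psi_form (\<alpha> - ?d / 2) \<kappa> p b I)"
    using cutoff_spectrum[OF \<psi>(1) \<beta>(1) k A, where 'i = nat] by meson
  obtain Am where Am: "0 < Am" "\<And>\<nu>. \<nu> \<in> {\<nu>min..\<nu>max} \<Longrightarrow> amp \<nu> \<le> Am" using amp_upper[OF c] by blast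
  obtain Ch where Ch: "0 < Ch" and hb: "\<And>n. 2 \<le> n \<Longrightarrow> 0 < fill_distance \<Omega> x n \<and> fill_distance \<Omega> x n \<le> Ch * real n powr (- 1 / ?d)"
  proof -
    obtain cc CC where q: "0 < cc" "0 < CC" "\<And>n. 2 \<le> n \<Longrightarrow> cc * real n powr (- 1 / ?d) \<le> separation_radius x n
      \<and> separation_radius x n \<le> fill_distance \<Omega> x n \<and> fill_distance \<Omega> x n \<le> CC * real n powr (- 1 / ?d)"
      using quasi_uniform_bounds[OF bdd opn sub inj qu] by blast
    show ?thesis
    proof (rule that[OF q(2)])
      fix n :: nat assume n: "2 \<le> n"
      have "0 < cc * real n powr (- 1 / ?d)" using q(1) n by simp
      thus "0 < fill_distance \<Omega> x n \<and> fill_distance \<Omega> x n \<le> CC * real n powr (- 1 / ?d)" using q(3)[OF n] by linarith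
    qed
  qed
  define e where "e = 2 * \<nu>0 - 2 * \<beta>"
  have e: "e \<le> 0" using \<beta> by (simp add: e_def)
  define c0 where "c0 = c1 * Ch powr e / (Am * C * D)"
  have c0: "0 < c0" unfolding c0_def using c1 Ch Am C D by simp
  have "filterlim (\<lambda>n. real n powr (- 1 / ?d)) (nhds 0) sequentially"
    by (intro tendsto_neg_powr filterlim_real_sequentially) simp
  hence "((\<lambda>n. Ch * real n powr (- 1 / ?d)) \<longlongrightarrow> Ch * 0) sequentially" by (intro tendsto_intros)
  hence "\<forall>\<^sub>F n in sequentially. Ch * real n powr (- 1 / ?d) < h0" using c1(2) by (intro order_tendstoD) auto
  hence "\<forall>\<^sub>F n in sequentially. \<forall>\<nu>\<in>{\<mu>..\<nu>max}. c0 * real n powr (1 + 2 * (\<mu> - \<nu>0) / ?d) \<le> fit f \<nu> n"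
    using eventually_ge_at_top[of 2]
  proof eventually_elim
    case (elim n)
    show ?case
    proof
      fix \<nu> assume \<nu>: "\<nu> \<in> {\<mu>..\<nu>max}"
      hence \<nu>\<Theta>: "\<nu> \<in> {\<nu>min..\<nu>max}" using \<mu> by simp
      define h where "h = fill_distance \<Omega> x n"
      have h: "0 < h" "h \<le> Ch * real n powr (- 1 / ?d)" "h \<le> h0" using hb[of n] elim by (auto simp: h_def)
      \<comment> \<open>The amplitude is moved into the coefficients, so that the interpolant is a
        combination of plain \<open>Psi\<close> kernels; the form then carries the amplitude twice,
        one copy of which belongs to \<open>fit\<close>.\<close>
      define b where "b = (\<lambda>j. amp \<nu> * coef f \<nu> n j)"
      define s where "s = (\<lambda>y. \<Sum>i<n. b i * Psi \<nu> (kap \<nu>) (norm (y - x i)))"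
      define v where "v = (\<lambda>y. \<psi> y * s y)"
      have dh: "?d / 2 < \<nu> + ?d / 2" using nu_pos[OF \<nu>\<Theta>] by simp
      have pf: "psi_form \<nu> (kap \<nu>) x b {..<n} = amp \<nu> * fit f \<nu> n"
      proof -
        have "psi_form \<nu> (kap \<nu>) x b {..<n} = amp \<nu> * (amp \<nu> * psi_form \<nu> (kap \<nu>) x (coef f \<nu> n) {..<n})"
          unfolding psi_form_def b_def sum_distrib_left by (intro sum.cong refl) (simp only: mult_ac)
        thus ?thesis unfolding fit_eq[OF \<nu>\<Theta>] qform_psi_form .
      qed
      have cv: "cont_cs v \<and> integrable lborel (\<lambda>\<xi>. (1 + (norm \<xi>)\<^sup>2) powr \<beta> * (norm (ft v \<xi>))\<^sup>2) \<and>
        (LINT \<xi>|lborel. (1 + (norm \<xi>)\<^sup>2) powr \<beta> * (norm (ft v \<xi>))\<^sup>2) \<le> C * D * (amp \<nu> * fit f \<nu> n)"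
        using cs[OF dh kap_pos[OF \<nu>\<Theta>] D(2)[OF \<nu>], where p = x and b = b and I = "{..<n}"] unfolding Let_def v_def s_def pf[symmetric] by simp
      have sx: "s (x i) = f (x i)" if "i < n" for i
        using coef_solution[OF \<nu>\<Theta> that, of f] by (simp add: s_def b_def mult_ac)
      \<comment> \<open>On S the cutoff is 1; at data points outside S both f and the interpolant
        vanish, so the value of the cutoff is irrelevant.\<close>
      have vx: "v (x i) = f (x i)" if "i < n" for i
        using sx[OF that] \<psi>(2)[of "x i"] fS[of "x i"] by (cases "x i \<in> S") (auto simp: v_def)
      have z: "\<exists>z. norm (z - y) \<le> h \<and> f z = v z" for y
      proof (cases "y \<in> \<Omega>")
        case True
        then obtain i where "i < n" "norm (y - x i) \<le> h" using fill_distance_cover[OF bdd _ True, of n x] elim by (auto simp: h_def)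
        thus ?thesis using vx by (intro exI[of _ "x i"]) (auto simp: norm_minus_commute)
      next
        case False
        hence "f y = 0" "v y = 0" using fS S\<Omega> \<psi>(3) by (auto simp: v_def)
        thus ?thesis using h by (intro exI[of _ y]) auto
      qed
      have "c1 * h powr e \<le> C * D * (amp \<nu> * fit f \<nu> n)"
        unfolding e_def using gap[OF h(1,3)] cv z by blast
      also have "\<dots> \<le> C * D * (Am * fit f \<nu> n)"
        using C D Am(2)[OF \<nu>\<Theta>] fit_nonneg[OF \<nu>\<Theta>, of n f] elim by (intro mult_left_mono mult_right_mono) auto
      finally have 1: "c1 * h powr e \<le> (Am * C * D) * fit f \<nu> n" by (simp add: mult_ac)
      have "(Ch * real n powr (- 1 / ?d)) powr e \<le> h powr e" using h e by (intro powr_mono2') auto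
      moreover have "(Ch * real n powr (- 1 / ?d)) powr e = Ch powr e * real n powr (1 + 2 * (\<mu> - \<nu>0) / ?d)"
      proof -
        \<comment> \<open>With h of order n^(-1/d), the exponent 2 \<nu>0 - 2 \<beta> = 2 (\<nu>0 -
          \<mu>) - d becomes 1 + 2 (\<mu> - \<nu>0)/d.\<close>
        have "- 1 / ?d * e = 1 + 2 * (\<mu> - \<nu>0) / ?d" by (simp add: e_def \<beta>_def field_simps)
        thus ?thesis by (simp only: powr_mult powr_powr)
      qed
      ultimately have "c1 * (Ch powr e * real n powr (1 + 2 * (\<mu> - \<nu>0) / ?d)) \<le> c1 * h powr e"
        using c1 by (intro mult_left_mono) auto
      also note 1
      finally show "c0 * real n powr (1 + 2 * (\<mu> - \<nu>0) / ?d) \<le> fit f \<nu> n"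
        using Am C D by (simp add: c0_def field_simps)
    qed
  qed
  with c0 show ?thesis by blast
qed

end

text \<open>Away from the unit ball the decay bound leaves |\<xi>|^(-d - 2 \<gamma>) with \<gamma> =
  \<nu>0 - \<alpha> > 0, which \<open>powr_tail\<close> integrates; inside, the weight is bounded
  and g is square integrable.\<close>

lemma self_similar_sobolev:
  fixes f :: "'a::euclidean_space \<Rightarrow> real"
  assumes f: "f \<in> self_similar_on \<nu>0 \<Omega>" and \<nu>0: "real DIM('a) / 2 < \<nu>0" and \<alpha>: "0 \<le> \<alpha>" "\<alpha> < \<nu>0"
  shows "f \<in> sobolev_on \<alpha> \<Omega>"
proof -
  let ?d = "real DIM('a)"
  obtain g B where sq: "square_integrable f" and cont: "continuous_on UNIV f"
    and g: "is_fourier_transform f g" and B: "AE \<xi> in lborel. norm \<xi> powr (2 * \<nu>0 + ?d) * (norm (g \<xi>))\<^sup>2 \<le> B"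
    using f \<nu>0 unfolding self_similar_on_def self_similar_def by blast
  have gm [measurable]: "g \<in> borel_measurable borel" and gi: "integrable lborel (\<lambda>\<xi>. (norm (g \<xi>))\<^sup>2)"
    using g by (auto simp: is_fourier_transform_def square_integrable_def)
  define \<gamma> where "\<gamma> = \<nu>0 - \<alpha>"
  have \<gamma>: "0 < \<gamma>" using \<alpha> by (simp add: \<gamma>_def)
  have i: "integrable lborel (\<lambda>\<xi>::'a. indicator {\<xi>. 1 \<le> norm \<xi>} \<xi> * norm \<xi> powr (- (?d + 2 * \<gamma>)))"
    using powr_tail[OF \<gamma>, where 'a = 'a] by (auto dest: spec[of _ "1::real"])
  have "integrable lborel (\<lambda>\<xi>. (1 + (norm \<xi>)\<^sup>2) powr \<alpha> * (norm (g \<xi>))\<^sup>2)"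
  proof (rule integrable_squeeze)
    show "integrable lborel (\<lambda>\<xi>. 2 powr \<alpha> * (norm (g \<xi>))\<^sup>2 + 2 powr \<alpha> * max B 0 * (indicator {\<xi>. 1 \<le> norm \<xi>} \<xi> * norm \<xi> powr (- (?d + 2 * \<gamma>))))"
      by (intro Bochner_Integration.integrable_add integrable_mult_right gi i)
    show "AE \<xi> in lborel. (1 + (norm \<xi>)\<^sup>2) powr \<alpha> * (norm (g \<xi>))\<^sup>2
        \<le> 2 powr \<alpha> * (norm (g \<xi>))\<^sup>2 + 2 powr \<alpha> * max B 0 * (indicator {\<xi>. 1 \<le> norm \<xi>} \<xi> * norm \<xi> powr (- (?d + 2 * \<gamma>)))"
      using B
    proof eventually_elim
      fix \<xi> :: 'a assume b: "norm \<xi> powr (2 * \<nu>0 + ?d) * (norm (g \<xi>))\<^sup>2 \<le> B"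
      show "(1 + (norm \<xi>)\<^sup>2) powr \<alpha> * (norm (g \<xi>))\<^sup>2
        \<le> 2 powr \<alpha> * (norm (g \<xi>))\<^sup>2 + 2 powr \<alpha> * max B 0 * (indicator {\<xi>. 1 \<le> norm \<xi>} \<xi> * norm \<xi> powr (- (?d + 2 * \<gamma>)))"
      proof (cases "1 \<le> norm \<xi>")
        case True
        hence p: "0 < norm \<xi>" by linarith
        have "1 \<le> (norm \<xi>)\<^sup>2" using True by (simp add: one_le_power)
        hence "(1 + (norm \<xi>)\<^sup>2) powr \<alpha> \<le> (2 * (norm \<xi>)\<^sup>2) powr \<alpha>" using \<alpha> by (intro powr_mono2) auto
        also have "\<dots> = 2 powr \<alpha> * ((norm \<xi> powr 2) powr \<alpha>)" using p by (simp add: powr_mult)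
        also have "(norm \<xi> powr 2) powr \<alpha> = norm \<xi> powr (- (?d + 2 * \<gamma>)) * norm \<xi> powr (2 * \<nu>0 + ?d)"
          unfolding powr_powr powr_add[symmetric] by (simp add: \<gamma>_def)
        finally have "(1 + (norm \<xi>)\<^sup>2) powr \<alpha> * (norm (g \<xi>))\<^sup>2 \<le> 2 powr \<alpha> * (norm \<xi> powr (- (?d + 2 * \<gamma>)) * norm \<xi> powr (2 * \<nu>0 + ?d)) * (norm (g \<xi>))\<^sup>2"
          by (rule mult_right_mono) simp
        also have "\<dots> = 2 powr \<alpha> * norm \<xi> powr (- (?d + 2 * \<gamma>)) * (norm \<xi> powr (2 * \<nu>0 + ?d) * (norm (g \<xi>))\<^sup>2)"
          by (simp only: mult_ac)
        also have "\<dots> \<le> 2 powr \<alpha> * norm \<xi> powr (- (?d + 2 * \<gamma>)) * max B 0" using b by (intro mult_left_mono) auto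
        also have "\<dots> \<le> 2 powr \<alpha> * (norm (g \<xi>))\<^sup>2 + 2 powr \<alpha> * max B 0 * (indicator {\<xi>. 1 \<le> norm \<xi>} \<xi> * norm \<xi> powr (- (?d + 2 * \<gamma>)))"
          using True by (simp add: mult_ac)
        finally show ?thesis .
      next
        case False
        hence "(norm \<xi>)\<^sup>2 \<le> 1" by (simp add: power_le_one)
        hence "(1 + (norm \<xi>)\<^sup>2) powr \<alpha> \<le> 2 powr \<alpha>" using \<alpha> by (intro powr_mono2) auto
        thus ?thesis using False by (simp add: mult_right_mono)
      qed
    qed
    show "(\<lambda>\<xi>. (1 + (norm \<xi>)\<^sup>2) powr \<alpha> * (norm (g \<xi>))\<^sup>2) \<in> borel_measurable lborel" by measurable
    show "AE \<xi> in lborel. 0 \<le> (1 + (norm \<xi>)\<^sup>2) powr \<alpha> * (norm (g \<xi>))\<^sup>2" by (intro AE_I2 mult_nonneg_nonneg) simp_all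
  qed
  thus ?thesis unfolding sobolev_on_def sobolev_def using sq g cont by blast
qed

section \<open>Upper bound for the estimator\<close>

context matern_sampling
begin

text \<open>With e = \<eta>/d, the data term at \<nu>0 is at most of order n^(1+e), since f lies in
  Sobolev spaces of every order below \<nu>0, whereas at any \<nu> \<ge> \<nu>0 + \<eta> it is at
  least of order n^(1+2e). The determinants only move terms of order n ln n.\<close>

lemma estimate_le:
  assumes argmin: "\<And>n. 1 \<le> n \<Longrightarrow> is_arg_min (\<lambda>\<nu>. neg_log_lik f (matern \<sigma> \<rho> c \<nu>) x n) (\<lambda>\<nu>. \<nu> \<in> {\<nu>min..\<nu>max}) (\<nu>hat n)"
    and f: "f \<in> self_similar_on \<nu>0 \<Omega>" and \<nu>0: "real DIM('a) / 2 < \<nu>0" "\<nu>0 \<in> {\<nu>min..\<nu>max}"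
    and c: "bdd_above (c ` {\<nu>min..\<nu>max})" and \<eta>: "0 < \<eta>"
  shows "\<forall>\<^sub>F n in sequentially. \<nu>hat n < \<nu>0 + \<eta>"
\<comment> \<open>If \<nu>0 + \<eta> exceeds \<nu>max, admissibility of the estimator already gives
  the claim.\<close>
proof (cases "\<nu>max < \<nu>0 + \<eta>")
  case True
  show ?thesis
    using eventually_ge_at_top[of 1]
  proof eventually_elim
    case (elim n)
    thus ?case using argmin[of n] True by (auto simp: is_arg_min_def)
  qed
next
  case False
  let ?d = "real DIM('a)"
  have d: "0 < ?d" by simp
  define \<mu> where "\<mu> = \<nu>0 + \<eta>"
  have \<mu>: "\<nu>0 \<le> \<mu>" "\<mu> \<in> {\<nu>min..\<nu>max}" using False \<eta> \<nu>0 by (auto simp: \<mu>_def)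
  \<comment> \<open>Above d/2 and within \<eta>/2 below \<nu>0, so that the exponent 1 + 2 (\<nu>0 -
    \<alpha>)/d is at most 1 + e.\<close>
  define \<alpha> where "\<alpha> = max ((?d / 2 + \<nu>0) / 2) (\<nu>0 - \<eta> / 2)"
  have "(?d / 2 + \<nu>0) / 2 \<le> \<alpha>" "\<nu>0 - \<eta> / 2 \<le> \<alpha>" "\<alpha> < \<nu>0"
    using \<nu>0 \<eta> by (auto simp: \<alpha>_def)
  hence \<alpha>: "?d / 2 < \<alpha>" "\<alpha> < \<nu>0" "\<nu>0 - \<alpha> \<le> \<eta> / 2" "0 \<le> \<alpha>" "\<alpha> - ?d / 2 \<le> \<nu>0"
    using \<nu>0(1) \<eta> by (auto simp: field_simps)
  obtain C1 where C1: "\<And>n. 2 \<le> n \<Longrightarrow> fit f \<nu>0 n \<le> C1 * real n powr (1 + 2 * (\<nu>0 - \<alpha>) / ?d)"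
    using fit_upper[OF \<nu>0(2) \<alpha>(1,5) self_similar_sobolev[OF f \<nu>0(1) \<alpha>(4,2)]] by blast
  obtain C2 where C2: "\<forall>\<^sub>F n in sequentially. ldet \<nu>0 n \<le> C2 * real n - (1 - 1 / 2) * (2 * \<nu>0 / ?d) * (real n * ln (real n))"
    using ldet_upper[OF \<nu>0(2), of "1 / 2"] by auto
  obtain C3 where C3: "\<And>n \<nu>. 2 \<le> n \<Longrightarrow> \<nu> \<in> {\<nu>min..\<nu>max} \<Longrightarrow> - (2 * \<nu> / ?d) * (real n * ln (real n)) - C3 * real n \<le> ldet \<nu> n"
    using ldet_lower by blast
  obtain c0 where c0: "0 < c0" and low: "\<forall>\<^sub>F n in sequentially. \<forall>\<nu>\<in>{\<mu>..\<nu>max}. c0 * real n powr (1 + 2 * (\<mu> - \<nu>0) / ?d) \<le> fit f \<nu> n"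
    using fit_lower[OF f \<nu>0(1) \<mu> c] by blast
  define e where "e = \<eta> / ?d"
  have e: "0 < e" using \<eta> d by (simp add: e_def)
  define C4 where "C4 = C2 + C3"
  define C5 where "C5 = 2 * \<nu>max / ?d"
  have lim: "\<forall>\<^sub>F n in sequentially. \<bar>C1\<bar> * real n powr (1 + e) + C4 * real n + C5 * (real n * ln (real n)) < c0 * real n powr (1 + 2 * e)"
    using e c0 by real_asymp
  from C2 low lim eventually_ge_at_top[of 2] show ?thesis
  proof eventually_elim
    case (elim n)
    have am: "\<nu>hat n \<in> {\<nu>min..\<nu>max}" "neg_log_lik f (matern \<sigma> \<rho> c (\<nu>hat n)) x n \<le> neg_log_lik f (matern \<sigma> \<rho> c \<nu>0) x n"
      using argmin[of n] elim \<nu>0 by (auto simp: is_arg_min_def not_less)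
    show ?case
    proof (rule ccontr)
      assume "\<not> \<nu>hat n < \<nu>0 + \<eta>"
      hence ge: "\<nu>hat n \<in> {\<mu>..\<nu>max}" using am by (simp add: \<mu>_def)
      define L where "L = real n * ln (real n)"
      have L: "0 \<le> L" using elim by (simp add: L_def)
      have "2 * (\<mu> - \<nu>0) / ?d = 2 * e" by (simp add: \<mu>_def e_def)
      hence "c0 * real n powr (1 + 2 * e) \<le> fit f (\<nu>hat n) n" using elim(2) ge by metis
      moreover have "- C5 * L - C3 * real n \<le> ldet (\<nu>hat n) n"
      proof -
        have "2 * \<nu>hat n / ?d \<le> C5" unfolding C5_def using am d by (intro divide_right_mono) auto
        hence "2 * \<nu>hat n / ?d * L \<le> C5 * L" using L by (rule mult_right_mono)
        thus ?thesis using C3[of n "\<nu>hat n"] elim am by (simp add: L_def)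
      qed
      moreover have "fit f \<nu>0 n \<le> \<bar>C1\<bar> * real n powr (1 + e)"
      proof -
        have "2 * (\<nu>0 - \<alpha>) / ?d \<le> e" unfolding e_def using \<alpha> d by (intro divide_right_mono) auto
        hence "real n powr (1 + 2 * (\<nu>0 - \<alpha>) / ?d) \<le> real n powr (1 + e)" using elim by (intro powr_mono) auto
        hence "C1 * real n powr (1 + 2 * (\<nu>0 - \<alpha>) / ?d) \<le> \<bar>C1\<bar> * real n powr (1 + e)" by (intro mult_mono) auto
        thus ?thesis using C1[of n] elim by linarith
      qed
      moreover have "ldet \<nu>0 n \<le> C2 * real n"
      proof -
        have "0 \<le> (1 - 1 / 2) * (2 * \<nu>0 / ?d) * L" using L \<nu>0 d by (intro mult_nonneg_nonneg divide_nonneg_pos) auto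
        thus ?thesis using elim(1) by (simp add: L_def)
      qed
      moreover have "fit f (\<nu>hat n) n + ldet (\<nu>hat n) n \<le> fit f \<nu>0 n + ldet \<nu>0 n"
        using am(2) neg_log_lik_eq[OF am(1), of n f] neg_log_lik_eq[OF \<nu>0(2), of n f] elim by simp
      ultimately have "c0 * real n powr (1 + 2 * e) \<le> \<bar>C1\<bar> * real n powr (1 + e) + C4 * real n + C5 * L"
        unfolding C4_def distrib_right by linarith
      thus False using elim(3) by (simp add: L_def)
    qed
  qed
qed

end

theorem theorem3p12:
  fixes \<nu>min \<nu>max \<sigma> \<rho> :: real
    and c :: "real \<Rightarrow> real"
    and \<Omega> :: "(real ^ 'd) set"
    and x :: "nat \<Rightarrow> real ^ 'd"
    and f0 :: "real ^ 'd \<Rightarrow> real"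
    and \<nu>hat :: "nat \<Rightarrow> real"
  assumes "0 < \<nu>min" and "\<nu>min \<le> \<nu>max" and "real CARD('d) / 2 < \<nu>max"
    and "0 < \<sigma>" and "0 < \<rho>"
    and "\<And>\<nu>. \<nu> \<in> {\<nu>min..\<nu>max} \<Longrightarrow> 0 < c \<nu>"
    and "0 < (INF \<nu>\<in>{\<nu>min..\<nu>max}. c \<nu>)"
    and "bounded \<Omega>" and "connected \<Omega>" and "open \<Omega>"
    and "interior_cone_condition \<Omega>" and "lipschitz_boundary \<Omega>"
    and "range x \<subseteq> \<Omega>" and "inj x" and "quasi_uniform \<Omega> x"
    and "\<And>n. 1 \<le> n \<Longrightarrow>
      is_arg_min (\<lambda>\<nu>. neg_log_lik f0 (matern \<sigma> \<rho> c \<nu>) x n) (\<lambda>\<nu>. \<nu> \<in> {\<nu>min..\<nu>max}) (\<nu>hat n)"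
  shows "(ereal (real CARD('d) / 2) < smoothness \<Omega> f0 \<and> smoothness \<Omega> f0 \<le> ereal \<nu>max \<longrightarrow>
           smoothness \<Omega> f0 \<le> liminf (\<lambda>n. ereal (\<nu>hat n))) \<and>
         (\<forall>\<nu>0. real CARD('d) / 2 < \<nu>0 \<and> \<nu>0 \<le> \<nu>max \<and> \<nu>min \<le> \<nu>0 \<and>
           f0 \<in> self_similar_on \<nu>0 \<Omega> \<and> bdd_above (c ` {\<nu>min..\<nu>max}) \<longrightarrow>
           \<nu>hat \<longlonglongrightarrow> \<nu>0)"
proof -
  have DIM: "real DIM(real ^ 'd) = real CARD('d)" by simp
  interpret matern_sampling \<nu>min \<nu>max \<sigma> \<rho> c \<Omega> x
    by unfold_locales (fact assms)+
  note argmin = assms(16)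
  show ?thesis
  proof (intro conjI impI allI)
    assume s: "ereal (real CARD('d) / 2) < smoothness \<Omega> f0 \<and> smoothness \<Omega> f0 \<le> ereal \<nu>max"
    show "smoothness \<Omega> f0 \<le> liminf (\<lambda>n. ereal (\<nu>hat n))"
    \<comment> \<open>The supremum defining the smoothness may not be attained, so the bound is
      shown for every y strictly below it.\<close>
    proof (rule dense_le)
      fix y assume y: "y < smoothness \<Omega> f0"
      \<comment> \<open>The maximum with d/2 selects an order \<alpha> above the embedding
        threshold, where the samples are those of a continuous representative.\<close>
      have "max y (ereal (real CARD('d) / 2)) < smoothness \<Omega> f0" using y s by simp
      then obtain \<alpha> where \<alpha>: "f0 \<in> sobolev_on \<alpha> \<Omega>" "y < ereal \<alpha>" "real CARD('d) / 2 < \<alpha>"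
        and in_set: "ereal \<alpha> \<in> ereal ` {\<nu>. 0 < \<nu> \<and> f0 \<in> sobolev_on \<nu> \<Omega>}"
        unfolding smoothness_def less_Sup_iff by auto
      have "ereal \<alpha> \<le> smoothness \<Omega> f0" unfolding smoothness_def by (rule Sup_upper[OF in_set])
      hence \<alpha>max: "\<alpha> \<le> \<nu>max" using s by (meson order_trans ereal_less_eq(3))
      \<comment> \<open>The gap between z and \<alpha> serves as \<eta> in
        \<open>estimate_ge\<close>.\<close>
      obtain z where z: "y < ereal z" "ereal z < ereal \<alpha>" using \<alpha>(2) ereal_dense2 by blast
      have "0 < \<alpha> - z" using z by simp
      from estimate_ge[OF argmin _ \<alpha>max \<alpha>(1) this] \<alpha>(3)
      have "\<forall>\<^sub>F n in sequentially. z \<le> \<nu>hat n" unfolding DIM by simp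
      hence "\<forall>\<^sub>F n in sequentially. ereal z \<le> ereal (\<nu>hat n)" by simp
      hence "ereal z \<le> liminf (\<lambda>n. ereal (\<nu>hat n))" by (rule Liminf_bounded)
      thus "y \<le> liminf (\<lambda>n. ereal (\<nu>hat n))" using z by simp
    qed
  next
    fix \<nu>0
    assume a: "real CARD('d) / 2 < \<nu>0 \<and> \<nu>0 \<le> \<nu>max \<and> \<nu>min \<le> \<nu>0 \<and>
           f0 \<in> self_similar_on \<nu>0 \<Omega> \<and> bdd_above (c ` {\<nu>min..\<nu>max})"
    hence d0: "real DIM(real ^ 'd) / 2 < \<nu>0" and f: "f0 \<in> self_similar_on \<nu>0 \<Omega>"
      and \<nu>0: "\<nu>0 \<in> {\<nu>min..\<nu>max}" and c: "bdd_above (c ` {\<nu>min..\<nu>max})" unfolding DIM by auto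
    show "\<nu>hat \<longlonglongrightarrow> \<nu>0"
    proof (rule order_tendstoI)
      fix u assume "\<nu>0 < u"
      thus "\<forall>\<^sub>F n in sequentially. \<nu>hat n < u"
        using estimate_le[OF argmin f d0 \<nu>0 c, of "u - \<nu>0"] by simp
    next
      fix l assume l: "l < \<nu>0"
      \<comment> \<open>An order above both l and d/2 but below \<nu>0, at which f still has Sobolev
        smoothness.\<close>
      define \<alpha> where "\<alpha> = (max l (real DIM(real ^ 'd) / 2) + \<nu>0) / 2"
      have \<alpha>: "real DIM(real ^ 'd) / 2 < \<alpha>" "\<alpha> < \<nu>0" "l < \<alpha>" "0 \<le> \<alpha>"
        using l d0 unfolding \<alpha>_def max_def DIM by (simp_all add: field_simps)
      have "\<forall>\<^sub>F n in sequentially. \<alpha> - (\<alpha> - l) / 2 \<le> \<nu>hat n"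
        using \<alpha> \<nu>0 by (intro estimate_ge[OF argmin _ _ self_similar_sobolev[OF f d0]]) auto
      thus "\<forall>\<^sub>F n in sequentially. l < \<nu>hat n"
        by eventually_elim (use \<alpha>(3) in \<open>simp add: field_simps\<close>)
    qed
  qed
qed

end
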